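(* Let $N_0=3$. There exist functions $\boldsymbol{G}^{(j)}_M$ ($j\in\mathbb{N}$, $M\ge N_0$ an integer), depending only on $j$ and $M$, each a linear combination of at most $M$ translates of $\phi(x)=e^{-|x|^2}$ on $\mathbb{R}^2$, such that, with $G_{\gamma,M}:=U_\gamma\boldsymbol{G}^{(j(\gamma))}_M$ for each curvelet $\gamma$, the following holds. Let $0<\beta<1$ and $\alpha>1/2$. For an integer $N\ge1$ define the sub-budgets $$N(n):=\left\lfloor (1-\beta)^\beta\Bigl(\frac{N}{2^{\nu}}\Bigr)^{\beta}\right\rfloor\quad\text{for } 2^{\nu-1}<n\le2^\nu,\ \nu\in\mathbb{N},$$ and $$m^*:=\max\Bigl\{2^\nu:\nu\in\mathbb{N},\ 2^\nu\le\frac{1-\beta}{N_0^{1/\beta}}N\Bigr\}$$ (with $m^*:=0$ if there is no such $\nu$). Then there is a constant $C$, independent of $N$ and $f$, such that for every $f\in\mathcal{C}_\alpha$ with decreasing rearrangement curvelet representation $f=\sum_{n=1}^\infty\omega_n\gamma_n$ and every integer $N\ge1$, the function $$\mathcal{T}_Nf:=\sum_{n=1}^{m^*}\omega_nG_{\gamma_n,N(n)}$$ is a linear combination of at most $N$ members of $\mathcal{D}$ and $$\|\mathcal{T}_Nf-f\|_{L_2(\mathbb{R}^2)}\le C\,[f]_\alpha\,N^{\frac12-\alpha}.$$ In particular, the number $m^*$ of approximated curvelets is independent of $f$, and the sub-budgets $N(n)$ are independent of $f$ and $\alpha$.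
   Context: **Gaussian dictionary.** $\mathcal{D}$ is the set of all functions $x\mapsto e^{-|A(x-k)|^2}$ on $\mathbb{R}^2$ with $A$ an invertible real $2\times2$ matrix and $k\in\mathbb{R}^2$. **Curvelet system.** $\mathbb{N}=\{0,1,2,\dots\}$. The Fourier transform on $\mathbb{R}^d$ is $\widehat f(\xi)=(2\pi)^{-d/2}\int f(x)e^{-ix\cdot\xi}\,dx$, with inverse $\mathcal{F}^{-1}$. Fix non-negative $C^\infty$ functions $w_0$ (on $[0,\infty)$, supported in $[0,\frac{8\pi}3]$) and $w$ (supported in $[\frac{2\pi}3,\frac{8\pi}3]$) with $w_0(r)^2+\sum_{j\ge1}w(2^{-j}r)^2=1$ for $r\ge 0$, and a non-negative $\nu\in C_c^\infty(\mathbb{R})$ (a window function, not the integer index $\nu$ of the claim) supported in $[-\pi,\pi]$ with $\sum_{\ell\in\mathbb{Z}}\nu(\theta-\pi\ell)^2=1$. For $\xi=(r\cos\theta,r\sin\theta)$ put $\chi_0(\xi)=w_0(r)$, $\chi_1(\xi)=w(r/2)$ and, for $j\ge2$, $$\chi_j(\xi)=w(2^{-j}r)\bigl[\nu(2^{\lfloor j/2\rfloor}\theta)+\nu(2^{\lfloor j/2\rfloor}(\theta-\pi))\bigr],$$ where the angles $\theta$ and $\theta-\pi$ are each taken modulo $2\pi$ with representative in $[-\pi,\pi)$. Let $\Lambda_0=\lambda_0=\frac{16\pi}3$, $\Lambda_1=\lambda_1=\frac{32\pi}3$, and for $j\ge2$ let $\lambda_j=2^{j+1}\frac{8\pi}3\sin(2^{-\lfloor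 j/2\rfloor}\pi)$, $t_j=2^j\frac{2\pi}3\cos(2^{-\lfloor j/2\rfloor}\pi)$, $\Lambda_j=2(\frac{8\pi}3 2^j-t_j)$. Let $\mathbb{X}_j=\{(k_1/\Lambda_j,k_2/\lambda_j):(k_1,k_2)\in2\pi\mathbb{Z}^2\}$, let $R_{j,\ell}$ be the counter-clockwise rotation by $\pi\ell2^{-\lfloor j/2\rfloor}$, and let $D_j=\mathrm{diag}(2^j,2^{\lfloor j/2\rfloor})$, $|D_j|=\det D_j$. The curvelets are $$\gamma_{j,\ell,k}(x)=\frac1{\sqrt{\Lambda_j\lambda_j}}(\mathcal{F}^{-1}\chi_j)(R_{j,\ell}^*x-k),\quad j\in\mathbb{N},\ 0\le\ell\le2^{\lfloor j/2\rfloor}-1,\ k\in\mathbb{X}_j,$$ and $\mathcal{D}_{curv}$ is the set of all of them. For $\gamma=\gamma_{j,\ell,k}$ write $j(\gamma)=j$ and define the unitary operator $U_\gamma$ on $L_2(\mathbb{R}^2)$ by $(U_\gamma F)(x)=|D_j|^{1/2}F\bigl(D_j(R_{j,\ell}^*x-k)\bigr)$. **Smoothness class.** $\mathcal{C}_\alpha$ is the set of $f\in L_2(\mathbb{R}^2)$, expanded as $f=\sum_{\gamma\in\mathcal{D}_{curv}}\omega(\gamma)\gamma$ in $L_2$ with $\omega(\gamma)=\langle f,\gamma\rangle$, whose coefficients satisfy the following: writing the expansion in decreasing rearrangement $f=\sum_{n\ge1}\omega_n\gamma_n$ (the $\gamma_n$ distinct curvelets, including all those with non-zero coefficient, $\omega_n=\omega(\gamma_n)$,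 $|\omega_n|\ge|\omega_{n+1}|$), there is a constant $C'$ with $|\omega_n|\le C'n^{-\alpha}$ for all $n\ge1$. The smallest such $C'$ is denoted $[f]_\alpha$. *)

theory Defs
  imports "HOL-Analysis.Analysis" "HOL-Library.Real_Mod"
begin

section \<open>Functions on the plane\<close>

definition smooth_on :: "real set \<Rightarrow> (real \<Rightarrow> real) \<Rightarrow> bool" where
  "smooth_on S f \<longleftrightarrow> (\<exists>d :: nat \<Rightarrow> real \<Rightarrow> real. (\<forall>x\<in>S. d 0 x = f x) \<and>
     (\<forall>n. \<forall>x\<in>S. (d n has_real_derivative d (Suc n) x) (at x within S)))"

text \<open>Elements of \<open>L\<^sub>2\<close> are represented by Borel measurable functions; every
  \<open>L\<^sub>2\<close> class contains one. As the Bochner integral of a non-integrable function is \<open>0\<close>,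
  \<open>L2_norm\<close> is meaningful only on \<open>L2\<close>; below it is only applied to combinations
  of square integrable functions.\<close>

definition L2 :: "(real^2 \<Rightarrow> complex) set" where
  "L2 = {f. f \<in> borel_measurable lborel \<and> integrable lborel (\<lambda>x. (norm (f x))\<^sup>2)}"

definition L2_norm :: "(real^2 \<Rightarrow> complex) \<Rightarrow> real" where
  "L2_norm f = sqrt (LINT x|lborel. (norm (f x))\<^sup>2)"

definition L2_inner :: "(real^2 \<Rightarrow> complex) \<Rightarrow> (real^2 \<Rightarrow> complex) \<Rightarrow> complex" where
  "L2_inner f g = (LINT x|lborel. f x * cnj (g x))"

definition inv_fourier :: "(real^2 \<Rightarrow> complex) \<Rightarrow> real^2 \<Rightarrow> complex" where
  "inv_fourier F x = complex_of_real (1 / (2 * pi)) * (LINT \<xi>|lborel. F \<xi> * cis (x \<bullet> \<xi>))"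

definition lincomb_atmost ::
    "nat \<Rightarrow> (real^2 \<Rightarrow> complex) set \<Rightarrow> (real^2 \<Rightarrow> complex) \<Rightarrow> bool" where
  "lincomb_atmost m D g \<longleftrightarrow>
     (\<exists>S c. finite S \<and> card S \<le> m \<and> S \<subseteq> D \<and> g = (\<lambda>x. \<Sum>s\<in>S. c s * s x))"

definition gauss :: "real^2 \<Rightarrow> complex" where
  "gauss x = complex_of_real (exp (- (norm x)\<^sup>2))"

definition gauss_translates :: "(real^2 \<Rightarrow> complex) set" where
  "gauss_translates = {\<lambda>x. gauss (x - y) | y. True}"

definition gauss_dict :: "(real^2 \<Rightarrow> complex) set" where
  "gauss_dict = {\<lambda>x. complex_of_real (exp (- (norm (A *v (x - k)))\<^sup>2)) |
     (A :: real^2^2) k. invertible A}"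


section \<open>Curvelets\<close>

definition curvelet_windows ::
    "(real \<Rightarrow> real) \<Rightarrow> (real \<Rightarrow> real) \<Rightarrow> (real \<Rightarrow> real) \<Rightarrow> bool" where
  "curvelet_windows w0 w v \<longleftrightarrow>
     smooth_on {0..} w0 \<and> (\<forall>r\<ge>0. w0 r \<ge> 0) \<and> {r\<in>{0..}. w0 r \<noteq> 0} \<subseteq> {0..8 * pi / 3} \<and>
     smooth_on UNIV w \<and> (\<forall>r. w r \<ge> 0) \<and> {r. w r \<noteq> 0} \<subseteq> {2 * pi / 3..8 * pi / 3} \<and>
     (\<forall>r\<ge>0. (\<lambda>i. (w (r / 2 ^ Suc i))\<^sup>2) sums (1 - (w0 r)\<^sup>2)) \<and>
     smooth_on UNIV v \<and> (\<forall>\<theta>. v \<theta> \<ge> 0) \<and> {\<theta>. v \<theta> \<noteq> 0} \<subseteq> {- pi..pi} \<and>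
     (\<forall>\<theta>. ((\<lambda>l :: int. (v (\<theta> - pi * of_int l))\<^sup>2) has_sum 1) UNIV)"

text \<open>The representative of an angle modulo \<open>2\<pi>\<close> in \<open>[-\<pi>, \<pi>)\<close>.\<close>

definition wrap_angle :: "real \<Rightarrow> real" where
  "wrap_angle \<theta> = (\<theta> + pi) rmod (2 * pi) - pi"

text \<open>The angle of the origin is immaterial: it is multiplied by \<open>w 0 = 0\<close>.\<close>

definition chi ::
    "(real \<Rightarrow> real) \<Rightarrow> (real \<Rightarrow> real) \<Rightarrow> (real \<Rightarrow> real) \<Rightarrow> nat \<Rightarrow> real^2 \<Rightarrow> real" where
  "chi w0 w v j \<xi> =
     (let r = norm \<xi>; \<theta> = Arg (Complex (\<xi> $ 1) (\<xi> $ 2)) in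
      if j = 0 then w0 r
      else if j = 1 then w (r / 2)
      else w (r / 2 ^ j) * (v (2 ^ (j div 2) * wrap_angle \<theta>) +
                            v (2 ^ (j div 2) * wrap_angle (\<theta> - pi))))"

definition lam :: "nat \<Rightarrow> real" where
  "lam j = (if j = 0 then 16 * pi / 3 else if j = 1 then 32 * pi / 3
            else 2 ^ (j + 1) * (8 * pi / 3) * sin (pi / 2 ^ (j div 2)))"

definition Lam :: "nat \<Rightarrow> real" where
  "Lam j = (if j = 0 then 16 * pi / 3 else if j = 1 then 32 * pi / 3
            else (let t = 2 ^ j * (2 * pi / 3) * cos (pi / 2 ^ (j div 2))
                  in 2 * (8 * pi / 3 * 2 ^ j - t)))"

definition curv_lattice :: "nat \<Rightarrow> (real^2) set" where
  "curv_lattice j =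
     {vector [2 * pi * of_int a / Lam j, 2 * pi * of_int b / lam j] | a b :: int. True}"

definition curv_rot :: "nat \<Rightarrow> nat \<Rightarrow> real^2^2" where
  "curv_rot j l = (let \<theta> = pi * real l / 2 ^ (j div 2)
                   in vector [vector [cos \<theta>, - sin \<theta>], vector [sin \<theta>, cos \<theta>]])"

definition curv_dil :: "nat \<Rightarrow> real^2^2" where
  "curv_dil j = vector [vector [2 ^ j, 0], vector [0, 2 ^ (j div 2)]]"

type_synonym curv_index = "nat \<times> nat \<times> (real^2)"

definition curv_indices :: "curv_index set" where
  "curv_indices = {(j, l, k). l < 2 ^ (j div 2) \<and> k \<in> curv_lattice j}"

fun curvelet ::
    "(real \<Rightarrow> real) \<Rightarrow> (real \<Rightarrow> real) \<Rightarrow> (real \<Rightarrow> real) \<Rightarrow> curv_index \<Rightarrow> real^2 \<Rightarrow> complex" where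
  "curvelet w0 w v (j, l, k) =
     (\<lambda>x. complex_of_real (1 / sqrt (Lam j * lam j)) *
          inv_fourier (\<lambda>\<xi>. complex_of_real (chi w0 w v j \<xi>)) (transpose (curv_rot j l) *v x - k))"

definition curv_dict ::
    "(real \<Rightarrow> real) \<Rightarrow> (real \<Rightarrow> real) \<Rightarrow> (real \<Rightarrow> real) \<Rightarrow> (real^2 \<Rightarrow> complex) set" where
  "curv_dict w0 w v = curvelet w0 w v ` curv_indices"

fun curv_scale :: "curv_index \<Rightarrow> nat" where
  "curv_scale (j, l, k) = j"

fun curv_U :: "curv_index \<Rightarrow> (real^2 \<Rightarrow> complex) \<Rightarrow> real^2 \<Rightarrow> complex" where
  "curv_U (j, l, k) F =
     (\<lambda>x. complex_of_real (sqrt (det (curv_dil j))) *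
          F (curv_dil j *v (transpose (curv_rot j l) *v x - k)))"


section \<open>The smoothness class\<close>

text \<open>Unconditional convergence in \<open>L\<^sub>2\<close> of \<open>\<Sum>\<langle>f,\<gamma>\<rangle>\<gamma>\<close> to \<open>f\<close>, \<open>\<gamma>\<close> ranging over all curvelets.\<close>

definition has_curv_expansion ::
    "(real \<Rightarrow> real) \<Rightarrow> (real \<Rightarrow> real) \<Rightarrow> (real \<Rightarrow> real) \<Rightarrow> (real^2 \<Rightarrow> complex) \<Rightarrow> bool" where
  "has_curv_expansion w0 w v f \<longleftrightarrow>
     ((\<lambda>F. L2_norm (\<lambda>x. f x - (\<Sum>g\<in>F. L2_inner f g * g x))) \<longlongrightarrow> 0)
       (finite_subsets_at_top (curv_dict w0 w v))"

text \<open>A decreasing rearrangement is given by a sequence of indices \<open>p 1, p 2, \<dots>\<close> of curvelets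
  (\<open>p 0\<close> is not used); being distinct and covering all non-zero coefficients refer to
  the curvelets as functions, not to their indices.\<close>

definition decr_rearrangement ::
    "(real \<Rightarrow> real) \<Rightarrow> (real \<Rightarrow> real) \<Rightarrow> (real \<Rightarrow> real) \<Rightarrow> (real^2 \<Rightarrow> complex) \<Rightarrow>
     (nat \<Rightarrow> curv_index) \<Rightarrow> bool" where
  "decr_rearrangement w0 w v f p \<longleftrightarrow>
     p ` {1..} \<subseteq> curv_indices \<and>
     inj_on (\<lambda>n. curvelet w0 w v (p n)) {1..} \<and>
     {g \<in> curv_dict w0 w v. L2_inner f g \<noteq> 0} \<subseteq> (\<lambda>n. curvelet w0 w v (p n)) ` {1..} \<and>
     (\<forall>n\<ge>1. norm (L2_inner f (curvelet w0 w v (p n)))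
             \<ge> norm (L2_inner f (curvelet w0 w v (p (Suc n)))))"

definition coeff_decay ::
    "(real \<Rightarrow> real) \<Rightarrow> (real \<Rightarrow> real) \<Rightarrow> (real \<Rightarrow> real) \<Rightarrow> real \<Rightarrow> (real^2 \<Rightarrow> complex) \<Rightarrow> real \<Rightarrow> bool" where
  "coeff_decay w0 w v \<alpha> f C' \<longleftrightarrow>
     (\<exists>p. decr_rearrangement w0 w v f p \<and>
        (\<forall>n\<ge>1. norm (L2_inner f (curvelet w0 w v (p n))) \<le> C' * real n powr (- \<alpha>)))"

definition curv_class ::
    "(real \<Rightarrow> real) \<Rightarrow> (real \<Rightarrow> real) \<Rightarrow> (real \<Rightarrow> real) \<Rightarrow> real \<Rightarrow> (real^2 \<Rightarrow> complex) set" where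
  "curv_class w0 w v \<alpha> =
     {f \<in> L2. has_curv_expansion w0 w v f \<and> (\<exists>C'. coeff_decay w0 w v \<alpha> f C')}"

definition curv_quasinorm ::
    "(real \<Rightarrow> real) \<Rightarrow> (real \<Rightarrow> real) \<Rightarrow> (real \<Rightarrow> real) \<Rightarrow> real \<Rightarrow> (real^2 \<Rightarrow> complex) \<Rightarrow> real" where
  "curv_quasinorm w0 w v \<alpha> f = (LEAST C'. coeff_decay w0 w v \<alpha> f C')"


section \<open>Budgets\<close>

definition N0 :: nat where
  "N0 = 3"

text \<open>For \<open>n \<ge> 1\<close> the \<open>\<nu>\<close> with \<open>2\<^sup>\<nu>\<^sup>-\<^sup>1 < n \<le> 2\<^sup>\<nu>\<close>; the lower bound is \<open>1/2\<close> for \<open>\<nu> = 0\<close>.\<close>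

definition dyadic_level :: "nat \<Rightarrow> nat" where
  "dyadic_level n = (THE \<nu>. 2 ^ \<nu> / 2 < real n \<and> real n \<le> 2 ^ \<nu>)"

definition sub_budget :: "real \<Rightarrow> nat \<Rightarrow> nat \<Rightarrow> nat" where
  "sub_budget \<beta> N n =
     nat \<lfloor>(1 - \<beta>) powr \<beta> * (real N / 2 ^ dyadic_level n) powr \<beta>\<rfloor>"

definition num_curvelets :: "real \<Rightarrow> nat \<Rightarrow> nat" where
  "num_curvelets \<beta> N =
     (let S = {2 ^ \<nu> | \<nu>. (2 :: real) ^ \<nu> \<le> (1 - \<beta>) / real N0 powr (1 / \<beta>) * real N}
      in if S = {} then 0 else Max S)"

definition gauss_approx ::
    "(real \<Rightarrow> real) \<Rightarrow> (real \<Rightarrow> real) \<Rightarrow> (real \<Rightarrow> real) \<Rightarrow> (nat \<Rightarrow> nat \<Rightarrow> real^2 \<Rightarrow> complex) \<Rightarrow>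
     real \<Rightarrow> nat \<Rightarrow> (real^2 \<Rightarrow> complex) \<Rightarrow> (nat \<Rightarrow> curv_index) \<Rightarrow> real^2 \<Rightarrow> complex" where
  "gauss_approx w0 w v G \<beta> N f p =
     (\<lambda>x. \<Sum>n = 1..num_curvelets \<beta> N.
        L2_inner f (curvelet w0 w v (p n)) *
        curv_U (p n) (G (curv_scale (p n)) (sub_budget \<beta> N n)) x)"

end

theory Submission
  imports Defs "HOL-Probability.Probability"
begin

text \<open>On the Fourier side a curvelet of scale \<open>j\<close> is a rotated, dilated and modulated copy of one
compactly supported generator \<open>curv_gen j\<close>. It is therefore enough to approximate the generators by
Fourier transforms of combinations of Gaussian translates, provided that this is done uniformly in
the scale and that errors in the generators are not amplified when the copies are superposed.

Stability is \<open>curvelet_synthesis_bound\<close>: if every generator is perturbed by at most \<open>\<delta>\<close> times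
\<open>weight j\<close>, any finite combination of the copies changes in \<open>L\<^sub>2\<close> by at most a constant times \<open>\<delta>\<close>
times the \<open>\<ell>\<^sub>2\<close> norm of its coefficients. The weight is a Gaussian, multiplied by the square of the
first coordinate from scale \<open>4\<close> on. Its decay makes the coarse scales, and its zero the
fine scales, negligible at a given frequency, so that the sum of all weights over scales and
rotations is bounded (\<open>weight_sum_le\<close>). The translations of one scale and rotation form a
trigonometric polynomial whose frequencies are separated, hence almost orthogonal with respect to
a Gaussian (\<open>gauss_trig_polynomial_integral\<close>). The Cauchy-Schwarz inequality and Plancherel's
inequality combine the two.

For the approximation, a combination of \<open>M\<close> Gaussian translates has the Fourier transform
\<open>1/2 exp (- |\<xi>|\<^sup>2 / 4) T \<xi>\<close>, where \<open>T\<close> is a trigonometric sum with \<open>M\<close> terms. Thus the generators,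
divided by the Gaussian, have to be approximated by trigonometric sums up to a tolerance which
may grow like \<open>exp (|\<xi>|\<^sup>2 / 8)\<close>. These quotients have uniformly bounded supports and, by
parabolic scaling, derivatives bounded uniformly in the scale (\<open>profile_smooth\<close>); the zero of the
weight is accounted for by splitting off the factor \<open>4 sin\<^sup>2 (\<xi>\<^sub>1 / 4)\<close>, a trigonometric sum with three
terms. Averages against powers of the cosine then give errors smaller than any power of \<open>M\<close>
(\<open>trigonometric_approximation\<close>). Choosing for each \<open>j\<close> and \<open>M\<close> a nearly optimal combination makes the
functions independent of the power that is aimed at (\<open>universal_spectra\<close>).

Finally, let \<open>|\<omega>\<^sub>n| \<le> q n powr (- \<alpha>)\<close>. The curvelets of the dyadic block \<open>\<nu>\<close> share a budget of order
\<open>(N / 2 ^ \<nu>) powr \<beta>\<close>, so their error is at most a constant times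
\<open>q * 2 powr (\<nu> * (1/2 - \<alpha>)) * (N / 2 ^ \<nu>) powr (- \<beta> K)\<close>.
For large \<open>K\<close> this increases geometrically with \<open>\<nu>\<close>, and the last block, of size comparable to
\<open>N\<close>, yields \<open>N powr (1/2 - \<alpha>)\<close>. The omitted coefficients have the same order by stability, and the budgets
add up to at most \<open>N\<close> by comparison with the integral of \<open>x powr (- \<beta>)\<close>.\<close>

section \<open>Linear substitutions and Gaussian integrals in the plane\<close>

text \<open>Both measures agree on boxes: the preimage of a box under \<open>A\<close> is its image under the
inverse matrix, whose volume is known.\<close>

lemma distr_lborel_matrix:
  fixes A :: "real^2^2"
  assumes "det A \<noteq> 0"
  shows "lborel = density (distr lborel borel (\<lambda>x. A *v x)) (\<lambda>_. ennreal \<bar>det A\<bar>)"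
proof (rule lborel_eqI)
  have inv: "invertible A"
    using assms by (simp add: invertible_det_nz)
  then obtain B where AB: "A ** B = mat 1" "B ** A = mat 1"
    unfolding invertible_def by blast
  have detAB: "det A * det B = 1"
    using AB(1) det_mul[of A B] by (simp add: det_I)
  have [measurable]: "(\<lambda>x. A *v x) \<in> borel_measurable borel"
    by (intro borel_measurable_continuous_onI continuous_intros)
  fix l u :: "real^2"
  assume le: "\<And>b. b \<in> Basis \<Longrightarrow> l \<bullet> b \<le> u \<bullet> b"
  have vim: "(\<lambda>x. A *v x) -` box l u = (\<lambda>x. B *v x) ` box l u"
  proof safe
    fix x assume "A *v x \<in> box l u"
    moreover have "x = B *v (A *v x)"
      by (simp add: matrix_vector_mul_assoc AB)
    ultimately show "x \<in> (\<lambda>x. B *v x) ` box l u" by blast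
  qed (simp add: matrix_vector_mul_assoc AB)
  have [measurable]: "(\<lambda>x. A *v x) -` box l u \<in> sets borel"
    using measurable_sets[of "\<lambda>x. A *v x" borel borel "box l u"] by simp
  have lm: "box l u \<in> lmeasurable" by simp
  have lmB: "(\<lambda>x. B *v x) ` box l u \<in> lmeasurable"
    by (rule measurable_linear_image) auto
  have "measure lebesgue ((\<lambda>x. B *v x) ` box l u) = \<bar>det B\<bar> * measure lebesgue (box l u)"
    by (subst measure_linear_image) auto
  then have "emeasure lborel ((\<lambda>x. A *v x) -` box l u) = ennreal (\<bar>det B\<bar> * measure lebesgue (box l u))"
    using lmB emeasure_eq_measure2[OF lmB] unfolding vim[symmetric]
    by simp
  then have "emeasure (density (distr lborel borel (\<lambda>x. A *v x)) (\<lambda>_. ennreal \<bar>det A\<bar>)) (box l u)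
     = ennreal \<bar>det A\<bar> * ennreal (\<bar>det B\<bar> * measure lebesgue (box l u))"
    by (simp add: emeasure_density nn_integral_cmult emeasure_distr)
  also have "\<dots> = ennreal (measure lebesgue (box l u))"
    using detAB by (simp add: ennreal_mult[symmetric] abs_mult[symmetric] mult.assoc[symmetric])
  also have "\<dots> = (\<Prod>b\<in>Basis. (u - l) \<bullet> b)"
    using le emeasure_eq_measure2[OF lm] emeasure_lborel_box_eq[of l u] by simp
  finally show "emeasure (density (distr lborel borel (\<lambda>x. A *v x)) (\<lambda>_. ennreal \<bar>det A\<bar>)) (box l u)
     = (\<Prod>b\<in>Basis. (u - l) \<bullet> b)" .
qed simp

lemma integrable_matrix_substitution:
  fixes f :: "real^2 \<Rightarrow> 'a::{banach,second_countable_topology}" and A :: "real^2^2"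
  assumes "det A \<noteq> 0" and [measurable]: "f \<in> borel_measurable borel"
  shows "integrable lborel (\<lambda>x. f (A *v x)) \<longleftrightarrow> integrable lborel f"
proof -
  have [measurable]: "(\<lambda>x. A *v x) \<in> borel_measurable borel"
    by (intro borel_measurable_continuous_onI continuous_intros)
  show ?thesis
    by (subst (2) distr_lborel_matrix[OF assms(1)])
       (use assms(1) integrable_scaleR_right[of "inverse \<bar>det A\<bar>" lborel "\<lambda>x. \<bar>det A\<bar> *\<^sub>R f (A *v x)"]
          integrable_scaleR_right[of "\<bar>det A\<bar>" lborel "\<lambda>x. f (A *v x)"]
        in \<open>auto simp: integrable_density integrable_distr_eq\<close>)
qed

lemma integral_matrix_substitution:
  fixes f :: "real^2 \<Rightarrow> 'a::{banach,second_countable_topology}" and A :: "real^2^2"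
  assumes "det A \<noteq> 0" and [measurable]: "f \<in> borel_measurable borel"
  shows "(LINT x|lborel. f x) = \<bar>det A\<bar> *\<^sub>R (LINT x|lborel. f (A *v x))"
proof -
  have [measurable]: "(\<lambda>x. A *v x) \<in> borel_measurable borel"
    by (intro borel_measurable_continuous_onI continuous_intros)
  show ?thesis
    by (subst distr_lborel_matrix[OF assms(1)])
       (simp add: integral_density integral_distr)
qed

lemma Basis_vec2: "(Basis :: (real^2) set) = {axis 1 1, axis 2 1}"
  by (auto simp: Basis_vec_def UNIV_2)

text \<open>Lebesgue measure on the plane is the image of the product measure on the coordinate axes.\<close>

lemma integral_vec2_product:
  fixes f g :: "real \<Rightarrow> complex"
  assumes f: "integrable lborel f" and g: "integrable lborel g"
  shows "integrable lborel (\<lambda>x::real^2. f (x $ 1) * g (x $ 2))"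
    and "(LINT x|lborel. f ((x::real^2) $ 1) * g (x $ 2)) = (LINT t|lborel. f t) * (LINT t|lborel. g t)"
proof -
  interpret product_sigma_finite "\<lambda>_::real^2. lborel :: real measure"
    by standard
  define a b :: "real^2" where "a = axis 1 1" and "b = axis 2 1"
  have ab: "a \<noteq> b" "Basis = {a, b}"
    by (auto simp: a_def b_def Basis_vec2 axis_eq_axis)
  define h where "h = (\<lambda>i. if i = a then f else g)"
  have h: "\<And>i. i \<in> {a,b} \<Longrightarrow> integrable lborel (h i)"
    using f g by (simp add: h_def)
  have [measurable]: "f \<in> borel_measurable borel" "g \<in> borel_measurable borel"
    using f g by auto
  have comp: "(\<Sum>i\<in>{a,b}. x i *\<^sub>R i) $ 1 = x a" "(\<Sum>i\<in>{a,b}. x i *\<^sub>R i) $ 2 = x b" for x :: "real^2 \<Rightarrow> real"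
    using ab(1) by (auto simp: a_def b_def axis_def)
  have eq: "(\<lambda>x. f ((\<Sum>i\<in>{a,b}. x i *\<^sub>R i) $ 1) * g ((\<Sum>i\<in>{a,b}. x i *\<^sub>R i) $ 2))
      = (\<lambda>x. \<Prod>i\<in>{a,b}. h i (x i))"
    using ab(1) unfolding comp by (auto simp: h_def)
  have ms: "(\<lambda>x. \<Sum>i\<in>{a,b}. x i *\<^sub>R i) \<in> measurable (\<Pi>\<^sub>M b\<in>{a,b}. lborel) borel"
    by measurable
  show "integrable lborel (\<lambda>x::real^2. f (x $ 1) * g (x $ 2))"
    apply (subst lborel_eq)
    unfolding ab(2)
    apply (subst integrable_distr_eq[OF ms])
     apply measurable
    unfolding eq
    by (rule product_integrable_prod) (use h in auto)
  show "(LINT x|lborel. f ((x::real^2) $ 1) * g (x $ 2)) = (LINT t|lborel. f t) * (LINT t|lborel. g t)"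
    apply (subst lborel_eq)
    unfolding ab(2)
    apply (subst integral_distr[OF ms])
     apply measurable
    unfolding eq
    apply (subst product_integral_prod)
    using h ab(1) by (auto simp: h_def)
qed

text \<open>This is the characteristic function of the standard normal distribution, rescaled.\<close>

lemma gauss_char_1d:
  fixes c y :: real
  assumes "c > 0"
  shows "integrable lborel (\<lambda>t. complex_of_real (exp (- c * t\<^sup>2)) * cis (y * t))"
    and "(LINT t|lborel. complex_of_real (exp (- c * t\<^sup>2)) * cis (y * t))
           = complex_of_real (sqrt (pi / c) * exp (- y\<^sup>2 / (4 * c)))"
proof -
  define s where "s = sqrt (2 * c)"
  have s: "s > 0" "s\<^sup>2 = 2 * c" using assms by (auto simp: s_def)
  have sn: "std_normal_density t = exp (- t\<^sup>2 / 2) / sqrt (2 * pi)" for t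
    by (simp add: std_normal_density_def)
  have i0: "integrable lborel (\<lambda>t. std_normal_density t)"
    by (rule integrable_normal_density) simp
  have ie: "integrable lborel (\<lambda>t. complex_of_real (exp (- t\<^sup>2 / 2)) * cis (u * t))" for u
  proof (rule Bochner_Integration.integrable_bound)
    show "integrable lborel (\<lambda>t. sqrt (2 * pi) * std_normal_density t)"
      using i0 by simp
    show "AE t in lborel. norm (complex_of_real (exp (- t\<^sup>2 / 2)) * cis (u * t))
        \<le> norm (sqrt (2 * pi) * std_normal_density t)"
      by (simp add: sn norm_mult)
    show "(\<lambda>t. complex_of_real (exp (- t\<^sup>2 / 2)) * cis (u * t)) \<in> borel_measurable lborel"
      unfolding cis_conv_exp by measurable
  qed
  have v: "(LINT t|lborel. complex_of_real (exp (- t\<^sup>2 / 2)) * cis (u * t))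
        = complex_of_real (sqrt (2 * pi) * exp (- u\<^sup>2 / 2))" for u
  proof -
    have "complex_of_real (exp (- u\<^sup>2 / 2)) = (CLINT t|std_normal_distribution. iexp (u * t))"
      using fun_cong[OF char_std_normal_distribution, of u] by (simp add: char_def)
    also have "\<dots> = (LINT t|lborel. std_normal_density t *\<^sub>R iexp (u * t))"
      by (subst integral_density) (auto simp: normal_density_nonneg)
    also have "\<dots> = (LINT t|lborel. complex_of_real (1 / sqrt (2*pi)) * (complex_of_real (exp (- t\<^sup>2 / 2)) * cis (u * t)))"
      by (intro Bochner_Integration.integral_cong) (simp_all add: sn scaleR_conv_of_real cis_conv_exp)
    also have "\<dots> = complex_of_real (1 / sqrt (2*pi)) * (LINT t|lborel. complex_of_real (exp (- t\<^sup>2 / 2)) * cis (u * t))"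
      by simp
    finally show ?thesis by (simp add: field_simps)
  qed
  have e: "complex_of_real (exp (- (0 + s * t)\<^sup>2 / 2)) * cis (y / s * (0 + s * t))
      = complex_of_real (exp (- c * t\<^sup>2)) * cis (y * t)" for t
    using s by (simp add: power_mult_distrib)
  show "integrable lborel (\<lambda>t. complex_of_real (exp (- c * t\<^sup>2)) * cis (y * t))"
    using lborel_integrable_real_affine[OF ie[of "y/s"], of s 0] s(1) unfolding e by simp
  have "complex_of_real (sqrt (2 * pi) * exp (- (y/s)\<^sup>2 / 2))
      = s *\<^sub>R (LINT t|lborel. complex_of_real (exp (- c * t\<^sup>2)) * cis (y * t))"
    using v[of "y/s"] lborel_integral_real_affine[of s "\<lambda>t. complex_of_real (exp (- t\<^sup>2 / 2)) * cis (y / s * t)" 0] s(1)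
    unfolding e by simp
  then have "(LINT t|lborel. complex_of_real (exp (- c * t\<^sup>2)) * cis (y * t))
      = complex_of_real ((sqrt (2 * pi) * exp (- (y/s)\<^sup>2 / 2)) / s)"
    using s(1) by (simp add: scaleR_conv_of_real field_simps)
  also have "(sqrt (2 * pi) * exp (- (y/s)\<^sup>2 / 2)) / s = sqrt (pi / c) * exp (- y\<^sup>2 / (4 * c))"
    using assms s by (simp add: s_def power_divide real_sqrt_divide real_sqrt_mult field_simps)
  finally show "(LINT t|lborel. complex_of_real (exp (- c * t\<^sup>2)) * cis (y * t))
           = complex_of_real (sqrt (pi / c) * exp (- y\<^sup>2 / (4 * c)))" .
qed

lemma norm_vec2: "(norm (x::real^2))\<^sup>2 = (x$1)\<^sup>2 + (x$2)\<^sup>2"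
  by (simp add: norm_vec_def L2_set_def UNIV_2 real_sqrt_pow2)

lemma inner_vec2: "(x::real^2) \<bullet> y = x$1 * y$1 + x$2 * y$2"
  by (simp add: inner_vec_def UNIV_2)

lemma gauss_char_2d:
  fixes c :: real and y :: "real^2"
  assumes "c > 0"
  shows "integrable lborel (\<lambda>x. complex_of_real (exp (- c * (norm x)\<^sup>2)) * cis (y \<bullet> x))"
    and "(LINT x|lborel. complex_of_real (exp (- c * (norm x)\<^sup>2)) * cis (y \<bullet> x))
           = complex_of_real (pi / c * exp (- (norm y)\<^sup>2 / (4 * c)))"
proof -
  have e: "complex_of_real (exp (- c * (norm x)\<^sup>2)) * cis (y \<bullet> x)
     = (complex_of_real (exp (- c * (x$1)\<^sup>2)) * cis (y$1 * x$1)) *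
       (complex_of_real (exp (- c * (x$2)\<^sup>2)) * cis (y$2 * x$2))" for x :: "real^2"
    by (simp add: norm_vec2 inner_vec2 exp_add[symmetric] cis_mult[symmetric] algebra_simps flip: of_real_mult)
  show "integrable lborel (\<lambda>x. complex_of_real (exp (- c * (norm x)\<^sup>2)) * cis (y \<bullet> x))"
    unfolding e using gauss_char_1d(1)[OF assms] by (intro integral_vec2_product)
  show "(LINT x|lborel. complex_of_real (exp (- c * (norm x)\<^sup>2)) * cis (y \<bullet> x))
           = complex_of_real (pi / c * exp (- (norm y)\<^sup>2 / (4 * c)))"
  proof -
    have r: "sqrt (pi / c) * exp (- (y$1)\<^sup>2 / (4 * c)) * (sqrt (pi / c) * exp (- (y$2)\<^sup>2 / (4 * c)))
        = pi / c * exp (- (norm y)\<^sup>2 / (4 * c))"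
    proof -
      have "sqrt (pi / c) * sqrt (pi / c) = pi / c" using assms by simp
      moreover have "exp (- (y$1)\<^sup>2 / (4 * c)) * exp (- (y$2)\<^sup>2 / (4 * c)) = exp (- (norm y)\<^sup>2 / (4 * c))"
        by (simp add: norm_vec2 exp_add[symmetric] diff_divide_distrib)
      ultimately show ?thesis by (metis (no_types, opaque_lifting) mult.assoc mult.left_commute)
    qed
    show ?thesis
      unfolding e integral_vec2_product(2)[OF gauss_char_1d(1)[OF assms] gauss_char_1d(1)[OF assms]]
        gauss_char_1d(2)[OF assms] of_real_mult[symmetric] r ..
  qed
qed

section \<open>Plancherel's inequality\<close>

lemma nn_integral_vec_translate:
  fixes f :: "real^2 \<Rightarrow> ennreal"
  assumes [measurable]: "f \<in> borel_measurable borel"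
  shows "(\<integral>\<^sup>+x. f (x - y) \<partial>lborel) = (\<integral>\<^sup>+x. f x \<partial>lborel)"
proof -
  have "(\<integral>\<^sup>+x. f x \<partial>lborel) = (\<integral>\<^sup>+x. f x \<partial>(distr lborel borel ((+) (- y))))"
    by (simp add: lborel_distr_plus)
  also have "\<dots> = (\<integral>\<^sup>+x. f (- y + x) \<partial>lborel)"
    by (rule nn_integral_distr) auto
  finally show ?thesis by simp
qed

lemma gauss_integrable_vec2:
  assumes "c > 0" shows "integrable lborel (\<lambda>x::real^2. exp (- c * (norm x)\<^sup>2))"
  using gauss_char_2d(1)[OF assms, of 0] by (simp add: complex_of_real_integrable_eq)

lemma gauss_nn_integral:
  assumes "c > 0"
  shows "(\<integral>\<^sup>+(x::real^2). ennreal (exp (- c * (norm x)\<^sup>2)) \<partial>lborel) = ennreal (pi / c)"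
proof -
  have e: "complex_of_real (exp (- c * (norm x)\<^sup>2)) * cis (0 \<bullet> x) = complex_of_real (exp (- c * (norm x)\<^sup>2))"
    for x :: "real^2" by simp
  note i = gauss_integrable_vec2[OF assms]
  have "complex_of_real (LINT (x::real^2)|lborel. exp (- c * (norm x)\<^sup>2)) = complex_of_real (pi / c)"
    using gauss_char_2d(2)[OF assms, of 0] unfolding e integral_complex_of_real by simp
  then have "(LINT (x::real^2)|lborel. exp (- c * (norm x)\<^sup>2)) = pi / c"
    unfolding of_real_eq_iff .
  with i show ?thesis
    by (subst nn_integral_eq_integral) auto
qed

lemma inv_fourier_measurable:
  assumes [measurable]: "H \<in> borel_measurable borel"
  shows "inv_fourier H \<in> borel_measurable borel"
  unfolding inv_fourier_def[abs_def] cis_conv_exp by measurable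

text \<open>By Fubini's theorem the damped integral is the double integral of \<open>H \<xi> * cnj (H \<eta>)\<close> against a Gaussian
in \<open>\<xi> - \<eta>\<close> of mass \<open>4 * pi\<^sup>2\<close>, to which \<open>2 |H \<xi>| |H \<eta>| \<le> |H \<xi>|\<^sup>2 + |H \<eta>|\<^sup>2\<close> is applied. The resulting bound
does not depend on the damping.\<close>

lemma inv_fourier_damped_bound:
  assumes H: "integrable lborel H" and H2: "integrable lborel (\<lambda>\<xi>. (norm (H \<xi>))\<^sup>2)" and e: "e > 0"
  shows "(\<integral>\<^sup>+x. ennreal ((norm (inv_fourier H x))\<^sup>2 * exp (- e * (norm x)\<^sup>2)) \<partial>lborel)
     \<le> ennreal (LINT \<xi>|lborel. (norm (H \<xi>))\<^sup>2)"
proof -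
  have Hm[measurable]: "H \<in> borel_measurable borel" using H by auto
  define g :: "real^2 \<Rightarrow> real" where "g x = exp (- e * (norm x)\<^sup>2)" for x
  define P :: "((real^2) \<times> (real^2)) measure" where "P = lborel \<Otimes>\<^sub>M lborel"
  interpret LP: pair_sigma_finite "lborel :: (real^2) measure" P
    unfolding P_def
    by (intro pair_sigma_finite.intro sigma_finite_lborel)
       (simp add: lborel_prod sigma_finite_lborel)
  have [measurable]: "g \<in> borel_measurable borel" unfolding g_def[abs_def] by measurable
  have [measurable_cong]: "sets P = sets (borel \<Otimes>\<^sub>M borel)" unfolding P_def by (intro sets_pair_measure_cong) auto
  define K where "K = (\<lambda>z. H (fst z) * cnj (H (snd z)))"
  have [measurable]: "cnj \<in> borel_measurable borel"
    by (intro borel_measurable_continuous_onI continuous_intros)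
  have Km[measurable]: "K \<in> borel_measurable (borel \<Otimes>\<^sub>M borel)" unfolding K_def by measurable
  have K: "integrable P K"
    unfolding K_def P_def
    by (rule lborel_pair.Fubini_integrable) (use H in \<open>auto simp: norm_mult\<close>)
  have gi: "integrable lborel g"
    using gauss_char_2d(1)[OF e, of 0] by (simp add: g_def[abs_def] complex_of_real_integrable_eq)
  have sq: "complex_of_real ((norm (inv_fourier H x))\<^sup>2) = complex_of_real (1 / (4 * pi\<^sup>2)) * (LINT z|P. K z * cis (x \<bullet> (fst z - snd z)))" for x
  proof -
    define I where "I = (LINT \<xi>|lborel. H \<xi> * cis (x \<bullet> \<xi>))"
    have cd: "cis (a - b) = cis a * cnj (cis b)" for a b
      by (simp add: cis_cnj cis_mult)
    have Hc: "integrable lborel (\<lambda>\<xi>. H \<xi> * cis (x \<bullet> \<xi>))"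
      by (rule Bochner_Integration.integrable_bound[OF H]) (auto simp: norm_mult cis_conv_exp)
    have cI: "cnj I = (LINT \<eta>|lborel. cnj (H \<eta> * cis (x \<bullet> \<eta>)))"
      unfolding I_def by (rule Bochner_Integration.integral_cnj[symmetric])
    have ip: "integrable P (\<lambda>z. (H (fst z) * cis (x \<bullet> fst z)) * cnj (H (snd z) * cis (x \<bullet> snd z)))"
      unfolding P_def cis_conv_exp
    proof (rule lborel_pair.Fubini_integrable)
      have n: "integrable lborel (\<lambda>\<xi>. norm (H \<xi>))" using H by simp
      show "integrable lborel (\<lambda>\<xi>. LINT \<eta>|lborel. norm (H (fst (\<xi>, \<eta>)) * exp (\<i> * complex_of_real (x \<bullet> fst (\<xi>, \<eta>))) *
            cnj (H (snd (\<xi>, \<eta>)) * exp (\<i> * complex_of_real (x \<bullet> snd (\<xi>, \<eta>))))))"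
        using n by (simp add: norm_mult)
      have "integrable lborel (\<lambda>\<eta>. cnj (H \<eta> * cis (x \<bullet> \<eta>)))"
        by (rule integrable_cnj[OF Hc])
      then show "AE \<xi> in lborel. integrable lborel (\<lambda>\<eta>. H (fst (\<xi>, \<eta>)) * exp (\<i> * complex_of_real (x \<bullet> fst (\<xi>, \<eta>))) *
            cnj (H (snd (\<xi>, \<eta>)) * exp (\<i> * complex_of_real (x \<bullet> snd (\<xi>, \<eta>)))))"
        by (intro AE_I2) (simp only: fst_conv snd_conv cis_conv_exp integrable_mult_right)
    qed measurable
    have "(LINT z|P. (H (fst z) * cis (x \<bullet> fst z)) * cnj (H (snd z) * cis (x \<bullet> snd z)))
       = (LINT \<xi>|lborel. (LINT \<eta>|lborel. (H \<xi> * cis (x \<bullet> \<xi>)) * cnj (H \<eta> * cis (x \<bullet> \<eta>))))"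
      using lborel_pair.integral_fst'[OF ip[unfolded P_def]] unfolding P_def by simp
    also have "\<dots> = I * cnj I"
      unfolding cI by (simp add: I_def)
    finally have "I * cnj I = (LINT z|P. (H (fst z) * cis (x \<bullet> fst z)) * cnj (H (snd z) * cis (x \<bullet> snd z)))" ..
    also have "\<dots> = (LINT z|P. K z * cis (x \<bullet> (fst z - snd z)))"
      by (intro Bochner_Integration.integral_cong)
         (simp_all add: K_def inner_diff_right cd)
    finally have "I * cnj I = \<dots>" .
    then show ?thesis
      unfolding complex_norm_square inv_fourier_def I_def[symmetric]
      by (simp add: power2_eq_square)
  qed
  have "integrable (lborel \<Otimes>\<^sub>M P) (\<lambda>(x, z). (complex_of_real (g x)) * (K z * cis (x \<bullet> (fst z - snd z))))"
  proof (rule Bochner_Integration.integrable_bound)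
    show "integrable (lborel \<Otimes>\<^sub>M P) (\<lambda>w. complex_of_real (g (fst w)) * K (snd w))"
      by (rule LP.Fubini_integrable) (use K gi in \<open>auto simp: norm_mult\<close>)
  qed (auto simp: norm_mult split_beta' cis_conv_exp)
  note Fub = LP.Fubini_integral[OF this]
  have in1: "(LINT x|lborel. complex_of_real (g x) * (K z * cis (x \<bullet> (fst z - snd z))))
     = K z * complex_of_real (pi / e * exp (- (norm (fst z - snd z))\<^sup>2 / (4 * e)))" for z
  proof -
    have "(LINT x|lborel. complex_of_real (g x) * (K z * cis (x \<bullet> (fst z - snd z))))
      = (LINT x|lborel. K z * (complex_of_real (exp (- e * (norm x)\<^sup>2)) * cis ((fst z - snd z) \<bullet> x)))"
      by (intro Bochner_Integration.integral_cong) (simp_all add: g_def inner_commute mult_ac)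
    then show ?thesis unfolding integral_mult_right_zero gauss_char_2d(2)[OF e] .
  qed
  have bdd: "norm (inv_fourier H x) \<le> (1 / (2*pi)) * (LINT \<xi>|lborel. norm (H \<xi>))" for x
  proof -
    have "norm (LINT \<xi>|lborel. H \<xi> * cis (x \<bullet> \<xi>)) \<le> (LINT \<xi>|lborel. norm (H \<xi> * cis (x \<bullet> \<xi>)))"
      by (rule integral_norm_bound)
    then show ?thesis by (simp add: inv_fourier_def norm_mult norm_divide divide_right_mono)
  qed
  have ui: "integrable lborel (\<lambda>x. (norm (inv_fourier H x))\<^sup>2 * g x)"
  proof (rule Bochner_Integration.integrable_bound)
    show "integrable lborel (\<lambda>x. ((1 / (2*pi)) * (LINT \<xi>|lborel. norm (H \<xi>)))\<^sup>2 * g x)"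
      using gi by simp
    show "(\<lambda>x. (norm (inv_fourier H x))\<^sup>2 * g x) \<in> borel_measurable lborel"
      using inv_fourier_measurable[OF Hm] by measurable
    show "AE x in lborel. norm ((norm (inv_fourier H x))\<^sup>2 * g x) \<le> norm (((1 / (2*pi)) * (LINT \<xi>|lborel. norm (H \<xi>)))\<^sup>2 * g x)"
    proof (rule AE_I2)
      fix x show "norm ((norm (inv_fourier H x))\<^sup>2 * g x) \<le> norm (((1 / (2*pi)) * (LINT \<xi>|lborel. norm (H \<xi>)))\<^sup>2 * g x)"
        using power_mono[OF bdd[of x], of 2] by (simp add: norm_mult abs_mult mult_right_mono g_def power_mult_distrib)
    qed
  qed
  define G where "G = (\<lambda>y::real^2. pi / e * exp (- (norm y)\<^sup>2 / (4 * e)))"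
  have Gm[measurable]: "G \<in> borel_measurable borel" unfolding G_def by measurable
  have G0: "G y \<ge> 0" for y using e by (simp add: G_def)
  have "complex_of_real (LINT x|lborel. (norm (inv_fourier H x))\<^sup>2 * g x)
     = (LINT x|lborel. complex_of_real ((norm (inv_fourier H x))\<^sup>2) * complex_of_real (g x))"
    by (simp flip: integral_complex_of_real)
  also have "\<dots> = (LINT x|lborel. complex_of_real (1 / (4 * pi\<^sup>2)) * (LINT z|P. complex_of_real (g x) * (K z * cis (x \<bullet> (fst z - snd z)))))"
    by (intro Bochner_Integration.integral_cong refl) (simp only: sq integral_mult_right_zero, simp only: mult_ac)
  also have "\<dots> = complex_of_real (1 / (4 * pi\<^sup>2)) * (LINT x|lborel. (LINT z|P. complex_of_real (g x) * (K z * cis (x \<bullet> (fst z - snd z)))))"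
    by simp
  also have "\<dots> = complex_of_real (1 / (4 * pi\<^sup>2)) * (LINT z|P. K z * complex_of_real (G (fst z - snd z)))"
    unfolding Fub[symmetric] in1 G_def ..
  finally have eq: "complex_of_real (LINT x|lborel. (norm (inv_fourier H x))\<^sup>2 * g x)
      = complex_of_real (1 / (4 * pi\<^sup>2)) * (LINT z|P. K z * complex_of_real (G (fst z - snd z)))" .
  have nn0: "(\<integral>\<^sup>+y. ennreal (G (y - a)) \<partial>lborel) = ennreal (4 * pi\<^sup>2)" for a
  proof -
    have "(\<integral>\<^sup>+y. ennreal (G (y - a)) \<partial>lborel) = (\<integral>\<^sup>+y. ennreal (G y) \<partial>lborel)"
      by (rule nn_integral_vec_translate) measurable
    also have "\<dots> = (\<integral>\<^sup>+y. ennreal (pi / e) * ennreal (exp (- (1 / (4*e)) * (norm (y::real^2))\<^sup>2)) \<partial>lborel)"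
      using e by (intro nn_integral_cong) (simp add: G_def ennreal_mult[symmetric])
    also have "\<dots> = ennreal (pi / e) * ennreal (pi / (1 / (4 * e)))"
      using e by (subst nn_integral_cmult) (auto simp: gauss_nn_integral[of "1/(4*e)", simplified])
    finally show ?thesis using e by (simp add: ennreal_mult[symmetric] power2_eq_square)
  qed
  have nn0': "(\<integral>\<^sup>+y. ennreal (G (a - y)) \<partial>lborel) = ennreal (4 * pi\<^sup>2)" for a
  proof -
    have "G (a - y) = G (y - a)" for y by (simp add: G_def norm_minus_commute)
    then show ?thesis using nn0[of a] by simp
  qed
  define Q where "Q = (LINT \<xi>|lborel. (norm (H \<xi>))\<^sup>2)"
  have Q0: "Q \<ge> 0" unfolding Q_def by simp
  have nnH: "(\<integral>\<^sup>+\<xi>. ennreal ((norm (H \<xi>))\<^sup>2) \<partial>lborel) = ennreal Q"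
    unfolding Q_def by (rule nn_integral_eq_integral[OF H2]) auto
  have a1: "(\<integral>\<^sup>+\<xi>. \<integral>\<^sup>+\<eta>. ennreal ((norm (H \<xi>))\<^sup>2) * ennreal (G (\<xi> - \<eta>)) \<partial>lborel \<partial>lborel) = ennreal Q * ennreal (4 * pi\<^sup>2)"
  proof -
    have "(\<integral>\<^sup>+\<xi>. \<integral>\<^sup>+\<eta>. ennreal ((norm (H \<xi>))\<^sup>2) * ennreal (G (\<xi> - \<eta>)) \<partial>lborel \<partial>lborel)
      = (\<integral>\<^sup>+\<xi>. ennreal ((norm (H \<xi>))\<^sup>2) * ennreal (4 * pi\<^sup>2) \<partial>lborel)"
      by (intro nn_integral_cong) (simp add: nn_integral_cmult nn0')
    then show ?thesis by (simp add: nn_integral_multc nnH)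
  qed
  have a2: "(\<integral>\<^sup>+\<xi>. \<integral>\<^sup>+\<eta>. ennreal ((norm (H \<eta>))\<^sup>2) * ennreal (G (\<xi> - \<eta>)) \<partial>lborel \<partial>lborel) = ennreal Q * ennreal (4 * pi\<^sup>2)"
  proof -
    have "(\<integral>\<^sup>+\<xi>. \<integral>\<^sup>+\<eta>. ennreal ((norm (H \<eta>))\<^sup>2) * ennreal (G (\<xi> - \<eta>)) \<partial>lborel \<partial>lborel)
      = (\<integral>\<^sup>+\<eta>. \<integral>\<^sup>+\<xi>. ennreal ((norm (H \<eta>))\<^sup>2) * ennreal (G (\<xi> - \<eta>)) \<partial>lborel \<partial>lborel)"
      by (rule lborel_pair.Fubini'[symmetric]) measurable
    also have "\<dots> = (\<integral>\<^sup>+\<xi>. ennreal ((norm (H \<xi>))\<^sup>2) * ennreal (4 * pi\<^sup>2) \<partial>lborel)"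
      by (intro nn_integral_cong) (simp add: nn_integral_cmult nn0)
    finally show ?thesis by (simp add: nn_integral_multc nnH)
  qed
  have h: "ennreal c * (ennreal a * ennreal g + ennreal b * ennreal g) = ennreal (c * (a + b) * g)"
    if "a \<ge> 0" "b \<ge> 0" "c \<ge> 0" "g \<ge> 0" for a b c g :: real
    using that by (simp add: ennreal_mult[symmetric] ennreal_plus[symmetric] algebra_simps del: ennreal_plus)
  have "ennreal (norm (LINT z|P. K z * complex_of_real (G (fst z - snd z))))
     \<le> (\<integral>\<^sup>+z. norm (K z * complex_of_real (G (fst z - snd z))) \<partial>P)"
  proof -
    have "integrable P (\<lambda>z. K z * complex_of_real (G (fst z - snd z)))"
    proof (rule Bochner_Integration.integrable_bound)
      show "integrable P (\<lambda>z. complex_of_real (pi / e) * K z)" using K by simp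
      show "AE z in P. norm (K z * complex_of_real (G (fst z - snd z))) \<le> norm (complex_of_real (pi / e) * K z)"
      proof (rule AE_I2)
        fix z
        have "G (fst z - snd z) \<le> pi / e" using e by (auto simp: G_def divide_right_mono)
        then show "norm (K z * complex_of_real (G (fst z - snd z))) \<le> norm (complex_of_real (pi / e) * K z)"
          using G0[of "fst z - snd z"] e unfolding norm_mult norm_of_real
          by (subst mult.commute) (intro mult_right_mono, auto)
      qed
    qed measurable
    then show ?thesis by (rule integral_norm_bound_ennreal)
  qed
  also have "\<dots> = (\<integral>\<^sup>+\<xi>. \<integral>\<^sup>+\<eta>. ennreal (norm (H \<xi>) * norm (H \<eta>) * G (\<xi> - \<eta>)) \<partial>lborel \<partial>lborel)"
    unfolding P_def
    by (subst lborel.nn_integral_fst[symmetric]) (auto simp: K_def norm_mult G0)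
  also have "\<dots> \<le> (\<integral>\<^sup>+\<xi>. \<integral>\<^sup>+\<eta>. ennreal (1/2) * (ennreal ((norm (H \<xi>))\<^sup>2) * ennreal (G (\<xi> - \<eta>)) + ennreal ((norm (H \<eta>))\<^sup>2) * ennreal (G (\<xi> - \<eta>))) \<partial>lborel \<partial>lborel)"
  proof (intro nn_integral_mono)
    fix \<xi> \<eta>
    have "2 * (norm (H \<xi>) * norm (H \<eta>)) \<le> (norm (H \<xi>))\<^sup>2 + (norm (H \<eta>))\<^sup>2"
      using sum_squares_bound[of "norm (H \<xi>)" "norm (H \<eta>)"] by simp
    then have "norm (H \<xi>) * norm (H \<eta>) * G (\<xi> - \<eta>) \<le> (1/2 * ((norm (H \<xi>))\<^sup>2 + (norm (H \<eta>))\<^sup>2)) * G (\<xi> - \<eta>)"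
      using G0 by (intro mult_right_mono) auto
    then show "ennreal (norm (H \<xi>) * norm (H \<eta>) * G (\<xi> - \<eta>)) \<le> ennreal (1/2) * (ennreal ((norm (H \<xi>))\<^sup>2) * ennreal (G (\<xi> - \<eta>)) + ennreal ((norm (H \<eta>))\<^sup>2) * ennreal (G (\<xi> - \<eta>)))"
      using G0 by (subst h) (auto intro: ennreal_leI)
  qed
  also have "\<dots> = ennreal (1/2) * ((\<integral>\<^sup>+\<xi>. \<integral>\<^sup>+\<eta>. ennreal ((norm (H \<xi>))\<^sup>2) * ennreal (G (\<xi> - \<eta>)) \<partial>lborel \<partial>lborel)
     + (\<integral>\<^sup>+\<xi>. \<integral>\<^sup>+\<eta>. ennreal ((norm (H \<eta>))\<^sup>2) * ennreal (G (\<xi> - \<eta>)) \<partial>lborel \<partial>lborel))"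
    by (simp add: nn_integral_cmult nn_integral_add)
  also have "\<dots> = ennreal (Q * (4 * pi\<^sup>2))"
    unfolding a1 a2 using Q0 by (subst h) auto
  finally have "norm (LINT z|P. K z * complex_of_real (G (fst z - snd z))) \<le> Q * (4 * pi\<^sup>2)"
    using Q0 by (subst (asm) ennreal_le_iff) auto
  then have "norm (complex_of_real (LINT x|lborel. (norm (inv_fourier H x))\<^sup>2 * g x)) \<le> Q"
    unfolding eq by (simp add: norm_mult norm_divide field_simps power2_eq_square)
  then have "(LINT x|lborel. (norm (inv_fourier H x))\<^sup>2 * g x) \<le> Q"
    by simp
  moreover have "(\<integral>\<^sup>+x. ennreal ((norm (inv_fourier H x))\<^sup>2 * g x) \<partial>lborel) = ennreal (LINT x|lborel. (norm (inv_fourier H x))\<^sup>2 * g x)"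
    by (rule nn_integral_eq_integral[OF ui]) (auto simp: g_def)
  ultimately show ?thesis
    by (simp add: g_def Q_def ennreal_leI)
qed

text \<open>Fatou's lemma removes the damping.\<close>

lemma inv_fourier_plancherel_le:
  assumes H: "integrable lborel H" and H2: "integrable lborel (\<lambda>\<xi>. (norm (H \<xi>))\<^sup>2)"
  shows "inv_fourier H \<in> L2"
    and "(L2_norm (inv_fourier H))\<^sup>2 \<le> (LINT \<xi>|lborel. (norm (H \<xi>))\<^sup>2)"
proof -
  have um[measurable]: "inv_fourier H \<in> borel_measurable borel"
    using H by (intro inv_fourier_measurable) auto
  define Q where "Q = (LINT \<xi>|lborel. (norm (H \<xi>))\<^sup>2)"
  define F where "F n x = ennreal ((norm (inv_fourier H x))\<^sup>2 * exp (- (1 / real (Suc n)) * (norm x)\<^sup>2))" for n x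
  have lim: "(\<lambda>n. F n x) \<longlonglongrightarrow> ennreal ((norm (inv_fourier H x))\<^sup>2)" for x
  proof -
    have "(\<lambda>n. (norm (inv_fourier H x))\<^sup>2 * exp (- (1 / real (Suc n)) * (norm x)\<^sup>2)) \<longlonglongrightarrow> (norm (inv_fourier H x))\<^sup>2 * exp (- 0 * (norm x)\<^sup>2)"
      by (intro tendsto_intros LIMSEQ_inverse_real_of_nat[unfolded inverse_eq_divide])
    then show ?thesis unfolding F_def by (intro tendsto_ennrealI) simp
  qed
  have "(\<integral>\<^sup>+x. ennreal ((norm (inv_fourier H x))\<^sup>2) \<partial>lborel) = (\<integral>\<^sup>+x. liminf (\<lambda>n. F n x) \<partial>lborel)"
    using lim by (intro nn_integral_cong) (metis lim_imp_Liminf trivial_limit_sequentially)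
  also have "\<dots> \<le> liminf (\<lambda>n. \<integral>\<^sup>+x. F n x \<partial>lborel)"
    by (rule nn_integral_liminf) (auto simp: F_def)
  also have "\<dots> \<le> liminf (\<lambda>n::nat. ennreal Q)"
    unfolding F_def Q_def by (intro Liminf_mono always_eventually allI inv_fourier_damped_bound H H2) simp
  also have "\<dots> = ennreal Q" by (simp add: Liminf_const)
  finally have le: "(\<integral>\<^sup>+x. ennreal ((norm (inv_fourier H x))\<^sup>2) \<partial>lborel) \<le> ennreal Q" .
  have i: "integrable lborel (\<lambda>x. (norm (inv_fourier H x))\<^sup>2)"
    using le by (intro integrableI_bounded) (auto simp: le_less_trans)
  then show "inv_fourier H \<in> L2" by (simp add: L2_def)
  have "Q \<ge> 0" by (simp add: Q_def)
  moreover have "(LINT x|lborel. (norm (inv_fourier H x))\<^sup>2) \<le> Q"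
    using le nn_integral_eq_integral[OF i] \<open>Q \<ge> 0\<close> by (simp add: ennreal_le_iff)
  ultimately show "(L2_norm (inv_fourier H))\<^sup>2 \<le> (LINT \<xi>|lborel. (norm (H \<xi>))\<^sup>2)"
    by (simp add: L2_norm_def Q_def)
qed

section \<open>Square integrable functions\<close>

lemma norm_add_sq_le:
  fixes a b :: complex assumes "t > 0"
  shows "(norm (a + b))\<^sup>2 \<le> (1 + t) * (norm a)\<^sup>2 + (1 + 1/t) * (norm b)\<^sup>2"
proof -
  have "(norm (a + b))\<^sup>2 \<le> (norm a + norm b)\<^sup>2"
    by (simp add: norm_triangle_ineq power_mono)
  also have "\<dots> = (1 + t) * (norm a)\<^sup>2 + (1 + 1/t) * (norm b)\<^sup>2 - (t * norm a - norm b)\<^sup>2 / t"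
    using assms by (simp add: field_simps power2_eq_square)
  also have "\<dots> \<le> (1 + t) * (norm a)\<^sup>2 + (1 + 1/t) * (norm b)\<^sup>2"
    using assms by simp
  finally show ?thesis .
qed

lemma L2_norm_nonneg [simp]: "L2_norm f \<ge> 0"
  by (simp add: L2_norm_def)

lemma L2_zero: "(\<lambda>_. 0) \<in> L2" by (simp add: L2_def)

lemma L2_norm_zero: "L2_norm (\<lambda>_. 0) = 0" by (simp add: L2_norm_def)

lemma L2_cmult: "f \<in> L2 \<Longrightarrow> (\<lambda>x. c * f x) \<in> L2"
  by (auto simp: L2_def norm_mult power_mult_distrib)

lemma L2_add:
  assumes f: "f \<in> L2" and g: "g \<in> L2"
  shows "(\<lambda>x. f x + g x) \<in> L2"
proof -
  have [measurable]: "f \<in> borel_measurable borel" "g \<in> borel_measurable borel"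
    using f g by (auto simp: L2_def)
  have "integrable lborel (\<lambda>x. (norm (f x + g x))\<^sup>2)"
  proof (rule Bochner_Integration.integrable_bound)
    show "integrable lborel (\<lambda>x. 2 * (norm (f x))\<^sup>2 + 2 * (norm (g x))\<^sup>2)"
      using f g by (auto simp: L2_def)
    show "AE x in lborel. norm ((norm (f x + g x))\<^sup>2) \<le> norm (2 * (norm (f x))\<^sup>2 + 2 * (norm (g x))\<^sup>2)"
      using norm_add_sq_le[of 1] by (intro AE_I2) simp
  qed measurable
  then show ?thesis by (simp add: L2_def)
qed

lemma L2_diff: "f \<in> L2 \<Longrightarrow> g \<in> L2 \<Longrightarrow> (\<lambda>x. f x - g x) \<in> L2"
  using L2_add[OF _ L2_cmult[of g "-1"], of f] by simp

lemma L2_sum: "(\<And>i. i \<in> I \<Longrightarrow> f i \<in> L2) \<Longrightarrow> (\<lambda>x. \<Sum>i\<in>I. f i x) \<in> L2"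
  by (induction I rule: infinite_finite_induct) (auto simp: L2_zero L2_add)

text \<open>Minkowski's inequality, by choosing the parameter \<open>t\<close> of \<open>norm_add_sq_le\<close> as the quotient of the two norms;
both are first increased by \<open>d\<close>, lest one of them vanish.\<close>

lemma L2_norm_add_le:
  assumes f: "f \<in> L2" and g: "g \<in> L2"
  shows "L2_norm (\<lambda>x. f x + g x) \<le> L2_norm f + L2_norm g"
proof -
  define a b where "a = L2_norm f" and "b = L2_norm g"
  have a2: "a\<^sup>2 = (LINT x|lborel. (norm (f x))\<^sup>2)" and b2: "b\<^sup>2 = (LINT x|lborel. (norm (g x))\<^sup>2)"
    by (simp_all add: a_def b_def L2_norm_def)
  have ab: "a \<ge> 0" "b \<ge> 0" by (simp_all add: a_def b_def)
  have fi: "integrable lborel (\<lambda>x. (norm (f x))\<^sup>2)" "integrable lborel (\<lambda>x. (norm (g x))\<^sup>2)"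
    using f g by (auto simp: L2_def)
  have s: "(L2_norm (\<lambda>x. f x + g x))\<^sup>2 = (LINT x|lborel. (norm (f x + g x))\<^sup>2)"
    by (simp add: L2_norm_def)
  have t: "(L2_norm (\<lambda>x. f x + g x))\<^sup>2 \<le> (1 + t) * a\<^sup>2 + (1 + 1/t) * b\<^sup>2" if "t > 0" for t
  proof -
    have "(LINT x|lborel. (norm (f x + g x))\<^sup>2) \<le> (LINT x|lborel. (1 + t) * (norm (f x))\<^sup>2 + (1 + 1/t) * (norm (g x))\<^sup>2)"
      using fi L2_add[OF f g] that
      by (intro integral_mono norm_add_sq_le) (auto simp: L2_def)
    then show ?thesis using fi by (simp add: s a2 b2)
  qed
  have le: "(L2_norm (\<lambda>x. f x + g x))\<^sup>2 \<le> (a + d + (b + d))\<^sup>2" if "d > 0" for d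
  proof -
    define A B where "A = a + d" and "B = b + d"
    have AB: "A > 0" "B > 0" "a \<le> A" "b \<le> B" using ab that by (auto simp: A_def B_def)
    have "(L2_norm (\<lambda>x. f x + g x))\<^sup>2 \<le> (1 + B/A) * a\<^sup>2 + (1 + 1/(B/A)) * b\<^sup>2"
      using AB by (intro t) simp
    also have "\<dots> \<le> (1 + B/A) * A\<^sup>2 + (1 + 1/(B/A)) * B\<^sup>2"
      using AB ab by (intro add_mono mult_left_mono power_mono) auto
    also have "\<dots> = A\<^sup>2 + B * A + (B\<^sup>2 + A * B)"
      using AB unfolding power2_eq_square distrib_right by simp
    also have "\<dots> = (A + B)\<^sup>2" by (simp add: power2_eq_square algebra_simps)
    finally show ?thesis by (simp add: A_def B_def)
  qed
  have "L2_norm (\<lambda>x. f x + g x) \<le> a + b + e" if "e > 0" for e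
  proof -
    have "L2_norm (\<lambda>x. f x + g x) \<le> a + e/2 + (b + e/2)"
      by (rule power2_le_imp_le[OF le]) (use ab that in auto)
    then show ?thesis by simp
  qed
  then show ?thesis unfolding a_def[symmetric] b_def[symmetric] by (rule field_le_epsilon)
qed

lemma L2_norm_sum_le:
  assumes "\<And>i. i \<in> I \<Longrightarrow> f i \<in> L2"
  shows "L2_norm (\<lambda>x. \<Sum>i\<in>I. f i x) \<le> (\<Sum>i\<in>I. L2_norm (f i))"
  using assms
proof (induction I rule: infinite_finite_induct)
  case (insert i I)
  have "L2_norm (\<lambda>x. f i x + (\<Sum>i\<in>I. f i x)) \<le> L2_norm (f i) + L2_norm (\<lambda>x. \<Sum>i\<in>I. f i x)"
    by (intro L2_norm_add_le L2_sum insert.prems) auto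
  also have "\<dots> \<le> L2_norm (f i) + (\<Sum>i\<in>I. L2_norm (f i))"
    using insert by simp
  finally show ?case using insert.hyps by simp
qed (simp_all add: L2_norm_zero)

section \<open>Sums of Gaussians over integers and rotations\<close>

text \<open>The integers on one side of \<open>x\<close> have distances at least \<open>0, 1, 2, \<dots>\<close> from it, so each side
contributes at most \<open>S\<close>.\<close>

lemma sum_int_distance_le:
  fixes g :: "real \<Rightarrow> real" and x :: real
  assumes anti: "\<And>s t. 0 \<le> s \<Longrightarrow> s \<le> t \<Longrightarrow> g t \<le> g s"
    and nonneg: "\<And>t. g t \<ge> 0"
    and S: "\<And>n. (\<Sum>i<n. g (real i)) \<le> S"
    and A: "finite (A :: int set)"
  shows "(\<Sum>n\<in>A. g \<bar>x - of_int n\<bar>) \<le> 2 * S"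
proof -
  have half: "(\<Sum>n\<in>B. g \<bar>x - of_int n\<bar>) \<le> S"
    if "finite B" "inj_on h B" "\<And>n. n \<in> B \<Longrightarrow> real (h n) \<le> \<bar>x - of_int n\<bar>" for B and h :: "int \<Rightarrow> nat"
  proof -
    have "(\<Sum>n\<in>B. g \<bar>x - of_int n\<bar>) \<le> (\<Sum>n\<in>B. g (real (h n)))"
      using that by (intro sum_mono anti) auto
    also have "\<dots> = (\<Sum>i\<in>h ` B. g (real i))"
      using that by (simp add: sum.reindex)
    also have "\<dots> \<le> (\<Sum>i<Suc (Max (insert 0 (h ` B))). g (real i))"
      using that nonneg by (intro sum_mono2) (auto simp: less_Suc_eq_le)
    also have "\<dots> \<le> S" by (rule S)
    finally show ?thesis .
  qed
  have "(\<Sum>n\<in>A. g \<bar>x - of_int n\<bar>)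
      = (\<Sum>n\<in>{n\<in>A. n \<le> \<lfloor>x\<rfloor>}. g \<bar>x - of_int n\<bar>) + (\<Sum>n\<in>{n\<in>A. \<lfloor>x\<rfloor> < n}. g \<bar>x - of_int n\<bar>)"
    using A by (subst sum.union_disjoint[symmetric]) (auto intro!: sum.cong)
  also have "(\<Sum>n\<in>{n\<in>A. n \<le> \<lfloor>x\<rfloor>}. g \<bar>x - of_int n\<bar>) \<le> S"
    by (rule half[where h = "\<lambda>n. nat (\<lfloor>x\<rfloor> - n)"]) (use A in \<open>auto simp: inj_on_def, linarith\<close>)
  also have "(\<Sum>n\<in>{n\<in>A. \<lfloor>x\<rfloor> < n}. g \<bar>x - of_int n\<bar>) \<le> S"
    by (rule half[where h = "\<lambda>n. nat (n - \<lfloor>x\<rfloor> - 1)"]) (use A in \<open>auto simp: inj_on_def, linarith\<close>)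
  finally show ?thesis by simp
qed

text \<open>Completing the square bounds the Gaussian by a geometric progression.\<close>

lemma sum_gauss_nat_le:
  fixes a :: real assumes "a > 0"
  shows "(\<Sum>i<n. exp (- (a * real i)\<^sup>2)) \<le> 2 * (1 + 1 / a)"
proof -
  have e14: "exp (1/4) \<le> (2::real)"
    using exp_bound[of "1/4::real"] by (simp add: power2_eq_square)
  have "exp (- (a * real i)\<^sup>2) \<le> 2 * exp (- a) ^ i" for i
  proof -
    have "0 \<le> (a * real i - 1/2)\<^sup>2" by simp
    then have "- (a * real i)\<^sup>2 \<le> 1/4 + real i * (- a)"
      by (simp add: power2_eq_square algebra_simps)
    then have "exp (- (a * real i)\<^sup>2) \<le> exp (1/4 + real i * (- a))" by simp
    also have "\<dots> = exp (1/4) * exp (- a) ^ i"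
      by (simp only: exp_add exp_of_nat_mult)
    also have "\<dots> \<le> 2 * exp (- a) ^ i"
      using e14 by (intro mult_right_mono) auto
    finally show ?thesis .
  qed
  then have "(\<Sum>i<n. exp (- (a * real i)\<^sup>2)) \<le> (\<Sum>i<n. 2 * exp (- a) ^ i)"
    by (intro sum_mono)
  also have "\<dots> = 2 * ((1 - exp (- a) ^ n) / (1 - exp (- a)))"
    using assms by (simp add: sum_distrib_left[symmetric] sum_gp_strict)
  also have "\<dots> \<le> 2 * (1 / (1 - exp (- a)))"
    using assms by (intro mult_left_mono divide_right_mono) auto
  also have "1 / (1 - exp (- a)) \<le> 1 + 1 / a"
  proof -
    have "1 + a \<le> exp a" by (rule exp_ge_add_one_self)
    then have "exp (- a) \<le> 1 / (1 + a)"
      using assms by (simp add: exp_minus inverse_eq_divide frac_le)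
    then have "a / (1 + a) \<le> 1 - exp (- a)"
      using assms by (simp add: field_simps)
    then have "1 / (1 - exp (- a)) \<le> 1 / (a / (1 + a))"
      using assms by (intro divide_left_mono) auto
    also have "\<dots> = 1 + 1 / a" using assms by (simp add: field_simps)
    finally show ?thesis .
  qed
  finally show ?thesis by simp
qed

lemma sum_gauss_int_le:
  fixes a x :: real
  assumes "a > 0" "finite (A :: int set)"
  shows "(\<Sum>n\<in>A. exp (- (a * (x - of_int n))\<^sup>2)) \<le> 4 * (1 + 1 / a)"
proof -
  have "(\<Sum>n\<in>A. exp (- (a * \<bar>x - of_int n\<bar>)\<^sup>2)) \<le> 2 * (2 * (1 + 1 / a))"
    by (rule sum_int_distance_le[where g = "\<lambda>t. exp (- (a * t)\<^sup>2)"])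
       (use assms sum_gauss_nat_le[OF assms(1)] in \<open>auto intro!: power_mono mult_left_mono\<close>)
  then show ?thesis by (simp add: power_mult_distrib)
qed

lemma sin_ge_half:
  fixes t :: real assumes "0 \<le> t" "t \<le> pi / 2"
  shows "t / 2 \<le> sin t"
proof (cases "t = 0")
  case False
  define u where "u = t / 2"
  have u: "0 < u" "u \<le> pi / 4" using assms False by (auto simp: u_def)
  have "\<exists>z>0. z < u \<and> sin u - sin 0 = (u - 0) * cos z"
    by (rule MVT2) (use u in \<open>auto intro!: derivative_eq_intros\<close>)
  then obtain z where z: "0 < z" "z < u" "sin u = u * cos z" by auto
  have c: "cos u \<le> cos z" using z u by (intro cos_monotone_0_pi_le) auto
  have c0: "0 \<le> cos u" using u by (intro cos_ge_zero) auto
  have ct: "0 \<le> cos t" using assms by (intro cos_ge_zero) auto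
  have "u * (2 * (cos u * cos u)) \<le> u * (2 * (cos z * cos u))"
    using u c c0 by (intro mult_left_mono mult_right_mono) auto
  also have "\<dots> = sin t"
    using sin_double[of u] z(3) by (simp add: u_def)
  finally have "u * (2 * (cos u * cos u)) \<le> sin t" .
  moreover have "2 * (cos u * cos u) = 1 + cos t"
    using cos_double_cos[of u] by (simp add: u_def power2_eq_square)
  ultimately have "u * (1 + cos t) \<le> sin t" by simp
  moreover have "u \<le> u * (1 + cos t)" using u ct by simp
  ultimately show ?thesis by (simp add: u_def)
qed simp

text \<open>The angles are spaced by \<open>pi / s\<close> and cover one period of \<open>\<bar>sin\<bar>\<close>. Hence \<open>s * \<bar>sin\<bar>\<close> at the \<open>l\<close>-th angle is at least
the distance between a fixed real number and an integer \<open>h l\<close>, where \<open>h\<close> is injective.\<close>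

lemma sum_rotations_gauss_le:
  fixes a \<phi> :: real and s :: nat
  assumes "a > 0" "s \<ge> 1"
  shows "(\<Sum>l<s. exp (- (a * (real s * sin (\<phi> - pi * real l / real s)))\<^sup>2)) \<le> 4 * (1 + 1 / a)"
proof -
  define x where "x = \<phi> * real s / pi"
  \<comment> \<open>\<open>pi * m l\<close> is the multiple of \<open>pi\<close> next to the \<open>l\<close>-th angle, and \<open>h l\<close> is congruent to \<open>l\<close> modulo \<open>s\<close>\<close>
  define m :: "nat \<Rightarrow> int" where "m l = round ((x - real l) / real s)" for l
  define h :: "nat \<Rightarrow> int" where "h l = int l + int s * m l" for l
  have le: "\<bar>x - of_int (h l)\<bar> \<le> \<bar>real s * sin (\<phi> - pi * real l / real s)\<bar>" for l
  proof -
    define y where "y = x - of_int (h l)"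
    have "\<bar>of_int (m l) - (x - real l) / real s\<bar> \<le> 1/2"
      unfolding m_def by (rule of_int_round_abs_le)
    moreover have "of_int (m l) - (x - real l) / real s = - y / real s"
      using assms by (simp add: y_def h_def field_simps)
    ultimately have ys: "\<bar>y\<bar> / real s \<le> 1/2" by simp
    define t where "t = pi * \<bar>y\<bar> / real s"
    have t: "0 \<le> t" "t \<le> pi / 2"
      using ys mult_left_mono[OF ys, of pi] by (auto simp: t_def)
    have eq: "\<phi> - pi * real l / real s = pi * y / real s + pi * of_int (m l)"
      using assms by (simp add: y_def h_def x_def field_simps)
    have "(sin (\<phi> - pi * real l / real s))\<^sup>2 = (sin (pi * y / real s) * cos (pi * of_int (m l)))\<^sup>2"
      unfolding eq sin_add by simp
    also have "\<dots> = (sin (pi * y / real s))\<^sup>2"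
      by (simp add: power_mult_distrib cos_squared_eq)
    also have "\<dots> = (sin t)\<^sup>2"
    proof (cases "y \<ge> 0")
      case False
      then have "sin t = - sin (pi * y / real s)" by (simp add: t_def)
      then show ?thesis by simp
    qed (simp add: t_def)
    finally have "\<bar>sin (\<phi> - pi * real l / real s)\<bar> = \<bar>sin t\<bar>"
      by (simp add: abs_eq_iff power2_eq_iff)
    moreover have "t / 2 \<le> \<bar>sin t\<bar>" using sin_ge_half[OF t] by simp
    ultimately have "real s * (t / 2) \<le> real s * \<bar>sin (\<phi> - pi * real l / real s)\<bar>"
      by (intro mult_left_mono) auto
    moreover have "real s * (t / 2) = pi / 2 * \<bar>y\<bar>" using assms by (simp add: t_def)
    moreover have "1 * \<bar>y\<bar> \<le> pi / 2 * \<bar>y\<bar>" using pi_gt3 by (intro mult_right_mono) auto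
    ultimately show ?thesis by (simp add: abs_mult y_def)
  qed
  have inj: "inj_on h {..<s}"
  proof (rule inj_onI)
    fix l l' assume l: "l \<in> {..<s}" "l' \<in> {..<s}" "h l = h l'"
    then have "h l mod int s = h l' mod int s" by simp
    then show "l = l'" using l by (simp add: h_def)
  qed
  have "(\<Sum>l<s. exp (- (a * (real s * sin (\<phi> - pi * real l / real s)))\<^sup>2))
      \<le> (\<Sum>l<s. exp (- (a * (x - of_int (h l)))\<^sup>2))"
  proof (rule sum_mono)
    fix l
    have "(a * (x - of_int (h l)))\<^sup>2 \<le> (a * (real s * sin (\<phi> - pi * real l / real s)))\<^sup>2"
      using le[of l] assms by (intro abs_le_square_iff[THEN iffD1]) (simp add: abs_mult mult_left_mono)
    then show "exp (- (a * (real s * sin (\<phi> - pi * real l / real s)))\<^sup>2) \<le> exp (- (a * (x - of_int (h l)))\<^sup>2)"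
      by simp
  qed
  also have "\<dots> = (\<Sum>n\<in>h ` {..<s}. exp (- (a * (x - of_int n))\<^sup>2))"
    using inj by (simp add: sum.reindex)
  also have "\<dots> \<le> 4 * (1 + 1 / a)"
    using assms by (intro sum_gauss_int_le) auto
  finally show ?thesis .
qed

section \<open>Frequency weights\<close>

text \<open>The tolerance, as a function of the frequency, for the approximation of the generators of scale
\<open>j\<close>. A given frequency \<open>\<xi>\<close> appears at scale \<open>j\<close> as a vector \<open>\<eta>\<close> which is long for coarse
and short for fine scales: the Gaussian makes the former negligible, the quadratic factor the
latter. The quadratic factor is omitted for
\<open>j < 4\<close>, where the supports of the windows may extend to the vertical axis.\<close>

definition weight :: "nat \<Rightarrow> real^2 \<Rightarrow> real" where
  "weight j \<eta> = (if j < 4 then 1 else (\<eta> $ 1)\<^sup>2) * exp (- (norm \<eta>)\<^sup>2 / 8)"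

text \<open>The inverse transpose of the linear part of \<open>curv_U\<close>, that is, the inverse of \<open>curv_dil j\<close> after the
transpose of \<open>curv_rot j l\<close>.\<close>

definition freq_mat :: "nat \<Rightarrow> nat \<Rightarrow> real^2^2" where
  "freq_mat j l = (let \<theta> = pi * real l / 2 ^ (j div 2) in
     vector [vector [cos \<theta> / 2 ^ j, sin \<theta> / 2 ^ j],
             vector [- sin \<theta> / 2 ^ (j div 2), cos \<theta> / 2 ^ (j div 2)]])"

lemma vec2_entries [simp]:
  "(vector [a, b] :: 'a::zero^2) $ 1 = a" "(vector [a, b] :: 'a::zero^2) $ 2 = b"
  by (simp_all add: vector_2)

lemma mat2_mult:
  "((A :: real^2^2) *v x) $ 1 = A$1$1 * x$1 + A$1$2 * x$2"
  "((A :: real^2^2) *v x) $ 2 = A$2$1 * x$1 + A$2$2 * x$2"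
  by (simp_all add: matrix_vector_mult_def UNIV_2)

lemma vec2_polar:
  obtains r \<phi> :: real where "r \<ge> 0" "(\<xi>::real^2) $ 1 = r * cos \<phi>" "\<xi> $ 2 = r * sin \<phi>"
proof -
  have "Complex (\<xi>$1) (\<xi>$2) = rcis (cmod (Complex (\<xi>$1) (\<xi>$2))) (Arg (Complex (\<xi>$1) (\<xi>$2)))"
    by (rule rcis_cmod_Arg[symmetric])
  then show ?thesis
    using that[of "cmod (Complex (\<xi>$1) (\<xi>$2))" "Arg (Complex (\<xi>$1) (\<xi>$2))"]
    by (metis Re_rcis Im_rcis complex.sel norm_ge_zero)
qed

lemma freq_mat_polar:
  assumes "\<xi> $ 1 = r * cos \<phi>" "\<xi> $ 2 = r * sin \<phi>"
  shows "(freq_mat j l *v \<xi>) $ 1 = r * cos (\<phi> - pi * real l / 2 ^ (j div 2)) / 2 ^ j"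
    "(freq_mat j l *v \<xi>) $ 2 = r * sin (\<phi> - pi * real l / 2 ^ (j div 2)) / 2 ^ (j div 2)"
  unfolding mat2_mult freq_mat_def Let_def vec2_entries assms cos_diff sin_diff
  by (simp_all add: add_divide_distrib diff_divide_distrib algebra_simps)

lemma weight_nonneg: "weight j \<eta> \<ge> 0"
  by (simp add: weight_def)

lemma two_pow_div2: "(2::real) ^ (j div 2) * 2 ^ (j div 2) \<le> 2 ^ j"
  by (simp add: power_add[symmetric])

text \<open>With \<open>\<rho> = r / 2 ^ j\<close> a single weight is at most \<open>\<rho>\<^sup>2 * exp (- \<rho>\<^sup>2 / 16)\<close> times a Gaussian in
\<open>\<rho> s sin \<psi>\<close>, where \<open>s\<close> is the number of rotations and \<open>\<psi>\<close> the angle between the frequency and the axis of the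
curvelet. Summing over the rotations costs a factor of order \<open>1 + 1 / \<rho>\<close>. The result is of
order \<open>\<rho>\<close> for small and at most of order \<open>1 / \<rho>\<close> for large \<open>\<rho>\<close>.\<close>

lemma weight_angular_sum:
  assumes j: "j \<ge> 4" and r: "r > 0" "\<xi> $ 1 = r * cos \<phi>" "\<xi> $ 2 = r * sin \<phi>"
  shows "(\<Sum>l<2 ^ (j div 2). weight j (freq_mat j l *v \<xi>))
     \<le> 10240 * 2 powr (- \<bar>log 2 r - real j\<bar>)"
proof -
  define s :: nat where "s = 2 ^ (j div 2)"
  define \<rho> where "\<rho> = r / 2 ^ j"
  have \<rho>: "\<rho> > 0" using r by (simp add: \<rho>_def)
  have s1: "s \<ge> 1" by (simp add: s_def)
  have "weight j (freq_mat j l *v \<xi>) \<le> \<rho>\<^sup>2 * exp (- \<rho>\<^sup>2 / 16) * exp (- (\<rho> / 4 * (real s * sin (\<phi> - pi * real l / real s)))\<^sup>2)"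
    for l
  proof -
    define \<eta> where "\<eta> = freq_mat j l *v \<xi>"
    define \<psi> where "\<psi> = \<phi> - pi * real l / real s"
    have e: "\<eta> $ 1 = \<rho> * cos \<psi>" "\<eta> $ 2 = r * sin \<psi> / real s"
      using freq_mat_polar[OF r(2,3), of j l] by (simp_all add: \<eta>_def \<psi>_def \<rho>_def s_def)
    have "(\<eta> $ 1)\<^sup>2 \<le> \<rho>\<^sup>2"
      unfolding e power_mult_distrib by (simp add: cos_squared_eq mult_left_le)
    have rs: "\<rho> * real s \<le> r / real s"
    proof -
      have "real s * real s \<le> 2 ^ j" using two_pow_div2[of j] by (simp add: s_def)
      then show ?thesis using r s1 by (simp add: \<rho>_def field_simps)
    qed
    have "(\<rho> * real s * sin \<psi>)\<^sup>2 \<le> (\<eta> $ 2)\<^sup>2"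
    proof -
      have "(\<rho> * real s)\<^sup>2 \<le> (r / real s)\<^sup>2" using rs \<rho> by (intro power_mono) auto
      then have "(\<rho> * real s)\<^sup>2 * (sin \<psi>)\<^sup>2 \<le> (r / real s)\<^sup>2 * (sin \<psi>)\<^sup>2"
        by (rule mult_right_mono) simp
      then show ?thesis by (simp add: e power_mult_distrib power_divide)
    qed
    then have n1: "\<rho>\<^sup>2 * (cos \<psi>)\<^sup>2 + (\<rho> * real s * sin \<psi>)\<^sup>2 \<le> (norm \<eta>)\<^sup>2"
      by (simp add: norm_vec2 e power_mult_distrib)
    have n2: "\<rho>\<^sup>2 * (cos \<psi>)\<^sup>2 + (\<rho> * real s * sin \<psi>)\<^sup>2 \<ge> \<rho>\<^sup>2"
    proof -
      have "\<rho> * 1 \<le> \<rho> * real s" using s1 \<rho> by (intro mult_left_mono) auto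
      then have "\<rho>\<^sup>2 \<le> (\<rho> * real s)\<^sup>2" using \<rho> by (intro power_mono) auto
      then have "\<rho>\<^sup>2 * (sin \<psi>)\<^sup>2 \<le> (\<rho> * real s)\<^sup>2 * (sin \<psi>)\<^sup>2" by (rule mult_right_mono) simp
      then show ?thesis by (simp add: power_mult_distrib cos_squared_eq algebra_simps)
    qed
    have n3: "\<rho>\<^sup>2 + (\<rho> * real s * sin \<psi>)\<^sup>2 \<le> 2 * (norm \<eta>)\<^sup>2"
    proof -
      have "0 \<le> \<rho>\<^sup>2 * (cos \<psi>)\<^sup>2" by simp
      with n1 n2 show ?thesis by linarith
    qed
    have "weight j \<eta> = (\<eta>$1)\<^sup>2 * exp (- (norm \<eta>)\<^sup>2 / 8)" using j by (simp add: weight_def)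
    also have "\<dots> \<le> \<rho>\<^sup>2 * exp (- (\<rho>\<^sup>2 + (\<rho> * real s * sin \<psi>)\<^sup>2) / 16)"
      using n3 by (intro mult_mono \<open>(\<eta> $ 1)\<^sup>2 \<le> \<rho>\<^sup>2\<close>) auto
    also have "\<dots> = \<rho>\<^sup>2 * exp (- \<rho>\<^sup>2 / 16) * exp (- (\<rho> / 4 * (real s * sin \<psi>))\<^sup>2)"
      by (simp add: exp_add[symmetric] power_mult_distrib power_divide add_divide_distrib diff_divide_distrib mult_ac)
    finally show ?thesis by (simp add: \<eta>_def \<psi>_def)
  qed
  then have "(\<Sum>l<s. weight j (freq_mat j l *v \<xi>))
     \<le> (\<Sum>l<s. \<rho>\<^sup>2 * exp (- \<rho>\<^sup>2 / 16) * exp (- (\<rho> / 4 * (real s * sin (\<phi> - pi * real l / real s)))\<^sup>2))"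
    by (rule sum_mono)
  also have "\<dots> \<le> \<rho>\<^sup>2 * exp (- \<rho>\<^sup>2 / 16) * (4 * (1 + 1 / (\<rho> / 4)))"
    unfolding sum_distrib_left[symmetric] using \<rho> s1
    by (intro mult_left_mono sum_rotations_gauss_le) auto
  also have "\<dots> = exp (- \<rho>\<^sup>2 / 16) * (4 * \<rho>\<^sup>2 + 16 * \<rho>)"
    using \<rho> by (simp add: field_simps power2_eq_square)
  also have "\<dots> \<le> 10240 * 2 powr (- \<bar>log 2 r - real j\<bar>)"
  proof -
    have lr: "log 2 r - real j = log 2 \<rho>"
      using r by (simp add: \<rho>_def log_divide log_nat_power)
    show ?thesis
    proof (cases "\<rho> \<le> 1")
      case True
      then have "2 powr (- \<bar>log 2 r - real j\<bar>) = \<rho>"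
        using \<rho> unfolding lr by (simp add: abs_if)
      moreover have "exp (- \<rho>\<^sup>2 / 16) * (4 * \<rho>\<^sup>2 + 16 * \<rho>) \<le> 1 * (4 * \<rho> + 16 * \<rho>)"
        using \<rho> True by (intro mult_mono add_mono) (auto simp: power2_eq_square mult_left_le)
      ultimately show ?thesis using \<rho> by simp
    next
      case False
      then have p: "2 powr (- \<bar>log 2 r - real j\<bar>) = 1 / \<rho>"
        using \<rho> unfolding lr by (simp add: powr_minus inverse_eq_divide)
      define y where "y = \<rho>\<^sup>2 / 16"
      have y: "y > 0" using \<rho> by (simp add: y_def)
      \<comment> \<open>the quadratic lower bound of the exponential function yields the constant \<open>512 * (4 + 16) = 10240\<close>\<close>
      have "y\<^sup>2 / 2 \<le> exp y" using exp_lower_Taylor_quadratic[of y] y by simp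
      then have "exp (- y) \<le> 2 / y\<^sup>2"
        using y by (simp add: exp_minus field_simps)
      then have e: "exp (- \<rho>\<^sup>2 / 16) \<le> 512 / (\<rho>\<^sup>2)\<^sup>2"
        by (simp add: y_def power_divide field_simps)
      have "exp (- \<rho>\<^sup>2 / 16) * (4 * \<rho>\<^sup>2 + 16 * \<rho>) \<le> 512 / (\<rho>\<^sup>2)\<^sup>2 * (4 * \<rho>\<^sup>2 + 16 * \<rho>\<^sup>2)"
        using False \<rho> by (intro mult_mono e add_mono) (auto simp: power2_eq_square)
      also have "\<dots> = 10240 / \<rho>\<^sup>2" using \<rho> by (simp add: field_simps power2_eq_square)
      also have "\<dots> \<le> 10240 / \<rho>"
        using False \<rho> by (intro divide_left_mono) (auto simp: power2_eq_square)
      finally show ?thesis unfolding p by simp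
    qed
  qed
  finally show ?thesis by (simp add: s_def)
qed

text \<open>For \<open>j \<ge> 4\<close> the sums over the rotations form a two-sided geometric series in the scale; the four
other scales have at most two rotations each, and weights at most \<open>1\<close>.\<close>

lemma weight_sum_le:
  assumes J: "finite J" "\<And>j l. (j, l) \<in> J \<Longrightarrow> l < 2 ^ (j div 2)"
  shows "(\<Sum>(j,l)\<in>J. weight j (freq_mat j l *v \<xi>)) \<le> 50000"
proof -
  obtain r \<phi> where r: "r \<ge> 0" "\<xi> $ 1 = r * cos \<phi>" "\<xi> $ 2 = r * sin \<phi>"
    by (rule vec2_polar)
  define JJ where "JJ = fst ` J"
  have JJ: "finite JJ" using J by (simp add: JJ_def)
  define V where "V j = (\<Sum>l<2 ^ (j div 2). weight j (freq_mat j l *v \<xi>))" for j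
  have "(\<Sum>(j,l)\<in>J. weight j (freq_mat j l *v \<xi>)) \<le> (\<Sum>(j,l)\<in>(SIGMA j:JJ. {..<2 ^ (j div 2)}). weight j (freq_mat j l *v \<xi>))"
    using J JJ by (intro sum_mono2) (auto simp: weight_nonneg JJ_def image_iff, force)
  also have "\<dots> = (\<Sum>j\<in>JJ. V j)"
    unfolding V_def using JJ by (subst sum.Sigma[symmetric]) auto
  also have "\<dots> = (\<Sum>j\<in>{j\<in>JJ. j < 4}. V j) + (\<Sum>j\<in>{j\<in>JJ. j \<ge> 4}. V j)"
    using JJ by (subst sum.union_disjoint[symmetric]) (auto intro!: sum.cong)
  also have "(\<Sum>j\<in>{j\<in>JJ. j < 4}. V j) \<le> (\<Sum>j<4. V j)"
    using JJ by (intro sum_mono2) (auto simp: V_def intro!: sum_nonneg weight_nonneg)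
  also have "\<dots> \<le> (\<Sum>j<(4::nat). 2)"
  proof (rule sum_mono)
    fix j :: nat assume "j \<in> {..<4}"
    then have j: "j < 4" by simp
    then have "j div 2 \<le> 1" by simp
    then have p: "(2::nat) ^ (j div 2) \<le> 2 ^ 1" by (intro power_increasing) auto
    have "V j \<le> (\<Sum>l<(2::nat) ^ (j div 2). 1)"
      unfolding V_def using j by (intro sum_mono) (simp add: weight_def)
    also have "\<dots> = real (2 ^ (j div 2))" by simp
    also have "\<dots> \<le> real (2 ^ 1)" using p by (simp only: of_nat_le_iff)
    finally show "V j \<le> 2" by simp
  qed
  also have "(\<Sum>j\<in>{j\<in>JJ. j \<ge> 4}. V j) \<le> 40960"
  proof (cases "r = 0")
    case True
    have "V j = 0" if "j \<ge> 4" for j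
      unfolding V_def using that True freq_mat_polar(1)[OF r(2,3)] by (intro sum.neutral) (simp add: weight_def)
    then show ?thesis by simp
  next
    case False
    have "(\<Sum>j\<in>{j\<in>JJ. j \<ge> 4}. V j) \<le> (\<Sum>j\<in>{j\<in>JJ. j \<ge> 4}. 10240 * 2 powr (- \<bar>log 2 r - real j\<bar>))"
      unfolding V_def using False r by (intro sum_mono weight_angular_sum) auto
    also have "\<dots> = 10240 * (\<Sum>n\<in>int ` {j\<in>JJ. j \<ge> 4}. 2 powr (- \<bar>log 2 r - of_int n\<bar>))"
      by (simp add: sum.reindex sum_distrib_left)
    also have "(\<Sum>n\<in>int ` {j\<in>JJ. j \<ge> 4}. 2 powr (- \<bar>log 2 r - of_int n\<bar>)) \<le> 2 * 2"
    proof (rule sum_int_distance_le[where g = "\<lambda>t. 2 powr (- t)"])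
      show "(\<Sum>i<n. 2 powr (- real i)) \<le> (2::real)" for n
      proof -
        have "(\<Sum>i<n. 2 powr (- real i)) = (\<Sum>i<n. (1/2::real) ^ i)"
          by (intro sum.cong) (simp_all add: powr_minus powr_realpow power_one_over inverse_eq_divide)
        also have "\<dots> \<le> 2" by (simp add: sum_gp_strict)
        finally show ?thesis .
      qed
    qed (use JJ in auto)
    finally show ?thesis by simp
  qed
  finally show ?thesis by simp
qed

section \<open>Almost orthogonality of the translations\<close>

text \<open>Expanding the square yields a quadratic form in the coefficients with the matrix
\<open>16 * pi * exp (- 4 * |y k - y k'|\<^sup>2)\<close>. Schur's test bounds it by the row sums.\<close>

lemma gauss_trig_polynomial_integral:
  fixes y :: "'k \<Rightarrow> real^2" and c :: "'k \<Rightarrow> complex"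
  assumes K: "finite K" and B: "\<And>k. k \<in> K \<Longrightarrow> (\<Sum>k'\<in>K. exp (- 4 * (norm (y k - y k'))\<^sup>2)) \<le> B"
  shows "integrable lborel (\<lambda>\<eta>. exp (- (norm \<eta>)\<^sup>2 / 16) * (norm (\<Sum>k\<in>K. c k * cis (- (y k \<bullet> \<eta>))))\<^sup>2)" (is ?int)
    and "(LINT \<eta>|lborel. exp (- (norm \<eta>)\<^sup>2 / 16) * (norm (\<Sum>k\<in>K. c k * cis (- (y k \<bullet> \<eta>))))\<^sup>2)
       \<le> 16 * pi * B * (\<Sum>k\<in>K. (norm (c k))\<^sup>2)" (is "?I \<le> _")
proof -
  define g where "g k k' \<eta> = complex_of_real (exp (- (1/16) * (norm \<eta>)\<^sup>2)) * cis ((y k' - y k) \<bullet> \<eta>)" for k k' and \<eta> :: "real^2"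
  have gi: "integrable lborel (g k k')" for k k'
    unfolding g_def[abs_def] by (rule gauss_char_2d) simp
  have gv: "(LINT \<eta>|lborel. g k k' \<eta>) = complex_of_real (16 * pi * exp (- 4 * (norm (y k - y k'))\<^sup>2))" for k k'
    unfolding g_def by (subst gauss_char_2d(2)) (simp_all add: norm_minus_commute)
  have cd: "cis (a - b) = cis (- b) * cnj (cis (- a))" for a b
    by (simp add: cis_cnj cis_mult)
  have eq: "complex_of_real (exp (- (norm \<eta>)\<^sup>2 / 16) * (norm (\<Sum>k\<in>K. c k * cis (- (y k \<bullet> \<eta>))))\<^sup>2)
     = (\<Sum>k\<in>K. \<Sum>k'\<in>K. (c k * cnj (c k')) * g k k' \<eta>)" for \<eta>
    unfolding of_real_mult complex_norm_square cnj_sum sum_product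
    unfolding sum_distrib_left
    by (intro sum.cong refl) (simp add: g_def inner_diff_left cd mult_ac)
  have int2: "integrable lborel (\<lambda>\<eta>. \<Sum>k\<in>K. \<Sum>k'\<in>K. (c k * cnj (c k')) * g k k' \<eta>)"
    using gi by (intro Bochner_Integration.integrable_sum integrable_mult_right)
  show ?int
    using int2 unfolding eq[symmetric] complex_of_real_integrable_eq .
  have "complex_of_real ?I = (LINT \<eta>|lborel. (\<Sum>k\<in>K. \<Sum>k'\<in>K. (c k * cnj (c k')) * g k k' \<eta>))"
    unfolding integral_complex_of_real[symmetric] eq ..
  also have "\<dots> = (\<Sum>k\<in>K. \<Sum>k'\<in>K. (c k * cnj (c k')) * complex_of_real (16 * pi * exp (- 4 * (norm (y k - y k'))\<^sup>2)))"
    using gi by (simp add: gv del: of_real_mult)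
  finally have ce: "complex_of_real ?I = (\<Sum>k\<in>K. \<Sum>k'\<in>K. (c k * cnj (c k')) * complex_of_real (16 * pi * exp (- 4 * (norm (y k - y k'))\<^sup>2)))" .
  have "\<bar>?I\<bar> = norm (\<Sum>k\<in>K. \<Sum>k'\<in>K. (c k * cnj (c k')) * complex_of_real (16 * pi * exp (- 4 * (norm (y k - y k'))\<^sup>2)))"
    unfolding ce[symmetric] norm_of_real ..
  also have "\<dots> \<le> (\<Sum>k\<in>K. \<Sum>k'\<in>K. norm (c k) * norm (c k') * (16 * pi * exp (- 4 * (norm (y k - y k'))\<^sup>2)))"
    by (intro order.trans[OF norm_sum] sum_mono) (simp add: norm_mult abs_mult)
  also have "\<dots> \<le> (\<Sum>k\<in>K. \<Sum>k'\<in>K. (norm (c k))\<^sup>2 * (8 * pi * exp (- 4 * (norm (y k - y k'))\<^sup>2)) + (norm (c k'))\<^sup>2 * (8 * pi * exp (- 4 * (norm (y k - y k'))\<^sup>2)))"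
  proof (intro sum_mono)
    fix k k'
    have "norm (c k) * norm (c k') \<le> ((norm (c k))\<^sup>2 + (norm (c k'))\<^sup>2) / 2"
      using sum_squares_bound[of "norm (c k)" "norm (c k')"] by simp
    then have "norm (c k) * norm (c k') * (16 * pi * exp (- 4 * (norm (y k - y k'))\<^sup>2))
       \<le> ((norm (c k))\<^sup>2 + (norm (c k'))\<^sup>2) / 2 * (16 * pi * exp (- 4 * (norm (y k - y k'))\<^sup>2))"
      by (intro mult_right_mono) auto
    then show "norm (c k) * norm (c k') * (16 * pi * exp (- 4 * (norm (y k - y k'))\<^sup>2))
      \<le> (norm (c k))\<^sup>2 * (8 * pi * exp (- 4 * (norm (y k - y k'))\<^sup>2)) + (norm (c k'))\<^sup>2 * (8 * pi * exp (- 4 * (norm (y k - y k'))\<^sup>2))"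
      by (simp add: algebra_simps)
  qed
  also have "\<dots> = (\<Sum>k\<in>K. \<Sum>k'\<in>K. (norm (c k))\<^sup>2 * (8 * pi * exp (- 4 * (norm (y k - y k'))\<^sup>2)))
      + (\<Sum>k\<in>K. \<Sum>k'\<in>K. (norm (c k'))\<^sup>2 * (8 * pi * exp (- 4 * (norm (y k - y k'))\<^sup>2)))"
    by (simp only: sum.distrib)
  also have "(\<Sum>k\<in>K. \<Sum>k'\<in>K. (norm (c k'))\<^sup>2 * (8 * pi * exp (- 4 * (norm (y k - y k'))\<^sup>2)))
      = (\<Sum>k\<in>K. \<Sum>k'\<in>K. (norm (c k))\<^sup>2 * (8 * pi * exp (- 4 * (norm (y k - y k'))\<^sup>2)))"
    by (subst sum.swap) (simp add: norm_minus_commute)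
  also have "(\<Sum>k\<in>K. \<Sum>k'\<in>K. (norm (c k))\<^sup>2 * (8 * pi * exp (- 4 * (norm (y k - y k'))\<^sup>2)))
     = (\<Sum>k\<in>K. (norm (c k))\<^sup>2 * (8 * pi * (\<Sum>k'\<in>K. exp (- 4 * (norm (y k - y k'))\<^sup>2))))"
    by (simp add: sum_distrib_left)
  also have "\<dots> \<le> (\<Sum>k\<in>K. (norm (c k))\<^sup>2 * (8 * pi * B))"
    by (intro sum_mono mult_left_mono B) auto
  also have "\<dots> = 8 * pi * B * (\<Sum>k\<in>K. (norm (c k))\<^sup>2)"
    by (simp add: sum_distrib_left mult_ac)
  finally show "?I \<le> 16 * pi * B * (\<Sum>k\<in>K. (norm (c k))\<^sup>2)" by (simp add: mult_ac)
qed

text \<open>Up to constants the lattice spacing is the inverse of the dilation: \<open>Lam j\<close> is comparable to \<open>2 ^ j\<close> and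
\<open>lam j\<close> to \<open>2 ^ (j div 2)\<close>.\<close>

lemma Lam_bounds: "2 ^ j * (4 * pi) \<le> Lam j" "Lam j \<le> 2 ^ j * (16 * pi / 3)"
proof -
  consider "j = 0" | "j = 1" | "j \<ge> 2" by linarith
  then have "2 ^ j * (4 * pi) \<le> Lam j \<and> Lam j \<le> 2 ^ j * (16 * pi / 3)"
  proof cases
    case 3
    define C where "C = cos (pi / 2 ^ (j div 2))"
    have "(2::real) ^ 1 \<le> 2 ^ (j div 2)" using 3 by (intro power_increasing) auto
    then have "pi / 2 ^ (j div 2) \<le> pi / 2" by (intro divide_left_mono) auto
    moreover have "- (pi / 2) \<le> pi / 2 ^ (j div 2)"
      by (rule order.trans[of _ 0]) auto
    ultimately have "0 \<le> C" unfolding C_def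
      by (intro cos_ge_zero)
    moreover have "C \<le> 1" by (simp add: C_def)
    ultimately have "4 * pi / 3 * C \<le> 4 * pi / 3 * 1" "0 \<le> 4 * pi / 3 * C"
      by (intro mult_left_mono, auto)
    then have "4 * pi \<le> 16 * pi / 3 - 4 * pi / 3 * C" "16 * pi / 3 - 4 * pi / 3 * C \<le> 16 * pi / 3"
      by linarith+
    moreover have "Lam j = 2 ^ j * (16 * pi / 3 - 4 * pi / 3 * C)"
      using 3 by (simp add: Lam_def Let_def C_def algebra_simps)
    ultimately show ?thesis by (simp only: mult_left_mono zero_le_power zero_le_numeral)
  qed (simp_all add: Lam_def)
  then show "2 ^ j * (4 * pi) \<le> Lam j" "Lam j \<le> 2 ^ j * (16 * pi / 3)" by auto
qed

lemma lam_bounds: "2 ^ (j div 2) \<le> lam j" "lam j \<le> 2 ^ (j div 2) * (32 * pi\<^sup>2 / 3)"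
proof -
  have pi1: "pi \<le> pi\<^sup>2" using pi_gt3 by (simp add: power2_eq_square)
  consider "j = 0" | "j = 1" | "j \<ge> 2" by linarith
  then have "2 ^ (j div 2) \<le> lam j \<and> lam j \<le> 2 ^ (j div 2) * (32 * pi\<^sup>2 / 3)"
  proof cases
    case 3
    define s :: real where "s = 2 ^ (j div 2)"
    have "(2::real) ^ 1 \<le> 2 ^ (j div 2)" using 3 by (intro power_increasing) auto
    then have s: "s \<ge> 2" by (simp add: s_def)
    have x: "0 \<le> pi / s" using s by simp
    have x': "pi / s \<le> pi / 2" using s by (intro divide_left_mono) auto
    have sn: "sin (pi / s) \<le> pi / s" "pi / s / 2 \<le> sin (pi / s)"
      using sin_x_le_x[OF x(1)] sin_ge_half[OF x x'] by auto
    have "j \<le> Suc (j div 2 + j div 2)" by linarith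
    then have "(2::real) ^ j \<le> 2 ^ Suc (j div 2 + j div 2)" by (intro power_increasing) auto
    then have ss: "s * s \<le> 2 ^ j" "2 ^ j \<le> 2 * (s * s)"
      using two_pow_div2[of j] by (simp_all add: s_def power_add)
    have l: "lam j = 2 ^ j * (16 * pi / 3) * sin (pi / s)"
      using 3 by (simp add: lam_def s_def)
    have "lam j \<le> 2 * (s * s) * (16 * pi / 3) * (pi / s)"
      unfolding l using sn ss x s by (intro mult_mono) auto
    also have "\<dots> = s * (32 * pi\<^sup>2 / 3)" using s by (simp add: power2_eq_square)
    finally have "lam j \<le> s * (32 * pi\<^sup>2 / 3)" .
    moreover have "s * s * (16 * pi / 3) * (pi / s / 2) \<le> lam j"
      unfolding l using sn ss x s by (intro mult_mono) auto
    moreover have "s * s * (16 * pi / 3) * (pi / s / 2) = s * (8 * pi\<^sup>2 / 3)" using s by (simp add: power2_eq_square)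
    moreover have "s * 1 \<le> s * (8 * pi\<^sup>2 / 3)"
      using s pi1 pi_gt3 by (intro mult_left_mono) auto
    ultimately have "s \<le> lam j \<and> lam j \<le> s * (32 * pi\<^sup>2 / 3)" by linarith
    then show ?thesis by (simp add: s_def)
  qed (use pi1 pi_gt3 in \<open>simp_all add: lam_def\<close>)
  then show "2 ^ (j div 2) \<le> lam j" "lam j \<le> 2 ^ (j div 2) * (32 * pi\<^sup>2 / 3)" by auto
qed

lemma curv_dil_mult: "(curv_dil j *v k) $ 1 = 2 ^ j * k $ 1" "(curv_dil j *v k) $ 2 = 2 ^ (j div 2) * k $ 2"
  by (simp_all add: mat2_mult curv_dil_def)

lemma det_curv_dil: "det (curv_dil j) = 2 ^ j * 2 ^ (j div 2)"
  by (simp add: det_2 curv_dil_def)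

text \<open>The dilated lattice has spacing at least \<open>1/32\<close> in both directions, so the sum is at most a product of two
one-dimensional sums, each at most \<open>4 * (1 + 16)\<close>.\<close>

lemma lattice_gauss_sum_le:
  assumes K: "finite K" "K \<subseteq> curv_lattice j" and k: "k \<in> curv_lattice j"
  shows "(\<Sum>k'\<in>K. exp (- 4 * (norm (curv_dil j *v k - curv_dil j *v k'))\<^sup>2)) \<le> 4624"
proof -
  define e1 e2 where "e1 = 2 * pi * 2 ^ j / Lam j" and "e2 = 2 * pi * 2 ^ (j div 2) / lam j"
  define pt :: "int \<times> int \<Rightarrow> real^2" where
    "pt = (\<lambda>(a, b). vector [2 * pi * of_int a / Lam j, 2 * pi * of_int b / lam j])"
  have L: "Lam j > 0" "lam j > 0"
    using Lam_bounds(1)[of j] lam_bounds(1)[of j]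
    by (auto intro: less_le_trans[OF _ Lam_bounds(1)] less_le_trans[OF _ lam_bounds(1)])
  have "2 * pi * 2 ^ j / (2 ^ j * (16 * pi / 3)) \<le> e1"
    unfolding e1_def using L Lam_bounds by (intro divide_left_mono) auto
  then have e1: "e1 \<ge> 1 / 32" by (simp add: field_simps)
  have "2 * pi * 2 ^ (j div 2) / (2 ^ (j div 2) * (32 * pi\<^sup>2 / 3)) \<le> e2"
    unfolding e2_def using L lam_bounds by (intro divide_left_mono) auto
  moreover have "2 * pi * 2 ^ (j div 2) / (2 ^ (j div 2) * (32 * pi\<^sup>2 / 3)) = 3 / (16 * pi)"
    by (simp add: power2_eq_square)
  moreover have "1 / 32 \<le> 3 / (16 * pi)" using pi_less_4 by (simp add: field_simps)
  ultimately have e2: "e2 \<ge> 1 / 32" by linarith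
  have "k \<in> range pt" using k by (auto simp: curv_lattice_def pt_def)
  then obtain a b where ab: "k = pt (a, b)" by auto
  have "K \<subseteq> range pt" using K(2) by (force simp: curv_lattice_def pt_def)
  then obtain I where I: "finite I" "K = pt ` I"
    using K(1) by (meson finite_subset_image)
  define A B where "A = fst ` I" and "B = snd ` I"
  have AB: "finite A" "finite B" "I \<subseteq> A \<times> B" using I by (force simp: A_def B_def)+
  have each: "exp (- 4 * (norm (curv_dil j *v k - curv_dil j *v pt z))\<^sup>2)
     \<le> exp (- (1/16 * (of_int a - of_int (fst z)))\<^sup>2) * exp (- (1/16 * (of_int b - of_int (snd z)))\<^sup>2)" for z
  proof -
    obtain a' b' where z: "z = (a', b')" by force
    have "(curv_dil j *v k - curv_dil j *v pt z) $ 1 = e1 * (of_int a - of_int a')"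
      "(curv_dil j *v k - curv_dil j *v pt z) $ 2 = e2 * (of_int b - of_int b')"
      unfolding ab z pt_def e1_def e2_def by (simp_all add: curv_dil_mult diff_divide_distrib algebra_simps)
    then have n: "(norm (curv_dil j *v k - curv_dil j *v pt z))\<^sup>2
       = e1\<^sup>2 * (of_int a - of_int a')\<^sup>2 + e2\<^sup>2 * (of_int b - of_int b')\<^sup>2"
      by (simp add: norm_vec2 power_mult_distrib)
    have "(1/32)\<^sup>2 \<le> e1\<^sup>2" "(1/32)\<^sup>2 \<le> e2\<^sup>2" using e1 e2 by (intro power_mono; simp)+
    then have "(1/32)\<^sup>2 * (of_int a - of_int a')\<^sup>2 + (1/32)\<^sup>2 * (of_int b - of_int b')\<^sup>2
       \<le> (norm (curv_dil j *v k - curv_dil j *v pt z))\<^sup>2"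
      unfolding n by (intro add_mono mult_right_mono) auto
    then show ?thesis
      unfolding exp_add[symmetric] exp_le_cancel_iff z fst_conv snd_conv power_mult_distrib
      by (simp add: power2_eq_square algebra_simps)
  qed
  have "(\<Sum>k'\<in>K. exp (- 4 * (norm (curv_dil j *v k - curv_dil j *v k'))\<^sup>2))
    \<le> (\<Sum>z\<in>I. exp (- 4 * (norm (curv_dil j *v k - curv_dil j *v pt z))\<^sup>2))"
    unfolding I(2) using I(1) by (intro sum_image_le[unfolded o_def]) auto
  also have "\<dots> \<le> (\<Sum>z\<in>I. exp (- (1/16 * (of_int a - of_int (fst z)))\<^sup>2) * exp (- (1/16 * (of_int b - of_int (snd z)))\<^sup>2))"
    by (intro sum_mono each)
  also have "\<dots> \<le> (\<Sum>z\<in>A \<times> B. exp (- (1/16 * (of_int a - of_int (fst z)))\<^sup>2) * exp (- (1/16 * (of_int b - of_int (snd z)))\<^sup>2))"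
    using AB by (intro sum_mono2) auto
  also have "\<dots> = (\<Sum>a'\<in>A. exp (- (1/16 * (of_int a - of_int a'))\<^sup>2)) * (\<Sum>b'\<in>B. exp (- (1/16 * (of_int b - of_int b'))\<^sup>2))"
    unfolding sum_product sum.cartesian_product by (simp add: split_beta)
  also have "\<dots> \<le> (4 * (1 + 1 / (1/16))) * (4 * (1 + 1 / (1/16)))"
    using AB by (intro mult_mono sum_gauss_int_le) (auto intro!: sum_nonneg)
  finally show ?thesis by simp
qed

section \<open>The operators of the curvelet system on the Fourier side\<close>

text \<open>The action of \<open>curv_U\<close> on Fourier transforms; see \<open>curv_U_inv_fourier\<close>.\<close>

fun curv_spec :: "curv_index \<Rightarrow> (real^2 \<Rightarrow> complex) \<Rightarrow> real^2 \<Rightarrow> complex" where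
  "curv_spec (j, l, k) F = (\<lambda>\<xi>. complex_of_real (1 / sqrt (det (curv_dil j))) *
     (F (freq_mat j l *v \<xi>) * cis (- ((curv_dil j *v k) \<bullet> (freq_mat j l *v \<xi>)))))"

lemma det_freq_mat: "det (freq_mat j l) = 1 / det (curv_dil j)"
proof -
  define \<theta> where "\<theta> = pi * real l / 2 ^ (j div 2)"
  have "cos \<theta> * cos \<theta> + sin \<theta> * sin \<theta> = 1"
    using sin_cos_squared_add[of \<theta>] unfolding power2_eq_square by linarith
  moreover have "det (freq_mat j l) = (cos \<theta> * cos \<theta> + sin \<theta> * sin \<theta>) / (2 ^ j * 2 ^ (j div 2))"
    unfolding det_2 freq_mat_def Let_def \<theta>_def[symmetric] vec2_entries
    by (simp add: divide_inverse algebra_simps del: sin_cos_squared_add3)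
  ultimately show ?thesis by (simp only: det_curv_dil)
qed

lemma dil_rot_inner_freq:
  "(curv_dil j *v (transpose (curv_rot j l) *v x)) \<bullet> (freq_mat j l *v \<xi>) = x \<bullet> \<xi>"
proof -
  define c s where "c = cos (pi * real l / 2 ^ (j div 2))" and "s = sin (pi * real l / 2 ^ (j div 2))"
  have cs: "c * c + s * s = 1"
    using sin_cos_squared_add[of "pi * real l / 2 ^ (j div 2)"] unfolding c_def s_def power2_eq_square by linarith
  have R: "(transpose (curv_rot j l) *v x) $ 1 = c * x$1 + s * x$2"
      "(transpose (curv_rot j l) *v x) $ 2 = - s * x$1 + c * x$2"
    unfolding mat2_mult by (simp_all add: transpose_def curv_rot_def Let_def c_def s_def)
  have F: "(freq_mat j l *v \<xi>) $ 1 = (c * \<xi>$1 + s * \<xi>$2) / 2 ^ j"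
      "(freq_mat j l *v \<xi>) $ 2 = (- s * \<xi>$1 + c * \<xi>$2) / 2 ^ (j div 2)"
    unfolding mat2_mult freq_mat_def Let_def vec2_entries c_def[symmetric] s_def[symmetric]
    by (simp_all add: divide_inverse algebra_simps)
  have pc: "p * a * (b / p) = a * b" if "p \<noteq> 0" for p a b :: real
    using that by simp
  have "(curv_dil j *v (transpose (curv_rot j l) *v x)) \<bullet> (freq_mat j l *v \<xi>)
     = (c * x$1 + s * x$2) * (c * \<xi>$1 + s * \<xi>$2) + (- s * x$1 + c * x$2) * (- s * \<xi>$1 + c * \<xi>$2)"
    unfolding inner_vec2 curv_dil_mult R F
    by (subst (1 2) pc) simp_all
  also have "\<dots> = (c * c + s * s) * (x$1 * \<xi>$1 + x$2 * \<xi>$2)"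
    by (simp add: algebra_simps)
  finally show ?thesis by (simp add: cs inner_vec2)
qed

lemma matrix_mult_measurable [measurable]:
  "(\<lambda>x. (A::real^2^2) *v x) \<in> borel_measurable borel"
  by (intro borel_measurable_continuous_onI continuous_intros)

lemma curv_U_inv_fourier:
  assumes [measurable]: "F \<in> borel_measurable borel"
  shows "curv_U \<gamma> (inv_fourier F) = inv_fourier (curv_spec \<gamma> F)"
proof (rule ext)
  fix x
  obtain j l k where \<gamma>: "\<gamma> = (j, l, k)" by (cases \<gamma>) auto
  define d where "d = det (curv_dil j)"
  have d: "d > 0" by (simp add: d_def det_curv_dil)
  define z where "z = curv_dil j *v (transpose (curv_rot j l) *v x - k)"
  have "(LINT \<eta>|lborel. F \<eta> * cis (z \<bullet> \<eta>)) = \<bar>1 / d\<bar> *\<^sub>R (LINT \<xi>|lborel. F (freq_mat j l *v \<xi>) * cis (z \<bullet> (freq_mat j l *v \<xi>)))"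
    by (subst integral_matrix_substitution[of "freq_mat j l"])
       (use d in \<open>simp_all add: det_freq_mat d_def[symmetric] cis_conv_exp\<close>)
  also have "\<dots> = \<bar>1 / d\<bar> *\<^sub>R (LINT \<xi>|lborel. (F (freq_mat j l *v \<xi>) * cis (- ((curv_dil j *v k) \<bullet> (freq_mat j l *v \<xi>)))) * cis (x \<bullet> \<xi>))"
    by (intro arg_cong2[where f = scaleR] refl Bochner_Integration.integral_cong)
       (simp_all add: z_def matrix_vector_mult_diff_distrib inner_diff_left dil_rot_inner_freq cis_mult mult.assoc
        del: transpose_matrix_vector)
  also have "\<dots> = complex_of_real (1 / sqrt d) * (LINT \<xi>|lborel. complex_of_real (1 / sqrt d) * (F (freq_mat j l *v \<xi>) * cis (- ((curv_dil j *v k) \<bullet> (freq_mat j l *v \<xi>)))) * cis (x \<bullet> \<xi>))"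
    unfolding mult.assoc integral_mult_right_zero
    using d by (simp add: scaleR_conv_of_real flip: of_real_mult)
  finally have e: "(LINT \<eta>|lborel. F \<eta> * cis (z \<bullet> \<eta>)) = complex_of_real (1 / sqrt d) * (LINT \<xi>|lborel. complex_of_real (1 / sqrt d) * (F (freq_mat j l *v \<xi>) * cis (- ((curv_dil j *v k) \<bullet> (freq_mat j l *v \<xi>)))) * cis (x \<bullet> \<xi>))" .
  have "curv_U \<gamma> (inv_fourier F) x = complex_of_real (sqrt d) * (complex_of_real (1 / (2 * pi)) * (LINT \<eta>|lborel. F \<eta> * cis (z \<bullet> \<eta>)))"
    by (simp add: \<gamma> inv_fourier_def z_def d_def)
  also have "\<dots> = inv_fourier (curv_spec \<gamma> F) x"
    unfolding e \<gamma> inv_fourier_def curv_spec.simps d_def[symmetric] using d by simp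
  finally show "curv_U \<gamma> (inv_fourier F) x = inv_fourier (curv_spec \<gamma> F) x" .
qed

section \<open>The synthesis bound\<close>

lemma weight_le_gauss: "weight j \<eta> \<le> 16 * exp (- (norm \<eta>)\<^sup>2 / 16)"
proof -
  define y where "y = (norm \<eta>)\<^sup>2 / 16"
  have y: "y \<ge> 0" "(norm \<eta>)\<^sup>2 = 16 * y" by (simp_all add: y_def)
  have "(\<eta> $ 1)\<^sup>2 \<le> 16 * y" unfolding y(2)[symmetric] norm_vec2 by simp
  moreover have "y \<le> exp y" using exp_ge_add_one_self[of y] by linarith
  moreover have "1 \<le> exp y" using y by simp
  ultimately have "1 \<le> 16 * exp y" "(\<eta> $ 1)\<^sup>2 \<le> 16 * exp y" by linarith+
  then have "(if j < 4 then 1 else (\<eta> $ 1)\<^sup>2) \<le> 16 * exp y" by auto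
  then have "weight j \<eta> \<le> 16 * exp y * exp (- (2 * y))"
    unfolding weight_def y(2) by (simp add: mult_right_mono)
  also have "\<dots> = 16 * exp (- y)" by (simp add: mult_exp_exp)
  finally show ?thesis by (simp add: y_def)
qed

lemma weight_measurable [measurable]: "weight j \<in> borel_measurable borel"
  unfolding weight_def[abs_def] by measurable

text \<open>The factors are the bound for the sum of all weights, the constant of \<open>weight_le_gauss\<close> and the bound for
trigonometric polynomials over the dilated lattice.\<close>

definition synthesis_const :: real where
  "synthesis_const = sqrt (50000 * (16 * (16 * pi * 4624)))"

text \<open>Collect the terms of each scale \<open>j\<close> and rotation \<open>l\<close>; their translations make up a
trigonometric polynomial \<open>P\<close>. The Cauchy-Schwarz inequality over the pairs \<open>(j, l)\<close>
bounds the squared modulus of the whole spectrum by the sum of all weights times the sum of the products of weight and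
\<open>|P|\<^sup>2\<close>. The first factor is bounded; each term of the second is integrated by a linear
substitution and the almost orthogonality of the translations. Plancherel's inequality
transfers the bound to \<open>L\<^sub>2\<close>.\<close>

theorem curvelet_synthesis_bound:
  fixes F :: "nat \<Rightarrow> real^2 \<Rightarrow> complex" and c :: "curv_index \<Rightarrow> complex"
  assumes I: "finite I" "I \<subseteq> curv_indices"
    and Fm: "\<And>j. F j \<in> borel_measurable borel"
    and F: "\<And>j \<eta>. norm (F j \<eta>) \<le> \<delta> * weight j \<eta>" and \<delta>: "\<delta> \<ge> 0"
  shows "(\<lambda>x. \<Sum>\<gamma>\<in>I. c \<gamma> * curv_U \<gamma> (inv_fourier (F (curv_scale \<gamma>))) x) \<in> L2" (is "?u \<in> L2")
    and "L2_norm (\<lambda>x. \<Sum>\<gamma>\<in>I. c \<gamma> * curv_U \<gamma> (inv_fourier (F (curv_scale \<gamma>))) x)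
       \<le> synthesis_const * \<delta> * sqrt (\<Sum>\<gamma>\<in>I. (norm (c \<gamma>))\<^sup>2)"
proof -
  note [measurable] = Fm
  define jj :: "curv_index \<Rightarrow> nat" where "jj = fst"
  define ll :: "curv_index \<Rightarrow> nat" where "ll \<gamma> = fst (snd \<gamma>)" for \<gamma>
  define kk :: "curv_index \<Rightarrow> real^2" where "kk \<gamma> = snd (snd \<gamma>)" for \<gamma>
  have \<gamma>eq: "\<gamma> = (jj \<gamma>, ll \<gamma>, kk \<gamma>)" for \<gamma> by (simp add: jj_def ll_def kk_def)
  have sc: "curv_scale \<gamma> = jj \<gamma>" for \<gamma> by (subst \<gamma>eq) simp
  define S where "S \<gamma> = curv_spec \<gamma> (F (jj \<gamma>))" for \<gamma>
  define d where "d j = det (curv_dil j)" for j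
  have d: "d j > 0" for j by (simp add: d_def det_curv_dil)
  have Seq: "S \<gamma> \<xi> = complex_of_real (1 / sqrt (d (jj \<gamma>))) * (F (jj \<gamma>) (freq_mat (jj \<gamma>) (ll \<gamma>) *v \<xi>)
      * cis (- ((curv_dil (jj \<gamma>) *v kk \<gamma>) \<bullet> (freq_mat (jj \<gamma>) (ll \<gamma>) *v \<xi>))))" for \<gamma> \<xi>
    unfolding S_def d_def by (subst (1) \<gamma>eq) simp
  have Sm[measurable]: "S \<gamma> \<in> borel_measurable borel" for \<gamma>
    unfolding Seq cis_conv_exp by measurable
  have det0: "det (freq_mat j l) \<noteq> 0" for j l by (simp add: det_freq_mat det_curv_dil)
  have Sbound: "norm (S \<gamma> \<xi>) \<le> \<delta> * weight (jj \<gamma>) (freq_mat (jj \<gamma>) (ll \<gamma>) *v \<xi>)" for \<gamma> \<xi>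
  proof -
    have "1 \<le> sqrt (d (jj \<gamma>))"
      unfolding d_def det_curv_dil by (simp flip: power_add)
    then have "1 / sqrt (d (jj \<gamma>)) \<le> 1" by simp
    then have "norm (S \<gamma> \<xi>) \<le> 1 * norm (F (jj \<gamma>) (freq_mat (jj \<gamma>) (ll \<gamma>) *v \<xi>))"
      unfolding Seq norm_mult norm_of_real norm_cis
      using d[of "jj \<gamma>"] by (intro mult_mono) auto
    then show ?thesis using F order.trans by fastforce
  qed
  have Sgauss: "norm (S \<gamma> \<xi>) \<le> \<delta> * (16 * exp (- (1/16) * (norm (freq_mat (jj \<gamma>) (ll \<gamma>) *v \<xi>))\<^sup>2))" for \<gamma> \<xi>
    using order.trans[OF Sbound mult_left_mono[OF weight_le_gauss \<delta>]] by simp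
  have Si: "integrable lborel (S \<gamma>)" for \<gamma>
  proof (rule Bochner_Integration.integrable_bound)
    show "integrable lborel (\<lambda>\<xi>. \<delta> * (16 * exp (- (1/16) * (norm (freq_mat (jj \<gamma>) (ll \<gamma>) *v \<xi>))\<^sup>2)))"
      using integrable_matrix_substitution[OF det0, of "\<lambda>x. exp (- (1/16) * (norm x)\<^sup>2)"]
      by (intro integrable_mult_right) (simp add: gauss_integrable_vec2[of "1/16", simplified])
    show "AE \<xi> in lborel. norm (S \<gamma> \<xi>) \<le> norm (\<delta> * (16 * exp (- (1/16) * (norm (freq_mat (jj \<gamma>) (ll \<gamma>) *v \<xi>))\<^sup>2)))"
      using Sgauss \<delta> by (intro AE_I2) (simp add: abs_mult)
  qed measurable
  define H where "H \<xi> = (\<Sum>\<gamma>\<in>I. c \<gamma> * S \<gamma> \<xi>)" for \<xi>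
  have Hi: "integrable lborel H"
    unfolding H_def[abs_def] using Si by (intro Bochner_Integration.integrable_sum integrable_mult_right)
  have u: "?u = inv_fourier H"
  proof (rule ext)
    fix x
    have Sc: "integrable lborel (\<lambda>\<xi>. S \<gamma> \<xi> * cis (x \<bullet> \<xi>))" for \<gamma>
      by (rule Bochner_Integration.integrable_bound[OF Si[of \<gamma>]]) (auto simp: norm_mult cis_conv_exp)
    have "(LINT \<xi>|lborel. H \<xi> * cis (x \<bullet> \<xi>)) = (LINT \<xi>|lborel. (\<Sum>\<gamma>\<in>I. c \<gamma> * (S \<gamma> \<xi> * cis (x \<bullet> \<xi>))))"
      by (simp add: H_def sum_distrib_right mult.assoc)
    also have "\<dots> = (\<Sum>\<gamma>\<in>I. c \<gamma> * (LINT \<xi>|lborel. S \<gamma> \<xi> * cis (x \<bullet> \<xi>)))"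
      using Sc by simp
    finally have "inv_fourier H x = (\<Sum>\<gamma>\<in>I. c \<gamma> * inv_fourier (S \<gamma>) x)"
      unfolding inv_fourier_def by (simp add: sum_distrib_left mult.left_commute)
    moreover have "curv_U \<gamma> (inv_fourier (F (curv_scale \<gamma>))) = inv_fourier (S \<gamma>)" for \<gamma>
      unfolding S_def sc by (rule curv_U_inv_fourier) measurable
    ultimately show "?u x = inv_fourier H x" by simp
  qed
  define g where "g \<gamma> = (jj \<gamma>, ll \<gamma>)" for \<gamma>
  define J where "J = g ` I"
  define IJ where "IJ z = {\<gamma>\<in>I. g \<gamma> = z}" for z
  define P where "P z \<eta> = (\<Sum>\<gamma>\<in>IJ z. c \<gamma> * cis (- ((curv_dil (fst z) *v kk \<gamma>) \<bullet> \<eta>)))" for z \<eta>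
  define Et where "Et z \<xi> = freq_mat (fst z) (snd z) *v \<xi>" for z \<xi>
  have J: "finite J" "\<And>j l. (j, l) \<in> J \<Longrightarrow> l < 2 ^ (j div 2)"
    using I by (auto simp: J_def g_def jj_def ll_def curv_indices_def)
  have fIJ: "finite (IJ z)" for z using I by (simp add: IJ_def)
  have Hsum: "H \<xi> = (\<Sum>z\<in>J. complex_of_real (1 / sqrt (d (fst z))) * (F (fst z) (Et z \<xi>) * P z (Et z \<xi>)))" for \<xi>
  proof -
    have "H \<xi> = (\<Sum>z\<in>J. \<Sum>\<gamma>\<in>IJ z. c \<gamma> * S \<gamma> \<xi>)"
      unfolding H_def IJ_def J_def using I by (intro sum.group[symmetric]) auto
    also have "\<dots> = (\<Sum>z\<in>J. complex_of_real (1 / sqrt (d (fst z))) * (F (fst z) (Et z \<xi>) * P z (Et z \<xi>)))"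
    proof (rule sum.cong[OF refl])
      fix z
      have "(\<Sum>\<gamma>\<in>IJ z. c \<gamma> * S \<gamma> \<xi>) = (\<Sum>\<gamma>\<in>IJ z. (complex_of_real (1 / sqrt (d (fst z))) * F (fst z) (Et z \<xi>)) * (c \<gamma> * cis (- ((curv_dil (fst z) *v kk \<gamma>) \<bullet> Et z \<xi>))))"
        by (rule sum.cong[OF refl]) (auto simp: IJ_def g_def Seq Et_def)
      then show "(\<Sum>\<gamma>\<in>IJ z. c \<gamma> * S \<gamma> \<xi>) = complex_of_real (1 / sqrt (d (fst z))) * (F (fst z) (Et z \<xi>) * P z (Et z \<xi>))"
        by (simp add: P_def sum_distrib_left mult.assoc)
    qed
    finally show ?thesis .
  qed
  define W where "W z \<eta> = exp (- (norm \<eta>)\<^sup>2 / 16) * (norm (P z \<eta>))\<^sup>2" for z \<eta>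
  have Wm[measurable]: "W z \<in> borel_measurable borel" for z
    unfolding W_def[abs_def] P_def cis_conv_exp by measurable
  have W: "integrable lborel (W z)"
    "(LINT \<eta>|lborel. W z \<eta>) \<le> 16 * pi * 4624 * (\<Sum>\<gamma>\<in>IJ z. (norm (c \<gamma>))\<^sup>2)" if "z \<in> J" for z
  proof -
    have lat: "(\<Sum>\<gamma>'\<in>IJ z. exp (- 4 * (norm (curv_dil (fst z) *v kk \<gamma> - curv_dil (fst z) *v kk \<gamma>'))\<^sup>2)) \<le> 4624"
      if "\<gamma> \<in> IJ z" for \<gamma>
    proof -
      have inj: "inj_on kk (IJ z)"
        by (rule inj_onI) (auto simp: IJ_def g_def jj_def ll_def kk_def prod_eq_iff)
      have sub: "kk ` IJ z \<subseteq> curv_lattice (fst z)"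
        using I(2) by (auto simp: IJ_def g_def jj_def ll_def kk_def curv_indices_def)
      have "(\<Sum>\<gamma>'\<in>IJ z. exp (- 4 * (norm (curv_dil (fst z) *v kk \<gamma> - curv_dil (fst z) *v kk \<gamma>'))\<^sup>2))
        = (\<Sum>k'\<in>kk ` IJ z. exp (- 4 * (norm (curv_dil (fst z) *v kk \<gamma> - curv_dil (fst z) *v k'))\<^sup>2))"
        using inj by (simp add: sum.reindex)
      also have "\<dots> \<le> 4624"
        using sub that fIJ by (intro lattice_gauss_sum_le) auto
      finally show ?thesis .
    qed
    show "integrable lborel (W z)"
      unfolding W_def[abs_def] P_def
      by (rule gauss_trig_polynomial_integral(1)[OF fIJ lat])
    show "(LINT \<eta>|lborel. W z \<eta>) \<le> 16 * pi * 4624 * (\<Sum>\<gamma>\<in>IJ z. (norm (c \<gamma>))\<^sup>2)"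
      unfolding W_def[abs_def] P_def
      by (rule gauss_trig_polynomial_integral(2)[OF fIJ lat])
  qed
  have pt: "(norm (H \<xi>))\<^sup>2 \<le> 50000 * (\<delta>\<^sup>2 * (\<Sum>z\<in>J. 16 / d (fst z) * W z (Et z \<xi>)))" for \<xi>
  proof -
    define h where "h z = weight (fst z) (Et z \<xi>)" for z
    have h0: "h z \<ge> 0" for z by (simp add: h_def weight_nonneg)
    define q where "q z = \<delta> * (1 / sqrt (d (fst z))) * norm (P z (Et z \<xi>))" for z
    have "norm (H \<xi>) \<le> (\<Sum>z\<in>J. norm (complex_of_real (1 / sqrt (d (fst z))) * (F (fst z) (Et z \<xi>) * P z (Et z \<xi>))))"
      unfolding Hsum by (rule norm_sum)
    also have "\<dots> \<le> (\<Sum>z\<in>J. sqrt (h z) * (sqrt (h z) * q z))"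
    proof (rule sum_mono)
      fix z
      have "norm (complex_of_real (1 / sqrt (d (fst z))) * (F (fst z) (Et z \<xi>) * P z (Et z \<xi>)))
        = norm (F (fst z) (Et z \<xi>)) * ((1 / sqrt (d (fst z))) * norm (P z (Et z \<xi>)))"
        using d[of "fst z"] by (simp add: norm_mult norm_divide)
      also have "\<dots> \<le> (\<delta> * h z) * ((1 / sqrt (d (fst z))) * norm (P z (Et z \<xi>)))"
        using d[of "fst z"] F unfolding h_def by (intro mult_right_mono) auto
      also have "\<dots> = sqrt (h z) * (sqrt (h z) * q z)"
        using h0[of z] by (simp add: q_def mult.assoc[symmetric])
      finally show "norm (complex_of_real (1 / sqrt (d (fst z))) * (F (fst z) (Et z \<xi>) * P z (Et z \<xi>))) \<le> sqrt (h z) * (sqrt (h z) * q z)" .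
    qed
    finally have "(norm (H \<xi>))\<^sup>2 \<le> (\<Sum>z\<in>J. sqrt (h z) * (sqrt (h z) * q z))\<^sup>2"
      by (intro power_mono) auto
    also have "\<dots> \<le> (\<Sum>z\<in>J. (sqrt (h z))\<^sup>2) * (\<Sum>z\<in>J. (sqrt (h z) * q z)\<^sup>2)"
      by (rule Cauchy_Schwarz_ineq_sum)
    also have "\<dots> \<le> 50000 * (\<Sum>z\<in>J. (sqrt (h z) * q z)\<^sup>2)"
    proof (rule mult_right_mono)
      have "(\<Sum>z\<in>J. (sqrt (h z))\<^sup>2) = (\<Sum>(j,l)\<in>J. weight j (freq_mat j l *v \<xi>))"
        using h0 by (intro sum.cong) (auto simp: h_def Et_def)
      also have "\<dots> \<le> 50000" by (rule weight_sum_le[OF J])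
      finally show "(\<Sum>z\<in>J. (sqrt (h z))\<^sup>2) \<le> 50000" .
    qed (auto intro!: sum_nonneg)
    also have "(\<Sum>z\<in>J. (sqrt (h z) * q z)\<^sup>2) \<le> (\<Sum>z\<in>J. \<delta>\<^sup>2 * (16 / d (fst z) * W z (Et z \<xi>)))"
    proof (rule sum_mono)
      fix z
      have "(sqrt (h z) * q z)\<^sup>2 = h z * (\<delta>\<^sup>2 * (1 / d (fst z)) * (norm (P z (Et z \<xi>)))\<^sup>2)"
        using h0[of z] d[of "fst z"] by (simp add: q_def power_mult_distrib power_divide)
      also have "\<dots> \<le> (16 * exp (- (norm (Et z \<xi>))\<^sup>2 / 16)) * (\<delta>\<^sup>2 * (1 / d (fst z)) * (norm (P z (Et z \<xi>)))\<^sup>2)"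
        using d[of "fst z"] unfolding h_def by (intro mult_right_mono weight_le_gauss) auto
      finally show "(sqrt (h z) * q z)\<^sup>2 \<le> \<delta>\<^sup>2 * (16 / d (fst z) * W z (Et z \<xi>))"
        by (simp add: W_def mult_ac)
    qed
    finally show ?thesis by (simp add: sum_distrib_left)
  qed
  have Wi: "integrable lborel (\<lambda>\<xi>. W z (Et z \<xi>))"
    "(LINT \<xi>|lborel. W z (Et z \<xi>)) = d (fst z) * (LINT \<eta>|lborel. W z \<eta>)" if "z \<in> J" for z
  proof -
    show "integrable lborel (\<lambda>\<xi>. W z (Et z \<xi>))"
      unfolding Et_def using integrable_matrix_substitution[OF det0 Wm] W(1)[OF that] by blast
    show "(LINT \<xi>|lborel. W z (Et z \<xi>)) = d (fst z) * (LINT \<eta>|lborel. W z \<eta>)"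
      unfolding Et_def using integral_matrix_substitution[OF det0 Wm, of z "fst z" "snd z"] d[of "fst z"]
      by (simp add: det_freq_mat d_def[symmetric])
  qed
  define R where "R \<xi> = 50000 * (\<delta>\<^sup>2 * (\<Sum>z\<in>J. 16 / d (fst z) * W z (Et z \<xi>)))" for \<xi>
  have Ri: "integrable lborel R"
    unfolding R_def[abs_def] using Wi by (intro integrable_mult_right Bochner_Integration.integrable_sum)
  have H2i: "integrable lborel (\<lambda>\<xi>. (norm (H \<xi>))\<^sup>2)"
  proof (rule Bochner_Integration.integrable_bound[OF Ri])
    show "AE \<xi> in lborel. norm ((norm (H \<xi>))\<^sup>2) \<le> norm (R \<xi>)"
      using pt by (intro AE_I2) (auto simp: R_def intro: order.trans[OF _ abs_ge_self])
    show "(\<lambda>\<xi>. (norm (H \<xi>))\<^sup>2) \<in> borel_measurable lborel"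
      using Hi by simp
  qed
  have "(LINT \<xi>|lborel. (norm (H \<xi>))\<^sup>2) \<le> (LINT \<xi>|lborel. R \<xi>)"
    using pt by (intro integral_mono H2i Ri) (simp add: R_def)
  also have "\<dots> = 50000 * (\<delta>\<^sup>2 * (\<Sum>z\<in>J. 16 / d (fst z) * (d (fst z) * (LINT \<eta>|lborel. W z \<eta>))))"
    unfolding R_def using Wi by simp
  also have "\<dots> = 50000 * (\<delta>\<^sup>2 * (\<Sum>z\<in>J. 16 * (LINT \<eta>|lborel. W z \<eta>)))"
    using d by (simp add: less_imp_neq[THEN not_sym])
  also have "\<dots> \<le> 50000 * (\<delta>\<^sup>2 * (\<Sum>z\<in>J. 16 * (16 * pi * 4624 * (\<Sum>\<gamma>\<in>IJ z. (norm (c \<gamma>))\<^sup>2))))"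
    using W(2) by (intro mult_left_mono sum_mono) auto
  also have "\<dots> = 50000 * (16 * (16 * pi * 4624)) * \<delta>\<^sup>2 * (\<Sum>z\<in>J. \<Sum>\<gamma>\<in>IJ z. (norm (c \<gamma>))\<^sup>2)"
    unfolding sum_distrib_left[symmetric] by (simp only: mult_ac)
  also have "(\<Sum>z\<in>J. \<Sum>\<gamma>\<in>IJ z. (norm (c \<gamma>))\<^sup>2) = (\<Sum>\<gamma>\<in>I. (norm (c \<gamma>))\<^sup>2)"
    unfolding IJ_def J_def using I by (intro sum.group) auto
  finally have fin: "(LINT \<xi>|lborel. (norm (H \<xi>))\<^sup>2) \<le> 50000 * (16 * (16 * pi * 4624)) * \<delta>\<^sup>2 * (\<Sum>\<gamma>\<in>I. (norm (c \<gamma>))\<^sup>2)" .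
  show "?u \<in> L2" unfolding u by (rule inv_fourier_plancherel_le[OF Hi H2i])
  have "(L2_norm (inv_fourier H))\<^sup>2 \<le> 50000 * (16 * (16 * pi * 4624)) * \<delta>\<^sup>2 * (\<Sum>\<gamma>\<in>I. (norm (c \<gamma>))\<^sup>2)"
    using inv_fourier_plancherel_le(2)[OF Hi H2i] fin by linarith
  then have "L2_norm (inv_fourier H) \<le> sqrt (50000 * (16 * (16 * pi * 4624)) * \<delta>\<^sup>2 * (\<Sum>\<gamma>\<in>I. (norm (c \<gamma>))\<^sup>2))"
    by (rule real_le_rsqrt)
  also have "\<dots> = synthesis_const * \<delta> * sqrt (\<Sum>\<gamma>\<in>I. (norm (c \<gamma>))\<^sup>2)"
    unfolding synthesis_const_def real_sqrt_mult using \<delta> by simp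
  finally show "L2_norm ?u \<le> synthesis_const * \<delta> * sqrt (\<Sum>\<gamma>\<in>I. (norm (c \<gamma>))\<^sup>2)"
    unfolding u .
qed

section \<open>Uniformly smooth families of functions\<close>

definition bounded_family :: "('i \<Rightarrow> real set) \<Rightarrow> ('i \<Rightarrow> real \<Rightarrow> real) \<Rightarrow> bool" where
  "bounded_family U f \<longleftrightarrow> (\<exists>B. \<forall>i. \<forall>s\<in>U i. \<bar>f i s\<bar> \<le> B)"

text \<open>Derivatives up to order \<open>k\<close> exist on \<open>U i\<close> and are bounded uniformly in \<open>i\<close>. The set depends on the index because
the functions will be restrictions of a function on a plane region to lines, which meet the region in different sets.\<close>

primrec uniformly_smooth :: "nat \<Rightarrow> ('i \<Rightarrow> real set) \<Rightarrow> ('i \<Rightarrow> real \<Rightarrow> real) \<Rightarrow> bool" where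
  "uniformly_smooth 0 U f \<longleftrightarrow> bounded_family U f"
| "uniformly_smooth (Suc k) U f \<longleftrightarrow> bounded_family U f \<and>
     (\<forall>i. \<forall>s\<in>U i. f i differentiable (at s)) \<and> uniformly_smooth k U (\<lambda>i. deriv (f i))"

lemma bounded_familyI: "(\<And>i s. s \<in> U i \<Longrightarrow> \<bar>f i s\<bar> \<le> B) \<Longrightarrow> bounded_family U f"
  by (auto simp: bounded_family_def)

lemma bounded_familyE:
  assumes "bounded_family U f"
  obtains B where "B \<ge> 0" "\<And>i s. s \<in> U i \<Longrightarrow> \<bar>f i s\<bar> \<le> B"
proof -
  obtain B where B: "\<And>i s. s \<in> U i \<Longrightarrow> \<bar>f i s\<bar> \<le> B"
    using assms by (auto simp: bounded_family_def)
  show ?thesis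
    by (rule that[of "max B 0"]) (auto dest: B simp: le_max_iff_disj)
qed

lemma uniformly_smooth_bounded: "uniformly_smooth k U f \<Longrightarrow> bounded_family U f"
  by (cases k) auto

lemma uniformly_smooth_lower: "uniformly_smooth (Suc k) U f \<Longrightarrow> uniformly_smooth k U f"
proof (induction k arbitrary: f)
  case (Suc k)
  have "bounded_family U f" "\<forall>i. \<forall>s\<in>U i. f i differentiable (at s)"
    "uniformly_smooth (Suc k) U (\<lambda>i. deriv (f i))"
    using Suc.prems unfolding uniformly_smooth.simps(2)[of "Suc k"] by blast+
  with Suc.IH[of "\<lambda>i. deriv (f i)"] show ?case
    unfolding uniformly_smooth.simps(2)[of k] by blast
qed simp

text \<open>As the sets are open, equality on them extends to all derivatives.\<close>

lemma uniformly_smooth_cong: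
  assumes "\<And>i. open (U i)" "\<And>i s. s \<in> U i \<Longrightarrow> f i s = g i s"
  shows "uniformly_smooth k U f \<Longrightarrow> uniformly_smooth k U g"
  using assms(2)
proof (induction k arbitrary: f g)
  case 0
  then show ?case by (simp add: bounded_family_def)
next
  case (Suc k)
  have d: "(g i has_real_derivative D) (at s)" if "(f i has_real_derivative D) (at s)" "s \<in> U i" for i s D
    using that Suc.prems(2) assms(1) by (metis has_field_derivative_transform_within_open)
  have dd: "deriv (f i) s = deriv (g i) s" "g i differentiable (at s)" if "s \<in> U i" for i s
  proof -
    have "f i differentiable (at s)" using Suc.prems(1) that by simp
    then have "(f i has_real_derivative deriv (f i) s) (at s)"
      by (simp add: DERIV_deriv_iff_real_differentiable)
    from d[OF this that] show "deriv (f i) s = deriv (g i) s" "g i differentiable (at s)"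
      by (auto simp: DERIV_imp_deriv real_differentiable_def)
  qed
  have "uniformly_smooth k U (\<lambda>i. deriv (g i))"
    by (rule Suc.IH[of "\<lambda>i. deriv (f i)"]) (use Suc.prems(1) dd in auto)
  then show ?case using Suc.prems dd by (auto simp: bounded_family_def)
qed

lemma uniformly_smooth_SucI:
  assumes "\<And>i. open (U i)" "bounded_family U f"
    "\<And>i s. s \<in> U i \<Longrightarrow> (f i has_real_derivative f' i s) (at s)" "uniformly_smooth k U f'"
  shows "uniformly_smooth (Suc k) U f"
proof -
  have "uniformly_smooth k U (\<lambda>i. deriv (f i))"
    by (rule uniformly_smooth_cong[OF assms(1) _ assms(4)]) (use DERIV_imp_deriv[OF assms(3)] in auto)
  then show ?thesis using assms(2,3) by (auto simp: real_differentiable_def)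
qed

lemma uniformly_smooth_SucD:
  assumes "uniformly_smooth (Suc k) U f"
  shows "s \<in> U i \<Longrightarrow> (f i has_real_derivative deriv (f i) s) (at s)"
    "uniformly_smooth k U (\<lambda>i. deriv (f i))"
  using assms by (auto simp: DERIV_deriv_iff_real_differentiable)

context
  fixes U :: "'i \<Rightarrow> real set"
  assumes open_U: "\<And>i. open (U i)"
begin

lemma uniformly_smooth_const:
  assumes "\<And>i. U i \<noteq> {} \<Longrightarrow> \<bar>c i\<bar> \<le> B"
  shows "uniformly_smooth k U (\<lambda>i s. c i)"
proof -
  have zero: "uniformly_smooth k U (\<lambda>i s. 0)" for k
  proof (induction k)
    case (Suc k)
    show ?case by (rule uniformly_smooth_SucI[OF open_U _ _ Suc]) (auto simp: bounded_family_def)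
  qed (auto simp: bounded_family_def)
  have b: "bounded_family U (\<lambda>i s. c i)" using assms by (intro bounded_familyI[of _ _ B]) auto
  show ?thesis
  proof (cases k)
    case (Suc k')
    show ?thesis unfolding Suc by (rule uniformly_smooth_SucI[OF open_U b _ zero]) auto
  qed (use b in simp)
qed

lemma uniformly_smooth_affine:
  assumes "bounded_family U (\<lambda>i s. a i + s * b i)" "\<And>i. U i \<noteq> {} \<Longrightarrow> \<bar>b i\<bar> \<le> B"
  shows "uniformly_smooth k U (\<lambda>i s. a i + s * b i)"
proof (cases k)
  case (Suc k')
  show ?thesis unfolding Suc
    by (rule uniformly_smooth_SucI[OF open_U assms(1) _ uniformly_smooth_const[of b, OF assms(2)]]) (auto intro!: derivative_eq_intros)
qed (use assms in simp)

lemma bounded_family_add: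
  assumes "bounded_family U f" "bounded_family U g"
  shows "bounded_family U (\<lambda>i s. f i s + g i s)"
proof -
  obtain A B where "\<And>i s. s \<in> U i \<Longrightarrow> \<bar>f i s\<bar> \<le> A" "\<And>i s. s \<in> U i \<Longrightarrow> \<bar>g i s\<bar> \<le> B"
    using assms by (metis bounded_familyE)
  then show ?thesis
    by (intro bounded_familyI[of _ _ "A + B"]) (meson abs_triangle_ineq add_mono order.trans)
qed

lemma uniformly_smooth_add:
  assumes "uniformly_smooth k U f" "uniformly_smooth k U g"
  shows "uniformly_smooth k U (\<lambda>i s. f i s + g i s)"
  using assms
proof (induction k arbitrary: f g)
  case 0
  then show ?case using bounded_family_add by simp
next
  case (Suc k)
  show ?case
    by (rule uniformly_smooth_SucI[OF open_U bounded_family_add[OF uniformly_smooth_bounded[OF Suc.prems(1)] uniformly_smooth_bounded[OF Suc.prems(2)]] _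
          Suc.IH[OF uniformly_smooth_SucD(2)[OF Suc.prems(1)] uniformly_smooth_SucD(2)[OF Suc.prems(2)]]])
       (intro derivative_intros uniformly_smooth_SucD(1)[OF Suc.prems(1)] uniformly_smooth_SucD(1)[OF Suc.prems(2)])
qed

lemma bounded_family_mult:
  assumes "bounded_family U f" "bounded_family U g"
  shows "bounded_family U (\<lambda>i s. f i s * g i s)"
proof -
  obtain A B where "A \<ge> 0" "\<And>i s. s \<in> U i \<Longrightarrow> \<bar>f i s\<bar> \<le> A" "\<And>i s. s \<in> U i \<Longrightarrow> \<bar>g i s\<bar> \<le> B"
    using assms by (metis bounded_familyE)
  then show ?thesis
    by (intro bounded_familyI[of _ _ "A * B"]) (auto simp: abs_mult intro!: mult_mono)
qed

lemma uniformly_smooth_mult: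
  assumes "uniformly_smooth k U f" "uniformly_smooth k U g"
  shows "uniformly_smooth k U (\<lambda>i s. f i s * g i s)"
  using assms
proof (induction k arbitrary: f g)
  case 0
  then show ?case using bounded_family_mult by simp
next
  case (Suc k)
  have "uniformly_smooth k U (\<lambda>i s. f i s * deriv (g i) s + deriv (f i) s * g i s)"
    by (intro uniformly_smooth_add Suc.IH uniformly_smooth_SucD(2) uniformly_smooth_lower[OF Suc.prems(1)] uniformly_smooth_lower[OF Suc.prems(2)] Suc.prems)
  then show ?case
    by (rule uniformly_smooth_SucI[OF open_U bounded_family_mult[OF uniformly_smooth_bounded[OF Suc.prems(1)] uniformly_smooth_bounded[OF Suc.prems(2)]], rotated])
       (auto intro!: derivative_eq_intros uniformly_smooth_SucD(1)[OF Suc.prems(1)] uniformly_smooth_SucD(1)[OF Suc.prems(2)] simp: mult.commute)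
qed

text \<open>The outer function comes with the sequence \<open>d\<close> of its derivatives; a statement about all of them is
what the induction on \<open>k\<close> reproduces.\<close>

lemma uniformly_smooth_compose:
  fixes d :: "nat \<Rightarrow> real \<Rightarrow> real"
  assumes bd: "\<And>n. \<exists>B. \<forall>x\<in>R. \<bar>d n x\<bar> \<le> B"
    and der: "\<And>n x. x \<in> R \<Longrightarrow> (d n has_real_derivative d (Suc n) x) (at x)"
    and R: "\<And>i s. s \<in> U i \<Longrightarrow> f i s \<in> R"
    and f: "uniformly_smooth k U f"
  shows "uniformly_smooth k U (\<lambda>i s. d n (f i s))"
  using f
proof (induction k arbitrary: n)
  case 0
  then show ?case using bd[of n] R by (fastforce simp: bounded_family_def)
next
  case (Suc k)
  have b: "bounded_family U (\<lambda>i s. d n (f i s))"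
    using bd[of n] R by (fastforce simp: bounded_family_def)
  have "uniformly_smooth k U (\<lambda>i s. d (Suc n) (f i s) * deriv (f i) s)"
    by (intro uniformly_smooth_mult Suc.IH uniformly_smooth_lower[OF Suc.prems] uniformly_smooth_SucD(2)[OF Suc.prems])
  then show ?case
    by (rule uniformly_smooth_SucI[OF open_U b, rotated])
       (auto intro!: DERIV_chain2[OF der] R uniformly_smooth_SucD(1)[OF Suc.prems])
qed

lemma uniformly_smooth_exp:
  assumes "uniformly_smooth k U f"
  shows "uniformly_smooth k U (\<lambda>i s. exp (f i s))"
proof -
  obtain B where B: "\<And>i s. s \<in> U i \<Longrightarrow> \<bar>f i s\<bar> \<le> B"
    using uniformly_smooth_bounded[OF assms] by (metis bounded_familyE)
  show ?thesis
    by (rule uniformly_smooth_compose[where d = "\<lambda>n. exp" and R = "{-B..B}"])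
       (use B assms in \<open>auto intro!: exI[of _ "exp B"] derivative_eq_intros simp: abs_le_iff, fastforce\<close>)
qed

lemma uniformly_smooth_sin:
  assumes "uniformly_smooth k U f"
  shows "uniformly_smooth k U (\<lambda>i s. sin (f i s))"
proof -
  have eq: "sin (x + real (Suc n) * (pi / 2)) = cos (x + real n * (pi / 2))" for n x
  proof -
    have "x + real (Suc n) * (pi / 2) = (x + real n * (pi / 2)) + pi / 2" by (simp add: algebra_simps)
    then show ?thesis by (simp only: sin_add cos_pi_half sin_pi_half)
  qed
  have "uniformly_smooth k U (\<lambda>i s. (\<lambda>n x. sin (x + real n * (pi/2))) 0 (f i s))"
  proof (rule uniformly_smooth_compose[where d = "\<lambda>n x. sin (x + real n * (pi/2))" and R = UNIV])
    show "\<exists>B. \<forall>x\<in>UNIV. \<bar>sin (x + real n * (pi / 2))\<bar> \<le> B" for n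
      by (rule exI[of _ 1]) simp
    show "((\<lambda>x. sin (x + real n * (pi / 2))) has_real_derivative sin (x + real (Suc n) * (pi / 2))) (at x)" for n x
      unfolding eq by (auto intro!: derivative_eq_intros)
  qed (use assms in auto)
  then show ?thesis by simp
qed

lemma uniformly_smooth_inverse:
  assumes "uniformly_smooth k U f" and e: "e > 0" "\<And>i s. s \<in> U i \<Longrightarrow> e \<le> \<bar>f i s\<bar>"
  shows "uniformly_smooth k U (\<lambda>i s. inverse (f i s))"
  using assms(1)
proof (induction k)
  have b: "bounded_family U (\<lambda>i s. inverse (f i s))"
    using e by (intro bounded_familyI[of _ _ "inverse e"]) (auto simp: abs_inverse intro!: le_imp_inverse_le)
  {
    case 0
    show ?case using b by simp
  next
    case (Suc k)
    have I: "uniformly_smooth k U (\<lambda>i s. inverse (f i s))"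
      by (rule Suc.IH[OF uniformly_smooth_lower[OF Suc.prems]])
    have "uniformly_smooth k U (\<lambda>i s. (-1) * (inverse (f i s) * (inverse (f i s) * deriv (f i) s)))"
      by (intro uniformly_smooth_mult uniformly_smooth_const[of "\<lambda>_. -1" 1] I uniformly_smooth_SucD(2)[OF Suc.prems]) simp
    moreover have "((\<lambda>s. inverse (f i s)) has_real_derivative (-1) * (inverse (f i s) * (inverse (f i s) * deriv (f i) s))) (at s)"
      if "s \<in> U i" for i s
    proof -
      have "f i s \<noteq> 0" using e that by fastforce
      then show ?thesis
        by (auto intro!: derivative_eq_intros uniformly_smooth_SucD(1)[OF Suc.prems that] simp: power2_eq_square)
    qed
    ultimately show ?case by (intro uniformly_smooth_SucI[OF open_U b])
  }
qed

lemma uniformly_smooth_sqrt: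
  assumes "uniformly_smooth k U f" and e: "e > 0" "\<And>i s. s \<in> U i \<Longrightarrow> e \<le> f i s"
  shows "uniformly_smooth k U (\<lambda>i s. sqrt (f i s))"
  using assms(1)
proof (induction k)
  obtain B where B: "\<And>i s. s \<in> U i \<Longrightarrow> \<bar>f i s\<bar> \<le> B"
    using uniformly_smooth_bounded[OF assms(1)] by (metis bounded_familyE)
  have b: "bounded_family U (\<lambda>i s. sqrt (f i s))"
    using B by (intro bounded_familyI[of _ _ "sqrt B"]) (simp flip: real_sqrt_abs2 add: real_sqrt_abs)
  {
    case 0
    show ?case using b by simp
  next
    case (Suc k)
    have I: "uniformly_smooth k U (\<lambda>i s. sqrt (f i s))"
      by (rule Suc.IH[OF uniformly_smooth_lower[OF Suc.prems]])
    have J: "uniformly_smooth k U (\<lambda>i s. inverse (sqrt (f i s)))"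
      by (rule uniformly_smooth_inverse[OF I, of "sqrt e"]) (use e in \<open>auto intro!: order.trans[OF _ abs_ge_self]\<close>)
    have "uniformly_smooth k U (\<lambda>i s. 1/2 * (inverse (sqrt (f i s)) * deriv (f i) s))"
      by (intro uniformly_smooth_mult uniformly_smooth_const[of "\<lambda>_. 1/2" "1/2"] J uniformly_smooth_SucD(2)[OF Suc.prems]) simp
    moreover have "((\<lambda>s. sqrt (f i s)) has_real_derivative 1/2 * (inverse (sqrt (f i s)) * deriv (f i) s)) (at s)"
      if "s \<in> U i" for i s
    proof -
      have "f i s > 0" using e that by fastforce
      then show ?thesis
        by (auto intro!: derivative_eq_intros uniformly_smooth_SucD(1)[OF Suc.prems that])
    qed
    ultimately show ?case by (intro uniformly_smooth_SucI[OF open_U b])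
  }
qed

text \<open>The amplitudes \<open>a\<close> may be unbounded, because the derivative contains them only in the bounded product
\<open>a i * e i\<close>. In the angular windows \<open>a\<close> is the inverse of the opening angle and \<open>e\<close> the aspect ratio of
the parabolic scaling.\<close>

lemma uniformly_smooth_scaled_arctan:
  assumes f: "uniformly_smooth k U f"
    and se: "\<And>i. U i \<noteq> {} \<Longrightarrow> 0 \<le> e i \<and> e i \<le> 1 \<and> 0 \<le> a i \<and> a i * e i \<le> 1"
  shows "uniformly_smooth k U (\<lambda>i s. a i * arctan (e i * f i s))"
proof -
  obtain B where B: "\<And>i s. s \<in> U i \<Longrightarrow> \<bar>f i s\<bar> \<le> B"
    using uniformly_smooth_bounded[OF f] by (metis bounded_familyE)
  have at: "\<bar>arctan x\<bar> \<le> \<bar>x\<bar>" for x :: real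
  proof (cases "x \<ge> 0")
    case True
    then show ?thesis using arctan_le_self[of x] by simp
  next
    case False
    then show ?thesis using arctan_le_self[of "- x"] by (simp add: arctan_minus)
  qed
  have b: "bounded_family U (\<lambda>i s. a i * arctan (e i * f i s))"
  proof (rule bounded_familyI[of _ _ B])
    fix i s assume s: "s \<in> U i"
    then have se': "0 \<le> e i" "0 \<le> a i" "a i * e i \<le> 1" using se[of i] by auto
    have "\<bar>a i * arctan (e i * f i s)\<bar> \<le> a i * \<bar>e i * f i s\<bar>"
      using at[of "e i * f i s"] se' by (simp add: abs_mult mult_left_mono)
    also have "\<dots> = (a i * e i) * \<bar>f i s\<bar>" using se' by (simp add: abs_mult)
    also have "\<dots> \<le> 1 * \<bar>f i s\<bar>" using se' by (intro mult_right_mono) auto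
    also have "\<dots> \<le> B" using B[OF s] by simp
    finally show "\<bar>a i * arctan (e i * f i s)\<bar> \<le> B" .
  qed
  show ?thesis
  proof (cases k)
    case (Suc k')
    note f' = f[unfolded Suc]
    have E: "uniformly_smooth k' U (\<lambda>i s. e i)" by (rule uniformly_smooth_const[of e 1]) (use se in auto)
    have A: "uniformly_smooth k' U (\<lambda>i s. a i * e i)" by (rule uniformly_smooth_const[of "\<lambda>i. a i * e i" 1]) (use se in auto)
    have O: "uniformly_smooth k' U (\<lambda>i s. 1)" by (rule uniformly_smooth_const[of "\<lambda>_. 1" 1]) auto
    have ef: "uniformly_smooth k' U (\<lambda>i s. e i * f i s)" by (intro uniformly_smooth_mult E uniformly_smooth_lower[OF f'])
    have den: "uniformly_smooth k' U (\<lambda>i s. 1 + (e i * f i s) * (e i * f i s))"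
      by (intro uniformly_smooth_add uniformly_smooth_mult O ef)
    have "uniformly_smooth k' U (\<lambda>i s. inverse (1 + (e i * f i s) * (e i * f i s)))"
      by (rule uniformly_smooth_inverse[OF den, of 1]) (auto intro!: order.trans[OF _ abs_ge_self])
    then have "uniformly_smooth k' U (\<lambda>i s. (a i * e i) * (deriv (f i) s * inverse (1 + (e i * f i s) * (e i * f i s))))"
      by (intro uniformly_smooth_mult A uniformly_smooth_SucD(2)[OF f'])
    then show ?thesis unfolding Suc
      by (rule uniformly_smooth_SucI[OF open_U b, rotated])
         (auto intro!: derivative_eq_intros uniformly_smooth_SucD(1)[OF f'] simp: power2_eq_square)
  qed (use b in simp)
qed

end

lemma uniformly_smooth_union:
  assumes "uniformly_smooth k U f" "uniformly_smooth k V f"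
  shows "uniformly_smooth k (\<lambda>i. U i \<union> V i) f"
  using assms
proof (induction k arbitrary: f)
  have b: "bounded_family (\<lambda>i. U i \<union> V i) f" if fg: "bounded_family U f" "bounded_family V f" for f
  proof -
    obtain A where "A \<ge> 0" "\<And>i s. s \<in> U i \<Longrightarrow> \<bar>f i s\<bar> \<le> A"
      using bounded_familyE[OF fg(1)] by blast
    moreover obtain B where "B \<ge> 0" "\<And>i s. s \<in> V i \<Longrightarrow> \<bar>f i s\<bar> \<le> B"
      using bounded_familyE[OF fg(2)] by blast
    ultimately show ?thesis by (intro bounded_familyI[of _ _ "max A B"]) (auto simp: le_max_iff_disj)
  qed
  {
    case 0
    then show ?case using b by simp
  next
    case (Suc k)
    then show ?case using b[of f] by auto
  }
qed

lemma uniformly_smooth_subset: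
  assumes "uniformly_smooth k U f" "\<And>i. V i \<subseteq> U i"
  shows "uniformly_smooth k V f"
  using assms(1)
proof (induction k arbitrary: f)
  case 0
  then show ?case using assms(2) by (fastforce simp: bounded_family_def)
next
  case (Suc k)
  have "bounded_family V f" using uniformly_smooth_bounded[OF Suc.prems] assms(2) by (fastforce simp: bounded_family_def)
  moreover have "\<forall>i. \<forall>s\<in>V i. f i differentiable (at s)"
    using Suc.prems assms(2) unfolding uniformly_smooth.simps(2) by blast
  ultimately show ?case using Suc.IH[OF uniformly_smooth_SucD(2)[OF Suc.prems]] by simp
qed

section \<open>Finite differences\<close>

primrec finite_diff :: "nat \<Rightarrow> real \<Rightarrow> (real \<Rightarrow> real) \<Rightarrow> real \<Rightarrow> real" where
  "finite_diff 0 h g s = g s"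
| "finite_diff (Suc n) h g s = finite_diff n h g s - finite_diff n h g (s + h)"

lemma finite_diff_deriv:
  assumes "\<And>s. (g has_real_derivative g' s) (at s)"
  shows "(finite_diff n h g has_real_derivative finite_diff n h g' s) (at s)"
proof (induction n arbitrary: s)
  case (Suc n)
  have "((\<lambda>s. finite_diff n h g (s + h)) has_real_derivative finite_diff n h g' (s + h)) (at s)"
    using Suc[of "s + h"] unfolding DERIV_shift .
  then have "((\<lambda>s. finite_diff n h g s - finite_diff n h g (s + h)) has_real_derivative
      finite_diff n h g' s - finite_diff n h g' (s + h)) (at s)"
    by (intro DERIV_diff Suc)
  moreover have "finite_diff (Suc n) h g = (\<lambda>s. finite_diff n h g s - finite_diff n h g (s + h))"
    by (rule ext) simp
  ultimately show ?case by simp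
next
  case 0
  have "finite_diff 0 h g = g" "finite_diff 0 h g' = g'" by (auto simp: fun_eq_iff)
  then show ?case using assms by simp
qed

text \<open>The difference of order \<open>n + 1\<close> is an increment of the difference of order \<open>n\<close>, whose derivative is the
difference of order \<open>n\<close> of the derivative.\<close>

lemma finite_diff_bound:
  assumes "uniformly_smooth n U f"
  shows "\<exists>B\<ge>0. \<forall>i h s. U i = UNIV \<longrightarrow> \<bar>finite_diff n h (f i) s\<bar> \<le> B * \<bar>h\<bar> ^ n"
  using assms
proof (induction n arbitrary: f)
  case 0
  then obtain B where "B \<ge> 0" "\<And>i s. s \<in> U i \<Longrightarrow> \<bar>f i s\<bar> \<le> B"
    using bounded_familyE[of U f] by auto
  then show ?case by (intro exI[of _ B]) auto
next
  case (Suc n)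
  obtain B where B: "B \<ge> 0" "\<And>i h s. U i = UNIV \<Longrightarrow> \<bar>finite_diff n h (deriv (f i)) s\<bar> \<le> B * \<bar>h\<bar> ^ n"
    using Suc.IH[OF uniformly_smooth_SucD(2)[OF Suc.prems]] by blast
  have "\<bar>finite_diff (Suc n) h (f i) s\<bar> \<le> B * \<bar>h\<bar> ^ Suc n" if U: "U i = UNIV" for i h s
  proof -
    have d: "(finite_diff n h (f i) has_real_derivative finite_diff n h (deriv (f i)) s) (at s within S)" for s S
      by (rule has_field_derivative_at_within[OF finite_diff_deriv]) (use uniformly_smooth_SucD(1)[OF Suc.prems, of _ i] U in auto)
    have "norm (finite_diff n h (f i) s - finite_diff n h (f i) (s + h)) \<le> (B * \<bar>h\<bar> ^ n) * norm (s - (s + h))"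
      by (rule field_differentiable_bound[where S = UNIV, OF _ d]) (use B(2)[OF U] in auto)
    then show ?thesis by (simp add: mult_ac)
  qed
  then show ?case using B(1) by blast
qed

section \<open>The frequency windows\<close>

lemma wrap_angle_eq:
  assumes "- pi \<le> y" "y < pi"
  shows "wrap_angle (y + 2 * pi * of_int n) = y"
proof -
  have "(y + 2 * pi * of_int n + pi) rmod (2 * pi) = y + pi"
    by (rule rmod_unique[of _ _ _ n]) (use assms in \<open>auto simp: algebra_simps\<close>)
  then show ?thesis by (simp add: wrap_angle_def)
qed

lemma wrap_angle_idem: "- pi \<le> y \<Longrightarrow> y < pi \<Longrightarrow> wrap_angle y = y"
  using wrap_angle_eq[of y 0] by simp

lemma wrap_angle_shift: "wrap_angle (x + 2 * pi * of_int n) = wrap_angle x"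
proof -
  define y where "y = wrap_angle x"
  have y: "- pi \<le> y" "y < pi"
    using rmod_nonneg[of "2*pi" "x + pi"] rmod_less[of "2*pi" "x + pi"] by (auto simp: y_def wrap_angle_def)
  obtain m :: int where m: "x = y + 2 * pi * of_int m"
  proof
    show "x = y + 2 * pi * of_int \<lfloor>(x + pi) / (2 * pi)\<rfloor>"
      by (simp add: y_def wrap_angle_def rmod_conv_frac frac_def field_simps)
  qed
  have "x + 2 * pi * of_int n = y + 2 * pi * of_int (m + n)" by (simp add: m algebra_simps)
  then show ?thesis using wrap_angle_eq[OF y] y_def by metis
qed

lemma wrap_angle_trig:
  "sin (wrap_angle x) = sin x" "cos (wrap_angle x) = cos x"
proof -
  have "x = wrap_angle x + 2 * pi * of_int \<lfloor>(x + pi) / (2 * pi)\<rfloor>"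
    by (simp add: wrap_angle_def rmod_conv_frac frac_def field_simps)
  then have "sin x = sin (wrap_angle x) \<and> cos x = cos (wrap_angle x)"
    unfolding sin_cos_eq_iff by blast
  then show "sin (wrap_angle x) = sin x" "cos (wrap_angle x) = cos x" by auto
qed

lemma Arg_polar:
  assumes "r > 0" "x = r * cos \<phi>" "y = r * sin \<phi>"
  obtains n :: int where "Arg (Complex x y) = \<phi> + 2 * pi * of_int n"
proof -
  have z: "Complex x y \<noteq> 0" "cmod (Complex x y) = r"
  proof -
    have "Complex x y = rcis r \<phi>" using assms by (simp add: complex_eq_iff)
    then show "Complex x y \<noteq> 0" "cmod (Complex x y) = r" using assms(1) by auto
  qed
  then have "sin (Arg (Complex x y)) = sin \<phi> \<and> cos (Arg (Complex x y)) = cos \<phi>"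
    using assms by (simp add: sin_Arg cos_Arg)
  then show ?thesis using that unfolding sin_cos_eq_iff by blast
qed

lemma chi_polar:
  assumes j: "j \<ge> 2" and r: "r > 0" "\<xi> $ 1 = r * cos \<phi>" "\<xi> $ 2 = r * sin \<phi>"
  shows "norm \<xi> = r"
    and "chi w0 w v j \<xi> = w (r / 2 ^ j) *
      (v (2 ^ (j div 2) * wrap_angle \<phi>) + v (2 ^ (j div 2) * wrap_angle (\<phi> - pi)))"
proof -
  have "(norm \<xi>)\<^sup>2 = r\<^sup>2"
    by (simp add: norm_vec2 r power_mult_distrib cos_squared_eq algebra_simps)
  then show nr: "norm \<xi> = r" using r(1) by (simp add: power2_eq_iff_nonneg)
  obtain n :: int where n: "Arg (Complex (\<xi>$1) (\<xi>$2)) = \<phi> + 2 * pi * of_int n"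
    using Arg_polar[OF r] by blast
  have "wrap_angle (\<phi> + 2 * pi * of_int n - pi) = wrap_angle (\<phi> - pi)"
    using wrap_angle_shift[of "\<phi> - pi" n] by (simp add: algebra_simps)
  then show "chi w0 w v j \<xi> = w (r / 2 ^ j) *
      (v (2 ^ (j div 2) * wrap_angle \<phi>) + v (2 ^ (j div 2) * wrap_angle (\<phi> - pi)))"
    using j by (simp add: chi_def nr n wrap_angle_shift)
qed

lemma arctan_polar:
  fixes x y :: real
  assumes "x \<noteq> 0"
  shows "sqrt (x\<^sup>2 + y\<^sup>2) * cos (arctan (y / x)) = \<bar>x\<bar>"
    "sqrt (x\<^sup>2 + y\<^sup>2) * sin (arctan (y / x)) = y / x * \<bar>x\<bar>"
proof -
  have "x\<^sup>2 + y\<^sup>2 = x\<^sup>2 * (1 + (y/x)\<^sup>2)" using assms by (simp add: field_simps)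
  then have s: "sqrt (x\<^sup>2 + y\<^sup>2) = \<bar>x\<bar> * sqrt (1 + (y/x)\<^sup>2)" by (simp add: real_sqrt_mult)
  have p: "sqrt (1 + (y/x)\<^sup>2) > 0" by (simp add: add_pos_nonneg)
  show "sqrt (x\<^sup>2 + y\<^sup>2) * cos (arctan (y / x)) = \<bar>x\<bar>"
    "sqrt (x\<^sup>2 + y\<^sup>2) * sin (arctan (y / x)) = y / x * \<bar>x\<bar>"
    unfolding s cos_arctan sin_arctan using p by simp_all
qed

lemma norm_vec2_sqrt: "norm (\<xi>::real^2) = sqrt ((\<xi>$1)\<^sup>2 + (\<xi>$2)\<^sup>2)"
  using norm_vec2[of \<xi>] by (metis norm_ge_zero real_sqrt_unique)

lemma norm_vec2_le: "norm (\<eta>::real^2) \<le> \<bar>\<eta>$1\<bar> + \<bar>\<eta>$2\<bar>"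
  unfolding norm_vec2_sqrt by (rule sqrt_sum_squares_le_sum_abs)

locale curvelet_window_functions =
  fixes w0 w v :: "real \<Rightarrow> real"
  assumes windows: "curvelet_windows w0 w v"
begin

lemma w_support: "w r \<noteq> 0 \<Longrightarrow> 2 * pi / 3 \<le> r \<and> r \<le> 8 * pi / 3"
  using windows by (auto simp: curvelet_windows_def)

lemma v_support: "v \<theta> \<noteq> 0 \<Longrightarrow> \<bar>\<theta>\<bar> \<le> pi"
proof -
  have "{\<theta>. v \<theta> \<noteq> 0} \<subseteq> {- pi..pi}" using windows by (simp add: curvelet_windows_def)
  then show "v \<theta> \<noteq> 0 \<Longrightarrow> \<bar>\<theta>\<bar> \<le> pi" by (auto simp: abs_le_iff)
qed

lemma w0_support: "r \<ge> 0 \<Longrightarrow> w0 r \<noteq> 0 \<Longrightarrow> r \<le> 8 * pi / 3"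
proof -
  have "{r\<in>{0..}. w0 r \<noteq> 0} \<subseteq> {0..8 * pi / 3}" using windows by (simp add: curvelet_windows_def)
  then show "r \<ge> 0 \<Longrightarrow> w0 r \<noteq> 0 \<Longrightarrow> r \<le> 8 * pi / 3" by auto
qed

text \<open>The supports of the \<open>w (r / 2 ^ i)\<close> begin at \<open>4 * pi / 3\<close>, so the partition of unity leaves only \<open>w0\<close>. This makes
\<open>w0 (norm \<xi>)\<close> smooth at the origin.\<close>

lemma w0_near_zero:
  assumes "0 \<le> r" "r < 4 * pi / 3"
  shows "w0 r = 1"
proof -
  have "w (r / 2 ^ Suc i) = 0" for i
  proof (rule ccontr)
    assume "w (r / 2 ^ Suc i) \<noteq> 0"
    then have "2 * pi / 3 \<le> r / 2 ^ Suc i" using w_support by blast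
    moreover have "r / 2 ^ Suc i \<le> r / 2 ^ 1"
      using assms by (intro divide_left_mono power_increasing) auto
    ultimately show False using assms by simp
  qed
  then have "(\<lambda>i. (w (r / 2 ^ Suc i))\<^sup>2) = (\<lambda>_. 0)" by simp
  moreover have "(\<lambda>i. (w (r / 2 ^ Suc i))\<^sup>2) sums (1 - (w0 r)\<^sup>2)"
    using windows assms by (simp add: curvelet_windows_def)
  ultimately have "1 - (w0 r)\<^sup>2 = 0" by (metis sums_unique2 sums_zero)
  moreover have "w0 r \<ge> 0" using windows assms by (simp add: curvelet_windows_def)
  ultimately show ?thesis by (simp add: power2_eq_1_iff)
qed

lemma two_pow_div2_ge: "j \<ge> 2 \<Longrightarrow> (2::real) \<le> 2 ^ (j div 2)"
  using power_increasing[of 1 "j div 2" "2::real"] by simp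

lemma v_far: "j \<ge> 2 \<Longrightarrow> \<bar>\<theta>\<bar> > pi / 2 \<Longrightarrow> v (2 ^ (j div 2) * \<theta>) = 0"
proof (rule ccontr)
  assume j: "j \<ge> 2" and t: "\<bar>\<theta>\<bar> > pi / 2" and "v (2 ^ (j div 2) * \<theta>) \<noteq> 0"
  then have "2 ^ (j div 2) * \<bar>\<theta>\<bar> \<le> pi" using v_support[of "2 ^ (j div 2) * \<theta>"] by (simp add: abs_mult)
  moreover have "2 * \<bar>\<theta>\<bar> \<le> 2 ^ (j div 2) * \<bar>\<theta>\<bar>" using two_pow_div2_ge[OF j] by (intro mult_right_mono) auto
  ultimately show False using t by simp
qed

text \<open>The slope determines the angle modulo \<open>pi\<close>. Of the two angles in the definition of \<open>chi\<close> one is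
the arctangent of the slope; the other is larger than \<open>pi / 2\<close> in modulus, where the angular window vanishes.\<close>

lemma chi_off_vertical_axis:
  assumes j: "j \<ge> 2" and x: "\<xi> $ 1 \<noteq> 0"
  shows "chi w0 w v j \<xi> = w (norm \<xi> / 2 ^ j) * v (2 ^ (j div 2) * arctan (\<xi>$2 / \<xi>$1))"
proof -
  define a where "a = arctan (\<xi>$2 / \<xi>$1)"
  define r where "r = norm \<xi>"
  have r: "r > 0" using x by (auto simp: r_def)
  have ab: "- (pi / 2) < a" "a < pi / 2" using arctan_bounded by (auto simp: a_def)
  have p: "r * cos a = \<bar>\<xi>$1\<bar>" "r * sin a = \<xi>$2 / \<xi>$1 * \<bar>\<xi>$1\<bar>"
    using arctan_polar[OF x, of "\<xi>$2"] by (simp_all add: r_def a_def norm_vec2_sqrt)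
  have wa: "wrap_angle a = a" using ab pi_gt_zero by (intro wrap_angle_idem) linarith+
  have sh: "wrap_angle (a + pi) = wrap_angle (a - pi)"
  proof -
    have "a + pi = (a - pi) + 2 * pi * of_int 1" by simp
    then show ?thesis by (simp only: wrap_angle_shift)
  qed
  have far: "\<bar>wrap_angle (a - pi)\<bar> > pi / 2"
  proof (cases "a \<ge> 0")
    case True
    then have "wrap_angle (a - pi) = a - pi" using ab by (intro wrap_angle_idem) auto
    then show ?thesis using ab by simp
  next
    case False
    then have "wrap_angle (a + pi) = a + pi" using ab by (intro wrap_angle_idem) auto
    then have "wrap_angle (a - pi) = a + pi" using sh by simp
    then show ?thesis using ab by simp
  qed
  have e: "\<exists>A B. chi w0 w v j \<xi> = w (r / 2 ^ j) * (v (2 ^ (j div 2) * A) + v (2 ^ (j div 2) * B))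
     \<and> (A = a \<and> \<bar>B\<bar> > pi / 2 \<or> B = a \<and> \<bar>A\<bar> > pi / 2)"
  proof (cases "\<xi>$1 > 0")
    case True
    then have "\<xi>$1 = r * cos a" "\<xi>$2 = r * sin a" using p by auto
    from chi_polar(2)[OF j r this] show ?thesis using wa far by blast
  next
    case False
    then have "\<xi>$1 = r * cos (a + pi)" "\<xi>$2 = r * sin (a + pi)" using p x by auto
    from chi_polar(2)[OF j r this] have "chi w0 w v j \<xi> = w (r / 2 ^ j) *
      (v (2 ^ (j div 2) * wrap_angle (a + pi)) + v (2 ^ (j div 2) * wrap_angle a))" by simp
    then show ?thesis using wa far sh by metis
  qed
  then show ?thesis using v_far[OF j] by (auto simp: r_def a_def)
qed

text \<open>At the scales \<open>2\<close> and \<open>3\<close> the angular window has half-width \<open>pi / 2\<close> and may extend to the vertical axis,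
near which the reciprocal of the slope is the smooth coordinate.\<close>

lemma chi_off_horizontal_axis:
  assumes j: "j \<ge> 2" "j < 4" and y: "\<xi> $ 2 \<noteq> 0"
  shows "chi w0 w v j \<xi> = w (norm \<xi> / 2 ^ j) *
    (v (pi - 2 * arctan (\<xi>$1 / \<xi>$2)) + v (- pi - 2 * arctan (\<xi>$1 / \<xi>$2)))"
proof -
  define a where "a = arctan (\<xi>$1 / \<xi>$2)"
  define r where "r = norm \<xi>"
  have j2: "j div 2 = 1" using j by linarith
  have r: "r > 0" using y by (auto simp: r_def)
  have ab: "- (pi / 2) < a" "a < pi / 2" using arctan_bounded by (auto simp: a_def)
  have p: "r * cos a = \<bar>\<xi>$2\<bar>" "r * sin a = \<xi>$1 / \<xi>$2 * \<bar>\<xi>$2\<bar>"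
    using arctan_polar[OF y, of "\<xi>$1"] by (simp_all add: r_def a_def norm_vec2_sqrt add.commute)
  show ?thesis
  proof (cases "\<xi>$2 > 0")
    case True
    then have e: "\<xi>$1 = r * cos (pi / 2 - a)" "\<xi>$2 = r * sin (pi / 2 - a)"
      using p by (auto simp: cos_diff sin_diff)
    have "wrap_angle (pi / 2 - a) = pi / 2 - a" "wrap_angle (pi / 2 - a - pi) = pi / 2 - a - pi"
      using ab by (intro wrap_angle_idem; linarith)+
    then have c: "chi w0 w v j \<xi> = w (r / 2 ^ j) * (v (2 ^ 1 * (pi / 2 - a)) + v (2 ^ 1 * (pi / 2 - a - pi)))"
      using chi_polar(2)[OF j(1) r e, of w0 w v] by (simp only: j2)
    have m: "2 ^ 1 * (pi / 2 - a) = pi - 2 * a" "2 ^ 1 * (pi / 2 - a - pi) = - pi - 2 * a"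
      by simp_all
    show ?thesis unfolding r_def[symmetric] a_def[symmetric] c m ..
  next
    case False
    then have e: "\<xi>$1 = r * cos (- (pi / 2) - a)" "\<xi>$2 = r * sin (- (pi / 2) - a)"
      using p y by (auto simp: cos_diff sin_diff)
    have "wrap_angle (- (pi / 2) - a) = - (pi / 2) - a" "wrap_angle (pi / 2 - a) = pi / 2 - a"
      using ab by (intro wrap_angle_idem; linarith)+
    moreover have "wrap_angle (- (pi / 2) - a - pi) = wrap_angle (pi / 2 - a)"
      using wrap_angle_shift[of "- (pi / 2) - a - pi" 1] by (simp add: algebra_simps)
    ultimately have c: "chi w0 w v j \<xi> = w (r / 2 ^ j) * (v (2 ^ 1 * (- (pi / 2) - a)) + v (2 ^ 1 * (pi / 2 - a)))"
      using chi_polar(2)[OF j(1) r e, of w0 w v] by (simp only: j2)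
    have m: "2 ^ 1 * (pi / 2 - a) = pi - 2 * a" "2 ^ 1 * (- (pi / 2) - a) = - pi - 2 * a"
      by simp_all
    show ?thesis unfolding r_def[symmetric] a_def[symmetric] c m by (simp only: add.commute)
  qed
qed

text \<open>The angle \<open>y\<close> between \<open>\<xi>\<close> and the horizontal axis is at most \<open>pi / 2 ^ (j div 2)\<close>. For \<open>j \<ge> 4\<close> this is less than
\<open>pi / 3\<close>, so that \<open>cos y \<ge> 1/2\<close>.\<close>

lemma chi_support:
  assumes j: "j \<ge> 2" and nz: "chi w0 w v j \<xi> \<noteq> 0"
  shows "2 * pi / 3 * 2 ^ j \<le> norm \<xi>" "norm \<xi> \<le> 8 * pi / 3 * 2 ^ j"
    and "\<bar>\<xi> $ 2\<bar> \<le> norm \<xi> * (pi / 2 ^ (j div 2))"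
    and "j \<ge> 4 \<Longrightarrow> norm \<xi> \<le> 2 * \<bar>\<xi> $ 1\<bar>"
proof -
  obtain r \<phi> where r0: "r \<ge> 0" and e: "\<xi> $ 1 = r * cos \<phi>" "\<xi> $ 2 = r * sin \<phi>"
    by (rule vec2_polar)
  have "(norm \<xi>)\<^sup>2 = r\<^sup>2"
    by (simp add: norm_vec2 e power_mult_distrib cos_squared_eq algebra_simps)
  then have nr: "norm \<xi> = r" using r0 by (simp add: power2_eq_iff_nonneg)
  have wn: "w (norm \<xi> / 2 ^ j) \<noteq> 0" using nz j by (auto simp: chi_def Let_def)
  then have ws: "2 * pi / 3 \<le> r / 2 ^ j" "r / 2 ^ j \<le> 8 * pi / 3" using w_support[OF wn] unfolding nr by auto
  then show "2 * pi / 3 * 2 ^ j \<le> norm \<xi>" "norm \<xi> \<le> 8 * pi / 3 * 2 ^ j"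
    by (simp_all add: nr field_simps)
  have "r \<noteq> 0"
  proof
    assume "r = 0"
    with ws(1) have "pi \<le> 0" by simp
    then show False using pi_gt_zero by linarith
  qed
  with r0 have r: "r > 0" by simp
  define s :: real where "s = 2 ^ (j div 2)"
  have s: "s \<ge> 2" using two_pow_div2_ge[OF j] by (simp add: s_def)
  have "v (s * wrap_angle \<phi>) \<noteq> 0 \<or> v (s * wrap_angle (\<phi> - pi)) \<noteq> 0"
    using nz chi_polar(2)[OF j r e] by (auto simp: s_def)
  then obtain y where y: "\<bar>s * y\<bar> \<le> pi" "\<bar>sin y\<bar> = \<bar>sin \<phi>\<bar>" "\<bar>cos y\<bar> = \<bar>cos \<phi>\<bar>"
  proof
    assume "v (s * wrap_angle \<phi>) \<noteq> 0"
    then show ?thesis using that[of "wrap_angle \<phi>"] v_support by (simp add: wrap_angle_trig)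
  next
    assume "v (s * wrap_angle (\<phi> - pi)) \<noteq> 0"
    then show ?thesis using that[of "wrap_angle (\<phi> - pi)"] v_support
      by (simp add: wrap_angle_trig sin_diff cos_diff)
  qed
  have ys: "\<bar>y\<bar> \<le> pi / s" using y(1) s by (simp add: abs_mult field_simps)
  have "\<bar>\<xi>$2\<bar> = r * \<bar>sin y\<bar>" using r y(2) by (simp add: e abs_mult)
  also have "\<dots> \<le> r * (pi / s)"
    using r ys abs_sin_x_le_abs_x[of y] by (intro mult_left_mono) auto
  finally show "\<bar>\<xi> $ 2\<bar> \<le> norm \<xi> * (pi / 2 ^ (j div 2))" by (simp add: nr s_def)
  assume "j \<ge> 4"
  then have "2 \<le> j div 2" by linarith
  then have "(2::real) ^ 2 \<le> s" unfolding s_def by (intro power_increasing) auto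
  then have "pi / s \<le> pi / 4" by (intro divide_left_mono) auto
  then have yq: "\<bar>y\<bar> \<le> pi / 3" using ys pi_gt_zero by linarith
  have "cos (pi / 3) \<le> cos \<bar>y\<bar>" using yq by (intro cos_monotone_0_pi_le) auto
  then have "1 / 2 \<le> cos y" by (simp add: cos_60)
  then have "r * 1 \<le> r * (2 * \<bar>cos \<phi>\<bar>)" using r y(3) by (intro mult_left_mono) auto
  then show "norm \<xi> \<le> 2 * \<bar>\<xi> $ 1\<bar>" using r by (simp add: nr e abs_mult)
qed

end

section \<open>Smoothness along lines\<close>

lemma uniformly_smooth_compose_smooth:
  fixes U :: "'i \<Rightarrow> real set"
  assumes U: "\<And>i. open (U i)" and g: "smooth_on S g" and S: "{a..b} \<subseteq> interior S"
    and f: "uniformly_smooth k U f" "\<And>i s. s \<in> U i \<Longrightarrow> f i s \<in> {a..b}"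
  shows "uniformly_smooth k U (\<lambda>i s. g (f i s))"
proof -
  obtain d :: "nat \<Rightarrow> real \<Rightarrow> real" where d: "\<And>x. x \<in> S \<Longrightarrow> d 0 x = g x"
    "\<And>n x. x \<in> S \<Longrightarrow> (d n has_real_derivative d (Suc n) x) (at x within S)"
    using g by (auto simp: smooth_on_def)
  have inS: "x \<in> S" if "x \<in> {a..b}" for x using S that interior_subset by blast
  have der: "(d n has_real_derivative d (Suc n) x) (at x)" if "x \<in> {a..b}" for n x
    using d(2)[OF inS[OF that], of n] at_within_interior[of x S] S that by (simp add: subset_iff)
  have "uniformly_smooth k U (\<lambda>i s. d 0 (f i s))"
  proof (rule uniformly_smooth_compose[where d = d and R = "{a..b}" and n = 0 and f = f, OF U])
    show "\<exists>B. \<forall>x\<in>{a..b}. \<bar>d n x\<bar> \<le> B" for n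
    proof -
      have "continuous_on {a..b} (d n)"
        using der by (intro continuous_at_imp_continuous_on ballI DERIV_isCont) auto
      then have "compact (d n ` {a..b})" by (intro compact_continuous_image) auto
      then have "bounded (d n ` {a..b})" by (rule compact_imp_bounded)
      then show ?thesis by (auto simp: bounded_iff)
    qed
  qed (use der f in auto)
  then show ?thesis
    by (rule uniformly_smooth_cong[OF U, rotated]) (use f(2) inS d(1) in auto)
qed

text \<open>An index consists of a scale, a base point and a direction. Directions other than unit vectors get
the empty set, so that they impose no condition.\<close>

definition line_dom :: "(nat \<Rightarrow> (real^2) set) \<Rightarrow> nat \<times> (real^2) \<times> (real^2) \<Rightarrow> real set" where
  "line_dom V i = {s. norm (snd (snd i)) = 1 \<and> fst (snd i) + s *\<^sub>R snd (snd i) \<in> V (fst i)}"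

text \<open>Smoothness in the plane, uniform in the scale, expressed by derivatives along lines: all closure
properties are then inherited from the one-dimensional notion.\<close>

definition smooth_on_lines :: "nat \<Rightarrow> (nat \<Rightarrow> (real^2) set) \<Rightarrow> (nat \<Rightarrow> real^2 \<Rightarrow> real) \<Rightarrow> bool" where
  "smooth_on_lines k V f \<longleftrightarrow>
     uniformly_smooth k (line_dom V) (\<lambda>i s. f (fst i) (fst (snd i) + s *\<^sub>R snd (snd i)))"

lemma open_line_dom:
  assumes "\<And>j. open (V j)" shows "open (line_dom V i)"
proof (cases "norm (snd (snd i)) = 1")
  case True
  have "continuous_on UNIV (\<lambda>s. fst (snd i) + s *\<^sub>R snd (snd i))" by (intro continuous_intros)
  then have "open ((\<lambda>s. fst (snd i) + s *\<^sub>R snd (snd i)) -` V (fst i))"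
    using assms by (simp add: continuous_on_open_vimage)
  then show ?thesis using True by (simp add: line_dom_def vimage_def)
qed (simp add: line_dom_def)

lemma smooth_on_lines_union:
  assumes "smooth_on_lines k V f" "smooth_on_lines k V' f"
  shows "smooth_on_lines k (\<lambda>j. V j \<union> V' j) f"
proof -
  have "line_dom (\<lambda>j. V j \<union> V' j) = (\<lambda>i. line_dom V i \<union> line_dom V' i)"
    by (auto simp: line_dom_def)
  then show ?thesis using uniformly_smooth_union[OF assms[unfolded smooth_on_lines_def]] unfolding smooth_on_lines_def by simp
qed

lemma smooth_on_lines_subset:
  assumes "smooth_on_lines k V f" "\<And>j. V' j \<subseteq> V j"
  shows "smooth_on_lines k V' f"
  unfolding smooth_on_lines_def
  by (rule uniformly_smooth_subset[OF assms(1)[unfolded smooth_on_lines_def]]) (use assms(2) in \<open>auto simp: line_dom_def\<close>)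

context
  fixes V :: "nat \<Rightarrow> (real^2) set"
  assumes V: "\<And>j. open (V j)"
begin

lemma smooth_on_lines_cong:
  assumes "smooth_on_lines k V f" "\<And>j \<eta>. \<eta> \<in> V j \<Longrightarrow> f j \<eta> = g j \<eta>"
  shows "smooth_on_lines k V g"
  unfolding smooth_on_lines_def
  by (rule uniformly_smooth_cong[OF open_line_dom[OF V] _ assms(1)[unfolded smooth_on_lines_def]])
     (use assms(2) in \<open>auto simp: line_dom_def\<close>)

lemma smooth_on_lines_const:
  assumes "\<And>j. V j \<noteq> {} \<Longrightarrow> \<bar>c j\<bar> \<le> B"
  shows "smooth_on_lines k V (\<lambda>j \<eta>. c j)"
  unfolding smooth_on_lines_def
  by (rule uniformly_smooth_const[where c = "\<lambda>i. c (fst i)" and B = B, OF open_line_dom[OF V]]) (use assms in \<open>auto simp: line_dom_def\<close>)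

lemma smooth_on_lines_coord:
  assumes "\<And>j \<eta>. \<eta> \<in> V j \<Longrightarrow> norm \<eta> \<le> B"
  shows "smooth_on_lines k V (\<lambda>j \<eta>. \<eta> $ m)"
  unfolding smooth_on_lines_def vector_add_component vector_scaleR_component real_scaleR_def
proof (rule uniformly_smooth_affine[where B = 1, OF open_line_dom[OF V]])
  have "\<bar>\<eta> $ m\<bar> \<le> B" if "\<eta> \<in> V j" for \<eta> j
    using component_le_norm_cart[of \<eta> m] assms[OF that] by simp
  then have *: "\<bar>(\<xi> + s *\<^sub>R u) $ m\<bar> \<le> B" if "\<xi> + s *\<^sub>R u \<in> V j" for \<xi> u s j
    using that by blast
  show "bounded_family (line_dom V) (\<lambda>i s. fst (snd i) $ m + s * snd (snd i) $ m)"
    by (rule bounded_familyI[of _ _ B]) (use * in \<open>auto simp: line_dom_def\<close>)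
  show "\<bar>snd (snd i) $ m\<bar> \<le> 1" if "line_dom V i \<noteq> {}" for i
    using that component_le_norm_cart[of "snd (snd i)" m] by (auto simp: line_dom_def)
qed

lemma smooth_on_lines_add: "smooth_on_lines k V f \<Longrightarrow> smooth_on_lines k V g \<Longrightarrow> smooth_on_lines k V (\<lambda>j \<eta>. f j \<eta> + g j \<eta>)"
  unfolding smooth_on_lines_def by (rule uniformly_smooth_add[OF open_line_dom[OF V]])

lemma smooth_on_lines_mult: "smooth_on_lines k V f \<Longrightarrow> smooth_on_lines k V g \<Longrightarrow> smooth_on_lines k V (\<lambda>j \<eta>. f j \<eta> * g j \<eta>)"
  unfolding smooth_on_lines_def by (rule uniformly_smooth_mult[OF open_line_dom[OF V]])

lemma smooth_on_lines_exp: "smooth_on_lines k V f \<Longrightarrow> smooth_on_lines k V (\<lambda>j \<eta>. exp (f j \<eta>))"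
  unfolding smooth_on_lines_def by (rule uniformly_smooth_exp[OF open_line_dom[OF V]])

lemma smooth_on_lines_sin: "smooth_on_lines k V f \<Longrightarrow> smooth_on_lines k V (\<lambda>j \<eta>. sin (f j \<eta>))"
  unfolding smooth_on_lines_def by (rule uniformly_smooth_sin[OF open_line_dom[OF V]])

lemma smooth_on_lines_inverse:
  assumes "smooth_on_lines k V f" "e > 0" "\<And>j \<eta>. \<eta> \<in> V j \<Longrightarrow> e \<le> \<bar>f j \<eta>\<bar>"
  shows "smooth_on_lines k V (\<lambda>j \<eta>. inverse (f j \<eta>))"
  using assms(1) unfolding smooth_on_lines_def
  by (rule uniformly_smooth_inverse[OF open_line_dom[OF V] _ assms(2)]) (use assms(3) in \<open>auto simp: line_dom_def\<close>)

lemma smooth_on_lines_sqrt: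
  assumes "smooth_on_lines k V f" "e > 0" "\<And>j \<eta>. \<eta> \<in> V j \<Longrightarrow> e \<le> f j \<eta>"
  shows "smooth_on_lines k V (\<lambda>j \<eta>. sqrt (f j \<eta>))"
  using assms(1) unfolding smooth_on_lines_def
  by (rule uniformly_smooth_sqrt[OF open_line_dom[OF V] _ assms(2)]) (use assms(3) in \<open>auto simp: line_dom_def\<close>)

lemma smooth_on_lines_scaled_arctan:
  assumes "smooth_on_lines k V f"
    and "\<And>j. V j \<noteq> {} \<Longrightarrow> 0 \<le> e j \<and> e j \<le> 1 \<and> 0 \<le> a j \<and> a j * e j \<le> 1"
  shows "smooth_on_lines k V (\<lambda>j \<eta>. a j * arctan (e j * f j \<eta>))"
  using assms(1) unfolding smooth_on_lines_def
  by (rule uniformly_smooth_scaled_arctan[where e = "\<lambda>i. e (fst i)" and a = "\<lambda>i. a (fst i)", OF open_line_dom[OF V]])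
     (use assms(2) in \<open>auto simp: line_dom_def\<close>)

lemma smooth_on_lines_compose_smooth:
  assumes "smooth_on_lines k V f" "smooth_on S g" "{a..b} \<subseteq> interior S"
    "\<And>j \<eta>. \<eta> \<in> V j \<Longrightarrow> f j \<eta> \<in> {a..b}"
  shows "smooth_on_lines k V (\<lambda>j \<eta>. g (f j \<eta>))"
  using assms(1) unfolding smooth_on_lines_def
  by (rule uniformly_smooth_compose_smooth[OF open_line_dom[OF V] assms(2,3)])
     (use assms(4) in \<open>auto simp: line_dom_def\<close>)

lemma smooth_on_lines_compose_smooth_UNIV:
  assumes f: "smooth_on_lines k V f" and g: "smooth_on UNIV g"
  shows "smooth_on_lines k V (\<lambda>j \<eta>. g (f j \<eta>))"
proof -
  obtain B where B: "\<And>i s. s \<in> line_dom V i \<Longrightarrow> \<bar>f (fst i) (fst (snd i) + s *\<^sub>R snd (snd i))\<bar> \<le> B"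
    using bounded_familyE[OF uniformly_smooth_bounded[OF f[unfolded smooth_on_lines_def]]] by blast
  have "\<bar>f j \<eta>\<bar> \<le> B" if "\<eta> \<in> V j" for j \<eta>
    using B[of 0 "(j, \<eta>, axis 1 1)"] that by (simp add: line_dom_def)
  then show ?thesis
    by (intro smooth_on_lines_compose_smooth[OF f g, of "- B" B]) (auto simp: abs_le_iff, fastforce)
qed

end

lemma smooth_on_lines_zero:
  assumes "\<And>j \<eta>. \<eta> \<in> V j \<Longrightarrow> f j \<eta> = 0" "\<And>j. open (V j)"
  shows "smooth_on_lines k V f"
  by (rule smooth_on_lines_cong[OF assms(2) smooth_on_lines_const[where c = "\<lambda>_. 0" and B = 0, OF assms(2)]]) (use assms in auto)

context curvelet_window_functions
begin

lemma window_smooth: "smooth_on {0..} w0" "smooth_on UNIV w" "smooth_on UNIV v"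
  using windows by (auto simp: curvelet_windows_def)

section \<open>Generators of the curvelets\<close>

text \<open>The Fourier transform of the function whose images under \<open>curv_U\<close> are the curvelets of scale \<open>j\<close>; see
\<open>curvelet_eq_curv_U\<close>.\<close>

definition curv_gen :: "nat \<Rightarrow> real^2 \<Rightarrow> real" where
  "curv_gen j \<eta> = sqrt (det (curv_dil j) / (Lam j * lam j)) * chi w0 w v j (curv_dil j *v \<eta>)"

text \<open>The generator divided by \<open>1/2 * exp (- |\<eta>|\<^sup>2 / 4)\<close>, the Fourier transform of \<open>gauss\<close>.\<close>

definition deconv :: "nat \<Rightarrow> real^2 \<Rightarrow> real" where
  "deconv j \<eta> = curv_gen j \<eta> * (2 * exp ((norm \<eta>)\<^sup>2 / 4))"

definition aspect :: "nat \<Rightarrow> real" where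
  "aspect j = 2 ^ (j div 2) / 2 ^ j"

text \<open>The square of the radial variable \<open>norm \<xi> / 2 ^ j\<close> of the windows at \<open>\<xi> = curv_dil j *v \<eta>\<close>.\<close>

definition scaled_radius_sq :: "nat \<Rightarrow> real^2 \<Rightarrow> real" where
  "scaled_radius_sq j \<eta> = \<eta>$1 * \<eta>$1 + (aspect j * \<eta>$2) * (aspect j * \<eta>$2)"

lemma aspect_bounds: "0 < aspect j" "aspect j \<le> 1" "2 ^ (j div 2) * aspect j \<le> 1"
proof -
  have "(2::real) ^ (j div 2) \<le> 2 ^ j" by (intro power_increasing) auto
  then show "0 < aspect j" "aspect j \<le> 1" by (auto simp: aspect_def)
  show "2 ^ (j div 2) * aspect j \<le> 1" using two_pow_div2[of j] by (simp add: aspect_def)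
qed

lemma norm_dil: "norm (curv_dil j *v \<eta>) / 2 ^ j = sqrt (scaled_radius_sq j \<eta>)"
proof -
  have "scaled_radius_sq j \<eta> = ((2 ^ j * \<eta>$1)\<^sup>2 + (2 ^ (j div 2) * \<eta>$2)\<^sup>2) / (2 ^ j)\<^sup>2"
    by (simp add: scaled_radius_sq_def aspect_def power2_eq_square add_divide_distrib)
  then show ?thesis
    by (simp add: norm_vec2_sqrt curv_dil_mult real_sqrt_divide)
qed

lemma norm_dil': "norm (curv_dil j *v \<eta>) = 2 ^ j * sqrt (scaled_radius_sq j \<eta>)"
  using norm_dil[of j \<eta>] by (simp add: field_simps)

lemma generator_factor_le_1: "\<bar>sqrt (det (curv_dil j) / (Lam j * lam j))\<bar> \<le> 1"
proof -
  have L: "2 ^ j \<le> Lam j" "2 ^ (j div 2) \<le> lam j"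
    using order.trans[OF _ Lam_bounds(1)[of j], of "2 ^ j"] lam_bounds(1) pi_gt3 by (auto simp: mult_le_cancel_left1)
  then have "2 ^ j * 2 ^ (j div 2) \<le> Lam j * lam j"
    by (intro mult_mono) (auto intro: order.trans[OF _ L(1)])
  moreover have "(0::real) < 2 ^ j * 2 ^ (j div 2)" by simp
  ultimately have P: "2 ^ j * 2 ^ (j div 2) \<le> Lam j * lam j" "0 < Lam j * lam j" by linarith+
  then have "0 \<le> det (curv_dil j) / (Lam j * lam j)" "det (curv_dil j) / (Lam j * lam j) \<le> 1"
    unfolding det_curv_dil divide_le_eq_1_pos[OF P(2)] by (auto intro: divide_nonneg_pos)
  then show ?thesis by simp
qed

text \<open>Parabolic scaling keeps the supports bounded: the window extends radially to order \<open>2 ^ j\<close> and transversally to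
order \<open>2 ^ j\<close> times its opening angle, which is the order of the second dilation factor. The numbers follow from
\<open>3 < pi < 4\<close>.\<close>

lemma curv_gen_support:
  assumes nz: "curv_gen j \<eta> \<noteq> 0"
  shows "norm \<eta> \<le> 98" "j \<ge> 1 \<Longrightarrow> 4 \<le> scaled_radius_sq j \<eta>" "j \<ge> 4 \<Longrightarrow> 1 \<le> \<bar>\<eta>$1\<bar>" "j \<ge> 4 \<Longrightarrow> \<bar>\<eta>$1\<bar> \<le> 11"
proof -
  have c: "chi w0 w v j (curv_dil j *v \<eta>) \<noteq> 0" using nz by (auto simp: curv_gen_def)
  define R where "R = sqrt (scaled_radius_sq j \<eta>)"
  have R0: "R \<ge> 0" by (simp add: R_def scaled_radius_sq_def)
  have R2: "R\<^sup>2 = scaled_radius_sq j \<eta>" by (simp add: R_def scaled_radius_sq_def)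
  have R: "R \<le> 32 / 3 \<and> (j \<ge> 1 \<longrightarrow> 2 \<le> R)"
  proof -
    consider "j = 0" | "j = 1" | "j \<ge> 2" by linarith
    then show ?thesis
    proof cases
      case 1
      then have "w0 R \<noteq> 0" using c norm_dil'[of j \<eta>] by (simp add: chi_def R_def)
      then have "R \<le> 8 * pi / 3" using w0_support R0 by blast
      then show ?thesis using 1 pi_less_4 by simp
    next
      case 2
      then have "w R \<noteq> 0" using c norm_dil[of j \<eta>] by (simp add: chi_def R_def)
      then have "2 * pi / 3 \<le> R" "R \<le> 8 * pi / 3" using w_support by auto
      then show ?thesis using pi_less_4 pi_gt3 by (intro conjI impI; linarith)
    next
      case 3
      have "2 * pi / 3 * 2 ^ j \<le> 2 ^ j * R" "2 ^ j * R \<le> 8 * pi / 3 * 2 ^ j"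
        using chi_support(1,2)[OF 3 c] norm_dil'[of j \<eta>] by (simp_all add: R_def)
      then have "2 * pi / 3 \<le> R" "R \<le> 8 * pi / 3" by (simp_all add: field_simps)
      then show ?thesis using pi_less_4 pi_gt3 by (intro conjI impI; linarith)
    qed
  qed
  then show "4 \<le> scaled_radius_sq j \<eta>" if "j \<ge> 1"
    using that power_mono[of 2 R 2] by (simp add: R2)
  have "(\<eta>$1)\<^sup>2 \<le> R\<^sup>2" unfolding R2 by (simp add: scaled_radius_sq_def power2_eq_square)
  then have e1: "\<bar>\<eta>$1\<bar> \<le> R" using R0 by (simp add: abs_le_square_iff[symmetric])
  then show "\<bar>\<eta>$1\<bar> \<le> 11" using R by linarith
  have "(aspect j * \<eta>$2)\<^sup>2 \<le> R\<^sup>2" unfolding R2 by (simp add: scaled_radius_sq_def power2_eq_square)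
  then have e2: "\<bar>aspect j * \<eta>$2\<bar> \<le> R" using R0 by (simp add: abs_le_square_iff[symmetric])
  have "\<bar>\<eta>$2\<bar> \<le> 86"
  proof (cases "j \<ge> 2")
    case False
    then have "j = 0 \<or> j = 1" by linarith
    then have "1/2 \<le> aspect j" by (auto simp: aspect_def)
    then have "1/2 * \<bar>\<eta>$2\<bar> \<le> aspect j * \<bar>\<eta>$2\<bar>" by (intro mult_right_mono) auto
    also have "\<dots> \<le> R" using e2 aspect_bounds(1)[of j] by (simp add: abs_mult)
    finally show ?thesis using R by linarith
  next
    case True
    define s :: real where "s = 2 ^ (j div 2)"
    have s: "s > 0" by (simp add: s_def)
    have "j \<le> Suc (j div 2 + j div 2)" by linarith
    then have "(2::real) ^ j \<le> 2 ^ Suc (j div 2 + j div 2)" by (intro power_increasing) auto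
    then have ss: "2 ^ j \<le> 2 * (s * s)" by (simp add: s_def power_add)
    have "s * \<bar>\<eta>$2\<bar> \<le> 2 ^ j * R * (pi / s)"
      using chi_support(3)[OF True c] norm_dil'[of j \<eta>] by (simp add: curv_dil_mult R_def s_def abs_mult)
    also have "\<dots> \<le> 2 * (s * s) * (32 / 3) * (4 / s)"
      using R R0 s ss pi_less_4 by (intro mult_mono divide_right_mono) auto
    also have "\<dots> = s * (256 / 3)" using s by simp
    finally have "\<bar>\<eta>$2\<bar> \<le> 256 / 3" using s by simp
    then show ?thesis by simp
  qed
  then show "norm \<eta> \<le> 98" using norm_vec2_le[of \<eta>] e1 R by linarith
  assume j: "j \<ge> 4"
  have "norm (curv_dil j *v \<eta>) \<le> 2 * \<bar>(curv_dil j *v \<eta>) $ 1\<bar>" using chi_support(4)[OF _ c] j by simp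
  then have "2 ^ j * R \<le> 2 ^ j * (2 * \<bar>\<eta>$1\<bar>)"
    using norm_dil'[of j \<eta>] by (simp add: curv_dil_mult R_def abs_mult)
  then have "R \<le> 2 * \<bar>\<eta>$1\<bar>" by simp
  then show "1 \<le> \<bar>\<eta>$1\<bar>" using R j by linarith
qed

end

section \<open>Uniform smoothness of the generators\<close>

primrec line_diff :: "nat \<Rightarrow> real^2 \<Rightarrow> (real^2 \<Rightarrow> real) \<Rightarrow> real^2 \<Rightarrow> real" where
  "line_diff 0 t f \<xi> = f \<xi>"
| "line_diff (Suc n) t f \<xi> = line_diff n t f \<xi> - line_diff n t f (\<xi> + t)"

lemma finite_diff_line:
  "finite_diff n h (\<lambda>s. f (\<xi> + s *\<^sub>R u)) s = line_diff n (h *\<^sub>R u) f (\<xi> + s *\<^sub>R u)"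
  by (induction n arbitrary: s) (simp_all add: algebra_simps)

lemma unit_direction:
  obtains u :: "real^2" where "norm u = 1" "t = norm t *\<^sub>R u"
proof (cases "t = 0")
  case True
  then show ?thesis using that[of "axis 1 1"] by simp
next
  case False
  then show ?thesis using that[of "t /\<^sub>R norm t"] by simp
qed

lemma smooth_on_lines_line_diff:
  assumes "smooth_on_lines n (\<lambda>_. UNIV) f"
  obtains B where "B \<ge> 0" "\<And>j t \<xi>. \<bar>line_diff n t (f j) \<xi>\<bar> \<le> B * norm t ^ n"
proof -
  obtain B where B: "B \<ge> 0" "\<And>i h s. line_dom (\<lambda>_. UNIV) i = UNIV \<Longrightarrow>
     \<bar>finite_diff n h (\<lambda>s. f (fst i) (fst (snd i) + s *\<^sub>R snd (snd i))) s\<bar> \<le> B * \<bar>h\<bar> ^ n"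
    using finite_diff_bound[OF assms[unfolded smooth_on_lines_def]] by blast
  have "\<bar>line_diff n t (f j) \<xi>\<bar> \<le> B * norm t ^ n" for j t \<xi>
  proof -
    obtain u :: "real^2" where u: "norm u = 1" "t = norm t *\<^sub>R u" by (rule unit_direction)
    have "\<bar>finite_diff n (norm t) (\<lambda>s. f j (\<xi> + s *\<^sub>R u)) 0\<bar> \<le> B * norm t ^ n"
      using B(2)[of "(j, \<xi>, u)" "norm t" 0] u(1) by (simp add: line_dom_def)
    then show ?thesis unfolding finite_diff_line using u(2) by simp
  qed
  with B(1) that show ?thesis by blast
qed

text \<open>The nearest zeros of \<open>sin (x / 4)\<close> are \<open>0\<close> and \<open>\<plusminus> 4 * pi\<close>. The upper limit exceeds \<open>11\<close>, the bound of
\<open>curv_gen_support\<close> for the first coordinate, so that there is room for an open neighbourhood.\<close>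

lemma sin_quarter_lower:
  fixes x :: real
  assumes "1/2 < \<bar>x\<bar>" "\<bar>x\<bar> < 23/2"
  shows "1/16 \<le> \<bar>sin (x / 4)\<bar>"
proof -
  define y where "y = \<bar>x\<bar> / 4"
  have y: "1/8 < y" "y < 23/8" using assms by (auto simp: y_def)
  have "1/16 \<le> sin y"
  proof (cases "y \<le> pi / 2")
    case True
    then show ?thesis using sin_ge_half[of y] y by linarith
  next
    case False
    have "(pi - y) / 2 \<le> sin (pi - y)" by (rule sin_ge_half) (use False y pi_gt3 in linarith)+
    then show ?thesis using y pi_gt3 by (simp add: sin_diff)
  qed
  moreover have "\<bar>sin (x / 4)\<bar> = \<bar>sin y\<bar>" by (cases "x \<ge> 0") (auto simp: y_def)
  ultimately show ?thesis by linarith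
qed

context curvelet_window_functions
begin

text \<open>The plane is covered by five kinds of open regions, on each of which a different formula shows that
\<open>deconv\<close> is smooth. On this one the generator vanishes by
\<open>curv_gen_support\<close>, and the constants of the others leave a margin, so that the regions overlap.\<close>

definition zero_chart :: "nat \<Rightarrow> (real^2) set" where
  "zero_chart j = {\<eta>. 98 < norm \<eta> \<or> (1 \<le> j \<and> scaled_radius_sq j \<eta> < 4)
     \<or> (4 \<le> j \<and> (\<bar>\<eta>$1\<bar> < 1 \<or> 11 < \<bar>\<eta>$1\<bar>))}"

definition side_chart :: "nat \<Rightarrow> (real^2) set" where
  "side_chart j = {\<eta>. 2 \<le> j \<and> 1/2 < \<bar>\<eta>$1\<bar> \<and> norm \<eta> < 100}"

definition top_chart :: "nat \<Rightarrow> (real^2) set" where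
  "top_chart j = {\<eta>. 2 \<le> j \<and> j < 4 \<and> 1/2 < \<bar>\<eta>$2\<bar> \<and> norm \<eta> < 100}"

definition centre_chart :: "nat \<Rightarrow> (real^2) set" where
  "centre_chart j = {\<eta>. j = 0 \<and> norm \<eta> < 4}"

definition ring_chart :: "nat \<Rightarrow> (real^2) set" where
  "ring_chart j = {\<eta>. j < 2 \<and> 1 < scaled_radius_sq j \<eta> \<and> norm \<eta> < 100}"

lemma open_Collect_guard: "open {x. P x} \<Longrightarrow> open {x. Q \<and> P x}"
  by (cases Q) auto

lemma continuous_scaled_radius_sq: "continuous_on UNIV (scaled_radius_sq j)"
  unfolding scaled_radius_sq_def[abs_def] by (intro continuous_intros)

lemma open_charts: "open (zero_chart j)" "open (side_chart j)" "open (top_chart j)"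
    "open (centre_chart j)" "open (ring_chart j)"
  unfolding zero_chart_def side_chart_def top_chart_def centre_chart_def ring_chart_def
  by (intro open_Collect_guard open_Collect_disj open_Collect_conj open_Collect_less continuous_intros continuous_scaled_radius_sq)+

lemma curv_gen_zero_chart:
  assumes z: "\<eta> \<in> zero_chart j"
  shows "curv_gen j \<eta> = 0"
proof (rule ccontr)
  assume "curv_gen j \<eta> \<noteq> 0"
  from curv_gen_support[OF this] z show False by (force simp: zero_chart_def)
qed

lemma deconv_zero_chart: "smooth_on_lines k zero_chart deconv"
  by (rule smooth_on_lines_zero[OF _ open_charts(1)]) (simp add: deconv_def curv_gen_zero_chart)

lemma smooth_on_lines_gauss_factor:
  assumes V: "\<And>j. open (V j)" and b: "\<And>j \<eta>. \<eta> \<in> V j \<Longrightarrow> norm \<eta> < 100"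
  shows "smooth_on_lines k V (\<lambda>j \<eta>. sqrt (det (curv_dil j) / (Lam j * lam j)) * (2 * exp ((norm \<eta>)\<^sup>2 / 4)))"
proof -
  have "smooth_on_lines k V (\<lambda>j \<eta>. sqrt (det (curv_dil j) / (Lam j * lam j)) * (2 * exp (1/4 * (\<eta>$1 * \<eta>$1 + \<eta>$2 * \<eta>$2))))"
    by (intro smooth_on_lines_mult[OF V] smooth_on_lines_exp[OF V] smooth_on_lines_add[OF V] smooth_on_lines_coord[where B = 100, OF V]
        smooth_on_lines_const[where B = 1, OF V generator_factor_le_1] smooth_on_lines_const[where B = 2, OF V] smooth_on_lines_const[where B = "1/4", OF V])
       (auto dest: b less_imp_le)
  moreover have eq: "1/4 * (\<eta>$1 * \<eta>$1 + \<eta>$2 * \<eta>$2) = (norm \<eta>)\<^sup>2 / 4" for \<eta> :: "real^2"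
    by (subst norm_vec2) (simp add: power2_eq_square)
  ultimately show ?thesis unfolding eq by blast
qed

lemma smooth_on_lines_radius_sq:
  assumes V: "\<And>j. open (V j)" and b: "\<And>j \<eta>. \<eta> \<in> V j \<Longrightarrow> norm \<eta> < 100"
  shows "smooth_on_lines k V scaled_radius_sq"
proof -
  have "smooth_on_lines k V (\<lambda>j \<eta>. \<eta>$1 * \<eta>$1 + (aspect j * \<eta>$2) * (aspect j * \<eta>$2))"
    using aspect_bounds
    by (intro smooth_on_lines_mult[OF V] smooth_on_lines_add[OF V] smooth_on_lines_coord[where B = 100, OF V] smooth_on_lines_const[where B = 1, OF V])
       (auto dest: b less_imp_le simp: abs_if dest: less_asym)
  then show ?thesis unfolding scaled_radius_sq_def[abs_def] .
qed

lemma deconv_centre_chart: "smooth_on_lines k centre_chart deconv"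
proof (rule smooth_on_lines_cong[OF open_charts(4) smooth_on_lines_gauss_factor[OF open_charts(4)]])
  fix j \<eta> assume z: "\<eta> \<in> centre_chart j"
  then have "j = 0" "norm \<eta> < 4" by (auto simp: centre_chart_def)
  moreover have "curv_dil 0 *v \<eta> = \<eta>" by (simp add: vec_eq_iff forall_2 curv_dil_mult)
  moreover have "w0 (norm \<eta>) = 1" using \<open>norm \<eta> < 4\<close> pi_gt3 by (intro w0_near_zero) auto
  ultimately have "chi w0 w v j (curv_dil j *v \<eta>) = 1" by (simp add: chi_def)
  then show "sqrt (det (curv_dil j) / (Lam j * lam j)) * (2 * exp ((norm \<eta>)\<^sup>2 / 4)) = deconv j \<eta>"
    by (simp add: deconv_def curv_gen_def)
qed (auto simp: centre_chart_def)

lemma smooth_on_lines_radius: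
  assumes V: "\<And>j. open (V j)" and b: "\<And>j \<eta>. \<eta> \<in> V j \<Longrightarrow> norm \<eta> < 100 \<and> e \<le> scaled_radius_sq j \<eta>" and e: "e > 0"
  shows "smooth_on_lines k V (\<lambda>j \<eta>. sqrt (scaled_radius_sq j \<eta>))"
  by (rule smooth_on_lines_sqrt[OF V smooth_on_lines_radius_sq[OF V] e]) (use b in auto)

lemma deconv_ring_chart: "smooth_on_lines k ring_chart deconv"
proof -
  note V = open_charts(5)
  \<comment> \<open>the two scales have different radial windows, and \<open>w0\<close> is smooth on the half line only\<close>
  define V0 V1 where "V0 j = {\<eta>. j = 0 \<and> \<eta> \<in> ring_chart j}" and "V1 j = {\<eta>. j = 1 \<and> \<eta> \<in> ring_chart j}" for j
  have o0: "open (V0 j)" and o1: "open (V1 j)" for j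
    unfolding V0_def V1_def by (intro open_Collect_guard; simp add: V)+
  have bd: "norm \<eta> < 100 \<and> 1 \<le> scaled_radius_sq j \<eta>" if "\<eta> \<in> ring_chart j" for j \<eta>
    using that by (auto simp: ring_chart_def)
  have R0: "smooth_on_lines k V0 (\<lambda>j \<eta>. sqrt (scaled_radius_sq j \<eta>))"
    by (rule smooth_on_lines_radius[where e = 1, OF o0]) (use bd in \<open>auto simp: V0_def\<close>)
  have R1: "smooth_on_lines k V1 (\<lambda>j \<eta>. sqrt (scaled_radius_sq j \<eta>))"
    by (rule smooth_on_lines_radius[where e = 1, OF o1]) (use bd in \<open>auto simp: V1_def\<close>)
  have W0: "smooth_on_lines k V0 (\<lambda>j \<eta>. w0 (sqrt (scaled_radius_sq j \<eta>)))"
  proof (rule smooth_on_lines_compose_smooth[where a = 1 and b = 100, OF o0 R0 window_smooth(1)])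
    show "{1..100::real} \<subseteq> interior {0..}" by (subst interior_real_atLeast) auto
    fix j \<eta> assume e: "\<eta> \<in> V0 j"
    then have "j = 0" "norm \<eta> < 100" "1 < scaled_radius_sq j \<eta>" by (auto simp: V0_def ring_chart_def)
    moreover from this have "1 \<le> sqrt (scaled_radius_sq j \<eta>)" by simp
    moreover have "sqrt (scaled_radius_sq 0 \<eta>) = norm \<eta>"
      by (simp add: scaled_radius_sq_def aspect_def norm_vec2_sqrt power2_eq_square)
    ultimately show "sqrt (scaled_radius_sq j \<eta>) \<in> {1..100}" by auto
  qed
  have W1: "smooth_on_lines k V1 (\<lambda>j \<eta>. w (sqrt (scaled_radius_sq j \<eta>)))"
    by (rule smooth_on_lines_compose_smooth_UNIV[OF o1 R1 window_smooth(2)])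
  have D0: "smooth_on_lines k V0 deconv"
  proof (rule smooth_on_lines_cong[OF o0 smooth_on_lines_mult[OF o0 smooth_on_lines_gauss_factor[OF o0] W0]])
    fix j \<eta> assume e: "\<eta> \<in> V0 j"
    then have j: "j = 0" by (simp add: V0_def)
    have "chi w0 w v j (curv_dil j *v \<eta>) = w0 (sqrt (scaled_radius_sq j \<eta>))"
      using norm_dil'[of j \<eta>] by (simp add: chi_def j)
    then show "sqrt (det (curv_dil j) / (Lam j * lam j)) * (2 * exp ((norm \<eta>)\<^sup>2 / 4)) * w0 (sqrt (scaled_radius_sq j \<eta>)) = deconv j \<eta>"
      by (simp add: deconv_def curv_gen_def)
  qed (use bd in \<open>auto simp: V0_def\<close>)
  have D1: "smooth_on_lines k V1 deconv"
  proof (rule smooth_on_lines_cong[OF o1 smooth_on_lines_mult[OF o1 smooth_on_lines_gauss_factor[OF o1] W1]])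
    fix j \<eta> assume e: "\<eta> \<in> V1 j"
    then have j: "j = 1" by (simp add: V1_def)
    have "chi w0 w v j (curv_dil j *v \<eta>) = w (sqrt (scaled_radius_sq j \<eta>))"
      using norm_dil[of j \<eta>] by (simp add: chi_def j)
    then show "sqrt (det (curv_dil j) / (Lam j * lam j)) * (2 * exp ((norm \<eta>)\<^sup>2 / 4)) * w (sqrt (scaled_radius_sq j \<eta>)) = deconv j \<eta>"
      by (simp add: deconv_def curv_gen_def)
  qed (use bd in \<open>auto simp: V1_def\<close>)
  show ?thesis
    by (rule smooth_on_lines_subset[OF smooth_on_lines_union[OF D0 D1]]) (auto simp: V0_def V1_def ring_chart_def)
qed

text \<open>The angular window is \<open>v (2 ^ (j div 2) * arctan (aspect j * slope))\<close>. Its argument is smooth uniformly in \<open>j\<close>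
since \<open>2 ^ (j div 2) * aspect j \<le> 1\<close>.\<close>

lemma deconv_side_chart: "smooth_on_lines k side_chart deconv"
proof -
  note V = open_charts(2)
  have bd: "norm \<eta> < 100" "1/2 \<le> \<bar>\<eta>$1\<bar>" "2 \<le> j" if "\<eta> \<in> side_chart j" for j \<eta>
    using that by (auto simp: side_chart_def)
  have q: "1/4 \<le> scaled_radius_sq j \<eta>" if "\<eta> \<in> side_chart j" for j \<eta>
  proof -
    have "(1/2)\<^sup>2 \<le> \<bar>\<eta>$1\<bar>\<^sup>2" using bd(2)[OF that] by (intro power_mono) auto
    then have "1/4 \<le> \<eta>$1 * \<eta>$1" by (simp add: power2_eq_square)
    moreover have "0 \<le> (aspect j * \<eta>$2) * (aspect j * \<eta>$2)" by simp
    ultimately show ?thesis unfolding scaled_radius_sq_def by linarith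
  qed
  have R: "smooth_on_lines k side_chart (\<lambda>j \<eta>. sqrt (scaled_radius_sq j \<eta>))"
    by (rule smooth_on_lines_radius[where e = "1/4", OF V]) (use bd q in auto)
  have W: "smooth_on_lines k side_chart (\<lambda>j \<eta>. w (sqrt (scaled_radius_sq j \<eta>)))"
    by (rule smooth_on_lines_compose_smooth_UNIV[OF V R window_smooth(2)])
  have I: "smooth_on_lines k side_chart (\<lambda>j \<eta>. \<eta>$2 * inverse (\<eta>$1))"
    by (intro smooth_on_lines_mult[OF V] smooth_on_lines_inverse[where e = "1/2", OF V] smooth_on_lines_coord[where B = 100, OF V])
       (auto dest: bd less_imp_le)
  have A: "smooth_on_lines k side_chart (\<lambda>j \<eta>. 2 ^ (j div 2) * arctan (aspect j * (\<eta>$2 * inverse (\<eta>$1))))"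
    by (rule smooth_on_lines_scaled_arctan[where e = aspect and a = "\<lambda>j. 2 ^ (j div 2)", OF V I])
       (use aspect_bounds in \<open>auto intro: less_imp_le\<close>)
  have N: "smooth_on_lines k side_chart (\<lambda>j \<eta>. v (2 ^ (j div 2) * arctan (aspect j * (\<eta>$2 * inverse (\<eta>$1)))))"
    by (rule smooth_on_lines_compose_smooth_UNIV[OF V A window_smooth(3)])
  show ?thesis
  proof (rule smooth_on_lines_cong[OF V smooth_on_lines_mult[OF V smooth_on_lines_gauss_factor[OF V] smooth_on_lines_mult[OF V W N]]])
    fix j \<eta> assume e: "\<eta> \<in> side_chart j"
    have "\<eta>$1 \<noteq> 0" using bd(2)[OF e] by auto
    then have x: "(curv_dil j *v \<eta>) $ 1 \<noteq> 0" by (simp add: curv_dil_mult)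
    have "(curv_dil j *v \<eta>) $ 2 / (curv_dil j *v \<eta>) $ 1 = aspect j * (\<eta>$2 * inverse (\<eta>$1))"
      by (simp add: curv_dil_mult aspect_def field_simps)
    then have "chi w0 w v j (curv_dil j *v \<eta>) = w (sqrt (scaled_radius_sq j \<eta>)) * v (2 ^ (j div 2) * arctan (aspect j * (\<eta>$2 * inverse (\<eta>$1))))"
      using chi_off_vertical_axis[OF bd(3)[OF e] x] norm_dil[of j \<eta>] by simp
    then show "sqrt (det (curv_dil j) / (Lam j * lam j)) * (2 * exp ((norm \<eta>)\<^sup>2 / 4)) *
        (w (sqrt (scaled_radius_sq j \<eta>)) * v (2 ^ (j div 2) * arctan (aspect j * (\<eta>$2 * inverse (\<eta>$1))))) = deconv j \<eta>"
      by (simp add: deconv_def curv_gen_def)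
  qed (use bd in auto)
qed

text \<open>Only two scales occur here, so the reciprocal of \<open>aspect j\<close> is bounded.\<close>

lemma deconv_top_chart: "smooth_on_lines k top_chart deconv"
proof -
  note V = open_charts(3)
  have bd: "norm \<eta> < 100" "1/2 \<le> \<bar>\<eta>$2\<bar>" "2 \<le> j" "j < 4" if "\<eta> \<in> top_chart j" for j \<eta>
    using that by (auto simp: top_chart_def)
  have asp: "1/4 \<le> aspect j" if "2 \<le> j" "j < 4" for j
  proof -
    have "j = 2 \<or> j = 3" using that by linarith
    then show ?thesis by (auto simp: aspect_def)
  qed
  have q: "1/64 \<le> scaled_radius_sq j \<eta>" if "\<eta> \<in> top_chart j" for j \<eta>
  proof -
    have "1/4 * (1/2) \<le> aspect j * \<bar>\<eta>$2\<bar>"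
      using asp bd[OF that] aspect_bounds(1)[of j] by (intro mult_mono) auto
    then have "(1/8)\<^sup>2 \<le> (aspect j * \<bar>\<eta>$2\<bar>)\<^sup>2" by (intro power_mono) auto
    then have "1/64 \<le> (aspect j * \<eta>$2) * (aspect j * \<eta>$2)" by (simp add: power2_eq_square power_mult_distrib)
    moreover have "0 \<le> \<eta>$1 * \<eta>$1" by simp
    ultimately show ?thesis unfolding scaled_radius_sq_def by linarith
  qed
  have R: "smooth_on_lines k top_chart (\<lambda>j \<eta>. sqrt (scaled_radius_sq j \<eta>))"
    by (rule smooth_on_lines_radius[where e = "1/64", OF V]) (use bd q in auto)
  have W: "smooth_on_lines k top_chart (\<lambda>j \<eta>. w (sqrt (scaled_radius_sq j \<eta>)))"
    by (rule smooth_on_lines_compose_smooth_UNIV[OF V R window_smooth(2)])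
  have inv: "\<bar>inverse (aspect j)\<bar> \<le> 4" if ne: "top_chart j \<noteq> {}" for j
  proof -
    have "2 \<le> j" "j < 4" using ne by (auto simp: top_chart_def)
    then have "inverse (aspect j) \<le> inverse (1/4)" using asp by (intro le_imp_inverse_le) auto
    then show ?thesis using aspect_bounds(1)[of j] by simp
  qed
  have I: "smooth_on_lines k top_chart (\<lambda>j \<eta>. inverse (aspect j) * (\<eta>$1 * inverse (\<eta>$2)))"
    by (intro smooth_on_lines_mult[OF V] smooth_on_lines_inverse[where e = "1/2", OF V] smooth_on_lines_coord[where B = 100, OF V] smooth_on_lines_const[where B = 4, OF V inv])
       (auto dest: bd less_imp_le)
  define a where "a j \<eta> = arctan (inverse (aspect j) * (\<eta>$1 * inverse (\<eta>$2)))" for j and \<eta> :: "real^2"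
  have A: "smooth_on_lines k top_chart a"
    using smooth_on_lines_scaled_arctan[where e = "\<lambda>_. 1" and a = "\<lambda>_. 1", OF V I] by (simp add: a_def[abs_def])
  have P: "smooth_on_lines k top_chart (\<lambda>j \<eta>. v (pi + (- 2) * a j \<eta>) + v (- pi + (- 2) * a j \<eta>))"
    by (intro smooth_on_lines_add[OF V] smooth_on_lines_compose_smooth_UNIV[OF V _ window_smooth(3)] smooth_on_lines_mult[OF V] A
        smooth_on_lines_const[where B = pi, OF V] smooth_on_lines_const[where B = 2, OF V]) auto
  show ?thesis
  proof (rule smooth_on_lines_cong[OF V smooth_on_lines_mult[OF V smooth_on_lines_gauss_factor[OF V] smooth_on_lines_mult[OF V W P]]])
    fix j \<eta> assume e: "\<eta> \<in> top_chart j"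
    have "\<eta>$2 \<noteq> 0" using bd(2)[OF e] by auto
    then have x: "(curv_dil j *v \<eta>) $ 2 \<noteq> 0" by (simp add: curv_dil_mult)
    have "(curv_dil j *v \<eta>) $ 1 / (curv_dil j *v \<eta>) $ 2 = inverse (aspect j) * (\<eta>$1 * inverse (\<eta>$2))"
      by (simp add: curv_dil_mult aspect_def field_simps)
    then have "chi w0 w v j (curv_dil j *v \<eta>) = w (sqrt (scaled_radius_sq j \<eta>)) * (v (pi + (- 2) * a j \<eta>) + v (- pi + (- 2) * a j \<eta>))"
      using chi_off_horizontal_axis[OF bd(3,4)[OF e] x] norm_dil[of j \<eta>] by (simp add: a_def)
    then show "sqrt (det (curv_dil j) / (Lam j * lam j)) * (2 * exp ((norm \<eta>)\<^sup>2 / 4)) *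
        (w (sqrt (scaled_radius_sq j \<eta>)) * (v (pi + (- 2) * a j \<eta>) + v (- pi + (- 2) * a j \<eta>))) = deconv j \<eta>"
      by (simp add: deconv_def curv_gen_def)
  qed (use bd in auto)
qed

lemma deconv_smooth: "smooth_on_lines k (\<lambda>_. UNIV) deconv"
proof (rule smooth_on_lines_subset[OF smooth_on_lines_union[OF deconv_zero_chart smooth_on_lines_union[OF deconv_side_chart
        smooth_on_lines_union[OF deconv_top_chart smooth_on_lines_union[OF deconv_centre_chart deconv_ring_chart]]]]])
  fix j
  have "\<eta> \<in> zero_chart j \<union> (side_chart j \<union> (top_chart j \<union> (centre_chart j \<union> ring_chart j)))" for \<eta>
  proof (cases "98 < norm \<eta>")
    case True
    then show ?thesis by (simp add: zero_chart_def)
  next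
    case False
    then have n: "norm \<eta> < 100" by simp
    consider "j = 0" | "j = 1" | "2 \<le> j" by linarith
    then show ?thesis
    proof cases
      case 1
      have "1 < scaled_radius_sq 0 \<eta>" if "4 \<le> norm \<eta>"
      proof -
        have "4\<^sup>2 \<le> (norm \<eta>)\<^sup>2" using that by (intro power_mono) auto
        then show ?thesis unfolding norm_vec2 by (simp add: scaled_radius_sq_def aspect_def power2_eq_square)
      qed
      then show ?thesis using 1 n by (cases "norm \<eta> < 4") (auto simp: centre_chart_def ring_chart_def)
    next
      case 2
      then show ?thesis using n by (auto simp: zero_chart_def ring_chart_def)
    next
      case 3
      have "scaled_radius_sq j \<eta> < 4" if h: "\<bar>\<eta>$1\<bar> \<le> 1/2" "\<bar>\<eta>$2\<bar> \<le> 1/2"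
      proof -
        have "\<eta>$1 * \<eta>$1 \<le> 1" using h(1) abs_square_le_1[of "\<eta>$1"] by (simp add: power2_eq_square)
        moreover have "aspect j * \<bar>\<eta>$2\<bar> \<le> 1 * 1" using h(2) aspect_bounds(1,2)[of j] by (intro mult_mono) auto
        then have "(aspect j * \<eta>$2) * (aspect j * \<eta>$2) \<le> 1"
          using abs_square_le_1[of "aspect j * \<eta>$2"] aspect_bounds(1)[of j] by (simp add: power2_eq_square abs_mult)
        ultimately show ?thesis unfolding scaled_radius_sq_def by linarith
      qed
      then show ?thesis using 3 n
        by (cases "\<bar>\<eta>$1\<bar> \<le> 1/2"; cases "\<bar>\<eta>$2\<bar> \<le> 1/2"; cases "j < 4")
           (auto simp: zero_chart_def side_chart_def top_chart_def)
    qed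
  qed
  then show "UNIV \<subseteq> zero_chart j \<union> (side_chart j \<union> (top_chart j \<union> (centre_chart j \<union> ring_chart j)))" by auto
qed

text \<open>From scale \<open>4\<close> on the factor \<open>4 * sin\<^sup>2 (\<eta>\<^sub>1 / 4)\<close> is split off. It is bounded away from zero on the support of
the generator, vanishes to second order on the vertical axis like \<open>weight\<close>, and is a trigonometric sum.\<close>

definition profile :: "nat \<Rightarrow> real^2 \<Rightarrow> real" where
  "profile j \<eta> = deconv j \<eta> * (if j < 4 then 1 else inverse (4 * (sin (\<eta>$1 / 4))\<^sup>2))"

lemma profile_smooth: "smooth_on_lines k (\<lambda>_. UNIV) profile"
proof -
  define Va Vb Vc where "Va j = {\<eta>::real^2. j < 4}" and "Vb j = {\<eta>. 4 \<le> j \<and> \<eta> \<in> zero_chart j}"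
    and "Vc j = {\<eta>. 4 \<le> j \<and> 1/2 < \<bar>\<eta>$1\<bar> \<and> \<bar>\<eta>$1\<bar> < 23/2 \<and> norm (\<eta>::real^2) < 100}" for j
  have oa: "open (Va j)" and ob: "open (Vb j)" and oc: "open (Vc j)" for j
    unfolding Va_def Vb_def Vc_def using open_charts(1)[of j]
    by (auto intro!: open_Collect_guard open_Collect_conj open_Collect_less continuous_intros)
  have "smooth_on_lines k Va profile"
    by (rule smooth_on_lines_cong[OF oa smooth_on_lines_subset[OF deconv_smooth]]) (auto simp: Va_def profile_def)
  moreover have "smooth_on_lines k Vb profile"
  proof (rule smooth_on_lines_zero[OF _ ob])
    fix j \<eta> assume "\<eta> \<in> Vb j"
    then have "curv_gen j \<eta> = 0" by (simp add: Vb_def curv_gen_zero_chart)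
    then show "profile j \<eta> = 0" by (simp add: deconv_def profile_def)
  qed
  moreover have "smooth_on_lines k Vc profile"
  proof -
    have S: "smooth_on_lines k Vc (\<lambda>j \<eta>. sin (1/4 * \<eta>$1))"
      by (intro smooth_on_lines_sin[OF oc] smooth_on_lines_mult[OF oc] smooth_on_lines_coord[where B = 100, OF oc] smooth_on_lines_const[where B = "1/4", OF oc])
         (auto simp: Vc_def)
    have S4: "smooth_on_lines k Vc (\<lambda>j \<eta>. 4 * (sin (1/4 * \<eta>$1) * sin (1/4 * \<eta>$1)))"
      by (intro smooth_on_lines_mult[OF oc] S smooth_on_lines_const[where B = 4, OF oc]) auto
    have I: "smooth_on_lines k Vc (\<lambda>j \<eta>. inverse (4 * (sin (1/4 * \<eta>$1) * sin (1/4 * \<eta>$1))))"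
    proof (rule smooth_on_lines_inverse[where e = "1/64", OF oc S4])
      fix j and \<eta> :: "real^2" assume "\<eta> \<in> Vc j"
      then have "1/16 \<le> \<bar>sin (\<eta>$1 / 4)\<bar>" by (intro sin_quarter_lower) (auto simp: Vc_def)
      then have "1/16 * (1/16) \<le> \<bar>sin (\<eta>$1 / 4)\<bar> * \<bar>sin (\<eta>$1 / 4)\<bar>" by (intro mult_mono) auto
      then show "1/64 \<le> \<bar>4 * (sin (1/4 * \<eta>$1) * sin (1/4 * \<eta>$1))\<bar>" by simp
    qed simp
    show ?thesis
      by (rule smooth_on_lines_cong[OF oc smooth_on_lines_mult[OF oc smooth_on_lines_subset[OF deconv_smooth] I]])
         (auto simp: Vc_def profile_def power2_eq_square)
  qed
  ultimately have "smooth_on_lines k (\<lambda>j. Va j \<union> (Vb j \<union> Vc j)) profile" by (intro smooth_on_lines_union)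
  then show ?thesis
  proof (rule smooth_on_lines_subset)
    show "UNIV \<subseteq> Va j \<union> (Vb j \<union> Vc j)" for j
      by (auto simp: Va_def Vb_def Vc_def zero_chart_def)
  qed
qed

lemma profile_support: "profile j \<eta> \<noteq> 0 \<Longrightarrow> norm \<eta> \<le> 98"
  using curv_gen_support(1)[of j \<eta>] by (auto simp: profile_def deconv_def)

lemma curv_gen_eq_profile:
  "curv_gen j \<eta> = 1/2 * exp (- (norm \<eta>)\<^sup>2 / 4) * ((if j < 4 then 1 else 4 * (sin (\<eta>$1 / 4))\<^sup>2) * profile j \<eta>)"
proof (cases "curv_gen j \<eta> = 0")
  case False
  have e: "exp (- (norm \<eta>)\<^sup>2 / 4) * exp ((norm \<eta>)\<^sup>2 / 4) = 1" by (simp add: mult_exp_exp)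
  have s: "sin (\<eta>$1 / 4) \<noteq> 0" if "j \<ge> 4"
  proof -
    have "1/16 \<le> \<bar>sin (\<eta>$1 / 4)\<bar>"
      using curv_gen_support(3,4)[OF False] that by (intro sin_quarter_lower) auto
    then show ?thesis by auto
  qed
  have a: "1/2 * E * (c * (g * (2 * F) * inverse c)) = g * (E * F)" if "c \<noteq> 0" for E F c g :: real
    using that by (simp add: field_simps)
  show ?thesis
  proof (cases "j < 4")
    case True
    then show ?thesis using e a[of 1] by (simp add: profile_def deconv_def)
  next
    case nl: False
    then have "4 * (sin (\<eta>$1 / 4))\<^sup>2 \<noteq> 0" using s by simp
    from a[OF this, of "exp (- (norm \<eta>)\<^sup>2 / 4)" "curv_gen j \<eta>" "exp ((norm \<eta>)\<^sup>2 / 4)"]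
    show ?thesis using nl e unfolding profile_def deconv_def by (simp only: if_False mult_1_right)
  qed
qed (simp add: profile_def deconv_def)

lemma profile_continuous: "continuous_on UNIV (profile j)"
proof -
  obtain B where B: "B \<ge> 0" "\<And>j t \<xi>. \<bar>line_diff 1 t (profile j) \<xi>\<bar> \<le> B * norm t ^ 1"
    using smooth_on_lines_line_diff[OF profile_smooth[of 1]] by blast
  have "B-lipschitz_on UNIV (profile j)"
  proof (rule lipschitz_onI[OF _ B(1)])
    fix x y :: "real^2"
    show "dist (profile j x) (profile j y) \<le> B * dist x y"
      using B(2)[of "y - x" j x] by (simp add: dist_norm norm_minus_commute)
  qed
  then show ?thesis by (rule lipschitz_on_continuous_on)
qed

end

section \<open>A trigonometric kernel\<close>

lemma power_le_fact_exp:
  fixes x :: real assumes "x \<ge> 0"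
  shows "x ^ n \<le> fact n * exp x"
proof -
  have "(\<Sum>k\<in>{n}. x ^ k /\<^sub>R fact k) \<le> (\<Sum>k. x ^ k /\<^sub>R fact k)"
    by (rule sum_le_suminf[OF summable_exp_generic]) (use assms in auto)
  then have "x ^ n / fact n \<le> exp x"
    by (simp add: exp_def inverse_eq_divide)
  then show ?thesis by (simp add: field_simps)
qed

lemma power_gauss_bounded:
  fixes c :: real assumes "c > 0"
  shows "\<exists>D\<ge>0. \<forall>y\<ge>0. y ^ n \<le> D * exp (c * y\<^sup>2)"
proof -
  define D where "D = 1 + fact n / c ^ n"
  have "D \<ge> 0" using assms by (simp add: D_def)
  moreover have "y ^ n \<le> D * exp (c * y\<^sup>2)" if y: "y \<ge> 0" for y
  proof (cases "y \<le> 1")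
    case True
    have "y ^ n \<le> 1" using True y by (simp add: power_le_one)
    also have "\<dots> \<le> 1 * exp (c * y\<^sup>2)" using assms by simp
    also have "\<dots> \<le> D * exp (c * y\<^sup>2)" using assms by (intro mult_right_mono) (auto simp: D_def)
    finally show ?thesis .
  next
    case False
    have "y ^ n \<le> (y\<^sup>2) ^ n" using False by (intro power_mono) (auto simp: power2_eq_square)
    also have "\<dots> = (c * y\<^sup>2) ^ n / c ^ n" using assms by (simp add: power_mult_distrib)
    also have "\<dots> \<le> fact n * exp (c * y\<^sup>2) / c ^ n"
      using assms by (intro divide_right_mono power_le_fact_exp) auto
    also have "\<dots> \<le> D * exp (c * y\<^sup>2)" using assms by (simp add: D_def distrib_right)
    finally show ?thesis .
  qed
  ultimately show ?thesis by blast
qed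

text \<open>A trigonometric polynomial with \<open>2 * q ^ 4 + 1\<close> frequencies, all multiples of \<open>1 / q\<close>. On its period
\<open>[- pi * q, pi * q]\<close> it is concentrated on the scale \<open>1 / q\<close>: dilation and period grow with \<open>q\<close> while the exponent
sharpens the peak.\<close>

definition cos_kernel :: "nat \<Rightarrow> real \<Rightarrow> real" where
  "cos_kernel q t = cos (t / (2 * real q)) ^ (2 * q ^ 4)"

definition cos_kernel2 :: "nat \<Rightarrow> real^2 \<Rightarrow> real" where
  "cos_kernel2 q t = cos_kernel q (t $ 1) * cos_kernel q (t $ 2)"

lemma cos_kernel_nonneg: "cos_kernel q t \<ge> 0"
  by (simp add: cos_kernel_def power_mult)

lemma cos_kernel_le_1: "cos_kernel q t \<le> 1"
proof -
  have "((cos (t / (2 * real q)))\<^sup>2) ^ (q ^ 4) \<le> 1"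
    by (rule power_le_one[OF zero_le_power2]) (simp add: abs_square_le_1)
  then show ?thesis by (simp add: cos_kernel_def power_mult)
qed

lemma cos_kernel2_bounds: "0 \<le> cos_kernel2 q t" "cos_kernel2 q t \<le> 1"
  unfolding cos_kernel2_def
  using cos_kernel_nonneg cos_kernel_le_1 by (auto intro!: mult_le_one)

lemma cos_kernel_expand:
  "complex_of_real (cos_kernel q t) =
    (\<Sum>a\<le>2 * q ^ 4. complex_of_real (real (2 * q ^ 4 choose a) / 4 ^ (q ^ 4)) * cis ((real a - real (q ^ 4)) * t / real q))"
proof (cases "q = 0")
  case False
  define x where "x = t / (2 * real q)"
  define n where "n = q ^ 4"
  have "complex_of_real (cos x) = (cis x + cis (- x)) / 2"
    by (simp add: complex_eq_iff)
  then have "complex_of_real (cos_kernel q t) = ((cis x + cis (- x)) / 2) ^ (2 * n)"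
    unfolding cos_kernel_def x_def[symmetric] n_def[symmetric] of_real_power by (simp only:)
  also have "\<dots> = (cis x + cis (- x)) ^ (2 * n) / 4 ^ n"
    unfolding power_divide by (simp add: power_mult)
  also have "(cis x + cis (- x)) ^ (2 * n) = (\<Sum>a\<le>2 * n. of_nat (2 * n choose a) * cis x ^ a * cis (- x) ^ (2 * n - a))"
    by (rule binomial_ring)
  also have "\<dots> = (\<Sum>a\<le>2 * n. of_nat (2 * n choose a) * cis ((real a - real n) * t / real q))"
  proof (rule sum.cong[OF refl])
    fix a assume a: "a \<in> {..2 * n}"
    have "cis x ^ a * cis (- x) ^ (2 * n - a) = cis (real a * x + real (2 * n - a) * (- x))"
      unfolding Complex.DeMoivre cis_mult ..
    also have "real a * x + real (2 * n - a) * (- x) = (real a - real n) * t / real q"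
      using a False by (simp add: x_def of_nat_diff field_simps)
    finally show "of_nat (2 * n choose a) * cis x ^ a * cis (- x) ^ (2 * n - a) = of_nat (2 * n choose a) * cis ((real a - real n) * t / real q)"
      by (simp add: mult.assoc)
  qed
  finally show ?thesis
    by (simp add: n_def sum_divide_distrib)
qed (simp add: cos_kernel_def)

lemma cos_kernel_lower:
  assumes "q \<ge> 1" "\<bar>t\<bar> \<le> 1 / real q"
  shows "3 / 4 \<le> cos_kernel q t"
proof -
  define x where "x = t / (2 * real q)"
  define n where "n = q ^ 4"
  have q: "real q \<ge> 1" using assms by simp
  have "t\<^sup>2 \<le> (1 / real q)\<^sup>2" using assms(2) by (metis abs_ge_zero power2_abs power_mono)
  then have "x\<^sup>2 \<le> (1 / real q)\<^sup>2 / (2 * real q)\<^sup>2"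
    unfolding x_def power_divide by (intro divide_right_mono) auto
  also have "\<dots> = 1 / (4 * real n)"
    using q by (simp add: n_def power_divide power_mult_distrib eval_nat_numeral field_simps)
  finally have xn: "x\<^sup>2 \<le> 1 / (4 * real n)" .
  have n1: "real n \<ge> 1" using q by (simp add: n_def)
  have nx: "real n * x\<^sup>2 \<le> 1/4" using xn n1 by (simp add: field_simps)
  have "1 / (4 * real n) \<le> 1" using n1 by simp
  with xn have x1: "x\<^sup>2 \<le> 1" by linarith
  have c: "1 - x\<^sup>2 / 2 \<le> cos x"
  proof -
    have "(sin (x / 2))\<^sup>2 \<le> (x / 2)\<^sup>2"
      using abs_sin_x_le_abs_x[of "x / 2"] by (simp only: abs_le_square_iff)
    then show ?thesis using cos_double_sin[of "x / 2"] by (simp add: power2_eq_square)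
  qed
  have "1 + real (2 * n) * (- (x\<^sup>2 / 2)) \<le> (1 + - (x\<^sup>2 / 2)) ^ (2 * n)"
    using x1 by (intro Bernoulli_inequality) simp
  also have "\<dots> \<le> cos x ^ (2 * n)" using c x1 by (intro power_mono) auto
  finally have "1 - real n * x\<^sup>2 \<le> cos_kernel q t" by (simp add: cos_kernel_def x_def n_def)
  then show ?thesis using nx by linarith
qed

text \<open>On one period \<open>cos\<^sup>2 x \<le> 1 - x\<^sup>2 / 4 \<le> exp (- x\<^sup>2 / 4)\<close>, and the exponent outweighs the dilation.\<close>

lemma cos_kernel_upper:
  assumes "q \<ge> 1" "\<bar>t\<bar> \<le> pi * real q"
  shows "cos_kernel q t \<le> exp (- (real q * t)\<^sup>2 / 16)"
proof -
  define x where "x = t / (2 * real q)"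
  have q: "real q \<ge> 1" using assms by simp
  have x: "\<bar>x\<bar> \<le> pi / 2" using assms(2) q by (simp add: x_def field_simps)
  have "\<bar>x\<bar> / 2 \<le> sin \<bar>x\<bar>" using x by (intro sin_ge_half) auto
  then have "(\<bar>x\<bar> / 2)\<^sup>2 \<le> (sin \<bar>x\<bar>)\<^sup>2" by (intro power_mono) auto
  moreover have "(sin \<bar>x\<bar>)\<^sup>2 = (sin x)\<^sup>2" by (cases "x \<ge> 0") auto
  ultimately have "(cos x)\<^sup>2 \<le> 1 + - (x\<^sup>2 / 4)" by (simp add: cos_squared_eq power_divide)
  also have "\<dots> \<le> exp (- (x\<^sup>2 / 4))" by (rule exp_ge_add_one_self)
  finally have "((cos x)\<^sup>2) ^ (q ^ 4) \<le> exp (- (x\<^sup>2 / 4)) ^ (q ^ 4)" by (intro power_mono) auto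
  also have "\<dots> = exp (real (q ^ 4) * - (x\<^sup>2 / 4))" by (simp only: exp_of_nat_mult)
  also have "real (q ^ 4) * - (x\<^sup>2 / 4) = - (real q * t)\<^sup>2 / 16"
    using q by (simp add: x_def eval_nat_numeral field_simps)
  finally show ?thesis by (simp add: cos_kernel_def x_def power_mult)
qed

lemma cos_kernel2_measurable [measurable]: "cos_kernel2 q \<in> borel_measurable borel"
  unfolding cos_kernel2_def[abs_def] cos_kernel_def by measurable

definition square :: "real \<Rightarrow> (real^2) set" where
  "square a = cbox (vector [- a, - a]) (vector [a, a])"

lemma in_square: "x \<in> square a \<longleftrightarrow> \<bar>x$1\<bar> \<le> a \<and> \<bar>x$2\<bar> \<le> a"
  by (auto simp: square_def mem_box_cart forall_2 abs_le_iff)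

lemma square_measurable [measurable]: "square a \<in> sets borel"
  by (simp add: square_def)

lemma square_integral:
  assumes "a \<ge> 0"
  shows "integrable lborel (\<lambda>x. c * indicator (square a) x :: real)"
    "(LINT x|lborel. c * indicator (square a) x) = c * (4 * a\<^sup>2)"
proof -
  have "0 \<in> square a" using assms by (simp add: in_square)
  then have "measure lborel (square a) = 4 * a\<^sup>2"
    unfolding square_def by (subst content_cbox_cart) (auto simp: UNIV_2 power2_eq_square)
  moreover have "emeasure lborel (square a) < \<infinity>" using emeasure_bounded_finite[OF bounded_cbox] by (simp add: square_def)
  ultimately show "integrable lborel (\<lambda>x. c * indicator (square a) x :: real)"
    "(LINT x|lborel. c * indicator (square a) x) = c * (4 * a\<^sup>2)"
    by auto
qed

lemma affine_substitution:
  fixes g :: "real^2 \<Rightarrow> 'a::{banach,second_countable_topology}"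
  assumes [measurable]: "g \<in> borel_measurable borel" and m: "m > 0"
  shows "(LINT u|lborel. g u) = m\<^sup>2 *\<^sub>R (LINT t|lborel. g (\<xi> + m *\<^sub>R t))"
proof -
  have "(LINT u|lborel. g u) = (LINT u|density (distr lborel borel (\<lambda>x. \<xi> + m *\<^sub>R x)) (\<lambda>_. ennreal (\<bar>m\<bar> ^ 2)). g u)"
    using lborel_affine[of m \<xi>] m by (simp add: ennreal_power)
  also have "\<dots> = m\<^sup>2 *\<^sub>R (LINT t|lborel. g (\<xi> + m *\<^sub>R t))"
    by (subst integral_density) (auto simp: integral_distr)
  finally show ?thesis .
qed

text \<open>The difference operator is a power of the identity minus a translation; \<open>c 0 = 1\<close> belongs to the point
that is not displaced.\<close>

lemma line_diff_expand:
  "\<exists>c :: nat \<Rightarrow> real. c 0 = 1 \<and> (\<forall>f t \<xi>. line_diff n t f \<xi> = (\<Sum>m\<le>n. c m * f (\<xi> + real m *\<^sub>R t)))"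
proof (induction n)
  case 0
  show ?case by (rule exI[of _ "\<lambda>_. 1"]) simp
next
  case (Suc n)
  then obtain c where c: "c 0 = 1" "\<And>f t \<xi>. line_diff n t f \<xi> = (\<Sum>m\<le>n. c m * f (\<xi> + real m *\<^sub>R t))"
    by blast
  define c' where "c' m = (if m \<le> n then c m else 0) - (if m = 0 then 0 else c (m - 1))" for m
  have "line_diff (Suc n) t f \<xi> = (\<Sum>m\<le>Suc n. c' m * f (\<xi> + real m *\<^sub>R t))" for f t \<xi>
  proof -
    have "(\<Sum>m\<le>Suc n. c' m * f (\<xi> + real m *\<^sub>R t))
      = (\<Sum>m\<le>Suc n. (if m \<le> n then c m else 0) * f (\<xi> + real m *\<^sub>R t))
        - (\<Sum>m\<le>Suc n. (if m = 0 then 0 else c (m - 1)) * f (\<xi> + real m *\<^sub>R t))"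
      by (simp only: c'_def left_diff_distrib sum_subtractf)
    also have "(\<Sum>m\<le>Suc n. (if m \<le> n then c m else 0) * f (\<xi> + real m *\<^sub>R t)) = (\<Sum>m\<le>n. c m * f (\<xi> + real m *\<^sub>R t))"
      by simp
    also have "(\<Sum>m\<le>Suc n. (if m = 0 then 0 else c (m - 1)) * f (\<xi> + real m *\<^sub>R t))
      = (\<Sum>m\<le>n. c m * f (\<xi> + t + real m *\<^sub>R t))"
      by (subst sum.atMost_Suc_shift) (simp add: algebra_simps)
    finally show ?thesis by (simp only: line_diff.simps c(2))
  qed
  moreover have "c' 0 = 1" by (simp add: c'_def c)
  ultimately show ?case by blast
qed

text \<open>In the variable \<open>u = \<xi> + m t\<close> the kernel is a trigonometric polynomial in \<open>u - \<xi>\<close>, each term of which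
separates \<open>\<xi>\<close> from the variable of integration.\<close>

lemma kernel_average_trig:
  fixes f :: "real^2 \<Rightarrow> real"
  assumes f[measurable]: "f \<in> borel_measurable borel" and supp: "\<And>u. f u \<noteq> 0 \<Longrightarrow> u \<in> square A"
    and bd: "\<And>u. \<bar>f u\<bar> \<le> B" and A: "A \<ge> 0" and m: "m \<ge> (1::nat)" and q: "q \<ge> (1::nat)"
  shows "\<exists>b. \<forall>\<xi>. complex_of_real (LINT t|lborel. f (\<xi> + real m *\<^sub>R t) * cos_kernel2 q t)
      = (\<Sum>(a, a')\<in>{..2 * q ^ 4} \<times> {..2 * q ^ 4}. b a a' *
          cis (- (vector [(real a - real (q ^ 4)) / (real m * real q), (real a' - real (q ^ 4)) / (real m * real q)] \<bullet> \<xi>)))"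
    and "\<bar>LINT t|lborel. f (\<xi> + real m *\<^sub>R t) * cos_kernel2 q t\<bar> \<le> B * (4 * A\<^sup>2)"
proof -
  define n where "n = q ^ 4"
  define y :: "nat \<Rightarrow> nat \<Rightarrow> real^2" where
    "y a a' = vector [(real a - real n) / (real m * real q), (real a' - real n) / (real m * real q)]" for a a'
  define \<alpha> where "\<alpha> a = complex_of_real (real (2 * n choose a) / 4 ^ n)" for a
  have mq: "real m > 0" "real q > 0" using m q by auto
  have B0: "B \<ge> 0" using bd[of 0] by linarith
  have dom: "norm (f u) \<le> B * indicator (square A) u" for u
    using bd[of u] supp[of u] B0 by (auto simp: indicator_def)
  have fint: "integrable lborel f"
    by (rule Bochner_Integration.integrable_bound[OF square_integral(1)[OF A, of B]])
       (use dom B0 in \<open>auto intro!: AE_I2 simp: abs_mult\<close>)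
  have sub: "(LINT t|lborel. f (\<xi> + real m *\<^sub>R t) * cos_kernel2 q t)
     = (1 / (real m)\<^sup>2) * (LINT u|lborel. f u * cos_kernel2 q ((1 / real m) *\<^sub>R (u - \<xi>)))" for \<xi>
    using affine_substitution[of "\<lambda>u. f u * cos_kernel2 q ((1 / real m) *\<^sub>R (u - \<xi>))" "real m" \<xi>] mq
    by simp
  have exp2: "complex_of_real (cos_kernel2 q ((1 / real m) *\<^sub>R (u - \<xi>)))
      = (\<Sum>(a, a')\<in>{..2 * n} \<times> {..2 * n}. \<alpha> a * \<alpha> a' * cis (y a a' \<bullet> u) * cis (- (y a a' \<bullet> \<xi>)))" for u \<xi>
  proof -
    have "cis ((real a - real n) * ((1 / real m) * (u$1 - \<xi>$1)) / real q) * cis ((real a' - real n) * ((1 / real m) * (u$2 - \<xi>$2)) / real q)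
      = cis (y a a' \<bullet> u) * cis (- (y a a' \<bullet> \<xi>))" for a a'
    proof -
      have sc: "z * ((1 / real m) * x) / real q = z / (real m * real q) * x" for z x :: real
        by simp
      show ?thesis
        unfolding cis_mult sc y_def inner_vec2 vec2_entries
        by (rule arg_cong[where f = cis]) (simp only: right_diff_distrib minus_add_distrib)
    qed
    then have e: "(\<alpha> a * cis ((real a - real n) * ((1 / real m) * (u$1 - \<xi>$1)) / real q)) * (\<alpha> a' * cis ((real a' - real n) * ((1 / real m) * (u$2 - \<xi>$2)) / real q))
      = \<alpha> a * \<alpha> a' * cis (y a a' \<bullet> u) * cis (- (y a a' \<bullet> \<xi>))" for a a'
      by (simp add: mult_ac)
    have "complex_of_real (cos_kernel2 q ((1 / real m) *\<^sub>R (u - \<xi>)))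
      = (\<Sum>a\<le>2 * n. \<alpha> a * cis ((real a - real n) * ((1 / real m) * (u$1 - \<xi>$1)) / real q))
      * (\<Sum>a'\<le>2 * n. \<alpha> a' * cis ((real a' - real n) * ((1 / real m) * (u$2 - \<xi>$2)) / real q))"
      unfolding cos_kernel2_def of_real_mult cos_kernel_expand n_def[symmetric] \<alpha>_def
      by (simp only: vector_scaleR_component vector_minus_component real_scaleR_def)
    then show ?thesis
      unfolding sum_product e sum.cartesian_product .
  qed
  define b where "b a a' = complex_of_real (1 / (real m)\<^sup>2) * (\<alpha> a * \<alpha> a' * (LINT u|lborel. complex_of_real (f u) * cis (y a a' \<bullet> u)))" for a a'
  have ci: "integrable lborel (\<lambda>u. complex_of_real (f u) * cis (y a a' \<bullet> u))" for a a'
    by (rule Bochner_Integration.integrable_bound[OF fint]) (auto simp: norm_mult cis_conv_exp)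
  have "complex_of_real (LINT t|lborel. f (\<xi> + real m *\<^sub>R t) * cos_kernel2 q t)
    = (\<Sum>(a, a')\<in>{..2 * n} \<times> {..2 * n}. b a a' * cis (- (y a a' \<bullet> \<xi>)))" for \<xi>
  proof -
    have "complex_of_real (LINT u|lborel. f u * cos_kernel2 q ((1 / real m) *\<^sub>R (u - \<xi>)))
      = (LINT u|lborel. (\<Sum>(a, a')\<in>{..2 * n} \<times> {..2 * n}. (\<alpha> a * \<alpha> a' * cis (- (y a a' \<bullet> \<xi>))) * (complex_of_real (f u) * cis (y a a' \<bullet> u))))"
      unfolding integral_complex_of_real[symmetric] of_real_mult exp2
      by (intro Bochner_Integration.integral_cong refl) (simp add: sum_distrib_left split_beta mult_ac)
    also have "\<dots> = (\<Sum>(a, a')\<in>{..2 * n} \<times> {..2 * n}. (\<alpha> a * \<alpha> a' * cis (- (y a a' \<bullet> \<xi>))) * (LINT u|lborel. complex_of_real (f u) * cis (y a a' \<bullet> u)))"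
      using ci by (subst Bochner_Integration.integral_sum) (auto simp: split_beta)
    finally show ?thesis
      unfolding sub of_real_mult b_def by (simp add: sum_distrib_left split_beta mult_ac)
  qed
  then show "\<exists>b. \<forall>\<xi>. complex_of_real (LINT t|lborel. f (\<xi> + real m *\<^sub>R t) * cos_kernel2 q t)
      = (\<Sum>(a, a')\<in>{..2 * q ^ 4} \<times> {..2 * q ^ 4}. b a a' *
          cis (- (vector [(real a - real (q ^ 4)) / (real m * real q), (real a' - real (q ^ 4)) / (real m * real q)] \<bullet> \<xi>)))"
    unfolding y_def n_def by blast
  have "\<bar>LINT u|lborel. f u * cos_kernel2 q ((1 / real m) *\<^sub>R (u - \<xi>))\<bar> \<le> (LINT u|lborel. B * indicator (square A) u)"
  proof (rule integral_abs_bound[THEN order.trans], rule integral_mono)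
    have le: "\<bar>f u * cos_kernel2 q ((1 / real m) *\<^sub>R (u - \<xi>))\<bar> \<le> B * indicator (square A) u" for u
    proof -
      have "\<bar>f u\<bar> * \<bar>cos_kernel2 q ((1 / real m) *\<^sub>R (u - \<xi>))\<bar> \<le> (B * indicator (square A) u) * 1"
        using dom[of u] cos_kernel2_bounds B0 by (intro mult_mono) (auto simp: indicator_def)
      then show ?thesis by (simp add: abs_mult)
    qed
    show "integrable lborel (\<lambda>u. \<bar>f u * cos_kernel2 q ((1 / real m) *\<^sub>R (u - \<xi>))\<bar>)"
      by (rule Bochner_Integration.integrable_bound[OF square_integral(1)[OF A, of B]])
         (use le B0 in \<open>auto intro!: AE_I2 simp: abs_mult\<close>)
    show "integrable lborel (\<lambda>u. B * indicator (square A) u)" by (rule square_integral(1)[OF A])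
    show "\<bar>f u * cos_kernel2 q ((1 / real m) *\<^sub>R (u - \<xi>))\<bar> \<le> B * indicator (square A) u" for u by (rule le)
  qed
  also have "\<dots> = B * (4 * A\<^sup>2)" by (rule square_integral(2)[OF A])
  finally have le: "\<bar>LINT u|lborel. f u * cos_kernel2 q ((1 / real m) *\<^sub>R (u - \<xi>))\<bar> \<le> B * (4 * A\<^sup>2)" .
  have "1 / (real m)\<^sup>2 \<le> 1" using m by simp
  then have "1 / (real m)\<^sup>2 * \<bar>LINT u|lborel. f u * cos_kernel2 q ((1 / real m) *\<^sub>R (u - \<xi>))\<bar> \<le> 1 * (B * (4 * A\<^sup>2))"
    using le by (intro mult_mono) auto
  then show "\<bar>LINT t|lborel. f (\<xi> + real m *\<^sub>R t) * cos_kernel2 q t\<bar> \<le> B * (4 * A\<^sup>2)"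
    unfolding sub abs_mult by simp
qed

definition kernel_mass :: "nat \<Rightarrow> real" where
  "kernel_mass q = (LINT t|lborel. indicator (square (pi * real q)) t * cos_kernel2 q t)"

lemma kernel_integrable:
  fixes g :: "real^2 \<Rightarrow> real"
  assumes [measurable]: "g \<in> borel_measurable borel" and g: "\<And>t. t \<in> square (pi * real q) \<Longrightarrow> \<bar>g t\<bar> \<le> B" and B: "B \<ge> 0"
  shows "integrable lborel (\<lambda>t. indicator (square (pi * real q)) t * cos_kernel2 q t * g t)"
proof (rule Bochner_Integration.integrable_bound)
  show "integrable lborel (\<lambda>t. B * indicator (square (pi * real q)) t)" by (rule square_integral) simp
  show "AE t in lborel. norm (indicator (square (pi * real q)) t * cos_kernel2 q t * g t) \<le> norm (B * indicator (square (pi * real q)) t)"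
  proof (rule AE_I2)
    fix t
    show "norm (indicator (square (pi * real q)) t * cos_kernel2 q t * g t) \<le> norm (B * indicator (square (pi * real q)) t)"
      using g[of t] B cos_kernel2_bounds[of q t] mult_mono[of "cos_kernel2 q t" 1 "\<bar>g t\<bar>" B]
      by (auto simp: indicator_def abs_mult)
  qed
qed measurable

text \<open>The kernel is at least \<open>1/2\<close> on a square of side \<open>2 / q\<close>.\<close>

lemma kernel_mass_lower:
  assumes q: "q \<ge> 1"
  shows "1 / (real q)\<^sup>2 \<le> kernel_mass q"
proof -
  have q1: "real q \<ge> 1" using q by simp
  have sub: "t \<in> square (pi * real q)" if "t \<in> square (1 / real q)" for t
  proof -
    have "1 / real q \<le> 1" using q1 by simp
    moreover have "1 * 1 \<le> pi * real q" using q1 pi_gt3 by (intro mult_mono) auto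
    ultimately have "1 / real q \<le> pi * real q" by linarith
    then show ?thesis using that unfolding in_square by linarith
  qed
  have "(LINT t|lborel. (1/2) * indicator (square (1 / real q)) t) \<le> kernel_mass q"
    unfolding kernel_mass_def
  proof (rule integral_mono)
    show "integrable lborel (\<lambda>t. (1/2) * indicator (square (1 / real q)) t :: real)"
      by (rule square_integral) simp
    show "integrable lborel (\<lambda>t. indicator (square (pi * real q)) t * cos_kernel2 q t)"
      using kernel_integrable[of "\<lambda>_. 1" q 1] by simp
    fix t :: "real^2"
    show "(1/2) * indicator (square (1 / real q)) t \<le> indicator (square (pi * real q)) t * cos_kernel2 q t"
    proof (cases "t \<in> square (1 / real q)")
      case True
      then have "3/4 \<le> cos_kernel q (t$1)" "3/4 \<le> cos_kernel q (t$2)"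
        using cos_kernel_lower[OF q, of "t$1"] cos_kernel_lower[OF q, of "t$2"] unfolding in_square by blast+
      then have "3/4 * (3/4) \<le> cos_kernel2 q t" unfolding cos_kernel2_def by (intro mult_mono) auto
      then show ?thesis using True sub[OF True] by simp
    qed (simp add: cos_kernel2_bounds indicator_def)
  qed
  moreover have "(LINT t|lborel. (1/2) * indicator (square (1 / real q)) t) = (1/2) * (4 * (1 / real q)\<^sup>2)"
    by (rule square_integral) simp
  ultimately have "2 / (real q)\<^sup>2 \<le> kernel_mass q" by (simp add: power_divide)
  moreover have "1 / (real q)\<^sup>2 \<le> 2 / (real q)\<^sup>2" by (intro divide_right_mono) auto
  ultimately show ?thesis by linarith
qed

text \<open>On the period square the kernel is at most \<open>exp (- (q * |t|)\<^sup>2 / 16)\<close>, which absorbs \<open>(q * |t|) ^ n\<close>; the area of the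
square accounts for the factor \<open>q\<^sup>2\<close>.\<close>

lemma kernel_moment:
  "\<exists>D\<ge>0. \<forall>q\<ge>1. (LINT t|lborel. indicator (square (pi * real q)) t * cos_kernel2 q t * norm t ^ n) \<le> D * (real q)\<^sup>2 / real q ^ n"
proof -
  have c0: "(0::real) < 1/16" by simp
  obtain D where D0: "D \<ge> 0 \<and> (\<forall>y\<ge>(0::real). y ^ n \<le> D * exp (1/16 * y\<^sup>2))"
    using power_gauss_bounded[OF c0, of n] ..
  then have D: "D \<ge> 0" "\<And>y::real. y \<ge> 0 \<Longrightarrow> y ^ n \<le> D * exp (1/16 * y\<^sup>2)"
    by auto
  have "(LINT t|lborel. indicator (square (pi * real q)) t * cos_kernel2 q t * norm t ^ n) \<le> (D * (4 * pi\<^sup>2)) * (real q)\<^sup>2 / real q ^ n"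
    if q: "q \<ge> 1" for q
  proof -
    have q1: "real q \<ge> 1" using q by simp
    define a where "a = pi * real q"
    have a: "a \<ge> 0" by (simp add: a_def)
    have pt: "indicator (square a) t * cos_kernel2 q t * norm t ^ n \<le> D / real q ^ n * indicator (square a) t" for t :: "real^2"
    proof (cases "t \<in> square a")
      case True
      have "cos_kernel2 q t \<le> exp (- (real q * t$1)\<^sup>2 / 16) * exp (- (real q * t$2)\<^sup>2 / 16)"
        unfolding cos_kernel2_def using True q
        by (intro mult_mono cos_kernel_upper cos_kernel_nonneg) (auto simp: in_square a_def)
      also have "\<dots> = exp (- (1/16 * (real q * norm t)\<^sup>2))"
        unfolding exp_add[symmetric] power_mult_distrib norm_vec2 by (simp add: algebra_simps add_divide_distrib)
      finally have k: "cos_kernel2 q t \<le> exp (- (1/16 * (real q * norm t)\<^sup>2))" .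
      have "cos_kernel2 q t * (real q * norm t) ^ n \<le> exp (- (1/16 * (real q * norm t)\<^sup>2)) * (D * exp (1/16 * (real q * norm t)\<^sup>2))"
        using D(2)[of "real q * norm t"] by (intro mult_mono k) (auto intro!: mult_nonneg_nonneg D(1) zero_le_power)
      also have "\<dots> = D" by (simp add: mult_exp_exp mult.left_commute)
      finally have "cos_kernel2 q t * norm t ^ n \<le> D / real q ^ n"
        using q1 by (simp add: power_mult_distrib field_simps)
      then show ?thesis using True by simp
    qed simp
    have nle: "norm t ^ n \<le> (2 * a) ^ n" if "t \<in> square a" for t
      using norm_vec2_le[of t] that by (intro power_mono) (auto simp: in_square)
    have "(LINT t|lborel. indicator (square a) t * cos_kernel2 q t * norm t ^ n) \<le> (LINT t|lborel. D / real q ^ n * indicator (square a) t)"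
    proof (rule integral_mono)
      show "integrable lborel (\<lambda>t. indicator (square a) t * cos_kernel2 q t * norm t ^ n)"
        unfolding a_def by (rule kernel_integrable[where B = "(2 * a) ^ n"]) (use nle a in \<open>auto simp: a_def\<close>)
    qed (use pt square_integral(1)[OF a] in auto)
    also have "\<dots> = D / real q ^ n * (4 * a\<^sup>2)" by (rule square_integral(2)[OF a])
    also have "\<dots> = (D * (4 * pi\<^sup>2)) * (real q)\<^sup>2 / real q ^ n" by (simp add: a_def power_mult_distrib)
    finally show ?thesis by (simp add: a_def)
  qed
  then show ?thesis using D(1) by (intro exI[of _ "D * (4 * pi\<^sup>2)"]) auto
qed

section \<open>Approximation by trigonometric sums\<close>

text \<open>Let \<open>c\<close> be the coefficients of the \<open>R\<close>-th difference. Combining the kernel averages of \<open>f (\<xi> + m t)\<close> for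
\<open>m = 1, \<dots>, R\<close> with weights \<open>- c m\<close> reproduces \<open>f \<xi>\<close> up to an average of \<open>line_diff R t f\<close>, which is
small since the kernel is concentrated at \<open>t = 0\<close>. This average is taken over one period of
the kernel, whereas the trigonometric sum arises from integrals over the plane, so \<open>f (\<xi> + m t)\<close> has
to vanish for all other \<open>t\<close>; this is the case if \<open>\<xi>\<close> lies in a
square of half-side \<open>pi * q - A\<close>. For the other \<open>\<xi>\<close> both \<open>f\<close> and the sum are at most of order \<open>q\<^sup>2\<close>, and
\<open>q \<le> |\<xi>| + A\<close>, so that the tolerance \<open>exp (|\<xi>|\<^sup>2 / 8)\<close> outweighs any power of \<open>q\<close>.\<close>

theorem trigonometric_approximation:
  fixes f :: "'i \<Rightarrow> real^2 \<Rightarrow> real"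
  assumes meas: "\<And>i. f i \<in> borel_measurable borel"
    and supp: "\<And>i u. f i u \<noteq> 0 \<Longrightarrow> u \<in> square A" and A: "A \<ge> 0"
    and bd: "\<And>i u. \<bar>f i u\<bar> \<le> B"
    and diff: "\<And>n. \<exists>E\<ge>0. \<forall>i t \<xi>. \<bar>line_diff n t (f i) \<xi>\<bar> \<le> E * norm t ^ n"
  shows "\<exists>C\<ge>0. \<forall>i. \<forall>q\<ge>1. \<exists>(Y :: (nat \<times> nat \<times> nat) set) c y. finite Y \<and> card Y \<le> (r + 4) * (2 * q ^ 4 + 1)\<^sup>2 \<and>
     (\<forall>\<xi>. norm ((\<Sum>z\<in>Y. c z * cis (- (y z \<bullet> \<xi>))) - complex_of_real (f i \<xi>)) \<le> C / real q ^ r * exp ((norm \<xi>)\<^sup>2 / 8))"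
proof -
  note [measurable] = meas
  \<comment> \<open>four powers of \<open>q\<close> are lost, two in \<open>kernel_moment\<close> and two in the division by the mass of the kernel\<close>
  define R where "R = r + 4"
  have B0: "B \<ge> 0" using bd[of undefined 0] by linarith
  obtain c :: "nat \<Rightarrow> real" where c0: "c 0 = 1"
    and c: "\<And>f t \<xi>. line_diff R t f \<xi> = (\<Sum>m\<le>R. c m * f (\<xi> + real m *\<^sub>R t))"
    using line_diff_expand[of R] by blast
  obtain E where E: "E \<ge> 0" "\<And>i t \<xi>. \<bar>line_diff R t (f i) \<xi>\<bar> \<le> E * norm t ^ R"
    using diff[of R] by blast
  obtain D where D: "D \<ge> 0" "\<And>q. q \<ge> 1 \<Longrightarrow> (LINT t|lborel. indicator (square (pi * real q)) t * cos_kernel2 q t * norm t ^ R) \<le> D * (real q)\<^sup>2 / real q ^ R"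
    using kernel_moment[of R] by blast
  define I where "I i q m \<xi> = (LINT t|lborel. f i (\<xi> + real m *\<^sub>R t) * cos_kernel2 q t)" for i q m \<xi>
  define Z where "Z q = kernel_mass q" for q
  have Z: "1 / (real q)\<^sup>2 \<le> Z q" "Z q > 0" if "q \<ge> 1" for q
  proof -
    show le: "1 / (real q)\<^sup>2 \<le> Z q" unfolding Z_def by (rule kernel_mass_lower[OF that])
    have "0 < 1 / (real q)\<^sup>2" using that by simp
    then show "Z q > 0" using le by linarith
  qed
  have iZ: "1 / Z q \<le> (real q)\<^sup>2" if "q \<ge> 1" for q
    using Z[OF that] that by (simp add: field_simps)
  define T where "T i q \<xi> = - (\<Sum>m\<in>{1..R}. c m * I i q m \<xi>) / Z q" for i q \<xi>
  have inside: "\<bar>T i q \<xi> - f i \<xi>\<bar> \<le> E * D / real q ^ r"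
    if q: "q \<ge> 1" and \<xi>: "\<bar>\<xi>$1\<bar> \<le> pi * real q - A" "\<bar>\<xi>$2\<bar> \<le> pi * real q - A" for i q \<xi>
  proof -
    define K where "K t = indicator (square (pi * real q)) t * cos_kernel2 q t" for t
    have Km[measurable]: "K \<in> borel_measurable borel" unfolding K_def[abs_def] by measurable
    have Ki: "integrable lborel (\<lambda>t. K t * f i (\<xi> + real m *\<^sub>R t))" for m
      unfolding K_def by (rule kernel_integrable[where B = B]) (use bd B0 in auto)
    have IK: "I i q m \<xi> = (LINT t|lborel. K t * f i (\<xi> + real m *\<^sub>R t))" if m: "m \<ge> 1" for m
      unfolding I_def
    proof (intro Bochner_Integration.integral_cong refl)
      fix t :: "real^2"
      show "f i (\<xi> + real m *\<^sub>R t) * cos_kernel2 q t = K t * f i (\<xi> + real m *\<^sub>R t)"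
      proof (cases "f i (\<xi> + real m *\<^sub>R t) = 0")
        case False
        have "\<xi> + real m *\<^sub>R t \<in> square A" by (rule supp[OF False])
        then have s: "\<bar>\<xi>$1 + real m * t$1\<bar> \<le> A" "\<bar>\<xi>$2 + real m * t$2\<bar> \<le> A" by (auto simp: in_square)
        have mt: "\<bar>x\<bar> \<le> \<bar>real m * x\<bar>" for x
          using m mult_right_mono[of 1 "real m" "\<bar>x\<bar>"] by (simp add: abs_mult)
        have "t \<in> square (pi * real q)"
          unfolding in_square using s \<xi> mt[of "t$1"] mt[of "t$2"] by linarith
        then show ?thesis by (simp add: K_def)
      qed simp
    qed
    have ZK: "(LINT t|lborel. K t * f i (\<xi> + real 0 *\<^sub>R t)) = Z q * f i \<xi>"
      by (simp add: Z_def kernel_mass_def K_def)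
    have "Z q * (f i \<xi> - T i q \<xi>) = Z q * f i \<xi> + (\<Sum>m\<in>{1..R}. c m * I i q m \<xi>)"
      using Z(2)[OF q] by (simp add: T_def field_simps)
    also have "\<dots> = (\<Sum>m\<le>R. c m * (LINT t|lborel. K t * f i (\<xi> + real m *\<^sub>R t)))"
    proof -
      have "{..R} = insert 0 {1..R}" by auto
      then have sp: "(\<Sum>m\<le>R. g m) = g 0 + (\<Sum>m\<in>{1..R}. g m)" for g :: "nat \<Rightarrow> real" by simp
      show ?thesis unfolding sp ZK c0 using IK by simp
    qed
    also have "\<dots> = (LINT t|lborel. (\<Sum>m\<le>R. c m * (K t * f i (\<xi> + real m *\<^sub>R t))))"
      using Ki by simp
    also have "\<dots> = (LINT t|lborel. K t * line_diff R t (f i) \<xi>)"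
      by (intro Bochner_Integration.integral_cong refl) (simp add: c sum_distrib_left mult_ac)
    finally have eq: "Z q * (f i \<xi> - T i q \<xi>) = (LINT t|lborel. K t * line_diff R t (f i) \<xi>)" .
    have K0: "K t \<ge> 0" for t using cos_kernel2_bounds by (simp add: K_def)
    have ldm: "(\<lambda>t. line_diff R t (f i) \<xi>) \<in> borel_measurable borel"
      unfolding c by measurable
    have nle: "norm t ^ R \<le> (2 * (pi * real q)) ^ R" if "t \<in> square (pi * real q)" for t
      using norm_vec2_le[of t] that by (intro power_mono) (auto simp: in_square)
    have Kni: "integrable lborel (\<lambda>t. K t * (E * norm t ^ R))"
      unfolding K_def by (rule kernel_integrable[where B = "E * (2 * (pi * real q)) ^ R"])
        (use nle E(1) in \<open>auto simp: abs_mult intro!: mult_left_mono\<close>)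
    have "\<bar>LINT t|lborel. K t * line_diff R t (f i) \<xi>\<bar> \<le> (LINT t|lborel. K t * (E * norm t ^ R))"
    proof (rule integral_abs_bound[THEN order.trans], rule integral_mono)
      show le: "\<bar>K t * line_diff R t (f i) \<xi>\<bar> \<le> K t * (E * norm t ^ R)" for t
        using E(2) K0 by (simp add: abs_mult mult_left_mono)
      show "integrable lborel (\<lambda>t. \<bar>K t * line_diff R t (f i) \<xi>\<bar>)"
        by (rule Bochner_Integration.integrable_bound[OF Kni]) (use ldm le K0 E in \<open>auto intro!: AE_I2 simp: abs_mult\<close>)
    qed (rule Kni)
    also have "\<dots> = E * (LINT t|lborel. indicator (square (pi * real q)) t * cos_kernel2 q t * norm t ^ R)"
      by (simp add: K_def mult.left_commute)
    also have "\<dots> \<le> E * (D * (real q)\<^sup>2 / real q ^ R)"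
      by (intro mult_left_mono D E q)
    finally have "Z q * \<bar>f i \<xi> - T i q \<xi>\<bar> \<le> E * (D * (real q)\<^sup>2 / real q ^ R)"
      unfolding eq[symmetric] using Z(2)[OF q] by (simp add: abs_mult)
    then have "1 / Z q * (Z q * \<bar>f i \<xi> - T i q \<xi>\<bar>) \<le> 1 / Z q * (E * (D * (real q)\<^sup>2 / real q ^ R))"
      using Z(2)[OF q] by (intro mult_left_mono) auto
    moreover have "1 / Z q * (Z q * \<bar>f i \<xi> - T i q \<xi>\<bar>) = \<bar>f i \<xi> - T i q \<xi>\<bar>"
      using Z(2)[OF q] by simp
    ultimately have "\<bar>f i \<xi> - T i q \<xi>\<bar> \<le> 1 / Z q * (E * (D * (real q)\<^sup>2 / real q ^ R))"
      by linarith
    also have "\<dots> \<le> (real q)\<^sup>2 * (E * (D * (real q)\<^sup>2 / real q ^ R))"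
      using E D by (intro mult_right_mono iZ q) auto
    also have "\<dots> = E * D / real q ^ r"
      using q by (simp add: R_def power_add eval_nat_numeral field_simps)
    finally show ?thesis by (simp add: abs_minus_commute)
  qed
  define S where "S = (\<Sum>m\<in>{1..R}. \<bar>c m\<bar>) * (B * (4 * A\<^sup>2))"
  have S0: "S \<ge> 0" using B0 by (simp add: S_def sum_nonneg)
  have Tb: "\<bar>T i q \<xi>\<bar> \<le> S * (real q)\<^sup>2" if q: "q \<ge> 1" for i q \<xi>
  proof -
    have "\<bar>\<Sum>m\<in>{1..R}. c m * I i q m \<xi>\<bar> \<le> (\<Sum>m\<in>{1..R}. \<bar>c m\<bar> * (B * (4 * A\<^sup>2)))"
    proof (rule order.trans[OF sum_abs], rule sum_mono)
      fix m assume m: "m \<in> {1..R}"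
      have "\<bar>I i q m \<xi>\<bar> \<le> B * (4 * A\<^sup>2)"
        unfolding I_def by (rule kernel_average_trig(2)[OF meas supp bd A _ q]) (use m in auto)
      then show "\<bar>c m * I i q m \<xi>\<bar> \<le> \<bar>c m\<bar> * (B * (4 * A\<^sup>2))" by (simp add: abs_mult mult_left_mono)
    qed
    then have s: "\<bar>\<Sum>m\<in>{1..R}. c m * I i q m \<xi>\<bar> \<le> S" by (simp add: S_def sum_distrib_right)
    have "\<bar>T i q \<xi>\<bar> = \<bar>\<Sum>m\<in>{1..R}. c m * I i q m \<xi>\<bar> * (1 / Z q)"
      using Z(2)[OF q] by (simp add: T_def abs_mult)
    also have "\<dots> \<le> S * (real q)\<^sup>2"
      using s iZ[OF q] Z(2)[OF q] S0 by (intro mult_mono) auto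
    finally show ?thesis .
  qed
  \<comment> \<open>a small exponent, because \<open>(|\<xi>| + A)\<^sup>2 \<le> 2 * |\<xi>|\<^sup>2 + 2 * A\<^sup>2\<close>\<close>
  have c8: "(0::real) < 1/32" by simp
  obtain G where G0: "G \<ge> 0 \<and> (\<forall>y\<ge>(0::real). y ^ (r + 2) \<le> G * exp (1/32 * y\<^sup>2))"
    using power_gauss_bounded[OF c8, of "r + 2"] ..
  then have G: "G \<ge> 0" "\<And>y::real. y \<ge> 0 \<Longrightarrow> y ^ (r + 2) \<le> G * exp (1/32 * y\<^sup>2)" by auto
  define G' where "G' = G * exp (A\<^sup>2 / 16)"
  have shifted: "(real q) ^ (r + 2) \<le> G' * exp ((norm \<xi>)\<^sup>2 / 8)" if "real q \<le> norm \<xi> + A" for q and \<xi> :: "real^2"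
  proof -
    have "(real q) ^ (r + 2) \<le> (norm \<xi> + A) ^ (r + 2)" using that by (intro power_mono) auto
    also have "\<dots> \<le> G * exp (1/32 * (norm \<xi> + A)\<^sup>2)" using A by (intro G) simp
    also have "\<dots> \<le> G * exp (A\<^sup>2 / 16 + (norm \<xi>)\<^sup>2 / 8)"
    proof (rule mult_left_mono[OF _ G(1)])
      have "(norm \<xi> + A)\<^sup>2 \<le> 2 * (norm \<xi>)\<^sup>2 + 2 * A\<^sup>2"
        using sum_squares_bound[of "norm \<xi>" A] by (simp add: power2_sum)
      moreover have "0 \<le> (norm \<xi>)\<^sup>2" by simp
      ultimately have "1/32 * (norm \<xi> + A)\<^sup>2 \<le> A\<^sup>2 / 16 + (norm \<xi>)\<^sup>2 / 8" by linarith
      then show "exp (1/32 * (norm \<xi> + A)\<^sup>2) \<le> exp (A\<^sup>2 / 16 + (norm \<xi>)\<^sup>2 / 8)" by simp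
    qed
    also have "\<dots> = G' * exp ((norm \<xi>)\<^sup>2 / 8)" by (simp add: G'_def exp_add)
    finally show ?thesis .
  qed
  define C where "C = E * D + (S + B) * G'"
  have C0: "C \<ge> 0" using E D S0 B0 G by (simp add: C_def G'_def)
  have err: "\<bar>T i q \<xi> - f i \<xi>\<bar> \<le> C / real q ^ r * exp ((norm \<xi>)\<^sup>2 / 8)" if q: "q \<ge> 1" for i q \<xi>
  proof (cases "\<bar>\<xi>$1\<bar> \<le> pi * real q - A \<and> \<bar>\<xi>$2\<bar> \<le> pi * real q - A")
    case True
    have "\<bar>T i q \<xi> - f i \<xi>\<bar> \<le> E * D / real q ^ r * 1"
      using inside[OF q, of \<xi> i] True by simp
    also have "\<dots> \<le> C / real q ^ r * exp ((norm \<xi>)\<^sup>2 / 8)"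
      using E D S0 B0 G C0 by (intro mult_mono divide_right_mono) (auto simp: C_def G'_def)
    finally show ?thesis .
  next
    case False
    have "pi * real q - A < norm \<xi>"
      using False component_le_norm_cart[of \<xi> 1] component_le_norm_cart[of \<xi> 2] by linarith
    moreover have "1 * real q \<le> pi * real q" using pi_gt3 by (intro mult_right_mono) auto
    ultimately have "real q \<le> norm \<xi> + A" by linarith
    then have sh: "(real q) ^ (r + 2) \<le> G' * exp ((norm \<xi>)\<^sup>2 / 8)" by (rule shifted)
    have q1: "1 \<le> (real q)\<^sup>2" using q by simp
    have "\<bar>T i q \<xi> - f i \<xi>\<bar> \<le> S * (real q)\<^sup>2 + B * 1" using Tb[OF q, of i \<xi>] bd[of i \<xi>] by linarith
    also have "\<dots> \<le> (S + B) * (real q)\<^sup>2"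
      using mult_left_mono[OF q1 B0] by (simp add: distrib_right)
    also have "\<dots> = (S + B) * (real q ^ (r + 2)) / real q ^ r" using q by (simp add: power_add power2_eq_square)
    also have "\<dots> \<le> (S + B) * (G' * exp ((norm \<xi>)\<^sup>2 / 8)) / real q ^ r"
      using S0 B0 by (intro divide_right_mono mult_left_mono sh) auto
    also have "\<dots> = (S + B) * G' / real q ^ r * exp ((norm \<xi>)\<^sup>2 / 8)" by simp
    also have "\<dots> \<le> C / real q ^ r * exp ((norm \<xi>)\<^sup>2 / 8)"
      using E D by (intro mult_right_mono divide_right_mono) (auto simp: C_def)
    finally show ?thesis .
  qed
  have "\<exists>(Y :: (nat \<times> nat \<times> nat) set) c y. finite Y \<and> card Y \<le> (r + 4) * (2 * q ^ 4 + 1)\<^sup>2 \<and>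
     (\<forall>\<xi>. norm ((\<Sum>z\<in>Y. c z * cis (- (y z \<bullet> \<xi>))) - complex_of_real (f i \<xi>)) \<le> C / real q ^ r * exp ((norm \<xi>)\<^sup>2 / 8))"
    if q: "q \<ge> 1" for i q
  proof -
    define y :: "nat \<Rightarrow> nat \<Rightarrow> nat \<Rightarrow> real^2" where
      "y m a a' = vector [(real a - real (q ^ 4)) / (real m * real q), (real a' - real (q ^ 4)) / (real m * real q)]" for m a a'
    define N where "N = {..2 * q ^ 4} \<times> {..2 * q ^ 4}"
    have supp': "f i u \<noteq> 0 \<Longrightarrow> u \<in> square A" for u by (rule supp)
    have "\<forall>m. \<exists>b. m \<ge> 1 \<longrightarrow> (\<forall>\<xi>. complex_of_real (I i q m \<xi>) = (\<Sum>(a, a')\<in>N. b a a' * cis (- (y m a a' \<bullet> \<xi>))))"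
    proof
      fix m
      show "\<exists>b. m \<ge> 1 \<longrightarrow> (\<forall>\<xi>. complex_of_real (I i q m \<xi>) = (\<Sum>(a, a')\<in>N. b a a' * cis (- (y m a a' \<bullet> \<xi>))))"
        using kernel_average_trig(1)[where f = "f i" and m = m, OF meas supp' bd A _ q] unfolding I_def y_def N_def by blast
    qed
    from choice[OF this] obtain b where
      b0: "\<forall>m. m \<ge> 1 \<longrightarrow> (\<forall>\<xi>. complex_of_real (I i q m \<xi>) = (\<Sum>(a, a')\<in>N. b m a a' * cis (- (y m a a' \<bullet> \<xi>))))" ..
    then have b: "m \<ge> 1 \<Longrightarrow> complex_of_real (I i q m \<xi>) = (\<Sum>(a, a')\<in>N. b m a a' * cis (- (y m a a' \<bullet> \<xi>)))" for m \<xi>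
      by blast
    define Y where "Y = {1..R} \<times> N"
    define cc where "cc z = - complex_of_real (c (fst z) / Z q) * b (fst z) (fst (snd z)) (snd (snd z))" for z
    define yy where "yy z = y (fst z) (fst (snd z)) (snd (snd z))" for z
    have "(\<Sum>z\<in>Y. cc z * cis (- (yy z \<bullet> \<xi>))) = complex_of_real (T i q \<xi>)" for \<xi>
    proof -
      have "complex_of_real (T i q \<xi>) = (\<Sum>m\<in>{1..R}. - complex_of_real (c m / Z q) * complex_of_real (I i q m \<xi>))"
        unfolding T_def by (simp add: sum_negf sum_divide_distrib)
      also have "\<dots> = (\<Sum>m\<in>{1..R}. \<Sum>w\<in>N. cc (m, w) * cis (- (yy (m, w) \<bullet> \<xi>)))"
        by (intro sum.cong refl) (simp add: b cc_def yy_def sum_distrib_left split_beta mult.assoc)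
      also have "\<dots> = (\<Sum>z\<in>Y. cc z * cis (- (yy z \<bullet> \<xi>)))"
        unfolding Y_def sum.cartesian_product by (simp add: split_beta)
      finally show ?thesis ..
    qed
    then have "norm ((\<Sum>z\<in>Y. cc z * cis (- (yy z \<bullet> \<xi>))) - complex_of_real (f i \<xi>)) \<le> C / real q ^ r * exp ((norm \<xi>)\<^sup>2 / 8)" for \<xi>
      using err[OF q, of i \<xi>] by (simp flip: of_real_diff)
    moreover have "finite Y" by (simp add: Y_def N_def)
    moreover have "card Y \<le> (r + 4) * (2 * q ^ 4 + 1)\<^sup>2"
      by (simp add: Y_def N_def R_def card_cartesian_product power2_eq_square)
    ultimately show ?thesis by blast
  qed
  with C0 show ?thesis by blast
qed

text \<open>With \<open>M\<close> terms \<open>q\<close> can be of order \<open>M powr (1/8)\<close>; therefore \<open>r = 8 * K\<close>. The factor \<open>3\<close> leaves room for a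
multiplication by \<open>4 * sin\<^sup>2 (\<xi>\<^sub>1 / 4)\<close>.\<close>

corollary trigonometric_approximation_budget:
  fixes f :: "'i \<Rightarrow> real^2 \<Rightarrow> real"
  assumes meas: "\<And>i. f i \<in> borel_measurable borel"
    and supp: "\<And>i u. f i u \<noteq> 0 \<Longrightarrow> u \<in> square A" and A: "A \<ge> 0"
    and bd: "\<And>i u. \<bar>f i u\<bar> \<le> B"
    and diff: "\<And>n. \<exists>E\<ge>0. \<forall>i t \<xi>. \<bar>line_diff n t (f i) \<xi>\<bar> \<le> E * norm t ^ n"
  shows "\<exists>C\<ge>0. \<forall>i. \<forall>M\<ge>1. \<exists>(Y :: (nat \<times> nat \<times> nat) set) c y. finite Y \<and> 3 * card Y \<le> M \<and>
     (\<forall>\<xi>. norm ((\<Sum>z\<in>Y. c z * cis (- (y z \<bullet> \<xi>))) - complex_of_real (f i \<xi>)) \<le> C / real M ^ K * exp ((norm \<xi>)\<^sup>2 / 8))"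
proof -
  have B0: "B \<ge> 0" using bd[of undefined 0] by linarith
  \<comment> \<open>chosen such that \<open>3 * (8 * K + 4) * (2 * q ^ 4 + 1)\<^sup>2 \<le> L * q ^ 8\<close>\<close>
  define L where "L = 27 * (8 * K + 4)"
  have L1: "L \<ge> 1" by (simp add: L_def)
  obtain C where C0: "C \<ge> 0 \<and> (\<forall>i. \<forall>q\<ge>1. \<exists>(Y :: (nat \<times> nat \<times> nat) set) c y. finite Y \<and> card Y \<le> (8 * K + 4) * (2 * q ^ 4 + 1)\<^sup>2 \<and>
     (\<forall>\<xi>. norm ((\<Sum>z\<in>Y. c z * cis (- (y z \<bullet> \<xi>))) - complex_of_real (f i \<xi>)) \<le> C / real q ^ (8 * K) * exp ((norm \<xi>)\<^sup>2 / 8)))"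
    using trigonometric_approximation[where f = f and r = "8 * K", OF meas supp A bd diff] ..
  then have C: "C \<ge> 0" by (rule conjunct1)
  define C' where "C' = (C + B) * (256 * real L) ^ K"
  have C'0: "C' \<ge> 0" using C B0 by (simp add: C'_def)
  have "\<exists>(Y :: (nat \<times> nat \<times> nat) set) c y. finite Y \<and> 3 * card Y \<le> M \<and>
     (\<forall>\<xi>. norm ((\<Sum>z\<in>Y. c z * cis (- (y z \<bullet> \<xi>))) - complex_of_real (f i \<xi>)) \<le> C' / real M ^ K * exp ((norm \<xi>)\<^sup>2 / 8))"
    if M: "M \<ge> 1" for i M
  proof (cases "M < L")
    case True
    have M0: "real M > 0" using M by simp
    have "B \<le> C' / real M ^ K"
    proof -
      have "real M ^ K \<le> (256 * real L) ^ K" using True by (intro power_mono) auto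
      then have "B * real M ^ K \<le> (C + B) * (256 * real L) ^ K" using C B0 by (intro mult_mono) auto
      then show ?thesis using M0 by (simp add: C'_def field_simps)
    qed
    then have "\<bar>f i \<xi>\<bar> \<le> C' / real M ^ K * exp ((norm \<xi>)\<^sup>2 / 8)" for \<xi>
      using bd[of i \<xi>] mult_mono[of "\<bar>f i \<xi>\<bar>" "C' / real M ^ K" 1 "exp ((norm \<xi>)\<^sup>2 / 8)"] C'0 by simp
    \<comment> \<open>for budgets below \<open>L\<close> the empty sum is good enough\<close>
    then show ?thesis by (intro exI[of _ "{}"]) simp
  next
    case False
    define q where "q = (LEAST q. M < L * (q + 1) ^ 8)"
    have ex: "M < L * (M + 1) ^ 8"
    proof -
      have "M + 1 \<le> (M + 1) ^ 8" by (rule self_le_power) auto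
      also have "\<dots> \<le> L * (M + 1) ^ 8" using L1 by simp
      finally show ?thesis by simp
    qed
    have q1: "M < L * (q + 1) ^ 8" unfolding q_def by (rule LeastI[of _ M]) (rule ex)
    have q0: "q \<noteq> 0" using q1 False by (cases q) auto
    have "\<not> M < L * ((q - 1) + 1) ^ 8"
      using not_less_Least[of "q - 1" "\<lambda>q. M < L * (q + 1) ^ 8"] q0 unfolding q_def[symmetric] by simp
    then have q2: "L * q ^ 8 \<le> M" using q0 by simp
    have q: "q \<ge> 1" using q0 by simp
    obtain Y :: "(nat \<times> nat \<times> nat) set" and c y where Y: "finite Y" "card Y \<le> (8 * K + 4) * (2 * q ^ 4 + 1)\<^sup>2"
      "\<And>\<xi>. norm ((\<Sum>z\<in>Y. c z * cis (- (y z \<bullet> \<xi>))) - complex_of_real (f i \<xi>)) \<le> C / real q ^ (8 * K) * exp ((norm \<xi>)\<^sup>2 / 8)"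
      using C0[THEN conjunct2, THEN spec[of _ i], THEN spec[of _ q], THEN mp, OF q] by (elim exE conjE) blast
    have "2 * q ^ 4 + 1 \<le> 3 * q ^ 4" using q by simp
    then have "(2 * q ^ 4 + 1)\<^sup>2 \<le> (3 * q ^ 4)\<^sup>2" by (intro power_mono) auto
    also have "\<dots> = 9 * q ^ 8" by (simp add: power_mult_distrib flip: power_mult)
    finally have "3 * ((8 * K + 4) * (2 * q ^ 4 + 1)\<^sup>2) \<le> 3 * ((8 * K + 4) * (9 * q ^ 8))"
      by (intro mult_left_mono) auto
    also have "\<dots> = L * q ^ 8" by (simp add: L_def)
    finally have card: "3 * card Y \<le> M" using Y(2) q2 by linarith
    have qr: "real q \<ge> 1" using q by simp
    have "real M \<le> real L * (real q + 1) ^ 8"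
      using q1 by (metis less_imp_le of_nat_1 of_nat_add of_nat_le_iff of_nat_mult of_nat_power)
    also have "\<dots> \<le> real L * (2 * real q) ^ 8" using qr by (intro mult_left_mono power_mono) auto
    also have "\<dots> = 256 * real L * real q ^ 8" by (simp add: power_mult_distrib)
    finally have "real M ^ K \<le> (256 * real L * real q ^ 8) ^ K" by (intro power_mono) auto
    also have "\<dots> = (256 * real L) ^ K * real q ^ (8 * K)" by (simp add: power_mult_distrib power_mult)
    finally have "real M ^ K \<le> (256 * real L) ^ K * real q ^ (8 * K)" .
    then have "C * real M ^ K \<le> (C + B) * ((256 * real L) ^ K * real q ^ (8 * K))" using C B0 by (intro mult_mono) auto
    then have le: "C / real q ^ (8 * K) \<le> C' / real M ^ K"
      using qr M by (simp add: C'_def field_simps)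
    have "norm ((\<Sum>z\<in>Y. c z * cis (- (y z \<bullet> \<xi>))) - complex_of_real (f i \<xi>)) \<le> C' / real M ^ K * exp ((norm \<xi>)\<^sup>2 / 8)" for \<xi>
      using Y(3)[of \<xi>] mult_right_mono[OF le, of "exp ((norm \<xi>)\<^sup>2 / 8)"] by (simp add: order_trans)
    then show ?thesis using Y(1) card by blast
  qed
  with C'0 show ?thesis by blast
qed

section \<open>Combinations of Gaussian translates and their spectra\<close>

lemma lincomb_atmost_indexed:
  assumes Z: "finite Z" "card Z \<le> M" and D: "\<And>z. z \<in> Z \<Longrightarrow> \<phi> z \<in> D"
  shows "lincomb_atmost M D (\<lambda>x. \<Sum>z\<in>Z. c z * \<phi> z x)"
  unfolding lincomb_atmost_def
proof (intro exI conjI)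
  show "finite (\<phi> ` Z)" using Z by simp
  show "card (\<phi> ` Z) \<le> M" using card_image_le[OF Z(1), of \<phi>] Z(2) by simp
  show "\<phi> ` Z \<subseteq> D" using D by auto
  show "(\<lambda>x. \<Sum>z\<in>Z. c z * \<phi> z x) = (\<lambda>x. \<Sum>s\<in>\<phi> ` Z. (\<Sum>z\<in>{z\<in>Z. \<phi> z = s}. c z) * s x)"
  proof
    fix x
    have "(\<Sum>z\<in>Z. c z * \<phi> z x) = (\<Sum>s\<in>\<phi> ` Z. \<Sum>z\<in>{z\<in>Z. \<phi> z = s}. c z * \<phi> z x)"
      by (rule sum.image_gen[OF Z(1)])
    also have "\<dots> = (\<Sum>s\<in>\<phi> ` Z. (\<Sum>z\<in>{z\<in>Z. \<phi> z = s}. c z) * s x)"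
      unfolding sum_distrib_right by (intro sum.cong refl) auto
    finally show "(\<Sum>z\<in>Z. c z * \<phi> z x) = (\<Sum>s\<in>\<phi> ` Z. (\<Sum>z\<in>{z\<in>Z. \<phi> z = s}. c z) * s x)" .
  qed
qed

definition trig_sums :: "nat \<Rightarrow> (real^2 \<Rightarrow> complex) set" where
  "trig_sums M = {T. \<exists>Y c. finite Y \<and> card Y \<le> M \<and> T = (\<lambda>\<xi>. \<Sum>y\<in>Y. c y * cis (- (y \<bullet> \<xi>)))}"

lemma trig_sums_indexed:
  assumes Z: "finite Z" "card Z \<le> M"
  shows "(\<lambda>\<xi>. \<Sum>z\<in>Z. c z * cis (- (y z \<bullet> \<xi>))) \<in> trig_sums M"
  unfolding trig_sums_def mem_Collect_eq
proof (intro exI conjI)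
  show "finite (y ` Z)" using Z by simp
  show "card (y ` Z) \<le> M" using card_image_le[OF Z(1), of y] Z(2) by simp
  show "(\<lambda>\<xi>. \<Sum>z\<in>Z. c z * cis (- (y z \<bullet> \<xi>))) = (\<lambda>\<xi>. \<Sum>u\<in>y ` Z. (\<Sum>z\<in>{z\<in>Z. y z = u}. c z) * cis (- (u \<bullet> \<xi>)))"
  proof
    fix \<xi>
    have "(\<Sum>z\<in>Z. c z * cis (- (y z \<bullet> \<xi>))) = (\<Sum>u\<in>y ` Z. \<Sum>z\<in>{z\<in>Z. y z = u}. c z * cis (- (y z \<bullet> \<xi>)))"
      by (rule sum.image_gen[OF Z(1)])
    also have "\<dots> = (\<Sum>u\<in>y ` Z. (\<Sum>z\<in>{z\<in>Z. y z = u}. c z) * cis (- (u \<bullet> \<xi>)))"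
      unfolding sum_distrib_right by (intro sum.cong refl) auto
    finally show "(\<Sum>z\<in>Z. c z * cis (- (y z \<bullet> \<xi>))) = (\<Sum>u\<in>y ` Z. (\<Sum>z\<in>{z\<in>Z. y z = u}. c z) * cis (- (u \<bullet> \<xi>)))" .
  qed
qed

lemma trig_sums_mono: "M \<le> M' \<Longrightarrow> trig_sums M \<subseteq> trig_sums M'"
  unfolding trig_sums_def by fastforce

text \<open>Since \<open>4 * sin\<^sup>2 (x / 4) = 2 - 2 * cos (x / 2)\<close>, each frequency is replaced by three.\<close>

lemma trig_sums_second_difference:
  assumes T: "T \<in> trig_sums M"
  shows "(\<lambda>\<xi>. complex_of_real (4 * (sin (\<xi>$1 / 4))\<^sup>2) * T \<xi>) \<in> trig_sums (3 * M)"
proof -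
  obtain Y c where Y: "finite Y" "card Y \<le> M" and T: "T = (\<lambda>\<xi>. \<Sum>y\<in>Y. c y * cis (- (y \<bullet> \<xi>)))"
    using T by (auto simp: trig_sums_def)
  define d where "d k = (if k = 0 then 2 else - 1 :: complex)" for k :: nat
  define e :: "nat \<Rightarrow> real^2" where "e k = (if k = 0 then 0 else if k = 1 then vector [1/2, 0] else vector [- (1/2), 0])" for k
  have s4: "complex_of_real (4 * (sin (\<xi>$1 / 4))\<^sup>2) = (\<Sum>k\<in>{0,1,2}. d k * cis (- (e k \<bullet> \<xi>)))" for \<xi>
  proof -
    have "cos (\<xi>$1 / 2) = 1 - 2 * (sin (\<xi>$1 / 4))\<^sup>2"
      using cos_double_sin[of "\<xi>$1 / 4"] by simp
    then show ?thesis
      by (simp add: d_def e_def inner_vec2 complex_eq_iff)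
  qed
  have "(\<lambda>\<xi>. complex_of_real (4 * (sin (\<xi>$1 / 4))\<^sup>2) * T \<xi>)
    = (\<lambda>\<xi>. \<Sum>z\<in>{0,1,2} \<times> Y. (d (fst z) * c (snd z)) * cis (- ((e (fst z) + snd z) \<bullet> \<xi>)))"
  proof
    fix \<xi>
    have "complex_of_real (4 * (sin (\<xi>$1 / 4))\<^sup>2) * T \<xi>
      = (\<Sum>k\<in>{0,1,2}. \<Sum>y\<in>Y. (d k * cis (- (e k \<bullet> \<xi>))) * (c y * cis (- (y \<bullet> \<xi>))))"
      unfolding s4 T sum_product ..
    also have "\<dots> = (\<Sum>k\<in>{0,1,2}. \<Sum>y\<in>Y. (d k * c y) * cis (- ((e k + y) \<bullet> \<xi>)))"
    proof (intro sum.cong refl)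
      fix k y
      have "cis (- ((e k + y) \<bullet> \<xi>)) = cis (- (e k \<bullet> \<xi>)) * cis (- (y \<bullet> \<xi>))"
        by (simp add: cis_mult inner_add_left)
      then show "d k * cis (- (e k \<bullet> \<xi>)) * (c y * cis (- (y \<bullet> \<xi>))) = d k * c y * cis (- ((e k + y) \<bullet> \<xi>))"
        by simp
    qed
    also have "\<dots> = (\<Sum>z\<in>{0,1,2} \<times> Y. (d (fst z) * c (snd z)) * cis (- ((e (fst z) + snd z) \<bullet> \<xi>)))"
      unfolding sum.cartesian_product by (simp add: split_beta)
    finally show "complex_of_real (4 * (sin (\<xi>$1 / 4))\<^sup>2) * T \<xi> = (\<Sum>z\<in>{0,1,2} \<times> Y. (d (fst z) * c (snd z)) * cis (- ((e (fst z) + snd z) \<bullet> \<xi>)))" .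
  qed
  moreover have "(\<lambda>\<xi>. \<Sum>z\<in>{0,1,2::nat} \<times> Y. (d (fst z) * c (snd z)) * cis (- ((e (fst z) + snd z) \<bullet> \<xi>))) \<in> trig_sums (3 * M)"
    using Y by (intro trig_sums_indexed) (auto simp: card_cartesian_product)
  ultimately show ?thesis by simp
qed

lemma gauss_inv_fourier:
  "integrable lborel (\<lambda>\<xi>. complex_of_real (1/2 * exp (- (norm \<xi>)\<^sup>2 / 4)) * cis (- (y \<bullet> \<xi>)) * cis (x \<bullet> \<xi>))"
  "inv_fourier (\<lambda>\<xi>. complex_of_real (1/2 * exp (- (norm \<xi>)\<^sup>2 / 4)) * cis (- (y \<bullet> \<xi>))) x = gauss (x - y)"
proof -
  have e: "complex_of_real (1/2 * exp (- (norm \<xi>)\<^sup>2 / 4)) * cis (- (y \<bullet> \<xi>)) * cis (x \<bullet> \<xi>)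
    = complex_of_real (1/2) * (complex_of_real (exp (- (1/4) * (norm \<xi>)\<^sup>2)) * cis ((x - y) \<bullet> \<xi>))" for \<xi>
    by (simp add: cis_mult inner_diff_left mult.assoc)
  have c: "(0::real) < 1/4" by simp
  show "integrable lborel (\<lambda>\<xi>. complex_of_real (1/2 * exp (- (norm \<xi>)\<^sup>2 / 4)) * cis (- (y \<bullet> \<xi>)) * cis (x \<bullet> \<xi>))"
    unfolding e by (intro integrable_mult_right gauss_char_2d(1)[OF c])
  show "inv_fourier (\<lambda>\<xi>. complex_of_real (1/2 * exp (- (norm \<xi>)\<^sup>2 / 4)) * cis (- (y \<bullet> \<xi>))) x = gauss (x - y)"
    unfolding inv_fourier_def e integral_mult_right_zero gauss_char_2d(2)[OF c]
    by (simp add: gauss_def)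
qed

text \<open>The Fourier transforms of the combinations of at most \<open>M\<close> translates of \<open>gauss\<close>; see
\<open>inv_fourier_gauss_spectra\<close>.\<close>

definition gauss_spectra :: "nat \<Rightarrow> (real^2 \<Rightarrow> complex) set" where
  "gauss_spectra M = (\<lambda>T \<xi>. complex_of_real (1/2 * exp (- (norm \<xi>)\<^sup>2 / 4)) * T \<xi>) ` trig_sums M"

lemma gauss_spectra_measurable:
  assumes "F \<in> gauss_spectra M" shows "F \<in> borel_measurable borel"
proof -
  obtain Y c where F: "F = (\<lambda>\<xi>. complex_of_real (1/2 * exp (- (norm \<xi>)\<^sup>2 / 4)) * (\<Sum>y\<in>Y. c y * cis (- (y \<bullet> \<xi>))))"
    using assms by (auto simp: gauss_spectra_def trig_sums_def)
  show ?thesis unfolding F cis_conv_exp by measurable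
qed

lemma inv_fourier_gauss_spectra:
  assumes "F \<in> gauss_spectra M"
  shows "lincomb_atmost M gauss_translates (inv_fourier F)"
proof -
  obtain Y c where Y: "finite Y" "card Y \<le> M"
    and F: "F = (\<lambda>\<xi>. complex_of_real (1/2 * exp (- (norm \<xi>)\<^sup>2 / 4)) * (\<Sum>y\<in>Y. c y * cis (- (y \<bullet> \<xi>))))"
    using assms by (auto simp: gauss_spectra_def trig_sums_def)
  have "inv_fourier F = (\<lambda>x. \<Sum>y\<in>Y. c y * gauss (x - y))"
  proof
    fix x
    define g where "g y \<xi> = complex_of_real (1/2 * exp (- (norm \<xi>)\<^sup>2 / 4)) * cis (- (y \<bullet> \<xi>)) * cis (x \<bullet> \<xi>)" for y \<xi> :: "real^2"
    have gi: "integrable lborel (g y)" for y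
      unfolding g_def[abs_def] by (rule gauss_inv_fourier(1))
    have Fg: "F \<xi> * cis (x \<bullet> \<xi>) = (\<Sum>y\<in>Y. c y * g y \<xi>)" for \<xi>
      unfolding F g_def sum_distrib_left sum_distrib_right by (intro sum.cong refl) (simp only: mult_ac)
    have "inv_fourier F x = complex_of_real (1 / (2 * pi)) * (\<Sum>y\<in>Y. c y * (LINT \<xi>|lborel. g y \<xi>))"
      unfolding inv_fourier_def Fg using gi by simp
    also have "\<dots> = (\<Sum>y\<in>Y. c y * inv_fourier (\<lambda>\<xi>. complex_of_real (1/2 * exp (- (norm \<xi>)\<^sup>2 / 4)) * cis (- (y \<bullet> \<xi>))) x)"
      unfolding inv_fourier_def g_def sum_distrib_left by (intro sum.cong refl) (simp only: mult_ac)
    finally show "inv_fourier F x = (\<Sum>y\<in>Y. c y * gauss (x - y))" unfolding gauss_inv_fourier(2) .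
  qed
  then show ?thesis
    using lincomb_atmost_indexed[OF Y, of "\<lambda>y x. gauss (x - y)" gauss_translates c] by (auto simp: gauss_translates_def)
qed

section \<open>Spectra that approximate the generators\<close>

definition modulation_factor :: "nat \<Rightarrow> real^2 \<Rightarrow> real" where
  "modulation_factor j \<xi> = (if j < 4 then 1 else 4 * (sin (\<xi>$1 / 4))\<^sup>2)"

text \<open>The modulation supplies the quadratic factor of the weight, by \<open>\<bar>sin x\<bar> \<le> \<bar>x\<bar>\<close>.\<close>

lemma modulation_factor_weight:
  "0 \<le> modulation_factor j \<xi>"
  "modulation_factor j \<xi> * exp (- (norm \<xi>)\<^sup>2 / 8) \<le> weight j \<xi>"
proof -
  show "0 \<le> modulation_factor j \<xi>" by (simp add: modulation_factor_def)
  have "(sin (\<xi>$1 / 4))\<^sup>2 \<le> (\<xi>$1 / 4)\<^sup>2"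
    using abs_sin_x_le_abs_x[of "\<xi>$1 / 4"] by (simp only: abs_le_square_iff)
  then have "4 * (sin (\<xi>$1 / 4))\<^sup>2 \<le> (\<xi>$1)\<^sup>2 / 4" by (simp add: power_divide)
  moreover have "0 \<le> (\<xi>$1)\<^sup>2" by simp
  ultimately have "4 * (sin (\<xi>$1 / 4))\<^sup>2 \<le> (\<xi>$1)\<^sup>2" by linarith
  then show "modulation_factor j \<xi> * exp (- (norm \<xi>)\<^sup>2 / 8) \<le> weight j \<xi>"
    unfolding weight_def modulation_factor_def by (intro mult_right_mono) auto
qed

context curvelet_window_functions
begin

definition spectral_error :: "nat \<Rightarrow> (real^2 \<Rightarrow> complex) \<Rightarrow> real \<Rightarrow> bool" where
  "spectral_error j F \<delta> \<longleftrightarrow> (\<forall>\<xi>. norm (F \<xi> - complex_of_real (curv_gen j \<xi>)) \<le> \<delta> * weight j \<xi>)"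

lemma spectral_error_mono: "spectral_error j F \<delta> \<Longrightarrow> \<delta> \<le> \<delta>' \<Longrightarrow> spectral_error j F \<delta>'"
  unfolding spectral_error_def
proof
  fix \<xi>
  assume "\<forall>\<xi>. norm (F \<xi> - complex_of_real (curv_gen j \<xi>)) \<le> \<delta> * weight j \<xi>" and le: "\<delta> \<le> \<delta>'"
  then have "norm (F \<xi> - complex_of_real (curv_gen j \<xi>)) \<le> \<delta> * weight j \<xi>" by blast
  also have "\<dots> \<le> \<delta>' * weight j \<xi>" by (rule mult_right_mono[OF le weight_nonneg])
  finally show "norm (F \<xi> - complex_of_real (curv_gen j \<xi>)) \<le> \<delta>' * weight j \<xi>" .
qed

text \<open>The tolerance grows at half the rate at which the transformed Gaussian decays; what remains of the
latter is the Gaussian of \<open>weight\<close>.\<close>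

lemma spectral_error_transfer:
  assumes T: "\<And>\<xi>. norm (T \<xi> - complex_of_real (profile j \<xi>)) \<le> \<delta> * exp ((norm \<xi>)\<^sup>2 / 8)" and \<delta>: "\<delta> \<ge> 0"
  shows "spectral_error j (\<lambda>\<xi>::real^2. complex_of_real (1/2 * exp (- (norm \<xi>)\<^sup>2 / 4)) * (complex_of_real (modulation_factor j \<xi>) * T \<xi>)) \<delta>"
  unfolding spectral_error_def
proof
  fix \<xi> :: "real^2"
  define E where "E = exp (- (norm \<xi>)\<^sup>2 / 4)"
  define m where "m = modulation_factor j \<xi>"
  have m0: "m \<ge> 0" using modulation_factor_weight by (simp add: m_def)
  have g: "curv_gen j \<xi> = 1/2 * E * (m * profile j \<xi>)"
    by (simp add: curv_gen_eq_profile E_def m_def modulation_factor_def)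
  have eq: "complex_of_real (1/2 * E) * (complex_of_real m * T \<xi>) - complex_of_real (curv_gen j \<xi>)
    = complex_of_real (1/2 * E * m) * (T \<xi> - complex_of_real (profile j \<xi>))"
    unfolding g by (simp add: algebra_simps)
  have "norm (complex_of_real (1/2 * E) * (complex_of_real m * T \<xi>) - complex_of_real (curv_gen j \<xi>))
    = 1/2 * E * m * norm (T \<xi> - complex_of_real (profile j \<xi>))"
    unfolding eq using m0 by (simp add: norm_mult E_def)
  also have "\<dots> \<le> 1/2 * E * m * (\<delta> * exp ((norm \<xi>)\<^sup>2 / 8))"
    using m0 by (intro mult_left_mono T) (auto simp: E_def)
  also have "\<dots> = 1/2 * \<delta> * (m * (E * exp ((norm \<xi>)\<^sup>2 / 8)))" by simp
  also have "E * exp ((norm \<xi>)\<^sup>2 / 8) = exp (- (norm \<xi>)\<^sup>2 / 8)"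
    unfolding E_def exp_add[symmetric] by (rule arg_cong[where f = exp]) simp
  also have "1/2 * \<delta> * (m * exp (- (norm \<xi>)\<^sup>2 / 8)) \<le> \<delta> * weight j \<xi>"
    using modulation_factor_weight(2)[of j \<xi>] \<delta> m0 by (intro mult_mono) (auto simp: m_def)
  finally show "norm (complex_of_real (1/2 * exp (- (norm \<xi>)\<^sup>2 / 4)) * (complex_of_real (modulation_factor j \<xi>) * T \<xi>)
      - complex_of_real (curv_gen j \<xi>)) \<le> \<delta> * weight j \<xi>"
    by (simp only: E_def m_def)
qed

lemma profile_bounded: "\<exists>B\<ge>0. \<forall>j \<xi>. \<bar>profile j \<xi>\<bar> \<le> B"
proof -
  obtain B where "B \<ge> 0" "\<And>j t \<xi>. \<bar>line_diff 0 t (profile j) \<xi>\<bar> \<le> B * norm t ^ 0"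
    using smooth_on_lines_line_diff[OF profile_smooth[of 0]] by blast
  then show ?thesis by auto
qed

lemma curv_gen_weight_bound: "\<exists>B\<ge>0. \<forall>j \<xi>. \<bar>curv_gen j \<xi>\<bar> \<le> B * weight j \<xi>"
proof -
  obtain B where B0: "B \<ge> 0" and B: "\<forall>j \<xi>. \<bar>profile j \<xi>\<bar> \<le> B" using profile_bounded by blast
  have "\<bar>curv_gen j \<xi>\<bar> \<le> B * weight j \<xi>" for j \<xi>
  proof -
    have "norm (0 - complex_of_real (profile j \<xi>)) \<le> B * exp ((norm \<xi>)\<^sup>2 / 8)" for \<xi>
      using mult_mono[of "\<bar>profile j \<xi>\<bar>" B 1 "exp ((norm \<xi>)\<^sup>2 / 8)"] B B0 by simp
    from spectral_error_transfer[of "\<lambda>_. 0", OF this B0] show ?thesis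
      by (simp add: spectral_error_def)
  qed
  with B0 show ?thesis by blast
qed

lemma curv_gen_measurable [measurable]: "curv_gen j \<in> borel_measurable borel"
proof -
  have [measurable]: "profile j \<in> borel_measurable borel"
    by (rule borel_measurable_continuous_onI[OF profile_continuous])
  show ?thesis unfolding curv_gen_eq_profile[abs_def] by measurable
qed

lemma gauss_spectra_approximation:
  "\<exists>C\<ge>0. \<forall>j. \<forall>M\<ge>1. \<exists>F\<in>gauss_spectra M. spectral_error j F (C / real M ^ K)"
proof -
  obtain B where B: "\<forall>j \<xi>. \<bar>profile j \<xi>\<bar> \<le> B" using profile_bounded by blast
  have B': "\<bar>profile j \<xi>\<bar> \<le> B" for j \<xi> using B by blast
  have meas: "profile j \<in> borel_measurable borel" for j
    by (rule borel_measurable_continuous_onI[OF profile_continuous])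
  have supp: "u \<in> square 98" if "profile j u \<noteq> 0" for j u
    using profile_support[OF that] component_le_norm_cart[of u] by (auto simp: in_square intro: order.trans)
  have diff: "\<exists>E\<ge>0. \<forall>j t \<xi>. \<bar>line_diff n t (profile j) \<xi>\<bar> \<le> E * norm t ^ n" for n
    using smooth_on_lines_line_diff[OF profile_smooth[of n]] by metis
  have ex: "\<exists>C\<ge>0. (\<forall>j. \<forall>M\<ge>1. \<exists>(Y :: (nat \<times> nat \<times> nat) set) c y. finite Y \<and> 3 * card Y \<le> M \<and>
     (\<forall>\<xi>. norm ((\<Sum>z\<in>Y. c z * cis (- (y z \<bullet> \<xi>))) - complex_of_real (profile j \<xi>)) \<le> C / real M ^ K * exp ((norm \<xi>)\<^sup>2 / 8)))"
    by (rule trigonometric_approximation_budget[where A = 98 and B = B]) (rule meas diff B' | erule supp | simp)+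
  obtain C where C: "C \<ge> 0 \<and> (\<forall>j. \<forall>M\<ge>1. \<exists>(Y :: (nat \<times> nat \<times> nat) set) c y. finite Y \<and> 3 * card Y \<le> M \<and>
     (\<forall>\<xi>. norm ((\<Sum>z\<in>Y. c z * cis (- (y z \<bullet> \<xi>))) - complex_of_real (profile j \<xi>)) \<le> C / real M ^ K * exp ((norm \<xi>)\<^sup>2 / 8)))"
    using ex ..
  have "\<exists>F\<in>gauss_spectra M. spectral_error j F (C / real M ^ K)" if M: "M \<ge> 1" for j M
  proof -
    obtain Y :: "(nat \<times> nat \<times> nat) set" and c y where Y: "finite Y" "3 * card Y \<le> M"
      and e: "\<And>\<xi>. norm ((\<Sum>z\<in>Y. c z * cis (- (y z \<bullet> \<xi>))) - complex_of_real (profile j \<xi>)) \<le> C / real M ^ K * exp ((norm \<xi>)\<^sup>2 / 8)"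
      using C[THEN conjunct2, THEN spec[of _ j], THEN spec[of _ M], THEN mp, OF M] by (elim exE conjE) blast
    define T where "T \<xi> = (\<Sum>z\<in>Y. c z * cis (- (y z \<bullet> \<xi>)))" for \<xi>
    have T: "T \<in> trig_sums (card Y)" unfolding T_def[abs_def] using Y(1) by (intro trig_sums_indexed) auto
    have mT: "(\<lambda>\<xi>. complex_of_real (modulation_factor j \<xi>) * T \<xi>) \<in> trig_sums M"
    proof (cases "j < 4")
      case True
      have "T \<in> trig_sums M" using T trig_sums_mono[of "card Y" M] Y(2) by auto
      then show ?thesis using True by (simp add: modulation_factor_def)
    next
      case False
      then show ?thesis
        using trig_sums_second_difference[OF T] trig_sums_mono[OF Y(2)] by (auto simp: modulation_factor_def)
    qed
    have "spectral_error j (\<lambda>\<xi>. complex_of_real (1/2 * exp (- (norm \<xi>)\<^sup>2 / 4)) * (complex_of_real (modulation_factor j \<xi>) * T \<xi>)) (C / real M ^ K)"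
      by (rule spectral_error_transfer) (use e C in \<open>auto simp: T_def\<close>)
    moreover have "(\<lambda>\<xi>. complex_of_real (1/2 * exp (- (norm \<xi>)\<^sup>2 / 4)) * (complex_of_real (modulation_factor j \<xi>) * T \<xi>)) \<in> gauss_spectra M"
      unfolding gauss_spectra_def by (rule image_eqI[OF _ mT]) (rule refl)
    ultimately show ?thesis by blast
  qed
  with C show ?thesis by blast
qed

text \<open>The infimum of the possible errors need not be attained. A spectrum whose error exceeds it by less than \<open>exp (- M)\<close>
is as good as any other up to this term, which is smaller than any power of \<open>M\<close>.\<close>

lemma near_optimal_spectrum:
  "\<exists>F\<in>gauss_spectra M. \<forall>\<delta>\<ge>0. (\<exists>F'\<in>gauss_spectra M. spectral_error j F' \<delta>) \<longrightarrow> spectral_error j F (\<delta> + exp (- real M))"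
proof -
  define \<Delta> where "\<Delta> = {\<delta>. \<delta> \<ge> 0 \<and> (\<exists>F'\<in>gauss_spectra M. spectral_error j F' \<delta>)}"
  show ?thesis
  proof (cases "\<Delta> = {}")
    case True
    have "(\<lambda>_. 0) \<in> trig_sums M" unfolding trig_sums_def mem_Collect_eq by (intro exI[of _ "{}"]) auto
    then have "gauss_spectra M \<noteq> {}" by (auto simp: gauss_spectra_def)
    then show ?thesis using True by (auto simp: \<Delta>_def)
  next
    case False
    have bdd: "bdd_below \<Delta>" by (rule bdd_belowI[of _ 0]) (simp add: \<Delta>_def)
    have "Inf \<Delta> < Inf \<Delta> + exp (- real M)" by simp
    then obtain \<delta>0 where d: "\<delta>0 \<in> \<Delta>" "\<delta>0 < Inf \<Delta> + exp (- real M)"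
      using cInf_lessD[OF False] by blast
    then obtain F where F: "F \<in> gauss_spectra M" "spectral_error j F \<delta>0" by (auto simp: \<Delta>_def)
    have "spectral_error j F (\<delta> + exp (- real M))" if "\<delta> \<in> \<Delta>" for \<delta>
      using spectral_error_mono[OF F(2)] cInf_lower[OF that bdd] d(2) by simp
    then show ?thesis using F(1) by (auto simp: \<Delta>_def)
  qed
qed

text \<open>The spectra of \<open>gauss_spectra_approximation\<close> depend on the exponent \<open>K\<close>; near-optimal ones do not, and
their error is compared with the former for every \<open>K\<close>.\<close>

lemma universal_spectra:
  obtains F :: "nat \<Rightarrow> nat \<Rightarrow> real^2 \<Rightarrow> complex"
  where "\<And>j M. F j M \<in> gauss_spectra M"
    and "\<And>K. \<exists>C\<ge>0. \<forall>j. \<forall>M\<ge>1. spectral_error j (F j M) (C / real M ^ K)"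
proof -
  have "\<forall>z. \<exists>F. F \<in> gauss_spectra (snd z) \<and> (\<forall>\<delta>\<ge>0. (\<exists>F'\<in>gauss_spectra (snd z). spectral_error (fst z) F' \<delta>) \<longrightarrow> spectral_error (fst z) F (\<delta> + exp (- real (snd z))))"
    using near_optimal_spectrum by blast
  from choice[OF this] obtain f where f: "\<forall>z. f z \<in> gauss_spectra (snd z) \<and> (\<forall>\<delta>\<ge>0. (\<exists>F'\<in>gauss_spectra (snd z). spectral_error (fst z) F' \<delta>) \<longrightarrow> spectral_error (fst z) (f z) (\<delta> + exp (- real (snd z))))" ..
  define F where "F j M = f (j, M)" for j M
  have F1: "F j M \<in> gauss_spectra M" for j M using f[THEN spec, of "(j, M)"] by (simp add: F_def)
  have F2: "spectral_error j (F j M) (\<delta> + exp (- real M))"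
    if "\<delta> \<ge> 0" "F' \<in> gauss_spectra M" "spectral_error j F' \<delta>" for j M \<delta> F'
    using f[THEN spec, of "(j, M)"] that unfolding F_def by auto
  have "\<exists>C\<ge>0. \<forall>j. \<forall>M\<ge>1. spectral_error j (F j M) (C / real M ^ K)" for K
  proof -
    obtain C where C: "C \<ge> 0" "\<And>j M. M \<ge> 1 \<Longrightarrow> \<exists>F\<in>gauss_spectra M. spectral_error j F (C / real M ^ K)"
      using gauss_spectra_approximation[of K] by blast
    have "spectral_error j (F j M) ((C + fact K) / real M ^ K)" if M: "M \<ge> 1" for j M
    proof -
      have M0: "real M > 0" using M by simp
      obtain F' where F': "F' \<in> gauss_spectra M" "spectral_error j F' (C / real M ^ K)" using C(2)[OF M] by blast
      have sp: "spectral_error j (F j M) (C / real M ^ K + exp (- real M))"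
        by (rule F2[OF _ F']) (use C in simp)
      have "exp (- real M) \<le> fact K / real M ^ K"
        using power_le_fact_exp[of "real M" K] M0 by (simp add: exp_minus field_simps)
      then have "C / real M ^ K + exp (- real M) \<le> (C + fact K) / real M ^ K" by (simp add: add_divide_distrib)
      with sp show ?thesis by (rule spectral_error_mono)
    qed
    moreover have "C + fact K \<ge> 0" using C by simp
    ultimately show ?thesis by blast
  qed
  with F1 show ?thesis using that by blast
qed

end

section \<open>Ordered curvelet coefficients\<close>

definition coeff_abs :: "(real \<Rightarrow> real) \<Rightarrow> (real \<Rightarrow> real) \<Rightarrow> (real \<Rightarrow> real) \<Rightarrow> (real^2 \<Rightarrow> complex) \<Rightarrow> (nat \<Rightarrow> curv_index) \<Rightarrow> nat \<Rightarrow> real" where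
  "coeff_abs w0 w v f p n = norm (L2_inner f (curvelet w0 w v (p n)))"

lemma coeff_abs_antimono:
  assumes p: "decr_rearrangement w0 w v f p" and mn: "1 \<le> m" "m \<le> n"
  shows "coeff_abs w0 w v f p n \<le> coeff_abs w0 w v f p m"
  using mn(2)
proof (induction n rule: dec_induct)
  case (step n)
  have "coeff_abs w0 w v f p (Suc n) \<le> coeff_abs w0 w v f p n"
    using p mn(1) step.hyps by (simp add: decr_rearrangement_def coeff_abs_def)
  then show ?case using step.IH by linarith
qed simp

text \<open>The ordered coefficients do not depend on the rearrangement: otherwise the first \<open>n\<close> curvelets of \<open>p\<close> would all have
larger coefficients than the \<open>n\<close>-th curvelet of \<open>q\<close>, and only its \<open>n - 1\<close> predecessors can.\<close>

lemma decr_rearrangement_coeff_le: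
  assumes p: "decr_rearrangement w0 w v f p" and q: "decr_rearrangement w0 w v f q" and n: "n \<ge> 1"
  shows "coeff_abs w0 w v f p n \<le> coeff_abs w0 w v f q n"
proof (rule ccontr)
  assume "\<not> ?thesis"
  then have lt: "coeff_abs w0 w v f q n < coeff_abs w0 w v f p n" by simp
  define cp cq where "cp k = curvelet w0 w v (p k)" and "cq k = curvelet w0 w v (q k)" for k
  have sub: "cp ` {1..n} \<subseteq> cq ` {1..<n}"
  proof
    fix g assume "g \<in> cp ` {1..n}"
    then obtain k where k: "1 \<le> k" "k \<le> n" "g = cp k" by auto
    have big: "norm (L2_inner f g) > coeff_abs w0 w v f q n"
      using coeff_abs_antimono[OF p k(1,2)] lt by (simp add: coeff_abs_def k(3) cp_def)
    moreover have "coeff_abs w0 w v f q n \<ge> 0" by (simp add: coeff_abs_def)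
    ultimately have "L2_inner f g \<noteq> 0" by auto
    moreover have "g \<in> curv_dict w0 w v"
      using p k by (auto simp: decr_rearrangement_def curv_dict_def cp_def)
    ultimately have "g \<in> cq ` {1..}"
      using q by (auto simp: decr_rearrangement_def cq_def)
    then obtain m where m: "1 \<le> m" "g = cq m" by auto
    have "m < n"
    proof (rule ccontr)
      assume "\<not> m < n"
      then have "coeff_abs w0 w v f q m \<le> coeff_abs w0 w v f q n"
        by (intro coeff_abs_antimono[OF q n]) simp
      then show False using big by (simp add: coeff_abs_def m(2) cq_def)
    qed
    then show "g \<in> cq ` {1..<n}" using m by auto
  qed
  have "inj_on cp {1..n}"
    using p unfolding decr_rearrangement_def cp_def[abs_def] by (meson atLeastAtMost_iff atLeast_iff inj_on_subset subsetI)
  then have "card {1..n} = card (cp ` {1..n})" by (simp add: card_image)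
  also have "\<dots> \<le> card (cq ` {1..<n})" by (rule card_mono[OF _ sub]) simp
  also have "\<dots> \<le> card {1..<n}" by (rule card_image_le) simp
  finally show False using n by simp
qed

text \<open>As all rearrangements have the same ordered coefficients, the admissible constants are the upper
bounds of one set of real numbers, and the least one is its supremum.\<close>

lemma coeff_le_quasinorm:
  assumes f: "f \<in> curv_class w0 w v \<alpha>" and p: "decr_rearrangement w0 w v f p" and n: "n \<ge> 1"
  shows "coeff_abs w0 w v f p n \<le> curv_quasinorm w0 w v \<alpha> f * real n powr (- \<alpha>)"
    and "curv_quasinorm w0 w v \<alpha> f \<ge> 0"
proof -
  define S where "S = (\<lambda>n. coeff_abs w0 w v f p n * real n powr \<alpha>) ` {1..}"
  have iff: "coeff_decay w0 w v \<alpha> f C \<longleftrightarrow> (\<forall>s\<in>S. s \<le> C)" for C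
  proof -
    have e: "coeff_abs w0 w v f p n \<le> C * real n powr (- \<alpha>) \<longleftrightarrow> coeff_abs w0 w v f p n * real n powr \<alpha> \<le> C"
      if "n \<ge> 1" for n
    proof -
      have "real n powr \<alpha> > 0" using that by simp
      then show ?thesis by (simp add: powr_minus field_simps)
    qed
    have "coeff_decay w0 w v \<alpha> f C \<longleftrightarrow> (\<forall>n\<ge>1. coeff_abs w0 w v f p n \<le> C * real n powr (- \<alpha>))"
    proof
      assume "coeff_decay w0 w v \<alpha> f C"
      then obtain q where q: "decr_rearrangement w0 w v f q" "\<forall>n\<ge>1. coeff_abs w0 w v f q n \<le> C * real n powr (- \<alpha>)"
        unfolding coeff_decay_def coeff_abs_def by blast
      show "\<forall>n\<ge>1. coeff_abs w0 w v f p n \<le> C * real n powr (- \<alpha>)"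
        using decr_rearrangement_coeff_le[OF p q(1)] q(2) by (meson order.trans)
    next
      assume "\<forall>n\<ge>1. coeff_abs w0 w v f p n \<le> C * real n powr (- \<alpha>)"
      then show "coeff_decay w0 w v \<alpha> f C"
        using p unfolding coeff_decay_def coeff_abs_def by blast
    qed
    then show ?thesis using e by (auto simp: S_def)
  qed
  obtain C0 where "coeff_decay w0 w v \<alpha> f C0" using f by (auto simp: curv_class_def)
  then have bdd: "bdd_above S" unfolding iff by (auto intro: bdd_aboveI)
  have ne: "S \<noteq> {}" by (simp add: S_def)
  have L: "curv_quasinorm w0 w v \<alpha> f = Sup S"
    unfolding curv_quasinorm_def
  proof (rule Least_equality)
    show "coeff_decay w0 w v \<alpha> f (Sup S)" unfolding iff using cSup_upper bdd by blast
    show "Sup S \<le> y" if "coeff_decay w0 w v \<alpha> f y" for y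
      using that unfolding iff by (intro cSup_least[OF ne]) auto
  qed
  have mem: "coeff_abs w0 w v f p n * real n powr \<alpha> \<in> S" using n by (auto simp: S_def)
  have up: "coeff_abs w0 w v f p n * real n powr \<alpha> \<le> curv_quasinorm w0 w v \<alpha> f"
    unfolding L by (rule cSup_upper[OF mem bdd])
  moreover have "0 \<le> coeff_abs w0 w v f p n * real n powr \<alpha>" by (simp add: coeff_abs_def)
  ultimately show "curv_quasinorm w0 w v \<alpha> f \<ge> 0" by linarith
  have "real n powr \<alpha> > 0" using n by simp
  then show "coeff_abs w0 w v f p n \<le> curv_quasinorm w0 w v \<alpha> f * real n powr (- \<alpha>)"
    using up by (simp add: powr_minus field_simps)
qed

section \<open>Budgets\<close>

lemma dyadic_level_eq:
  assumes "2 ^ \<nu> / 2 < real n" "real n \<le> 2 ^ \<nu>"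
  shows "dyadic_level n = \<nu>"
  unfolding dyadic_level_def
proof (rule the_equality)
  have no: False if "2 ^ \<mu> / 2 < real n" "real n \<le> 2 ^ \<nu>" "\<nu> < \<mu>" for \<mu> \<nu>
  proof -
    have "(2::real) ^ Suc \<nu> \<le> 2 ^ \<mu>" using that by (intro power_increasing) auto
    then show False using that by simp
  qed
  fix \<mu> assume "2 ^ \<mu> / 2 < real n \<and> real n \<le> 2 ^ \<mu>"
  then show "\<mu> = \<nu>" using no[of \<mu> \<nu>] no[of \<nu> \<mu>] assms by (cases \<mu> \<nu> rule: linorder_cases) auto
qed (use assms in simp)

lemma dyadic_level_bounds:
  assumes "n \<ge> 1"
  shows "2 ^ dyadic_level n / 2 < real n" "real n \<le> 2 ^ dyadic_level n"
proof -
  define \<nu> where "\<nu> = (LEAST \<nu>. real n \<le> 2 ^ \<nu>)"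
  have "real n \<le> 2 ^ n" using of_nat_less_two_power[of n] by (simp add: less_imp_le)
  then have le: "real n \<le> 2 ^ \<nu>" unfolding \<nu>_def by (rule LeastI)
  have "2 ^ \<nu> / 2 < real n"
  proof (cases \<nu>)
    case 0
    then show ?thesis using assms by simp
  next
    case (Suc \<mu>)
    then have "\<not> real n \<le> 2 ^ \<mu>" using not_less_Least[of \<mu> "\<lambda>\<nu>. real n \<le> 2 ^ \<nu>"] unfolding \<nu>_def[symmetric] by simp
    then show ?thesis using Suc by simp
  qed
  then have "dyadic_level n = \<nu>" using le by (rule dyadic_level_eq)
  then show "2 ^ dyadic_level n / 2 < real n" "real n \<le> 2 ^ dyadic_level n"
    using le \<open>2 ^ \<nu> / 2 < real n\<close> by auto
qed

lemma num_curvelets_cases: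
  fixes \<beta> :: real
  defines "X \<equiv> \<lambda>N. (1 - \<beta>) / real N0 powr (1 / \<beta>) * real N"
  shows "num_curvelets \<beta> N = 0 \<and> X N < 1 \<or>
     (\<exists>\<mu>. num_curvelets \<beta> N = 2 ^ \<mu> \<and> 2 ^ \<mu> \<le> X N \<and> X N < 2 * 2 ^ \<mu>)"
proof -
  define S :: "nat set" where "S = {2 ^ \<nu> | \<nu>. (2 :: real) ^ \<nu> \<le> X N}"
  have num: "num_curvelets \<beta> N = (if S = {} then 0 else Max S)"
    by (simp add: num_curvelets_def S_def X_def Let_def)
  show ?thesis
  proof (cases "S = {}")
    case True
    have "\<not> (2::real) ^ 0 \<le> X N"
    proof
      assume "(2::real) ^ 0 \<le> X N"
      then have "2 ^ 0 \<in> S" unfolding S_def by blast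
      then show False using True by simp
    qed
    then show ?thesis using True num by simp
  next
    case False
    have "S \<subseteq> {..nat \<lceil>X N\<rceil>}"
    proof
      fix x assume "x \<in> S"
      then obtain \<nu> where x: "x = 2 ^ \<nu>" "(2 :: real) ^ \<nu> \<le> X N" by (auto simp: S_def)
      then have "real x \<le> X N" by simp
      then show "x \<in> {..nat \<lceil>X N\<rceil>}" by (simp add: le_nat_iff) linarith
    qed
    then have fin: "finite S" by (rule finite_subset) simp
    have "Max S \<in> S" using fin False by (rule Max_in)
    then obtain \<mu> where \<mu>: "Max S = 2 ^ \<mu>" "(2::real) ^ \<mu> \<le> X N" by (auto simp: S_def)
    have "X N < 2 * 2 ^ \<mu>"
    proof (rule ccontr)
      assume "\<not> ?thesis"
      then have "(2::real) ^ Suc \<mu> \<le> X N" by simp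
      then have "2 ^ Suc \<mu> \<in> S" unfolding S_def by blast
      then have "2 ^ Suc \<mu> \<le> Max S" using fin by simp
      then show False unfolding \<mu>(1) by simp
    qed
    then show ?thesis using num False \<mu> by auto
  qed
qed

text \<open>Comparison with the integral of \<open>x powr (- \<beta>)\<close>, term by term through the mean value theorem.\<close>

lemma sum_powr_le:
  fixes \<beta> :: real assumes "0 < \<beta>" "\<beta> < 1"
  shows "(\<Sum>n=1..m. real n powr (- \<beta>)) \<le> real m powr (1 - \<beta>) / (1 - \<beta>)"
proof (induction m)
  case (Suc m)
  have "real (Suc m) powr (- \<beta>) \<le> (real (Suc m) powr (1 - \<beta>) - real m powr (1 - \<beta>)) / (1 - \<beta>)"
  proof (cases "m = 0")
    case True
    then show ?thesis using assms by simp
  next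
    case False
    have "\<exists>z. real m < z \<and> z < real (Suc m) \<and>
       real (Suc m) powr (1 - \<beta>) - real m powr (1 - \<beta>) = (real (Suc m) - real m) * ((1 - \<beta>) * z powr (1 - \<beta> - 1))"
      using False by (intro MVT2) (auto intro!: derivative_eq_intros)
    then obtain z where z: "real m < z" "z < real (Suc m)"
      "real (Suc m) powr (1 - \<beta>) - real m powr (1 - \<beta>) = (1 - \<beta>) * z powr (- \<beta>)" by auto
    have "real (Suc m) powr (- \<beta>) \<le> z powr (- \<beta>)"
      using z False assms by (intro powr_mono2') auto
    then show ?thesis unfolding z(3) using assms by simp
  qed
  then show ?case using Suc by (simp add: diff_divide_distrib)
qed simp

text \<open>The bound is uniform in \<open>L\<close>. The induction also carries \<open>n powr (- a) / a\<close>, the integral of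
\<open>x powr (- a - 1)\<close> over the part beyond the last term.\<close>

lemma sum_powr_tail_le:
  fixes \<alpha> :: real assumes "\<alpha> > 1/2"
  shows "(\<Sum>n=Suc m..L. real n powr (- 2 * \<alpha>)) \<le> (1 + 1 / (2 * \<alpha> - 1)) * real (Suc m) powr (1 - 2 * \<alpha>)"
proof -
  define a where "a = 2 * \<alpha> - 1"
  have a: "a > 0" using assms by (simp add: a_def)
  have ea: "- 2 * \<alpha> = - a - 1" "1 - 2 * \<alpha> = - a" by (simp_all add: a_def)
  have main: "(\<Sum>n=Suc m..m + Suc k. real n powr (- a - 1)) + real (m + Suc k) powr (- a) / a \<le> (1 + 1 / a) * real (Suc m) powr (- a)" for k
  proof (induction k)
    case 0
    have "real (Suc m) powr (- a - 1) \<le> real (Suc m) powr (- a)" by (intro powr_mono) auto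
    then show ?case by (simp add: distrib_right)
  next
    case (Suc k)
    define n where "n = m + Suc k"
    have n: "n \<ge> 1" by (simp add: n_def)
    have "\<exists>z. real n < z \<and> z < real (Suc n) \<and>
       real (Suc n) powr (- a) - real n powr (- a) = (real (Suc n) - real n) * ((- a) * z powr (- a - 1))"
      using n by (intro MVT2) (auto intro!: derivative_eq_intros)
    then obtain z where z: "real n < z" "z < real (Suc n)"
      "real (Suc n) powr (- a) - real n powr (- a) = - (a * z powr (- a - 1))" by auto
    have "real (Suc n) powr (- a - 1) \<le> z powr (- a - 1)"
      using z n a by (intro powr_mono2') auto
    then have "a * real (Suc n) powr (- a - 1) \<le> a * z powr (- a - 1)" using a by simp
    then have "a * real (Suc n) powr (- a - 1) \<le> real n powr (- a) - real (Suc n) powr (- a)"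
      using z(3) by linarith
    then have "real (Suc n) powr (- a - 1) \<le> (real n powr (- a) - real (Suc n) powr (- a)) / a"
      using a by (simp add: pos_le_divide_eq mult.commute)
    then have st: "real (Suc n) powr (- a - 1) + real (Suc n) powr (- a) / a \<le> real n powr (- a) / a"
      by (simp add: diff_divide_distrib)
    have "(\<Sum>n=Suc m..m + Suc (Suc k). real n powr (- a - 1)) = (\<Sum>n=Suc m..m + Suc k. real n powr (- a - 1)) + real (Suc n) powr (- a - 1)"
      by (simp add: n_def)
    then show ?case using Suc st by (simp add: n_def)
  qed
  show ?thesis
  proof (cases "L \<le> m")
    case True
    then show ?thesis using a by (simp add: a_def)
  next
    case False
    then obtain k where L: "L = m + Suc k" by (metis add_Suc_right less_iff_Suc_add not_le)
    have "0 \<le> real (m + Suc k) powr (- a) / a" using a by simp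
    then show ?thesis using main[of k] unfolding ea L a_def[symmetric] by linarith
  qed
qed

text \<open>Up to \<open>num_curvelets\<close> the budget is at least \<open>N0\<close>, hence rounding down loses at most a factor \<open>2\<close>.\<close>

lemma sub_budget_bounds:
  fixes \<beta> :: real
  assumes \<beta>: "0 < \<beta>" "\<beta> < 1" and N: "N \<ge> 1" and n: "1 \<le> n" "n \<le> num_curvelets \<beta> N"
  shows "N0 \<le> sub_budget \<beta> N n"
    and "real (sub_budget \<beta> N n) \<le> ((1 - \<beta>) * real N / 2 ^ dyadic_level n) powr \<beta>"
    and "((1 - \<beta>) * real N / 2 ^ dyadic_level n) powr \<beta> \<le> 2 * real (sub_budget \<beta> N n)"
proof -
  define Y where "Y = (1 - \<beta>) * real N / 2 ^ dyadic_level n"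
  have Y0: "Y \<ge> 0" using \<beta> by (simp add: Y_def)
  obtain \<mu> where \<mu>: "num_curvelets \<beta> N = 2 ^ \<mu>" "2 ^ \<mu> \<le> (1 - \<beta>) / real N0 powr (1 / \<beta>) * real N"
    using num_curvelets_cases[of \<beta> N] n by auto
  have "2 ^ dyadic_level n \<le> (2::real) ^ \<mu>"
  proof (rule ccontr)
    assume "\<not> ?thesis"
    then have "\<mu> < dyadic_level n" by (simp add: not_le)
    then have "(2::real) ^ Suc \<mu> \<le> 2 ^ dyadic_level n" by (intro power_increasing) auto
    moreover have "real n \<le> 2 ^ \<mu>" using n(2) \<mu>(1) by (metis of_nat_le_iff of_nat_numeral of_nat_power)
    ultimately show False using dyadic_level_bounds(1)[OF n(1)] by simp
  qed
  then have "2 ^ dyadic_level n \<le> (1 - \<beta>) / real N0 powr (1 / \<beta>) * real N" using \<mu>(2) by linarith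
  then have "real N0 powr (1 / \<beta>) \<le> Y"
    by (simp add: Y_def N0_def field_simps)
  then have "(real N0 powr (1 / \<beta>)) powr \<beta> \<le> Y powr \<beta>" using \<beta> by (intro powr_mono2) auto
  then have Y3: "real N0 \<le> Y powr \<beta>" using \<beta> by (simp add: powr_powr N0_def)
  have e: "sub_budget \<beta> N n = nat \<lfloor>Y powr \<beta>\<rfloor>"
  proof -
    have "(1 - \<beta>) powr \<beta> * (real N / 2 ^ dyadic_level n) powr \<beta> = Y powr \<beta>"
      unfolding Y_def using \<beta> by (simp add: powr_mult[symmetric])
    then show ?thesis by (simp only: sub_budget_def)
  qed
  have f: "int N0 \<le> \<lfloor>Y powr \<beta>\<rfloor>" using Y3 by (simp add: le_floor_iff)
  then show "N0 \<le> sub_budget \<beta> N n" unfolding e by linarith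
  have r: "real (sub_budget \<beta> N n) = of_int \<lfloor>Y powr \<beta>\<rfloor>" unfolding e using f by simp
  show "real (sub_budget \<beta> N n) \<le> Y powr \<beta>" unfolding r by (rule of_int_floor_le)
  have "Y powr \<beta> < real (sub_budget \<beta> N n) + 1" unfolding r by (rule real_of_int_floor_add_one_gt)
  moreover have "1 \<le> real (sub_budget \<beta> N n)" using \<open>N0 \<le> sub_budget \<beta> N n\<close> by (simp add: N0_def)
  ultimately show "Y powr \<beta> \<le> 2 * real (sub_budget \<beta> N n)" by linarith
qed

text \<open>Since \<open>n \<le> 2 ^ dyadic_level n\<close>, the budgets are at most \<open>(Y / n) powr \<beta>\<close> with \<open>Y = (1 - \<beta>) * N\<close>, and there are at most
\<open>Y\<close> of them. Their sum is at most \<open>Y / (1 - \<beta>)\<close>: the factor \<open>1 - \<beta>\<close> compensates for the integration of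
\<open>x powr (- \<beta>)\<close>.\<close>

lemma sub_budget_total:
  fixes \<beta> :: real
  assumes \<beta>: "0 < \<beta>" "\<beta> < 1" and N: "N \<ge> 1"
  shows "(\<Sum>n=1..num_curvelets \<beta> N. sub_budget \<beta> N n) \<le> N"
proof -
  define m where "m = num_curvelets \<beta> N"
  define Y where "Y = (1 - \<beta>) * real N"
  have Y: "Y > 0" using \<beta> N by (simp add: Y_def)
  have mY: "real m \<le> Y"
  proof -
    have "real m \<le> (1 - \<beta>) / real N0 powr (1 / \<beta>) * real N"
      using num_curvelets_cases[of \<beta> N] \<beta> unfolding m_def by (auto intro!: mult_nonneg_nonneg divide_nonneg_nonneg)
    also have "\<dots> \<le> (1 - \<beta>) / 1 * real N"
      using \<beta> by (intro mult_right_mono divide_left_mono ge_one_powr_ge_zero) (auto simp: N0_def)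
    finally show ?thesis by (simp add: Y_def)
  qed
  have "(\<Sum>n=1..m. real (sub_budget \<beta> N n)) \<le> (\<Sum>n=1..m. Y powr \<beta> * real n powr (- \<beta>))"
  proof (rule sum_mono)
    fix n assume n: "n \<in> {1..m}"
    have "real (sub_budget \<beta> N n) \<le> (Y / 2 ^ dyadic_level n) powr \<beta>"
      using sub_budget_bounds(2)[OF \<beta> N, of n] n unfolding Y_def m_def by simp
    also have "\<dots> \<le> (Y / real n) powr \<beta>"
      using n Y \<beta> dyadic_level_bounds(2)[of n] by (intro powr_mono2 divide_left_mono) auto
    also have "\<dots> = Y powr \<beta> * real n powr (- \<beta>)"
      using powr_divide[of Y "real n" \<beta>] n Y by (simp add: powr_minus field_simps)
    finally show "real (sub_budget \<beta> N n) \<le> Y powr \<beta> * real n powr (- \<beta>)" .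
  qed
  also have "\<dots> = Y powr \<beta> * (\<Sum>n=1..m. real n powr (- \<beta>))" by (simp add: sum_distrib_left)
  also have "\<dots> \<le> Y powr \<beta> * (real m powr (1 - \<beta>) / (1 - \<beta>))"
    by (intro mult_left_mono sum_powr_le \<beta>) simp
  also have "\<dots> \<le> Y powr \<beta> * (Y powr (1 - \<beta>) / (1 - \<beta>))"
    using mY \<beta> by (intro mult_left_mono divide_right_mono powr_mono2) auto
  also have "\<dots> = real N"
  proof -
    have "Y powr \<beta> * Y powr (1 - \<beta>) = Y" using Y by (simp flip: powr_add)
    then show ?thesis using \<beta> by (simp add: Y_def)
  qed
  finally have "real (\<Sum>n=1..m. sub_budget \<beta> N n) \<le> real N" by simp
  then show ?thesis unfolding m_def of_nat_le_iff .
qed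

section \<open>Curvelets as images of their generators\<close>

lemma measurable_of_dilated:
  fixes f :: "real^2 \<Rightarrow> real"
  assumes "(\<lambda>\<eta>. c * f (curv_dil j *v \<eta>)) \<in> borel_measurable borel" "c \<noteq> 0"
  shows "f \<in> borel_measurable borel"
proof -
  define B :: "real^2^2" where "B = vector [vector [1 / 2 ^ j, 0], vector [0, 1 / 2 ^ (j div 2)]]"
  have "(B *v \<xi>) $ 1 = \<xi>$1 / 2 ^ j" "(B *v \<xi>) $ 2 = \<xi>$2 / 2 ^ (j div 2)" for \<xi>
    by (simp_all add: mat2_mult B_def)
  then have DB: "curv_dil j *v (B *v \<xi>) = \<xi>" for \<xi>
    by (simp add: vec_eq_iff forall_2 curv_dil_mult)
  have "(\<lambda>\<xi>. (1 / c) * (c * f (curv_dil j *v (B *v \<xi>)))) \<in> borel_measurable borel"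
    using measurable_compose[OF matrix_mult_measurable assms(1), of B] by measurable
  then show ?thesis using assms(2) by (simp add: DB)
qed

lemma lincomb_atmost_sum:
  assumes I: "finite I" and g: "\<And>n. n \<in> I \<Longrightarrow> lincomb_atmost (b n) D (g n)" and b: "(\<Sum>n\<in>I. b n) \<le> N"
  shows "lincomb_atmost N D (\<lambda>x. \<Sum>n\<in>I. a n * g n x)"
proof -
  have "\<forall>n\<in>I. \<exists>S. \<exists>c. finite S \<and> card S \<le> b n \<and> S \<subseteq> D \<and> g n = (\<lambda>x. \<Sum>s\<in>S. c s * s x)"
    using g unfolding lincomb_atmost_def by blast
  from bchoice[OF this] obtain S where
    "\<forall>n\<in>I. \<exists>c. finite (S n) \<and> card (S n) \<le> b n \<and> S n \<subseteq> D \<and> g n = (\<lambda>x. \<Sum>s\<in>S n. c s * s x)" ..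
  from bchoice[OF this] obtain c where
    Sc: "\<forall>n\<in>I. finite (S n) \<and> card (S n) \<le> b n \<and> S n \<subseteq> D \<and> g n = (\<lambda>x. \<Sum>s\<in>S n. c n s * s x)" ..
  define Z where "Z = (SIGMA n:I. S n)"
  have finZ: "finite Z" using I Sc by (auto simp: Z_def)
  have "card Z = (\<Sum>n\<in>I. card (S n))" unfolding Z_def using I Sc by (intro card_SigmaI) auto
  also have "\<dots> \<le> (\<Sum>n\<in>I. b n)" using Sc by (intro sum_mono) auto
  finally have card: "card Z \<le> N" using b by simp
  have "(\<lambda>x. \<Sum>n\<in>I. a n * g n x) = (\<lambda>x. \<Sum>z\<in>Z. (a (fst z) * c (fst z) (snd z)) * snd z x)"
  proof
    fix x
    have "(\<Sum>n\<in>I. a n * g n x) = (\<Sum>n\<in>I. \<Sum>s\<in>S n. (a n * c n s) * s x)"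
      using Sc by (intro sum.cong refl) (simp add: sum_distrib_left mult.assoc)
    also have "\<dots> = (\<Sum>z\<in>Z. (a (fst z) * c (fst z) (snd z)) * snd z x)"
      unfolding Z_def using I Sc by (subst sum.Sigma) (auto simp: split_beta)
    finally show "(\<Sum>n\<in>I. a n * g n x) = (\<Sum>z\<in>Z. (a (fst z) * c (fst z) (snd z)) * snd z x)" .
  qed
  moreover have "lincomb_atmost N D (\<lambda>x. \<Sum>z\<in>Z. (a (fst z) * c (fst z) (snd z)) * snd z x)"
    by (rule lincomb_atmost_indexed[OF finZ card]) (use Sc in \<open>fastforce simp: Z_def\<close>)
  ultimately show ?thesis by simp
qed

lemma curv_rot_det: "det (curv_rot j l) = 1"
  using sin_cos_squared_add[of "pi * real l / 2 ^ (j div 2)"]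
  unfolding det_2 curv_rot_def Let_def vec2_entries power2_eq_square by linarith

lemma curv_U_gauss_dict:
  assumes "lincomb_atmost M gauss_translates G"
  shows "lincomb_atmost M gauss_dict (curv_U \<gamma> G)"
proof -
  obtain j l k where \<gamma>: "\<gamma> = (j, l, k)" by (cases \<gamma>) auto
  obtain S c where S: "finite S" "card S \<le> M" "S \<subseteq> gauss_translates" "G = (\<lambda>x. \<Sum>s\<in>S. c s * s x)"
    using assms by (auto simp: lincomb_atmost_def)
  define A where "A = curv_dil j ** transpose (curv_rot j l)"
  have "det A \<noteq> 0" unfolding A_def det_mul det_transpose curv_rot_det det_curv_dil by simp
  then have inv: "invertible A" by (simp add: invertible_det_nz)
  then obtain B where AB: "A ** B = mat 1" unfolding invertible_def by blast
  have "(\<lambda>x. s (curv_dil j *v (transpose (curv_rot j l) *v x - k))) \<in> gauss_dict" if "s \<in> S" for s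
  proof -
    obtain y where y: "s = (\<lambda>x. gauss (x - y))" using S(3) \<open>s \<in> S\<close> by (auto simp: gauss_translates_def)
    define k' where "k' = B *v (curv_dil j *v k + y)"
    have "A *v (x - k') = curv_dil j *v (transpose (curv_rot j l) *v x - k) - y" for x
    proof -
      have "A *v k' = curv_dil j *v k + y" by (simp add: k'_def matrix_vector_mul_assoc AB)
      moreover have "A *v x = curv_dil j *v (transpose (curv_rot j l) *v x)"
        by (simp only: A_def matrix_vector_mul_assoc)
      ultimately show ?thesis
        by (simp only: matrix_vector_mult_diff_distrib) simp
    qed
    then have "(\<lambda>x. s (curv_dil j *v (transpose (curv_rot j l) *v x - k))) = (\<lambda>x. complex_of_real (exp (- (norm (A *v (x - k')))\<^sup>2)))"
      unfolding y gauss_def by (simp only:)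
    then show ?thesis using inv unfolding gauss_dict_def by blast
  qed
  from lincomb_atmost_indexed[OF S(1,2), of "\<lambda>s x. s (curv_dil j *v (transpose (curv_rot j l) *v x - k))", OF this,
      of "\<lambda>s. complex_of_real (sqrt (det (curv_dil j))) * c s"]
  show ?thesis unfolding \<gamma> S(4) curv_U.simps sum_distrib_left mult.assoc .
qed

context curvelet_window_functions
begin

lemma chi_measurable: "chi w0 w v j \<in> borel_measurable borel"
proof (rule measurable_of_dilated)
  show "(\<lambda>\<eta>. sqrt (det (curv_dil j) / (Lam j * lam j)) * chi w0 w v j (curv_dil j *v \<eta>)) \<in> borel_measurable borel"
    using curv_gen_measurable[of j] unfolding curv_gen_def[abs_def] .
  have "0 < Lam j" using Lam_bounds(1)[of j] by (rule less_le_trans[rotated]) simp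
  moreover have "0 < lam j" using lam_bounds(1)[of j] by (rule less_le_trans[rotated]) simp
  ultimately show "sqrt (det (curv_dil j) / (Lam j * lam j)) \<noteq> 0"
    by (simp add: det_curv_dil)
qed

lemma curvelet_eq_curv_U:
  "curvelet w0 w v \<gamma> = curv_U \<gamma> (inv_fourier (\<lambda>\<xi>. complex_of_real (curv_gen (curv_scale \<gamma>) \<xi>)))"
proof
  fix x
  obtain j l k where \<gamma>: "\<gamma> = (j, l, k)" by (cases \<gamma>) auto
  note [measurable] = chi_measurable[of j]
  define d where "d = det (curv_dil j)"
  define q where "q = Lam j * lam j"
  have d: "d > 0" by (simp add: d_def det_curv_dil)
  have "0 < Lam j" using Lam_bounds(1)[of j] by (rule less_le_trans[rotated]) simp
  moreover have "0 < lam j" using lam_bounds(1)[of j] by (rule less_le_trans[rotated]) simp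
  ultimately have q: "q > 0" by (simp add: q_def)
  define z where "z = transpose (curv_rot j l) *v x - k"
  define I where "I = (LINT \<eta>|lborel. complex_of_real (chi w0 w v j (curv_dil j *v \<eta>)) * cis ((curv_dil j *v z) \<bullet> \<eta>))"
  have "z \<bullet> (curv_dil j *v \<eta>) = (curv_dil j *v z) \<bullet> \<eta>" for \<eta>
    by (simp add: inner_vec2 curv_dil_mult)
  then have "(LINT \<xi>|lborel. complex_of_real (chi w0 w v j \<xi>) * cis (z \<bullet> \<xi>)) = \<bar>d\<bar> *\<^sub>R I"
    unfolding I_def using d
    by (subst integral_matrix_substitution[of "curv_dil j"]) (simp_all add: d_def cis_conv_exp)
  then have L: "curvelet w0 w v \<gamma> x = complex_of_real (1 / sqrt q) * (complex_of_real (1 / (2 * pi)) * (complex_of_real d * I))"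
    using d unfolding \<gamma> curvelet.simps inv_fourier_def z_def[symmetric] q_def[symmetric] by (simp add: scaleR_conv_of_real)
  have "(LINT \<eta>|lborel. complex_of_real (curv_gen j \<eta>) * cis ((curv_dil j *v z) \<bullet> \<eta>)) = complex_of_real (sqrt (d / q)) * I"
    unfolding I_def curv_gen_def d_def q_def of_real_mult mult.assoc integral_mult_right_zero ..
  then have R: "curv_U \<gamma> (inv_fourier (\<lambda>\<xi>. complex_of_real (curv_gen (curv_scale \<gamma>) \<xi>))) x
    = complex_of_real (sqrt d) * (complex_of_real (1 / (2 * pi)) * (complex_of_real (sqrt (d / q)) * I))"
    unfolding \<gamma> curv_U.simps curv_scale.simps inv_fourier_def z_def[symmetric] d_def[symmetric] by simp
  have s: "sqrt d * sqrt (d / q) = 1 / sqrt q * d" using d q by (simp add: real_sqrt_divide)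
  have "curv_U \<gamma> (inv_fourier (\<lambda>\<xi>. complex_of_real (curv_gen (curv_scale \<gamma>) \<xi>))) x
    = complex_of_real (1 / (2 * pi)) * (complex_of_real (sqrt d * sqrt (d / q)) * I)"
    unfolding R of_real_mult by (simp only: mult_ac)
  also have "\<dots> = curvelet w0 w v \<gamma> x"
    unfolding s L of_real_mult by (simp only: mult_ac)
  finally show "curvelet w0 w v \<gamma> x = curv_U \<gamma> (inv_fourier (\<lambda>\<xi>. complex_of_real (curv_gen (curv_scale \<gamma>) \<xi>))) x" ..
qed

lemma curv_U_diff: "curv_U \<gamma> (\<lambda>x. f x - g x) x = curv_U \<gamma> f x - curv_U \<gamma> g x"
  by (cases \<gamma>) (simp add: right_diff_distrib)

lemma weight_integrable: "integrable lborel (weight j)"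
proof (rule Bochner_Integration.integrable_bound)
  show "integrable lborel (\<lambda>\<xi>::real^2. 16 * exp (- (1/16) * (norm \<xi>)\<^sup>2))"
    by (intro integrable_mult_right gauss_integrable_vec2) simp
  show "AE \<xi> in lborel. norm (weight j \<xi>) \<le> norm (16 * exp (- (1/16) * (norm \<xi>)\<^sup>2))"
    using weight_le_gauss weight_nonneg by (intro AE_I2) simp
qed measurable

lemma weight_bounded_integrable:
  assumes [measurable]: "F \<in> borel_measurable borel" and b: "\<And>\<xi>. norm (F \<xi> :: complex) \<le> C * weight j \<xi>"
  shows "integrable lborel (\<lambda>\<xi>. F \<xi> * cis (x \<bullet> \<xi>))"
proof (rule Bochner_Integration.integrable_bound)
  show "integrable lborel (\<lambda>\<xi>. C * weight j \<xi>)" by (intro integrable_mult_right weight_integrable)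
  show "AE \<xi> in lborel. norm (F \<xi> * cis (x \<bullet> \<xi>)) \<le> norm (C * weight j \<xi>)"
    using b by (intro AE_I2) (auto simp: norm_mult intro: order.trans[OF _ abs_ge_self])
qed (auto simp: cis_conv_exp)

text \<open>Both spectra are dominated by a multiple of a weight and hence integrable, which makes \<open>inv_fourier\<close> additive.\<close>

lemma curvelet_error_eq:
  assumes F: "F \<in> gauss_spectra M" and e: "spectral_error (curv_scale \<gamma>) F \<delta>"
  shows "curv_U \<gamma> (inv_fourier F) x - curvelet w0 w v \<gamma> x
    = curv_U \<gamma> (inv_fourier (\<lambda>\<xi>. F \<xi> - complex_of_real (curv_gen (curv_scale \<gamma>) \<xi>))) x"
proof -
  define j where "j = curv_scale \<gamma>"
  note [measurable] = gauss_spectra_measurable[OF F]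
  obtain B where B: "B \<ge> 0" "\<forall>j \<xi>. \<bar>curv_gen j \<xi>\<bar> \<le> B * weight j \<xi>" using curv_gen_weight_bound by blast
  have e': "norm (F \<xi> - complex_of_real (curv_gen j \<xi>)) \<le> \<delta> * weight j \<xi>" for \<xi>
    using e by (simp add: spectral_error_def j_def)
  have g: "norm (complex_of_real (curv_gen j \<xi>)) \<le> B * weight j \<xi>" for \<xi> using B(2) by simp
  have Fb: "norm (F \<xi>) \<le> (\<delta> + B) * weight j \<xi>" for \<xi>
    using norm_triangle_ineq[of "F \<xi> - complex_of_real (curv_gen j \<xi>)" "complex_of_real (curv_gen j \<xi>)"] e'[of \<xi>] g[of \<xi>]
    by (simp add: distrib_right)
  have i1: "integrable lborel (\<lambda>\<xi>. F \<xi> * cis (y \<bullet> \<xi>))" for y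
    by (rule weight_bounded_integrable[OF _ Fb]) measurable
  have i2: "integrable lborel (\<lambda>\<xi>. complex_of_real (curv_gen j \<xi>) * cis (y \<bullet> \<xi>))" for y
    by (rule weight_bounded_integrable[OF _ g]) measurable
  have "inv_fourier (\<lambda>\<xi>. F \<xi> - complex_of_real (curv_gen j \<xi>)) y = inv_fourier F y - inv_fourier (\<lambda>\<xi>. complex_of_real (curv_gen j \<xi>)) y" for y
    unfolding inv_fourier_def left_diff_distrib Bochner_Integration.integral_diff[OF i1 i2] right_diff_distrib ..
  then have "inv_fourier (\<lambda>\<xi>. F \<xi> - complex_of_real (curv_gen j \<xi>)) = (\<lambda>y. inv_fourier F y - inv_fourier (\<lambda>\<xi>. complex_of_real (curv_gen j \<xi>)) y)"
    by (rule ext)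
  then show ?thesis
    unfolding curvelet_eq_curv_U j_def[symmetric] by (simp only: curv_U_diff)
qed

text \<open>The synthesis bound for the generators themselves.\<close>

lemma curvelet_combination_bound:
  "\<exists>B\<ge>0. \<forall>I c. finite I \<longrightarrow> I \<subseteq> curv_indices \<longrightarrow>
     (\<lambda>x. \<Sum>\<gamma>\<in>I. c \<gamma> * curvelet w0 w v \<gamma> x) \<in> L2 \<and>
     L2_norm (\<lambda>x. \<Sum>\<gamma>\<in>I. c \<gamma> * curvelet w0 w v \<gamma> x) \<le> B * sqrt (\<Sum>\<gamma>\<in>I. (norm (c \<gamma>))\<^sup>2)"
proof -
  obtain B where B: "B \<ge> 0" "\<forall>j \<xi>. \<bar>curv_gen j \<xi>\<bar> \<le> B * weight j \<xi>" using curv_gen_weight_bound by blast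
  have g: "norm (complex_of_real (curv_gen j \<xi>)) \<le> B * weight j \<xi>" for j \<xi> using B(2) by simp
  have m: "(\<lambda>\<xi>. complex_of_real (curv_gen j \<xi>)) \<in> borel_measurable borel" for j by measurable
  show ?thesis
    unfolding curvelet_eq_curv_U
    using curvelet_synthesis_bound[where F = "\<lambda>j \<xi>. complex_of_real (curv_gen j \<xi>)" and \<delta> = B, OF _ _ m g B(1)] B(1)
    by (intro exI[of _ "synthesis_const * B"]) (auto simp: synthesis_const_def)
qed

end

section \<open>Error of the approximation\<close>

lemma L2_norm_minus: "L2_norm (\<lambda>x. f x - g x) = L2_norm (\<lambda>x. g x - f x)"
  by (simp add: L2_norm_def norm_minus_commute)

lemma geometric_sum_le:
  fixes x :: real assumes "x \<ge> 2"
  shows "(\<Sum>\<nu>\<le>\<mu>. x ^ \<nu>) \<le> 2 * x ^ \<mu>"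
proof (induction \<mu>)
  case (Suc \<mu>)
  have "2 * x ^ \<mu> \<le> x * x ^ \<mu>" using assms by (intro mult_right_mono) auto
  then show ?case using Suc by simp
qed simp

context curvelet_window_functions
begin

lemma decr_rearrangement_indices:
  assumes p: "decr_rearrangement w0 w v f p"
  shows "n \<ge> 1 \<Longrightarrow> p n \<in> curv_indices" "inj_on p {1..}"
proof -
  show "n \<ge> 1 \<Longrightarrow> p n \<in> curv_indices" using p by (auto simp: decr_rearrangement_def)
  show "inj_on p {1..}"
    using p unfolding decr_rearrangement_def by (auto simp: inj_on_def)
qed

lemma curvelet_sum_reindex:
  assumes p: "decr_rearrangement w0 w v f p" and A: "A \<subseteq> {1..}"
  shows "(\<Sum>n\<in>A. a n * h (p n)) = (\<Sum>\<gamma>\<in>p ` A. a (inv_into {1..} p \<gamma>) * h \<gamma>)"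
    "(\<Sum>n\<in>A. b n) = (\<Sum>\<gamma>\<in>p ` A. b (inv_into {1..} p \<gamma>))"
proof -
  have inj: "inj_on p {1..}" by (rule decr_rearrangement_indices(2)[OF p])
  have injA: "inj_on p A" by (rule inj_on_subset[OF inj A])
  have i: "inv_into {1..} p (p n) = n" if "n \<in> A" for n using inv_into_f_f[OF inj, of n] A that by blast
  show "(\<Sum>n\<in>A. a n * h (p n)) = (\<Sum>\<gamma>\<in>p ` A. a (inv_into {1..} p \<gamma>) * h \<gamma>)"
    using i by (simp add: sum.reindex[OF injA])
  show "(\<Sum>n\<in>A. b n) = (\<Sum>\<gamma>\<in>p ` A. b (inv_into {1..} p \<gamma>))"
    using i by (simp add: sum.reindex[OF injA])
qed

text \<open>Terms with a common budget use one spectrum per scale, as \<open>curvelet_synthesis_bound\<close> presupposes.\<close>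

lemma block_error:
  assumes p: "decr_rearrangement w0 w v f p" and A: "finite A" "A \<subseteq> {1..}"
    and F: "\<And>j. F j \<in> gauss_spectra M" and e: "\<And>j. spectral_error j (F j) \<delta>" and \<delta>: "\<delta> \<ge> 0"
  shows "(\<lambda>x. \<Sum>n\<in>A. a n * (curv_U (p n) (inv_fourier (F (curv_scale (p n)))) x - curvelet w0 w v (p n) x)) \<in> L2"
    and "L2_norm (\<lambda>x. \<Sum>n\<in>A. a n * (curv_U (p n) (inv_fourier (F (curv_scale (p n)))) x - curvelet w0 w v (p n) x))
      \<le> synthesis_const * \<delta> * sqrt (\<Sum>n\<in>A. (norm (a n))\<^sup>2)"
proof -
  define E where "E j \<xi> = F j \<xi> - complex_of_real (curv_gen j \<xi>)" for j \<xi>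
  have Em: "E j \<in> borel_measurable borel" for j
    using gauss_spectra_measurable[OF F[of j]] unfolding E_def by measurable
  have Eb: "norm (E j \<xi>) \<le> \<delta> * weight j \<xi>" for j \<xi>
    using e[of j] by (simp add: spectral_error_def E_def)
  have sub: "p ` A \<subseteq> curv_indices" using decr_rearrangement_indices(1)[OF p] A by auto
  have eq: "(\<lambda>x. \<Sum>n\<in>A. a n * (curv_U (p n) (inv_fourier (F (curv_scale (p n)))) x - curvelet w0 w v (p n) x))
     = (\<lambda>x. \<Sum>\<gamma>\<in>p ` A. a (inv_into {1..} p \<gamma>) * curv_U \<gamma> (inv_fourier (E (curv_scale \<gamma>))) x)"
  proof
    fix x
    have "(\<Sum>n\<in>A. a n * (curv_U (p n) (inv_fourier (F (curv_scale (p n)))) x - curvelet w0 w v (p n) x))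
      = (\<Sum>n\<in>A. a n * curv_U (p n) (inv_fourier (E (curv_scale (p n)))) x)"
      using curvelet_error_eq[OF F e] by (simp add: E_def[abs_def])
    also have "\<dots> = (\<Sum>\<gamma>\<in>p ` A. a (inv_into {1..} p \<gamma>) * curv_U \<gamma> (inv_fourier (E (curv_scale \<gamma>))) x)"
      by (rule curvelet_sum_reindex(1)[OF p A(2), of a "\<lambda>\<gamma>. curv_U \<gamma> (inv_fourier (E (curv_scale \<gamma>))) x"])
    finally show "(\<Sum>n\<in>A. a n * (curv_U (p n) (inv_fourier (F (curv_scale (p n)))) x - curvelet w0 w v (p n) x))
     = (\<Sum>\<gamma>\<in>p ` A. a (inv_into {1..} p \<gamma>) * curv_U \<gamma> (inv_fourier (E (curv_scale \<gamma>))) x)" .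
  qed
  note syn = curvelet_synthesis_bound[OF finite_imageI[OF A(1)] sub Em Eb \<delta>, of "\<lambda>\<gamma>. a (inv_into {1..} p \<gamma>)"]
  show "(\<lambda>x. \<Sum>n\<in>A. a n * (curv_U (p n) (inv_fourier (F (curv_scale (p n)))) x - curvelet w0 w v (p n) x)) \<in> L2"
    unfolding eq by (rule syn(1))
  show "L2_norm (\<lambda>x. \<Sum>n\<in>A. a n * (curv_U (p n) (inv_fourier (F (curv_scale (p n)))) x - curvelet w0 w v (p n) x))
      \<le> synthesis_const * \<delta> * sqrt (\<Sum>n\<in>A. (norm (a n))\<^sup>2)"
    unfolding eq curvelet_sum_reindex(2)[OF p A(2), of "\<lambda>n. (norm (a n))\<^sup>2"] by (rule syn(2))
qed

text \<open>A finite partial sum of the expansion close to \<open>f\<close> can be enlarged to contain the first \<open>m\<close> terms. It then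
differs from their sum by finitely many later terms, which the synthesis bound controls. The
expansion runs over curvelets as functions; those missing from the rearrangement have zero coefficients.\<close>

lemma expansion_tail_error:
  assumes B: "\<forall>I c. finite I \<longrightarrow> I \<subseteq> curv_indices \<longrightarrow>
     (\<lambda>x. \<Sum>\<gamma>\<in>I. c \<gamma> * curvelet w0 w v \<gamma> x) \<in> L2 \<and>
     L2_norm (\<lambda>x. \<Sum>\<gamma>\<in>I. c \<gamma> * curvelet w0 w v \<gamma> x) \<le> B * sqrt (\<Sum>\<gamma>\<in>I. (norm (c \<gamma>))\<^sup>2)" "B \<ge> 0"
    and f: "f \<in> L2" "has_curv_expansion w0 w v f" and p: "decr_rearrangement w0 w v f p"
    and T: "\<And>L. (\<Sum>n=Suc m..L. (coeff_abs w0 w v f p n)\<^sup>2) \<le> T"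
  shows "(\<lambda>x. \<Sum>n=1..m. L2_inner f (curvelet w0 w v (p n)) * curvelet w0 w v (p n) x) \<in> L2"
    and "L2_norm (\<lambda>x. (\<Sum>n=1..m. L2_inner f (curvelet w0 w v (p n)) * curvelet w0 w v (p n) x) - f x) \<le> B * sqrt T"
proof -
  define \<omega> where "\<omega> n = L2_inner f (curvelet w0 w v (p n))" for n
  define cp where "cp n = curvelet w0 w v (p n)" for n
  have fin: "(\<lambda>x. \<Sum>n\<in>A. \<omega> n * cp n x) \<in> L2"
    "L2_norm (\<lambda>x. \<Sum>n\<in>A. \<omega> n * cp n x) \<le> B * sqrt (\<Sum>n\<in>A. (norm (\<omega> n))\<^sup>2)" if A: "finite A" "A \<subseteq> {1..}" for A
  proof -
    have sub: "p ` A \<subseteq> curv_indices" using decr_rearrangement_indices(1)[OF p] A by auto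
    have eq: "(\<lambda>x. \<Sum>n\<in>A. \<omega> n * cp n x) = (\<lambda>x. \<Sum>\<gamma>\<in>p ` A. \<omega> (inv_into {1..} p \<gamma>) * curvelet w0 w v \<gamma> x)"
      unfolding cp_def using curvelet_sum_reindex(1)[OF p A(2), of \<omega>] by (intro ext)
    have P: "(\<lambda>x. \<Sum>\<gamma>\<in>p ` A. \<omega> (inv_into {1..} p \<gamma>) * curvelet w0 w v \<gamma> x) \<in> L2 \<and>
     L2_norm (\<lambda>x. \<Sum>\<gamma>\<in>p ` A. \<omega> (inv_into {1..} p \<gamma>) * curvelet w0 w v \<gamma> x) \<le> B * sqrt (\<Sum>\<gamma>\<in>p ` A. (norm (\<omega> (inv_into {1..} p \<gamma>)))\<^sup>2)"
      using B(1)[THEN spec[of _ "p ` A"], THEN spec[of _ "\<lambda>\<gamma>. \<omega> (inv_into {1..} p \<gamma>)"]] A(1) sub by blast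
    show "(\<lambda>x. \<Sum>n\<in>A. \<omega> n * cp n x) \<in> L2" unfolding eq using P by blast
    show "L2_norm (\<lambda>x. \<Sum>n\<in>A. \<omega> n * cp n x) \<le> B * sqrt (\<Sum>n\<in>A. (norm (\<omega> n))\<^sup>2)"
      unfolding eq curvelet_sum_reindex(2)[OF p A(2), of "\<lambda>n. (norm (\<omega> n))\<^sup>2"] using P by blast
  qed
  have injcp: "inj_on cp {1..}"
    using p unfolding decr_rearrangement_def cp_def[abs_def] by blast
  show L2m: "(\<lambda>x. \<Sum>n=1..m. L2_inner f (curvelet w0 w v (p n)) * curvelet w0 w v (p n) x) \<in> L2"
    using fin(1)[of "{1..m}"] unfolding \<omega>_def cp_def by auto
  have step: "L2_norm (\<lambda>x. (\<Sum>n=1..m. \<omega> n * cp n x) - f x) \<le> B * sqrt T + e" if e: "e > 0" for e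
  proof -
    have "eventually (\<lambda>G. dist (L2_norm (\<lambda>x. f x - (\<Sum>g\<in>G. L2_inner f g * g x))) 0 < e) (finite_subsets_at_top (curv_dict w0 w v))"
      using f(2) e unfolding has_curv_expansion_def by (rule tendstoD)
    then obtain X where X: "finite X" "X \<subseteq> curv_dict w0 w v"
      "\<And>G. finite G \<Longrightarrow> X \<subseteq> G \<Longrightarrow> G \<subseteq> curv_dict w0 w v \<Longrightarrow> L2_norm (\<lambda>x. f x - (\<Sum>g\<in>G. L2_inner f g * g x)) < e"
      unfolding eventually_finite_subsets_at_top by auto
    define G where "G = X \<union> cp ` {1..m}"
    have cpd: "cp n \<in> curv_dict w0 w v" if "n \<ge> 1" for n
      using decr_rearrangement_indices(1)[OF p that] by (auto simp: cp_def curv_dict_def)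
    have G: "finite G" "X \<subseteq> G" "G \<subseteq> curv_dict w0 w v" using X cpd by (auto simp: G_def)
    define A where "A = {n\<in>{1..}. cp n \<in> G}"
    have finA: "finite A"
      by (rule finite_imageD[of cp]) (use G(1) injcp in \<open>auto simp: A_def intro: finite_subset inj_on_subset\<close>)
    have sub: "{1..m} \<subseteq> A" by (auto simp: A_def G_def)
    have A1: "A \<subseteq> {1..}" by (auto simp: A_def)
    have GA: "(\<Sum>g\<in>G. L2_inner f g * g x) = (\<Sum>n\<in>A. \<omega> n * cp n x)" for x
    proof -
      have "(\<Sum>g\<in>G. L2_inner f g * g x) = (\<Sum>g\<in>cp ` A. L2_inner f g * g x)"
      proof (rule sum.mono_neutral_right[OF G(1)])
        show "cp ` A \<subseteq> G" by (auto simp: A_def)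
        show "\<forall>g\<in>G - cp ` A. L2_inner f g * g x = 0"
        proof
          fix g assume g: "g \<in> G - cp ` A"
          have "L2_inner f g = 0"
          proof (rule ccontr)
            assume "L2_inner f g \<noteq> 0"
            then have "g \<in> cp ` {1..}" using p g G(3) unfolding decr_rearrangement_def cp_def[abs_def] by blast
            then show False using g by (auto simp: A_def)
          qed
          then show "L2_inner f g * g x = 0" by simp
        qed
      qed
      also have "\<dots> = (\<Sum>n\<in>A. \<omega> n * cp n x)"
        by (subst sum.reindex[OF inj_on_subset[OF injcp A1]]) (simp add: \<omega>_def cp_def)
      finally show ?thesis .
    qed
    have le: "L2_norm (\<lambda>x. f x - (\<Sum>n\<in>A. \<omega> n * cp n x)) < e"
      using X(3)[OF G] unfolding GA .
    have tail: "L2_norm (\<lambda>x. \<Sum>n\<in>A - {1..m}. \<omega> n * cp n x) \<le> B * sqrt T"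
    proof -
      have "L2_norm (\<lambda>x. \<Sum>n\<in>A - {1..m}. \<omega> n * cp n x) \<le> B * sqrt (\<Sum>n\<in>A - {1..m}. (norm (\<omega> n))\<^sup>2)"
        by (rule fin(2)) (use finA A1 in auto)
      also have "(\<Sum>n\<in>A - {1..m}. (norm (\<omega> n))\<^sup>2) \<le> (\<Sum>n=Suc m..Max (insert 0 A). (norm (\<omega> n))\<^sup>2)"
        using finA A1 by (intro sum_mono2) (auto simp: Suc_le_eq not_le)
      also have "\<dots> \<le> T" using T unfolding coeff_abs_def \<omega>_def .
      finally show ?thesis using B(2) by (simp add: mult_left_mono)
    qed
    have split: "(\<Sum>n\<in>A. \<omega> n * cp n x) = (\<Sum>n=1..m. \<omega> n * cp n x) + (\<Sum>n\<in>A - {1..m}. \<omega> n * cp n x)" for x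
      using sum.subset_diff[OF sub finA] by (simp add: add.commute)
    have AL2: "(\<lambda>x. f x - (\<Sum>n\<in>A. \<omega> n * cp n x)) \<in> L2" by (intro L2_diff f(1) fin(1) finA A1)
    have tL2: "(\<lambda>x. \<Sum>n\<in>A - {1..m}. \<omega> n * cp n x) \<in> L2" by (rule fin(1)) (use finA A1 in auto)
    have "L2_norm (\<lambda>x. f x - (\<Sum>n=1..m. \<omega> n * cp n x))
      = L2_norm (\<lambda>x. (f x - (\<Sum>n\<in>A. \<omega> n * cp n x)) + (\<Sum>n\<in>A - {1..m}. \<omega> n * cp n x))"
      unfolding split by simp
    also have "\<dots> \<le> L2_norm (\<lambda>x. f x - (\<Sum>n\<in>A. \<omega> n * cp n x)) + L2_norm (\<lambda>x. \<Sum>n\<in>A - {1..m}. \<omega> n * cp n x)"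
      by (rule L2_norm_add_le[OF AL2 tL2])
    finally show ?thesis using le tail L2_norm_minus[of f] by simp
  qed
  then have "L2_norm (\<lambda>x. (\<Sum>n=1..m. \<omega> n * cp n x) - f x) \<le> B * sqrt T"
    by (rule field_le_epsilon)
  then show "L2_norm (\<lambda>x. (\<Sum>n=1..m. L2_inner f (curvelet w0 w v (p n)) * curvelet w0 w v (p n) x) - f x) \<le> B * sqrt T"
    unfolding \<omega>_def cp_def .
qed

text \<open>A block has at most \<open>2 ^ \<nu>\<close> coefficients, each at most of order \<open>(2 ^ \<nu>) powr (- \<alpha>)\<close>.\<close>

lemma dyadic_block_energy:
  assumes f: "f \<in> curv_class w0 w v \<alpha>" and p: "decr_rearrangement w0 w v f p" and \<alpha>: "\<alpha> > 0"
    and A: "\<And>n. n \<in> A \<Longrightarrow> 1 \<le> n \<and> dyadic_level n = \<nu>"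
  shows "sqrt (\<Sum>n\<in>A. (norm (L2_inner f (curvelet w0 w v (p n))))\<^sup>2)
    \<le> curv_quasinorm w0 w v \<alpha> f * 2 powr \<alpha> * (2 ^ \<nu>) powr (1/2 - \<alpha>)"
proof -
  define q where "q = curv_quasinorm w0 w v \<alpha> f"
  have q0: "q \<ge> 0" unfolding q_def by (rule coeff_le_quasinorm(2)[OF f p order.refl])
  define t :: real where "t = 2 ^ \<nu>"
  have t: "t > 0" by (simp add: t_def)
  have each: "norm (L2_inner f (curvelet w0 w v (p n))) \<le> q * (2 powr \<alpha> * t powr (- \<alpha>))" if n: "n \<in> A" for n
  proof -
    have n1: "1 \<le> n" and lv: "dyadic_level n = \<nu>" using A[OF n] by auto
    have "norm (L2_inner f (curvelet w0 w v (p n))) \<le> q * real n powr (- \<alpha>)"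
      using coeff_le_quasinorm(1)[OF f p n1] by (simp add: coeff_abs_def q_def)
    also have "\<dots> \<le> q * (t / 2) powr (- \<alpha>)"
      using dyadic_level_bounds(1)[OF n1] t \<alpha> q0 by (intro mult_left_mono powr_mono2') (auto simp: lv t_def)
    also have "(t / 2) powr (- \<alpha>) = 2 powr \<alpha> * t powr (- \<alpha>)"
      by (simp add: powr_divide powr_minus field_simps)
    finally show ?thesis .
  qed
  have "A \<subseteq> {1..2 ^ \<nu>}"
  proof
    fix n assume n: "n \<in> A"
    then have "real n \<le> 2 ^ \<nu>" using dyadic_level_bounds(2)[of n] A[OF n] by simp
    then have "n \<le> 2 ^ \<nu>" by (metis of_nat_le_iff of_nat_numeral of_nat_power)
    then show "n \<in> {1..2 ^ \<nu>}" using A[OF n] by simp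
  qed
  then have "card A \<le> card {1..(2::nat) ^ \<nu>}" by (intro card_mono) auto
  then have "card A \<le> 2 ^ \<nu>" by simp
  then have cA: "real (card A) \<le> t" unfolding t_def by (metis of_nat_le_iff of_nat_numeral of_nat_power)
  have "(\<Sum>n\<in>A. (norm (L2_inner f (curvelet w0 w v (p n))))\<^sup>2) \<le> (\<Sum>n\<in>A. (q * (2 powr \<alpha> * t powr (- \<alpha>)))\<^sup>2)"
    by (intro sum_mono power_mono each) auto
  also have "\<dots> = real (card A) * (q * (2 powr \<alpha> * t powr (- \<alpha>)))\<^sup>2" by simp
  also have "\<dots> \<le> t * (q * (2 powr \<alpha> * t powr (- \<alpha>)))\<^sup>2" using cA by (intro mult_right_mono) auto
  finally have "sqrt (\<Sum>n\<in>A. (norm (L2_inner f (curvelet w0 w v (p n))))\<^sup>2) \<le> sqrt (t * (q * (2 powr \<alpha> * t powr (- \<alpha>)))\<^sup>2)"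
    by simp
  also have "\<dots> = t powr (1/2) * (q * (2 powr \<alpha> * t powr (- \<alpha>)))"
    using t q0 by (simp add: real_sqrt_mult powr_half_sqrt)
  also have "\<dots> = q * 2 powr \<alpha> * (t powr (1/2) * t powr (- \<alpha>))" by simp
  also have "t powr (1/2) * t powr (- \<alpha>) = t powr (1/2 - \<alpha>)" by (simp flip: powr_add)
  finally show ?thesis by (simp add: q_def t_def)
qed

text \<open>Let \<open>Y = (1 - \<beta>) * N\<close>. The error of block \<open>\<nu>\<close> is its energy times \<open>b powr (- K)\<close> for a budget \<open>b\<close> of order
\<open>(Y / 2 ^ \<nu>) powr \<beta>\<close>. This contains \<open>2 ^ \<nu>\<close> with the exponent \<open>\<beta> * K + 1/2 - \<alpha> \<ge> 1\<close>, so the sum over the blocks is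
a geometric sum dominated by its last term, where \<open>2 ^ \<nu> \<le> Y\<close>.\<close>

lemma approximated_part_error:
  fixes \<alpha> \<beta> :: real
  assumes \<beta>: "0 < \<beta>" "\<beta> < 1" and \<alpha>: "\<alpha> > 1/2" and K: "1 \<le> \<beta> * real K + 1/2 - \<alpha>"
    and F: "\<And>j M. F j M \<in> gauss_spectra M"
    and C: "C \<ge> 0" "\<And>j M. M \<ge> 1 \<Longrightarrow> spectral_error j (F j M) (C / real M ^ K)"
    and f: "f \<in> curv_class w0 w v \<alpha>" and p: "decr_rearrangement w0 w v f p" and N: "N \<ge> 1"
  defines "D \<equiv> \<lambda>n x. L2_inner f (curvelet w0 w v (p n)) *
      (curv_U (p n) (inv_fourier (F (curv_scale (p n)) (sub_budget \<beta> N n))) x - curvelet w0 w v (p n) x)"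
  shows "(\<lambda>x. \<Sum>n=1..num_curvelets \<beta> N. D n x) \<in> L2"
    and "L2_norm (\<lambda>x. \<Sum>n=1..num_curvelets \<beta> N. D n x)
       \<le> (2 * synthesis_const * C * 2 ^ K * 2 powr \<alpha>) * curv_quasinorm w0 w v \<alpha> f * ((1 - \<beta>) * real N) powr (1/2 - \<alpha>)"
proof -
  define q where "q = curv_quasinorm w0 w v \<alpha> f"
  have q0: "q \<ge> 0" unfolding q_def by (rule coeff_le_quasinorm(2)[OF f p order.refl])
  define Y where "Y = (1 - \<beta>) * real N"
  have Y: "Y > 0" using \<beta> N by (simp add: Y_def)
  define m where "m = num_curvelets \<beta> N"
  have sc0: "synthesis_const \<ge> 0" by (simp add: synthesis_const_def)
  have "(\<lambda>x. \<Sum>n=1..m. D n x) \<in> L2 \<and> L2_norm (\<lambda>x. \<Sum>n=1..m. D n x)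
       \<le> (2 * synthesis_const * C * 2 ^ K * 2 powr \<alpha>) * q * Y powr (1/2 - \<alpha>)"
  proof (cases "m = 0")
    case True
    have "0 \<le> (2 * synthesis_const * C * 2 ^ K * 2 powr \<alpha>) * q * Y powr (1/2 - \<alpha>)"
      using sc0 C(1) q0 by (intro mult_nonneg_nonneg) auto
    then show ?thesis using True by (simp add: L2_zero L2_norm_zero)
  next
    case False
    obtain \<mu> where \<mu>: "m = 2 ^ \<mu>" "2 ^ \<mu> \<le> (1 - \<beta>) / real N0 powr (1 / \<beta>) * real N"
      using num_curvelets_cases[of \<beta> N] False by (auto simp: m_def)
    have mY: "2 ^ \<mu> \<le> Y"
    proof -
      have "(1 - \<beta>) / real N0 powr (1 / \<beta>) * real N \<le> (1 - \<beta>) / 1 * real N"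
        using \<beta> by (intro mult_right_mono divide_left_mono ge_one_powr_ge_zero) (auto simp: N0_def)
      then show ?thesis using \<mu>(2) by (simp add: Y_def)
    qed
    define A where "A \<nu> = {n\<in>{1..m}. dyadic_level n = \<nu>}" for \<nu>
    define b where "b \<nu> = nat \<lfloor>(1 - \<beta>) powr \<beta> * (real N / 2 ^ \<nu>) powr \<beta>\<rfloor>" for \<nu> :: nat
    have bA: "sub_budget \<beta> N n = b \<nu>" if "n \<in> A \<nu>" for n \<nu>
      using that by (simp add: A_def sub_budget_def b_def)
    have lev: "dyadic_level ` {1..m} \<subseteq> {..\<mu>}"
    proof
      fix \<nu> assume "\<nu> \<in> dyadic_level ` {1..m}"
      then obtain n where n: "1 \<le> n" "n \<le> m" "\<nu> = dyadic_level n" by auto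
      have "real n \<le> 2 ^ \<mu>" using n(2) \<mu>(1) by (metis of_nat_le_iff of_nat_numeral of_nat_power)
      moreover have "2 ^ \<nu> / 2 < real n" using dyadic_level_bounds(1)[OF n(1)] by (simp only: n(3))
      ultimately have "(2::real) ^ \<nu> < 2 * 2 ^ \<mu>" by linarith
      then have "2 ^ \<nu> < (2::real) ^ Suc \<mu>" by simp
      then have "\<nu> < Suc \<mu>" by (rule power_less_imp_less_exp[rotated]) simp
      then show "\<nu> \<in> {..\<mu>}" by simp
    qed
    have split: "(\<Sum>n=1..m. D n x) = (\<Sum>\<nu>\<le>\<mu>. \<Sum>n\<in>A \<nu>. D n x)" for x
      unfolding A_def by (rule sum.group[symmetric]) (use lev in auto)
    have fA: "finite (A \<nu>)" "A \<nu> \<subseteq> {1..}" for \<nu> by (auto simp: A_def)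
    have DA: "(\<lambda>x. \<Sum>n\<in>A \<nu>. D n x) = (\<lambda>x. \<Sum>n\<in>A \<nu>. L2_inner f (curvelet w0 w v (p n)) *
      (curv_U (p n) (inv_fourier (F (curv_scale (p n)) (b \<nu>))) x - curvelet w0 w v (p n) x))" for \<nu>
      by (intro ext sum.cong refl) (simp add: D_def bA)
    define s where "s = \<beta> * real K + 1/2 - \<alpha>"
    have block: "(\<lambda>x. \<Sum>n\<in>A \<nu>. D n x) \<in> L2 \<and> L2_norm (\<lambda>x. \<Sum>n\<in>A \<nu>. D n x)
      \<le> (synthesis_const * C * 2 ^ K * 2 powr \<alpha>) * q * Y powr (- (\<beta> * real K)) * (2 powr s) ^ \<nu>"
      if \<nu>: "\<nu> \<in> {..\<mu>}" for \<nu>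
    proof -
      define t :: real where "t = 2 ^ \<nu>"
      have t: "t > 0" by (simp add: t_def)
      \<comment> \<open>the last index of the block, at which the bounds for the common budget are read off\<close>
      have wit: "2 ^ \<nu> \<in> A \<nu>"
      proof -
        have "dyadic_level (2 ^ \<nu>) = \<nu>" by (rule dyadic_level_eq) auto
        moreover have "(2::nat) ^ \<nu> \<le> m" unfolding \<mu>(1) using \<nu> by (intro power_increasing) auto
        ultimately show ?thesis by (simp add: A_def)
      qed
      then have n: "1 \<le> (2::nat) ^ \<nu>" "(2::nat) ^ \<nu> \<le> num_curvelets \<beta> N" "dyadic_level (2 ^ \<nu>) = \<nu>"
        by (auto simp: A_def m_def)
      have b3: "b \<nu> \<ge> 1" using sub_budget_bounds(1)[OF \<beta> N n(1,2)] bA[OF wit] by (simp add: N0_def)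
      have bY: "(Y / t) powr \<beta> \<le> 2 * real (b \<nu>)"
        using sub_budget_bounds(3)[OF \<beta> N n(1,2)] bA[OF wit] n(3) by (simp add: Y_def t_def)
      define \<delta> where "\<delta> = C / real (b \<nu>) ^ K"
      have \<delta>0: "\<delta> \<ge> 0" using C(1) by (simp add: \<delta>_def)
      have "((Y / t) powr \<beta>) ^ K \<le> (2 * real (b \<nu>)) ^ K" using bY by (intro power_mono) auto
      moreover have "((Y / t) powr \<beta>) ^ K = (Y / t) powr (\<beta> * real K)"
        using Y t by (simp add: powr_powr flip: powr_realpow)
      ultimately have "(Y / t) powr (\<beta> * real K) \<le> 2 ^ K * real (b \<nu>) ^ K" by (simp add: power_mult_distrib)
      then have "1 / real (b \<nu>) ^ K \<le> 2 ^ K * (Y / t) powr (- (\<beta> * real K))"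
        using b3 Y t by (simp add: powr_minus field_simps)
      then have "C * (1 / real (b \<nu>) ^ K) \<le> C * (2 ^ K * (Y / t) powr (- (\<beta> * real K)))"
        using C(1) by (intro mult_left_mono)
      also have "(Y / t) powr (- (\<beta> * real K)) = Y powr (- (\<beta> * real K)) * t powr (\<beta> * real K)"
        by (simp add: powr_divide powr_minus field_simps)
      finally have d: "\<delta> \<le> C * (2 ^ K * (Y powr (- (\<beta> * real K)) * t powr (\<beta> * real K)))" by (simp add: \<delta>_def)
      have e: "spectral_error j (F j (b \<nu>)) \<delta>" for j unfolding \<delta>_def by (rule C(2)[OF b3])
      note be = block_error[OF p fA[of \<nu>] F e \<delta>0, of "\<lambda>n. L2_inner f (curvelet w0 w v (p n))"]
      have en: "sqrt (\<Sum>n\<in>A \<nu>. (norm (L2_inner f (curvelet w0 w v (p n))))\<^sup>2) \<le> q * 2 powr \<alpha> * t powr (1/2 - \<alpha>)"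
        unfolding q_def t_def by (rule dyadic_block_energy[OF f p]) (use \<alpha> in \<open>auto simp: A_def\<close>)
      have "L2_norm (\<lambda>x. \<Sum>n\<in>A \<nu>. D n x) \<le> synthesis_const * \<delta> * sqrt (\<Sum>n\<in>A \<nu>. (norm (L2_inner f (curvelet w0 w v (p n))))\<^sup>2)"
        unfolding DA by (rule be(2))
      also have "\<dots> \<le> synthesis_const * (C * (2 ^ K * (Y powr (- (\<beta> * real K)) * t powr (\<beta> * real K)))) * (q * 2 powr \<alpha> * t powr (1/2 - \<alpha>))"
        using sc0 C(1) q0 \<delta>0 by (intro mult_mono d en mult_nonneg_nonneg) (auto intro: sum_nonneg)
      also have "\<dots> = (synthesis_const * C * 2 ^ K * 2 powr \<alpha>) * q * Y powr (- (\<beta> * real K)) * (t powr (\<beta> * real K) * t powr (1/2 - \<alpha>))"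
        by (simp only: mult_ac)
      also have "t powr (\<beta> * real K) * t powr (1/2 - \<alpha>) = t powr s" by (simp add: s_def add_diff_eq flip: powr_add)
      also have "t powr s = (2 powr s) ^ \<nu>" by (simp add: t_def powr_power powr_powr mult.commute flip: powr_realpow)
      finally show ?thesis using be(1) unfolding DA by blast
    qed
    have "L2_norm (\<lambda>x. \<Sum>n=1..m. D n x) \<le> (\<Sum>\<nu>\<le>\<mu>. L2_norm (\<lambda>x. \<Sum>n\<in>A \<nu>. D n x))"
      unfolding split by (rule L2_norm_sum_le) (use block in blast)
    also have "\<dots> \<le> (\<Sum>\<nu>\<le>\<mu>. (synthesis_const * C * 2 ^ K * 2 powr \<alpha>) * q * Y powr (- (\<beta> * real K)) * (2 powr s) ^ \<nu>)"
      using block by (intro sum_mono) blast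
    also have "\<dots> = (synthesis_const * C * 2 ^ K * 2 powr \<alpha>) * q * Y powr (- (\<beta> * real K)) * (\<Sum>\<nu>\<le>\<mu>. (2 powr s) ^ \<nu>)"
      by (simp only: sum_distrib_left)
    also have "\<dots> \<le> (synthesis_const * C * 2 ^ K * 2 powr \<alpha>) * q * Y powr (- (\<beta> * real K)) * (2 * Y powr s)"
    proof (rule mult_left_mono)
      have s1: "s \<ge> 1" using K by (simp add: s_def)
      then have "(2::real) powr 1 \<le> 2 powr s" by (intro powr_mono) auto
      then have "(\<Sum>\<nu>\<le>\<mu>. (2 powr s) ^ \<nu>) \<le> 2 * (2 powr s) ^ \<mu>" by (intro geometric_sum_le) simp
      also have "(2 powr s) ^ \<mu> = (2 ^ \<mu>) powr s" by (simp add: powr_power powr_powr mult.commute flip: powr_realpow)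
      also have "(2 ^ \<mu>) powr s \<le> Y powr s" using mY s1 by (intro powr_mono2) auto
      finally show "(\<Sum>\<nu>\<le>\<mu>. (2 powr s) ^ \<nu>) \<le> 2 * Y powr s" by simp
      show "0 \<le> (synthesis_const * C * 2 ^ K * 2 powr \<alpha>) * q * Y powr (- (\<beta> * real K))"
        using sc0 C(1) q0 by (intro mult_nonneg_nonneg) auto
    qed
    also have "\<dots> = (2 * synthesis_const * C * 2 ^ K * 2 powr \<alpha>) * q * (Y powr (- (\<beta> * real K)) * Y powr s)"
      by (simp only: mult_ac)
    also have "Y powr (- (\<beta> * real K)) * Y powr s = Y powr (1/2 - \<alpha>)" by (simp add: s_def flip: powr_add)
    finally have "L2_norm (\<lambda>x. \<Sum>n=1..m. D n x) \<le> (2 * synthesis_const * C * 2 ^ K * 2 powr \<alpha>) * q * Y powr (1/2 - \<alpha>)" .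
    moreover have "(\<lambda>x. \<Sum>n=1..m. D n x) \<in> L2"
      unfolding split by (rule L2_sum) (use block in blast)
    ultimately show ?thesis by blast
  qed
  then show "(\<lambda>x. \<Sum>n=1..num_curvelets \<beta> N. D n x) \<in> L2"
    and "L2_norm (\<lambda>x. \<Sum>n=1..num_curvelets \<beta> N. D n x)
       \<le> (2 * synthesis_const * C * 2 ^ K * 2 powr \<alpha>) * curv_quasinorm w0 w v \<alpha> f * ((1 - \<beta>) * real N) powr (1/2 - \<alpha>)"
    unfolding m_def q_def Y_def by auto
qed

text \<open>The first omitted index \<open>m + 1\<close> is at least a fixed fraction of \<open>N\<close>, and the squares of the coefficients from
there on sum to order \<open>(m + 1) powr (1 - 2 * \<alpha>)\<close>.\<close>

lemma omitted_part_error: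
  fixes \<alpha> \<beta> :: real
  assumes B: "\<forall>I c. finite I \<longrightarrow> I \<subseteq> curv_indices \<longrightarrow>
     (\<lambda>x. \<Sum>\<gamma>\<in>I. c \<gamma> * curvelet w0 w v \<gamma> x) \<in> L2 \<and>
     L2_norm (\<lambda>x. \<Sum>\<gamma>\<in>I. c \<gamma> * curvelet w0 w v \<gamma> x) \<le> B * sqrt (\<Sum>\<gamma>\<in>I. (norm (c \<gamma>))\<^sup>2)" "B \<ge> 0"
    and \<beta>: "0 < \<beta>" "\<beta> < 1" and \<alpha>: "\<alpha> > 1/2"
    and f: "f \<in> curv_class w0 w v \<alpha>" and p: "decr_rearrangement w0 w v f p" and N: "N \<ge> 1"
  defines "D \<equiv> \<lambda>x. (\<Sum>n=1..num_curvelets \<beta> N. L2_inner f (curvelet w0 w v (p n)) * curvelet w0 w v (p n) x) - f x"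
  shows "D \<in> L2"
    and "L2_norm D \<le> B * sqrt (1 + 1 / (2 * \<alpha> - 1)) * curv_quasinorm w0 w v \<alpha> f *
        ((1 - \<beta>) / real N0 powr (1 / \<beta>) / 2 * real N) powr (1/2 - \<alpha>)"
proof -
  define q where "q = curv_quasinorm w0 w v \<alpha> f"
  have q0: "q \<ge> 0" unfolding q_def by (rule coeff_le_quasinorm(2)[OF f p order.refl])
  define m where "m = num_curvelets \<beta> N"
  define c where "c = 1 + 1 / (2 * \<alpha> - 1)"
  have c0: "c \<ge> 0" using \<alpha> by (simp add: c_def)
  define X where "X = (1 - \<beta>) / real N0 powr (1 / \<beta>) * real N"
  have X: "X > 0" using \<beta> N by (simp add: X_def N0_def)
  have mX: "X / 2 \<le> real (Suc m)"
    using num_curvelets_cases[of \<beta> N] X unfolding m_def X_def[symmetric] by auto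
  have fc: "f \<in> L2" "has_curv_expansion w0 w v f" using f by (auto simp: curv_class_def)
  have T: "(\<Sum>n=Suc m..L. (coeff_abs w0 w v f p n)\<^sup>2) \<le> q\<^sup>2 * (c * real (Suc m) powr (1 - 2 * \<alpha>))" for L
  proof -
    have "(\<Sum>n=Suc m..L. (coeff_abs w0 w v f p n)\<^sup>2) \<le> (\<Sum>n=Suc m..L. q\<^sup>2 * real n powr (- 2 * \<alpha>))"
    proof (rule sum_mono)
      fix n assume n: "n \<in> {Suc m..L}"
      have "(coeff_abs w0 w v f p n)\<^sup>2 \<le> (q * real n powr (- \<alpha>))\<^sup>2"
        using coeff_le_quasinorm(1)[OF f p, of n] n by (intro power_mono) (auto simp: q_def coeff_abs_def)
      also have "\<dots> = q\<^sup>2 * real n powr (- 2 * \<alpha>)"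
        by (simp add: power_mult_distrib power2_eq_square[of "real n powr _"] flip: powr_add)
      finally show "(coeff_abs w0 w v f p n)\<^sup>2 \<le> q\<^sup>2 * real n powr (- 2 * \<alpha>)" .
    qed
    also have "\<dots> = q\<^sup>2 * (\<Sum>n=Suc m..L. real n powr (- 2 * \<alpha>))" by (simp add: sum_distrib_left)
    also have "\<dots> \<le> q\<^sup>2 * (c * real (Suc m) powr (1 - 2 * \<alpha>))"
      unfolding c_def by (intro mult_left_mono sum_powr_tail_le \<alpha>) simp
    finally show ?thesis .
  qed
  note te = expansion_tail_error[OF B fc p T]
  show "D \<in> L2" unfolding D_def m_def[symmetric] by (intro L2_diff te(1) fc(1))
  have "L2_norm D \<le> B * sqrt (q\<^sup>2 * (c * real (Suc m) powr (1 - 2 * \<alpha>)))"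
    unfolding D_def m_def[symmetric] by (rule te(2))
  also have "sqrt (q\<^sup>2 * (c * real (Suc m) powr (1 - 2 * \<alpha>))) = q * (sqrt c * real (Suc m) powr (1/2 - \<alpha>))"
  proof -
    have "1/2 - \<alpha> = (1 - 2 * \<alpha>) * (1/2)" by (simp add: algebra_simps)
    then have "real (Suc m) powr (1/2 - \<alpha>) = (real (Suc m) powr (1 - 2 * \<alpha>)) powr (1/2)"
      by (simp only: powr_powr)
    also have "\<dots> = sqrt (real (Suc m) powr (1 - 2 * \<alpha>))" by (rule powr_half_sqrt) simp
    finally have "sqrt (real (Suc m) powr (1 - 2 * \<alpha>)) = real (Suc m) powr (1/2 - \<alpha>)" ..
    then show ?thesis using q0 by (simp only: real_sqrt_mult real_sqrt_abs abs_of_nonneg)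
  qed
  also have "B * (q * (sqrt c * real (Suc m) powr (1/2 - \<alpha>))) \<le> B * (q * (sqrt c * (X / 2) powr (1/2 - \<alpha>)))"
    using B(2) q0 c0 mX X \<alpha> by (intro mult_left_mono powr_mono2') auto
  also have "\<dots> = B * sqrt c * q * (X / 2) powr (1/2 - \<alpha>)" by (simp only: mult_ac)
  also have "X / 2 = (1 - \<beta>) / real N0 powr (1 / \<beta>) / 2 * real N" by (simp add: X_def)
  finally show "L2_norm D \<le> B * sqrt (1 + 1 / (2 * \<alpha> - 1)) * curv_quasinorm w0 w v \<alpha> f *
        ((1 - \<beta>) / real N0 powr (1 / \<beta>) / 2 * real N) powr (1/2 - \<alpha>)"
    by (simp only: c_def q_def)
qed

end

theorem theorem2:
  fixes w0 w v :: "real \<Rightarrow> real"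
  assumes "curvelet_windows w0 w v"
  shows "\<exists>G :: nat \<Rightarrow> nat \<Rightarrow> real^2 \<Rightarrow> complex.
    (\<forall>j M. M \<ge> N0 \<longrightarrow> lincomb_atmost M gauss_translates (G j M)) \<and>
    (\<forall>\<beta> \<alpha> :: real. 0 < \<beta> \<and> \<beta> < 1 \<and> \<alpha> > 1/2 \<longrightarrow>
      (\<exists>C :: real. \<forall>f \<in> curv_class w0 w v \<alpha>. \<forall>p. decr_rearrangement w0 w v f p \<longrightarrow>
        (\<forall>N :: nat. N \<ge> 1 \<longrightarrow>
          lincomb_atmost N gauss_dict (gauss_approx w0 w v G \<beta> N f p) \<and>
          L2_norm (\<lambda>x. gauss_approx w0 w v G \<beta> N f p x - f x)
            \<le> C * curv_quasinorm w0 w v \<alpha> f * real N powr (1/2 - \<alpha>))))"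
proof -
  interpret curvelet_window_functions w0 w v by standard (rule assms)
  obtain F :: "nat \<Rightarrow> nat \<Rightarrow> real^2 \<Rightarrow> complex" where F: "\<And>j M. F j M \<in> gauss_spectra M"
    and FC: "\<And>K. \<exists>C\<ge>0. \<forall>j. \<forall>M\<ge>1. spectral_error j (F j M) (C / real M ^ K)"
    using universal_spectra by blast
  obtain B where B: "B \<ge> 0" "\<forall>I c. finite I \<longrightarrow> I \<subseteq> curv_indices \<longrightarrow>
     (\<lambda>x. \<Sum>\<gamma>\<in>I. c \<gamma> * curvelet w0 w v \<gamma> x) \<in> L2 \<and>
     L2_norm (\<lambda>x. \<Sum>\<gamma>\<in>I. c \<gamma> * curvelet w0 w v \<gamma> x) \<le> B * sqrt (\<Sum>\<gamma>\<in>I. (norm (c \<gamma>))\<^sup>2)"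
    using curvelet_combination_bound by blast
  define G where "G j M = inv_fourier (F j M)" for j M
  have G: "lincomb_atmost M gauss_translates (G j M)" for j M
    unfolding G_def by (rule inv_fourier_gauss_spectra[OF F])
  have "\<exists>C :: real. \<forall>f \<in> curv_class w0 w v \<alpha>. \<forall>p. decr_rearrangement w0 w v f p \<longrightarrow>
        (\<forall>N :: nat. N \<ge> 1 \<longrightarrow>
          lincomb_atmost N gauss_dict (gauss_approx w0 w v G \<beta> N f p) \<and>
          L2_norm (\<lambda>x. gauss_approx w0 w v G \<beta> N f p x - f x)
            \<le> C * curv_quasinorm w0 w v \<alpha> f * real N powr (1/2 - \<alpha>))"
    if \<beta>: "0 < \<beta>" "\<beta> < 1" and \<alpha>: "\<alpha> > 1/2" for \<alpha> \<beta> :: real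
  proof -
    \<comment> \<open>the rate that makes the block errors increase geometrically; \<open>F\<close> attains every rate\<close>
    define K where "K = nat \<lceil>(\<alpha> + 1/2) / \<beta>\<rceil>"
    have "(\<alpha> + 1/2) / \<beta> \<le> real K" unfolding K_def by (rule real_nat_ceiling_ge)
    then have K: "1 \<le> \<beta> * real K + 1/2 - \<alpha>" using \<beta> by (simp add: field_simps)
    obtain C where C0: "C \<ge> 0" and C: "\<forall>j. \<forall>M\<ge>1. spectral_error j (F j M) (C / real M ^ K)"
      using FC[of K] by blast
    have C': "\<And>j M. M \<ge> 1 \<Longrightarrow> spectral_error j (F j M) (C / real M ^ K)" using C by blast
    define c1 where "c1 = 2 * synthesis_const * C * 2 ^ K * 2 powr \<alpha>"
    define c2 where "c2 = B * sqrt (1 + 1 / (2 * \<alpha> - 1))"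
    define \<kappa> where "\<kappa> = (1 - \<beta>) / real N0 powr (1 / \<beta>) / 2"
    have \<kappa>: "\<kappa> > 0" using \<beta> by (simp add: \<kappa>_def N0_def)
    define Ctot where "Ctot = c1 * (1 - \<beta>) powr (1/2 - \<alpha>) + c2 * \<kappa> powr (1/2 - \<alpha>)"
    have "lincomb_atmost N gauss_dict (gauss_approx w0 w v G \<beta> N f p) \<and>
          L2_norm (\<lambda>x. gauss_approx w0 w v G \<beta> N f p x - f x)
            \<le> Ctot * curv_quasinorm w0 w v \<alpha> f * real N powr (1/2 - \<alpha>)"
      if f: "f \<in> curv_class w0 w v \<alpha>" and p: "decr_rearrangement w0 w v f p" and N: "N \<ge> 1" for f p N
    proof
      define q where "q = curv_quasinorm w0 w v \<alpha> f"
      define m where "m = num_curvelets \<beta> N"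
      show "lincomb_atmost N gauss_dict (gauss_approx w0 w v G \<beta> N f p)"
        unfolding gauss_approx_def
        by (rule lincomb_atmost_sum[where b = "sub_budget \<beta> N"])
           (use sub_budget_total[OF \<beta> N] curv_U_gauss_dict[OF G] in auto)
      define D where "D n x = L2_inner f (curvelet w0 w v (p n)) *
        (curv_U (p n) (inv_fourier (F (curv_scale (p n)) (sub_budget \<beta> N n))) x - curvelet w0 w v (p n) x)" for n x
      define R where "R x = (\<Sum>n=1..m. L2_inner f (curvelet w0 w v (p n)) * curvelet w0 w v (p n) x) - f x" for x
      note ap = approximated_part_error[OF \<beta> \<alpha> K F C0 C' f p N, folded D_def m_def c1_def q_def]
      note om = omitted_part_error[OF B(2,1) \<beta> \<alpha> f p N, folded m_def c2_def q_def \<kappa>_def, folded R_def[abs_def]]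
      have "gauss_approx w0 w v G \<beta> N f p x - f x = (\<Sum>n=1..m. D n x) + R x" for x
        unfolding gauss_approx_def D_def R_def G_def m_def right_diff_distrib sum_subtractf by simp
      then have "L2_norm (\<lambda>x. gauss_approx w0 w v G \<beta> N f p x - f x) = L2_norm (\<lambda>x. (\<Sum>n=1..m. D n x) + R x)"
        by simp
      also have "\<dots> \<le> L2_norm (\<lambda>x. \<Sum>n=1..m. D n x) + L2_norm R"
        by (rule L2_norm_add_le[OF ap(1) om(1)])
      also have "\<dots> \<le> c1 * q * ((1 - \<beta>) * real N) powr (1/2 - \<alpha>) + c2 * q * (\<kappa> * real N) powr (1/2 - \<alpha>)"
        by (rule add_mono[OF ap(2) om(2)])
      also have "\<dots> = c1 * q * ((1 - \<beta>) powr (1/2 - \<alpha>) * real N powr (1/2 - \<alpha>))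
          + c2 * q * (\<kappa> powr (1/2 - \<alpha>) * real N powr (1/2 - \<alpha>))"
        using \<beta> \<kappa> by (simp add: powr_mult)
      also have "\<dots> = Ctot * q * real N powr (1/2 - \<alpha>)"
        unfolding Ctot_def by (simp only: distrib_right distrib_left mult_ac)
      finally show "L2_norm (\<lambda>x. gauss_approx w0 w v G \<beta> N f p x - f x)
            \<le> Ctot * curv_quasinorm w0 w v \<alpha> f * real N powr (1/2 - \<alpha>)"
        by (simp only: q_def)
    qed
    then show ?thesis by blast
  qed
  with G show ?thesis by blast
qed

end
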